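(* Let $\Lambda$ be an artinian ring with Jacobson radical $J$. Suppose there exists a right $\Lambda$-module $T$ of finite syzygy type $s$ such that $\Lambda/J$, viewed as a right $\Lambda$-module, embeds into $T$. Moreover, let $A_1,\dots,A_s$ be representatives for the isomorphism types of the (nonzero) indecomposable objects in the syzygy category of $T$. Then: (a) $\operatorname{l\,Fin\,dim}\Lambda\le\operatorname{rep}(T)\le s$. (b) If $M$ is a left $\Lambda$-module of finite projective dimension and $$\mu=\max\{\sigma_T(A_i)\mid 1\le i\le s\text{ and }\operatorname{Tor}_1^\Lambda(A_i,M)\ne 0\},$$ where $\mu=-1$ if the set $\{\sigma_T(A_i)\mid 1\le i\le s\text{ and }\operatorname{Tor}_1^\Lambda(A_i,M)\ne 0\}$ is empty, then $\operatorname{p\,dim}(M)=\mu+1$.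
   Context: $\Lambda$ is an artinian ring (left and right artinian, with $1$), so every module has a projective cover. $\operatorname{p\,dim}$ is projective dimension, and $\operatorname{l\,Fin\,dim}\Lambda$ is the left big finitistic dimension: the supremum of the finite projective dimensions attained on arbitrary left $\Lambda$-modules. For a module $M$, $\Omega^0(M)=M$, $\Omega^1(M)$ is the kernel of a projective cover of $M$, and $\Omega^{j+1}(M)=\Omega^1(\Omega^j(M))$. For a class $\mathcal A$ of modules, $\operatorname{add}\mathcal A$ is the full subcategory whose objects are the finite direct sums of copies of direct summands of objects from $\mathcal A$. All definitions below apply to right modules as well as left modules. Repetition index: the minimal projective resolution of $M$ is repetitive at degree $n\ge 0$ if there is a decomposition $\Omega^n(M)= P\oplus\bigoplus_{i\in I}B_i$ with $P$ projective such that each $B_i$ occurs (up to isomorphism) as a direct summand of $\Omega^j(M)$ for infinitely many $j$. $\operatorname{rep}(M)$ is the least nonnegative integer $k$ such that the minimal projective resolution of $M$ is repetitive at degree $k$, or $\infty$ if there is no such $k$. Contingency: for modules $M,A$ put $\sigma_M(A)=-1$ if $A$ is not isomorphic to a direct summand of any $\Omega^j(M)$, $j\ge 0$, and $\sigma_M(A)=\sup\{j\ge 0\mid A\text{ is isomorphic to a direct summand of }\Omega^j(M)\}$ (possibly $\infty$) otherwise. Syzygy type: the syzygy category of $M$ is $\operatorname{add}(\{\Omega^j(M)\mid j\ge 0\})$. $M$ has finite syzygy type if this category is a Krull-Schmidt category of finite representation type, i.e., every object is a (possibly infinite) direct sum of indecomposable modules with local endomorphism rings, and there are only finitely many isomorphism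 types of indecomposable objects; the syzygy type of $M$ is then the number of isomorphism types of nonzero indecomposable objects in it. *)

theory Defs
  imports
    "HOL-Algebra.Module"
    "HOL-Algebra.AbelCoset"
    "HOL-Algebra.Free_Abelian_Groups"
    "HOL-Library.Extended_Real"
begin

section \<open>Modules over noncommutative rings\<close>

text \<open>The locale \<^locale>\<open>module\<close> of the library asks for a commutative ring; its record type is reused
  here (the fields \<open>mult\<close> and \<open>one\<close> of a module are irrelevant). A right module over \<open>R\<close> is a left
  module over the opposite ring, so for a right module \<open>r \<odot> x\<close> stands for the product \<open>x r\<close>. Every
  notion below is formulated for left modules over \<open>R\<close>; its version for right modules is the
  instance at \<open>opp_ring R\<close>.\<close>

locale left_module = R?: ring R + M?: abelian_group M
  for R :: "'r ring" (structure) and M :: "('r, 'm) module" (structure) +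
  assumes smult_closed:
      "\<lbrakk>a \<in> carrier R; x \<in> carrier M\<rbrakk> \<Longrightarrow> a \<odot>\<^bsub>M\<^esub> x \<in> carrier M"
    and smult_l_distr:
      "\<lbrakk>a \<in> carrier R; b \<in> carrier R; x \<in> carrier M\<rbrakk> \<Longrightarrow>
        (a \<oplus>\<^bsub>R\<^esub> b) \<odot>\<^bsub>M\<^esub> x = a \<odot>\<^bsub>M\<^esub> x \<oplus>\<^bsub>M\<^esub> b \<odot>\<^bsub>M\<^esub> x"
    and smult_r_distr:
      "\<lbrakk>a \<in> carrier R; x \<in> carrier M; y \<in> carrier M\<rbrakk> \<Longrightarrow>
        a \<odot>\<^bsub>M\<^esub> (x \<oplus>\<^bsub>M\<^esub> y) = a \<odot>\<^bsub>M\<^esub> x \<oplus>\<^bsub>M\<^esub> a \<odot>\<^bsub>M\<^esub> y"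
    and smult_assoc:
      "\<lbrakk>a \<in> carrier R; b \<in> carrier R; x \<in> carrier M\<rbrakk> \<Longrightarrow>
        (a \<otimes>\<^bsub>R\<^esub> b) \<odot>\<^bsub>M\<^esub> x = a \<odot>\<^bsub>M\<^esub> (b \<odot>\<^bsub>M\<^esub> x)"
    and smult_one:
      "x \<in> carrier M \<Longrightarrow> \<one>\<^bsub>R\<^esub> \<odot>\<^bsub>M\<^esub> x = x"

definition opp_ring :: "'r ring \<Rightarrow> 'r ring" where
  "opp_ring R = R\<lparr>monoid.mult := (\<lambda>x y. y \<otimes>\<^bsub>R\<^esub> x)\<rparr>"

abbreviation right_module :: "'r ring \<Rightarrow> ('r, 'm) module \<Rightarrow> bool" where
  "right_module R M \<equiv> left_module (opp_ring R) M"

definition regular_module :: "'r ring \<Rightarrow> ('r, 'r) module" where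
  "regular_module R =
    \<lparr>carrier = carrier R, monoid.mult = monoid.mult R, one = one R,
     ring.zero = ring.zero R, ring.add = ring.add R, smult = monoid.mult R\<rparr>"

definition submod :: "('r, 'm) module \<Rightarrow> 'm set \<Rightarrow> ('r, 'm) module" where
  "submod M N = M\<lparr>carrier := N\<rparr>"

definition quot_module :: "('r, 'm) module \<Rightarrow> 'm set \<Rightarrow> ('r, 'm set) module" where
  "quot_module M N =
    \<lparr>carrier = a_rcosets\<^bsub>M\<^esub> N, monoid.mult = undefined, one = undefined,
     ring.zero = N, ring.add = set_add M,
     smult = (\<lambda>r C. \<Union>c\<in>C. N +>\<^bsub>M\<^esub> (r \<odot>\<^bsub>M\<^esub> c))\<rparr>"

definition mod_hom :: "'r ring \<Rightarrow> ('r, 'm) module \<Rightarrow> ('r, 'n) module \<Rightarrow> ('m \<Rightarrow> 'n) set" where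
  "mod_hom R M N = {f \<in> carrier M \<rightarrow> carrier N.
     (\<forall>x\<in>carrier M. \<forall>y\<in>carrier M. f (x \<oplus>\<^bsub>M\<^esub> y) = f x \<oplus>\<^bsub>N\<^esub> f y) \<and>
     (\<forall>r\<in>carrier R. \<forall>x\<in>carrier M. f (r \<odot>\<^bsub>M\<^esub> x) = r \<odot>\<^bsub>N\<^esub> f x)}"

definition mod_iso :: "'r ring \<Rightarrow> ('r, 'm) module \<Rightarrow> ('r, 'n) module \<Rightarrow> bool" where
  "mod_iso R M N \<longleftrightarrow> (\<exists>f\<in>mod_hom R M N. bij_betw f (carrier M) (carrier N))"

definition embeds :: "'r ring \<Rightarrow> ('r, 'm) module \<Rightarrow> ('r, 'n) module \<Rightarrow> bool" where
  "embeds R M N \<longleftrightarrow> (\<exists>f\<in>mod_hom R M N. inj_on f (carrier M))"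


section \<open>Artinian rings and the Jacobson radical\<close>

definition artinian_module :: "'r ring \<Rightarrow> ('r, 'm) module \<Rightarrow> bool" where
  "artinian_module R M \<longleftrightarrow>
    (\<forall>N :: nat \<Rightarrow> 'm set. (\<forall>n. submodule (N n) R M \<and> N (Suc n) \<subseteq> N n) \<longrightarrow>
       (\<exists>n. \<forall>m\<ge>n. N m = N n))"

definition artinian_ring :: "'r ring \<Rightarrow> bool" where
  "artinian_ring R \<longleftrightarrow> ring R \<and> artinian_module R (regular_module R) \<and>
     artinian_module (opp_ring R) (regular_module (opp_ring R))"

definition maximal_left_ideal :: "'r ring \<Rightarrow> 'r set \<Rightarrow> bool" where
  "maximal_left_ideal R I \<longleftrightarrow> submodule I R (regular_module R) \<and> I \<noteq> carrier R \<and>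
     (\<forall>K. submodule K R (regular_module R) \<and> I \<subseteq> K \<longrightarrow> K = I \<or> K = carrier R)"

definition jacobson_radical :: "'r ring \<Rightarrow> 'r set" where
  "jacobson_radical R = {x \<in> carrier R. \<forall>I. maximal_left_ideal R I \<longrightarrow> x \<in> I}"


section \<open>Direct sums\<close>

definition direct_sum2 :: "('r, 'm) module \<Rightarrow> 'r ring \<Rightarrow> 'm set \<Rightarrow> 'm set \<Rightarrow> bool" where
  "direct_sum2 M R X Y \<longleftrightarrow> submodule X R M \<and> submodule Y R M \<and>
     X \<inter> Y = {\<zero>\<^bsub>M\<^esub>} \<and> X <+>\<^bsub>M\<^esub> Y = carrier M"

text \<open>\<open>M\<close> is the internal direct sum of a possibly infinite set of submodules. Indexing by the
  submodules themselves is no restriction, since distinct nonzero terms of an internal direct sum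
  are distinct submodules (which may still be isomorphic).\<close>

definition direct_sum :: "('r, 'm) module \<Rightarrow> 'r ring \<Rightarrow> 'm set set \<Rightarrow> bool" where
  "direct_sum M R \<B> \<longleftrightarrow> (\<forall>B\<in>\<B>. submodule B R M) \<and>
     bij_betw (\<lambda>f. \<Oplus>\<^bsub>M\<^esub>B\<in>{B \<in> \<B>. f B \<noteq> \<zero>\<^bsub>M\<^esub>}. f B)
       {f \<in> \<Pi>\<^sub>E B\<in>\<B>. B. finite {B \<in> \<B>. f B \<noteq> \<zero>\<^bsub>M\<^esub>}} (carrier M)"

text \<open>\<open>A\<close> is isomorphic to a direct summand of \<open>M\<close>.\<close>

definition is_summand :: "'r ring \<Rightarrow> ('r, 'a) module \<Rightarrow> ('r, 'm) module \<Rightarrow> bool" where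
  "is_summand R A M \<longleftrightarrow> (\<exists>X Y. direct_sum2 M R X Y \<and> mod_iso R A (submod M X))"

definition indecomposable :: "'r ring \<Rightarrow> ('r, 'm) module \<Rightarrow> bool" where
  "indecomposable R M \<longleftrightarrow> carrier M \<noteq> {\<zero>\<^bsub>M\<^esub>} \<and>
     (\<forall>X Y. direct_sum2 M R X Y \<longrightarrow> X = {\<zero>\<^bsub>M\<^esub>} \<or> Y = {\<zero>\<^bsub>M\<^esub>})"

definition End_ring :: "'r ring \<Rightarrow> ('r, 'm) module \<Rightarrow> ('m \<Rightarrow> 'm) ring" where
  "End_ring R M =
    \<lparr>carrier = mod_hom R M M \<inter> extensional (carrier M),
     monoid.mult = (\<lambda>f g. \<lambda>x\<in>carrier M. f (g x)),
     one = (\<lambda>x\<in>carrier M. x),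
     ring.zero = (\<lambda>x\<in>carrier M. \<zero>\<^bsub>M\<^esub>),
     ring.add = (\<lambda>f g. \<lambda>x\<in>carrier M. f x \<oplus>\<^bsub>M\<^esub> g x)\<rparr>"

definition local_ring :: "'a ring \<Rightarrow> bool" where
  "local_ring E \<longleftrightarrow> ring E \<and> \<one>\<^bsub>E\<^esub> \<noteq> \<zero>\<^bsub>E\<^esub> \<and>
     (\<forall>a\<in>carrier E. \<forall>b\<in>carrier E. a \<notin> Units E \<and> b \<notin> Units E \<longrightarrow> a \<oplus>\<^bsub>E\<^esub> b \<notin> Units E)"


section \<open>A universe of modules\<close>

text \<open>HOL cannot quantify over types inside a definition, so quantification over all modules that are
  relevant for a given module with elements in \<open>'m\<close> is quantification over the modules whose elements
  lie in the following type of iterated formal linear combinations. The type is infinite and contains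
  a copy of \<open>'m\<close> and of finitely supported families of ring elements indexed by any set of its own
  elements. Hence, up to isomorphism, the modules with elements in it include the given module and are
  closed under submodules, quotients, direct sums over index sets that embed into the type, and free
  modules on their underlying sets, so in particular under projective covers and syzygies.\<close>

datatype ('r, 'm) mod_univ = Base 'm | Comb "('r \<times> ('r, 'm) mod_univ) list"

definition univ_copy :: "('r, 'm) module \<Rightarrow> ('r, ('r, 'm) mod_univ) module" where
  "univ_copy M = (let dec = inv_into UNIV Base in
    \<lparr>carrier = Base ` carrier M, monoid.mult = undefined, one = undefined, ring.zero = Base \<zero>\<^bsub>M\<^esub>,
     ring.add = (\<lambda>x y. Base (dec x \<oplus>\<^bsub>M\<^esub> dec y)),
     smult = (\<lambda>r x. Base (r \<odot>\<^bsub>M\<^esub> dec x))\<rparr>)"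


section \<open>Projective modules, projective dimension and syzygies\<close>

text \<open>The test modules in the lifting property range over the universe of \<open>P\<close>. This includes a copy
  of \<open>P\<close> and the free module on its underlying set, so that \<open>P\<close> is a direct summand of a free module
  and hence has the lifting property with respect to epimorphisms between arbitrary modules.\<close>

definition projective :: "'r ring \<Rightarrow> ('r, 'p) module \<Rightarrow> bool" where
  "projective R P \<longleftrightarrow> left_module R P \<and>
    (\<forall>(X :: ('r, ('r, 'p) mod_univ) module) (Y :: ('r, ('r, 'p) mod_univ) module).
      \<forall>g\<in>mod_hom R X Y. \<forall>f\<in>mod_hom R P Y.
        left_module R X \<and> left_module R Y \<and> g ` carrier X = carrier Y \<longrightarrow>
        (\<exists>h\<in>mod_hom R P X. \<forall>x\<in>carrier P. g (h x) = f x))"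

definition proj_resolution ::
  "'r ring \<Rightarrow> ('r, 'm) module \<Rightarrow> (nat \<Rightarrow> ('r, 'p) module) \<Rightarrow> ('p \<Rightarrow> 'm) \<Rightarrow> (nat \<Rightarrow> 'p \<Rightarrow> 'p) \<Rightarrow> bool"
where
  "proj_resolution R M P \<epsilon> d \<longleftrightarrow>
     (\<forall>n. projective R (P n)) \<and> \<epsilon> \<in> mod_hom R (P 0) M \<and> (\<forall>n. d n \<in> mod_hom R (P (Suc n)) (P n)) \<and>
     \<epsilon> ` carrier (P 0) = carrier M \<and>
     d 0 ` carrier (P 1) = a_kernel (P 0) M \<epsilon> \<and>
     (\<forall>n. d (Suc n) ` carrier (P (Suc (Suc n))) = a_kernel (P (Suc n)) (P n) (d n))"

text \<open>The projective dimension of the zero module is 0 with this convention.\<close>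

definition pdim :: "'r ring \<Rightarrow> ('r, 'm) module \<Rightarrow> enat" where
  "pdim R M = Inf {enat n | n.
     \<exists>(P :: nat \<Rightarrow> ('r, ('r, 'm) mod_univ) module) \<epsilon> d.
       proj_resolution R M P \<epsilon> d \<and> (\<forall>k>n. carrier (P k) = {\<zero>\<^bsub>P k\<^esub>})}"

text \<open>The left big finitistic dimension as seen by the modules with elements in the type \<open>'m\<close>. The
  supremum over all modules is bounded by a number iff this holds for every type \<open>'m\<close>.\<close>

definition left_Fin_dim :: "'m itself \<Rightarrow> 'r ring \<Rightarrow> enat" where
  "left_Fin_dim _ R = Sup {pdim R M | M :: ('r, 'm) module. left_module R M \<and> pdim R M \<noteq> \<infinity>}"

definition superfluous :: "'r ring \<Rightarrow> ('r, 'm) module \<Rightarrow> 'm set \<Rightarrow> bool" where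
  "superfluous R M K \<longleftrightarrow> submodule K R M \<and>
     (\<forall>N. submodule N R M \<and> N <+>\<^bsub>M\<^esub> K = carrier M \<longrightarrow> N = carrier M)"

definition projective_cover ::
  "'r ring \<Rightarrow> ('r, 'p) module \<Rightarrow> ('p \<Rightarrow> 'm) \<Rightarrow> ('r, 'm) module \<Rightarrow> bool" where
  "projective_cover R P f M \<longleftrightarrow> projective R P \<and> f \<in> mod_hom R P M \<and>
     f ` carrier P = carrier M \<and> superfluous R P (a_kernel P M f)"

text \<open>\<open>syzygy R M j\<close> is \<open>\<Omega>\<^sup>j(M)\<close>, realised in the universe of \<open>M\<close>. Projective covers are unique up
  to isomorphism, so the choice is immaterial.\<close>

primrec syzygy :: "'r ring \<Rightarrow> ('r, 'm) module \<Rightarrow> nat \<Rightarrow> ('r, ('r, 'm) mod_univ) module" where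
  "syzygy R M 0 = univ_copy M"
| "syzygy R M (Suc j) =
    (let (P :: ('r, ('r, 'm) mod_univ) module, f) =
           (SOME (P, f). projective_cover R P f (syzygy R M j))
     in submod P (a_kernel P (syzygy R M j) f))"


section \<open>Repetition index, contingency and syzygy type\<close>

definition repetitive_at :: "'r ring \<Rightarrow> ('r, 'm) module \<Rightarrow> nat \<Rightarrow> bool" where
  "repetitive_at R M n \<longleftrightarrow> (let \<Omega> = syzygy R M in
     \<exists>P Q \<B>. direct_sum2 (\<Omega> n) R P Q \<and> projective R (submod (\<Omega> n) P) \<and>
       direct_sum (submod (\<Omega> n) Q) R \<B> \<and>
       (\<forall>B\<in>\<B>. infinite {j. is_summand R (submod (\<Omega> n) B) (\<Omega> j)}))"

definition rep_index :: "'r ring \<Rightarrow> ('r, 'm) module \<Rightarrow> enat" where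
  "rep_index R M = Inf {enat k | k. repetitive_at R M k}"

definition contingency :: "'r ring \<Rightarrow> ('r, 'm) module \<Rightarrow> ('r, 'a) module \<Rightarrow> ereal" where
  "contingency R M A =
    (if \<forall>j. \<not> is_summand R A (syzygy R M j) then -1
     else Sup {ereal (real j) | j. is_summand R A (syzygy R M j)})"

text \<open>Objects of \<open>add \<A>\<close>: finite direct sums of copies of direct summands of members of \<open>\<A>\<close>.\<close>

definition in_add :: "'r ring \<Rightarrow> ('r, 'm) module set \<Rightarrow> ('r, 'x) module \<Rightarrow> bool" where
  "in_add R \<A> X \<longleftrightarrow> left_module R X \<and>
     (\<exists>\<B>. finite \<B> \<and> direct_sum X R \<B> \<and> (\<forall>B\<in>\<B>. \<exists>A\<in>\<A>. is_summand R (submod X B) A))"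

definition in_syzygy_category :: "'r ring \<Rightarrow> ('r, 'm) module \<Rightarrow> ('r, 'x) module \<Rightarrow> bool" where
  "in_syzygy_category R M X \<longleftrightarrow> in_add R (range (syzygy R M)) X"

text \<open>Every object of the syzygy category of \<open>M\<close> is isomorphic to a module in the universe of \<open>M\<close>.\<close>

definition syzygy_indecs :: "'r ring \<Rightarrow> ('r, 'm) module \<Rightarrow> ('r, ('r, 'm) mod_univ) module set" where
  "syzygy_indecs R M = {X. in_syzygy_category R M X \<and> indecomposable R X}"

definition iso_types :: "'r ring \<Rightarrow> ('r, 'm) module set \<Rightarrow> ('r, 'm) module set set" where
  "iso_types R \<C> = \<C> // {(X, Y). X \<in> \<C> \<and> Y \<in> \<C> \<and> mod_iso R X Y}"

definition finite_syzygy_type :: "'r ring \<Rightarrow> ('r, 'm) module \<Rightarrow> bool" where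
  "finite_syzygy_type R M \<longleftrightarrow>
     (\<forall>X :: ('r, ('r, 'm) mod_univ) module. in_syzygy_category R M X \<longrightarrow>
        (\<exists>\<B>. direct_sum X R \<B> \<and>
          (\<forall>B\<in>\<B>. indecomposable R (submod X B) \<and> local_ring (End_ring R (submod X B))))) \<and>
     finite (iso_types R (syzygy_indecs R M))"

definition syzygy_type :: "'r ring \<Rightarrow> ('r, 'm) module \<Rightarrow> nat" where
  "syzygy_type R M = card (iso_types R (syzygy_indecs R M))"


section \<open>Tensor products and Tor\<close>

text \<open>In this section \<open>A\<close> is a right and \<open>M\<close> a left \<open>R\<close>-module; recall that \<open>r \<odot>\<^bsub>A\<^esub> a\<close> is \<open>a r\<close>.\<close>

definition tensor_rels ::
  "'r ring \<Rightarrow> ('r, 'a) module \<Rightarrow> ('r, 'm) module \<Rightarrow> ('a \<times> 'm \<Rightarrow>\<^sub>0 int) set" where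
  "tensor_rels R A M =
     {frag_of (a \<oplus>\<^bsub>A\<^esub> a', m) - frag_of (a, m) - frag_of (a', m) | a a' m.
        a \<in> carrier A \<and> a' \<in> carrier A \<and> m \<in> carrier M} \<union>
     {frag_of (a, m \<oplus>\<^bsub>M\<^esub> m') - frag_of (a, m) - frag_of (a, m') | a m m'.
        a \<in> carrier A \<and> m \<in> carrier M \<and> m' \<in> carrier M} \<union>
     {frag_of (r \<odot>\<^bsub>A\<^esub> a, m) - frag_of (a, r \<odot>\<^bsub>M\<^esub> m) | r a m.
        r \<in> carrier R \<and> a \<in> carrier A \<and> m \<in> carrier M}"

definition tensor_null ::
  "'r ring \<Rightarrow> ('r, 'a) module \<Rightarrow> ('r, 'm) module \<Rightarrow> ('a \<times> 'm \<Rightarrow>\<^sub>0 int) set" where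
  "tensor_null R A M = generate (free_Abelian_group (carrier A \<times> carrier M)) (tensor_rels R A M)"

definition tensor ::
  "'r ring \<Rightarrow> ('r, 'a) module \<Rightarrow> ('r, 'm) module \<Rightarrow> ('a \<times> 'm \<Rightarrow>\<^sub>0 int) set monoid" where
  "tensor R A M = free_Abelian_group (carrier A \<times> carrier M) Mod tensor_null R A M"

text \<open>The map \<open>f \<otimes> M\<close> from \<open>A \<otimes> M\<close> to \<open>B \<otimes> M\<close> induced by a homomorphism \<open>f\<close> from \<open>A\<close> to \<open>B\<close>.\<close>

definition tensor_map ::
  "'r ring \<Rightarrow> ('r, 'b) module \<Rightarrow> ('r, 'm) module \<Rightarrow> ('a \<Rightarrow> 'b) \<Rightarrow>
    ('a \<times> 'm \<Rightarrow>\<^sub>0 int) set \<Rightarrow> ('b \<times> 'm \<Rightarrow>\<^sub>0 int) set" where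
  "tensor_map R B M f C =
     (\<Union>c\<in>C. tensor_null R B M #>\<^bsub>free_Abelian_group (carrier B \<times> carrier M)\<^esub>
        frag_extend (\<lambda>(a, m). frag_of (f a, m)) c)"

text \<open>\<open>Tor\<^sub>n(A, M)\<close>: the homology at \<open>n\<close> of the deleted complex \<open>P \<otimes> M\<close>, for a chosen projective
  resolution \<open>P\<close> of the right module \<open>A\<close>.\<close>

definition Tor ::
  "'r ring \<Rightarrow> nat \<Rightarrow> ('r, 'a) module \<Rightarrow> ('r, 'm) module \<Rightarrow>
    ((('r, 'a) mod_univ \<times> 'm \<Rightarrow>\<^sub>0 int) set) set monoid" where
  "Tor R n A M =
    (let (P :: nat \<Rightarrow> ('r, ('r, 'a) mod_univ) module, \<epsilon>, d) =
           (SOME (P, \<epsilon>, d). proj_resolution (opp_ring R) A P \<epsilon> d);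
         cycles = (case n of 0 \<Rightarrow> carrier (tensor R (P 0) M)
                   | Suc k \<Rightarrow> kernel (tensor R (P (Suc k)) M) (tensor R (P k) M)
                               (tensor_map R (P k) M (d k)));
         boundaries = tensor_map R (P n) M (d n) ` carrier (tensor R (P (Suc n)) M)
     in (tensor R (P n) M)\<lparr>carrier := cycles\<rparr> Mod boundaries)"

end

theory Submission
  imports Defs
begin

text \<open>Throughout, \<open>J\<close> is the Jacobson radical, \<open>A\<close> ranges over right and \<open>M\<close> over left modules, and
  \<open>\<Omega>\<close> is the syzygy operator on either side.

  The theorem reduces to one fact about torsion: if \<open>M\<close> has finite projective dimension \<open>d \<ge> 1\<close>, then
  \<open>d - 1\<close> is the largest \<open>j\<close> with \<open>Tor\<^sub>1(\<Omega>\<^sup>jT, M) \<noteq> 0\<close>. Shifting dimensions on both sides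
  (\<open>tor_zero_shift\<close>), \<open>Tor\<^sub>1(\<Omega>\<^sup>jT, M)\<close> vanishes iff \<open>Tor\<^sub>1(T, \<Omega>\<^sup>jM)\<close> does. For \<open>j \<ge> d\<close> the module \<open>\<Omega>\<^sup>jM\<close>
  is projective (\<open>tor_zero_beyond_pdim\<close>). For \<open>j = d - 1\<close> let \<open>Q\<close> be the projective cover of
  \<open>\<Omega>\<^sup>jM\<close>, with kernel \<open>L = \<Omega>\<^sup>dM\<close>. This kernel is projective, nonzero and contained in \<open>JQ\<close>. The embedding
  of \<open>R/J\<close> yields an element \<open>t\<close> of \<open>T\<close> with annihilator \<open>J\<close>, and for \<open>l\<close> in \<open>L\<close> but not in \<open>JL\<close> the
  element \<open>t \<otimes> l\<close> is nonzero in \<open>T \<otimes> L\<close> and becomes zero in \<open>T \<otimes> Q\<close> (\<open>tor_nonzero\<close>).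

  Part (b) follows because \<open>Tor\<^sub>1\<close> commutes with direct sums: some indecomposable summand of \<open>\<Omega>\<^sup>d\<^sup>-\<^sup>1T\<close> has
  nonzero \<open>Tor\<^sub>1\<close> against \<open>M\<close>, and no \<open>A\<close> with nonzero \<open>Tor\<^sub>1(A, M)\<close> is a summand of \<open>\<Omega>\<^sup>jT\<close> for
  \<open>j \<ge> d\<close> (\<open>pdim_contingency\<close>). For the first inequality of (a), suppose that \<open>\<Omega>\<^sup>kT\<close> is a direct sum
  of a projective module and modules that recur as summands of \<open>\<Omega>\<^sup>jT\<close> for infinitely many \<open>j\<close>. Were
  \<open>d > k\<close>, then \<open>Tor\<^sub>1\<close> of \<open>\<Omega>\<^sup>kT\<close> and \<open>\<Omega>\<^sup>d\<^sup>-\<^sup>1\<^sup>-\<^sup>kM\<close> would be nonzero, although it vanishes on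
  each of these summands (\<open>pdim_le_repetitive\<close>).

  The second inequality of (a) is a pigeonhole argument (\<open>repetitive_at_bound\<close>). Syzygies commute
  with infinite direct sums, so decomposing into indecomposables at every stage exhibits \<open>\<Omega>\<^sup>sT\<close> as a
  direct sum of modules \<open>C\<^sub>s\<close>, each at the end of a chain \<open>C\<^sub>0, \<dots>, C\<^sub>s\<close> of indecomposables in which
  \<open>C\<^sub>k\<^sub>+\<^sub>1\<close> is a summand of \<open>\<Omega>(C\<^sub>k)\<close>. Two of the \<open>s + 1\<close> members are isomorphic, say \<open>C\<^sub>a\<close> and \<open>C\<^sub>b\<close>; going around
  the loop from \<open>a\<close> to \<open>b\<close> any number of times before proceeding to \<open>C\<^sub>s\<close> shows that \<open>C\<^sub>s\<close> recurs
  with period \<open>b - a\<close>. Since the chains are built along with the decompositions, no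
  uniqueness of decompositions is involved.

  The algebra behind this is developed for arbitrary, not necessarily finitely generated modules over a
  left artinian ring: nilpotence of \<open>J\<close>, Nakayama's lemma, existence of projective covers
  (\<open>projective_cover_in_epi\<close>), their compatibility with direct sums (\<open>biproduct_syz\<close>), flatness of
  projective modules (\<open>tens_inj_projective\<close>), and the symmetry of \<open>Tor\<^sub>1\<close> (\<open>tens_inj_balanced\<close>).
  A right module is a left module over the opposite ring, so each result serves both sides.\<close>


section \<open>Submodules and homomorphisms\<close>

lemma opp_ring_simps [simp]:
  "carrier (opp_ring R) = carrier R" "\<one>\<^bsub>opp_ring R\<^esub> = \<one>\<^bsub>R\<^esub>" "\<zero>\<^bsub>opp_ring R\<^esub> = \<zero>\<^bsub>R\<^esub>"
  "ring.add (opp_ring R) = ring.add R" "x \<otimes>\<^bsub>opp_ring R\<^esub> y = y \<otimes>\<^bsub>R\<^esub> x"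
  by (simp_all add: opp_ring_def)

lemma opp_ring_opp_ring [simp]: "opp_ring (opp_ring R) = R"
  by (simp add: opp_ring_def)

lemma ring_opp_ring: "ring R \<Longrightarrow> ring (opp_ring R)"
proof -
  assume "ring R"
  then interpret ring R .
  show ?thesis
    by (rule ringI[OF abelian_groupI monoidI]) (auto simp: a_ac m_assoc l_distr r_distr intro: l_neg)
qed

lemma left_moduleI:
  assumes "ring R"
    and "\<And>x y. x \<in> carrier M \<Longrightarrow> y \<in> carrier M \<Longrightarrow> x \<oplus>\<^bsub>M\<^esub> y \<in> carrier M"
    and "\<zero>\<^bsub>M\<^esub> \<in> carrier M"
    and "\<And>x y z. x \<in> carrier M \<Longrightarrow> y \<in> carrier M \<Longrightarrow> z \<in> carrier M \<Longrightarrow>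
           (x \<oplus>\<^bsub>M\<^esub> y) \<oplus>\<^bsub>M\<^esub> z = x \<oplus>\<^bsub>M\<^esub> (y \<oplus>\<^bsub>M\<^esub> z)"
    and "\<And>x y. x \<in> carrier M \<Longrightarrow> y \<in> carrier M \<Longrightarrow> x \<oplus>\<^bsub>M\<^esub> y = y \<oplus>\<^bsub>M\<^esub> x"
    and "\<And>x. x \<in> carrier M \<Longrightarrow> \<zero>\<^bsub>M\<^esub> \<oplus>\<^bsub>M\<^esub> x = x"
    and "\<And>x. x \<in> carrier M \<Longrightarrow> \<exists>y\<in>carrier M. y \<oplus>\<^bsub>M\<^esub> x = \<zero>\<^bsub>M\<^esub>"
    and "\<And>a x. a \<in> carrier R \<Longrightarrow> x \<in> carrier M \<Longrightarrow> a \<odot>\<^bsub>M\<^esub> x \<in> carrier M"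
    and "\<And>a b x. a \<in> carrier R \<Longrightarrow> b \<in> carrier R \<Longrightarrow> x \<in> carrier M \<Longrightarrow>
           (a \<oplus>\<^bsub>R\<^esub> b) \<odot>\<^bsub>M\<^esub> x = a \<odot>\<^bsub>M\<^esub> x \<oplus>\<^bsub>M\<^esub> b \<odot>\<^bsub>M\<^esub> x"
    and "\<And>a x y. a \<in> carrier R \<Longrightarrow> x \<in> carrier M \<Longrightarrow> y \<in> carrier M \<Longrightarrow>
           a \<odot>\<^bsub>M\<^esub> (x \<oplus>\<^bsub>M\<^esub> y) = a \<odot>\<^bsub>M\<^esub> x \<oplus>\<^bsub>M\<^esub> a \<odot>\<^bsub>M\<^esub> y"
    and "\<And>a b x. a \<in> carrier R \<Longrightarrow> b \<in> carrier R \<Longrightarrow> x \<in> carrier M \<Longrightarrow>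
           (a \<otimes>\<^bsub>R\<^esub> b) \<odot>\<^bsub>M\<^esub> x = a \<odot>\<^bsub>M\<^esub> (b \<odot>\<^bsub>M\<^esub> x)"
    and "\<And>x. x \<in> carrier M \<Longrightarrow> \<one>\<^bsub>R\<^esub> \<odot>\<^bsub>M\<^esub> x = x"
  shows "left_module R M"
  by (intro left_module.intro left_module_axioms.intro abelian_groupI) (use assms in auto)

lemma a_kernel_iff: "x \<in> a_kernel M N f \<longleftrightarrow> x \<in> carrier M \<and> f x = \<zero>\<^bsub>N\<^esub>"
  by (simp add: a_kernel_def kernel_def)

lemma set_add_iff: "x \<in> N <+>\<^bsub>M\<^esub> K \<longleftrightarrow> (\<exists>n\<in>N. \<exists>k\<in>K. x = n \<oplus>\<^bsub>M\<^esub> k)"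
  by (auto simp: set_add_def')

lemma submoduleD:
  assumes "submodule H R M"
  shows "x \<in> H \<Longrightarrow> x \<in> carrier M" "H \<subseteq> carrier M" "\<zero>\<^bsub>M\<^esub> \<in> H"
    "x \<in> H \<Longrightarrow> y \<in> H \<Longrightarrow> x \<oplus>\<^bsub>M\<^esub> y \<in> H" "a \<in> carrier R \<Longrightarrow> x \<in> H \<Longrightarrow> a \<odot>\<^bsub>M\<^esub> x \<in> H"
proof -
  interpret submodule H R M by fact
  show "x \<in> H \<Longrightarrow> x \<in> carrier M" "H \<subseteq> carrier M" "\<zero>\<^bsub>M\<^esub> \<in> H"
    "x \<in> H \<Longrightarrow> y \<in> H \<Longrightarrow> x \<oplus>\<^bsub>M\<^esub> y \<in> H" "a \<in> carrier R \<Longrightarrow> x \<in> H \<Longrightarrow> a \<odot>\<^bsub>M\<^esub> x \<in> H"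
    using subset one_closed m_closed smult_closed by auto
qed

lemma submod_simps [simp]:
  "carrier (submod M N) = N" "\<zero>\<^bsub>submod M N\<^esub> = \<zero>\<^bsub>M\<^esub>" "ring.add (submod M N) = ring.add M"
  "smult (submod M N) = smult M"
  by (simp_all add: submod_def)

lemma submod_carrier [simp]: "submod M (carrier M) = M"
  by (simp add: submod_def)

lemma submod_submod [simp]: "submod (submod M N) K = submod M K"
  by (simp add: submod_def)

lemma regular_module_simps [simp]:
  "carrier (regular_module R) = carrier R" "\<zero>\<^bsub>regular_module R\<^esub> = \<zero>\<^bsub>R\<^esub>"
  "ring.add (regular_module R) = ring.add R" "smult (regular_module R) = monoid.mult R"
  by (simp_all add: regular_module_def)

lemma regular_left_module: "ring R \<Longrightarrow> left_module R (regular_module R)"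
proof -
  assume "ring R"
  then interpret ring R .
  show ?thesis
    by (rule left_moduleI) (auto simp: ring_axioms a_ac m_assoc l_distr r_distr intro: l_neg)
qed

context left_module
begin

lemma smult_l_zero [simp]: "x \<in> carrier M \<Longrightarrow> \<zero>\<^bsub>R\<^esub> \<odot>\<^bsub>M\<^esub> x = \<zero>\<^bsub>M\<^esub>"
proof -
  assume x: "x \<in> carrier M"
  have "\<zero>\<^bsub>R\<^esub> \<odot>\<^bsub>M\<^esub> x = \<zero>\<^bsub>R\<^esub> \<odot>\<^bsub>M\<^esub> x \<oplus>\<^bsub>M\<^esub> \<zero>\<^bsub>R\<^esub> \<odot>\<^bsub>M\<^esub> x"
    using smult_l_distr[of "\<zero>\<^bsub>R\<^esub>" "\<zero>\<^bsub>R\<^esub>" x] x by simp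
  then show ?thesis
    using smult_closed[OF R.zero_closed x] M.add.r_cancel_one' by metis
qed

lemma smult_r_zero [simp]: "a \<in> carrier R \<Longrightarrow> a \<odot>\<^bsub>M\<^esub> \<zero>\<^bsub>M\<^esub> = \<zero>\<^bsub>M\<^esub>"
proof -
  assume a: "a \<in> carrier R"
  have "a \<odot>\<^bsub>M\<^esub> \<zero>\<^bsub>M\<^esub> = a \<odot>\<^bsub>M\<^esub> \<zero>\<^bsub>M\<^esub> \<oplus>\<^bsub>M\<^esub> a \<odot>\<^bsub>M\<^esub> \<zero>\<^bsub>M\<^esub>"
    using smult_r_distr[OF a M.zero_closed M.zero_closed] by simp
  then show ?thesis
    using smult_closed[OF a M.zero_closed] M.add.r_cancel_one' by metis
qed

lemma smult_l_minus: "a \<in> carrier R \<Longrightarrow> x \<in> carrier M \<Longrightarrow> (\<ominus>\<^bsub>R\<^esub> a) \<odot>\<^bsub>M\<^esub> x = \<ominus>\<^bsub>M\<^esub> (a \<odot>\<^bsub>M\<^esub> x)"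
proof -
  assume a: "a \<in> carrier R" and x: "x \<in> carrier M"
  have "(\<ominus>\<^bsub>R\<^esub> a) \<odot>\<^bsub>M\<^esub> x \<oplus>\<^bsub>M\<^esub> a \<odot>\<^bsub>M\<^esub> x = \<zero>\<^bsub>M\<^esub>"
    using smult_l_distr[of "\<ominus>\<^bsub>R\<^esub> a" a x] a x by (simp add: R.l_neg)
  then show ?thesis using M.minus_equality a x smult_closed by (metis R.a_inv_closed)
qed

lemma diff_eq_zeroD: "x \<in> carrier M \<Longrightarrow> y \<in> carrier M \<Longrightarrow> x \<ominus>\<^bsub>M\<^esub> y = \<zero>\<^bsub>M\<^esub> \<Longrightarrow> x = y"
  using M.minus_equality[of x "\<ominus>\<^bsub>M\<^esub> y"] by (simp add: a_minus_def)

lemma add_diff_cancel: "x \<in> carrier M \<Longrightarrow> y \<in> carrier M \<Longrightarrow> y \<oplus>\<^bsub>M\<^esub> (x \<ominus>\<^bsub>M\<^esub> y) = x"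
  by (simp add: a_minus_def M.a_lcomm M.r_neg)

lemma minus_one_smult: "x \<in> carrier M \<Longrightarrow> (\<ominus>\<^bsub>R\<^esub> \<one>\<^bsub>R\<^esub>) \<odot>\<^bsub>M\<^esub> x = \<ominus>\<^bsub>M\<^esub> x"
  by (simp add: smult_l_minus smult_one)

lemma submoduleI:
  assumes "H \<subseteq> carrier M" "\<zero>\<^bsub>M\<^esub> \<in> H" "\<And>x y. x \<in> H \<Longrightarrow> y \<in> H \<Longrightarrow> x \<oplus>\<^bsub>M\<^esub> y \<in> H"
    "\<And>a x. a \<in> carrier R \<Longrightarrow> x \<in> H \<Longrightarrow> a \<odot>\<^bsub>M\<^esub> x \<in> H"
  shows "submodule H R M"
proof -
  have "\<ominus>\<^bsub>M\<^esub> x \<in> H" if "x \<in> H" for x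
    using assms(4)[of "\<ominus>\<^bsub>R\<^esub> \<one>\<^bsub>R\<^esub>" x] minus_one_smult[of x] assms(1) that by auto
  then have "subgroup H (add_monoid M)"
    using assms by (intro M.add.subgroupI) (auto simp: a_inv_def)
  then show ?thesis
    using assms by (intro submodule.intro submodule_axioms.intro) auto
qed

lemma submodule_neg: "submodule H R M \<Longrightarrow> x \<in> H \<Longrightarrow> \<ominus>\<^bsub>M\<^esub> x \<in> H"
  using submoduleD(5)[of H R M "\<ominus>\<^bsub>R\<^esub> \<one>\<^bsub>R\<^esub>" x] minus_one_smult[of x] submoduleD(1)[of H R M x] by auto

lemma submodule_minus: "submodule H R M \<Longrightarrow> x \<in> H \<Longrightarrow> y \<in> H \<Longrightarrow> x \<ominus>\<^bsub>M\<^esub> y \<in> H"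
  using submodule_neg[of H y] submoduleD(4)[of H R M x "\<ominus>\<^bsub>M\<^esub> y"] by (simp add: a_minus_def)

lemma left_module_submod:
  assumes H: "submodule H R M"
  shows "left_module R (submod M H)"
proof -
  note D = submoduleD[OF H]
  have neg: "\<exists>y\<in>H. y \<oplus>\<^bsub>M\<^esub> x = \<zero>\<^bsub>M\<^esub>" if "x \<in> H" for x
    using submodule_neg[OF H that] D(1)[OF that] M.l_neg by blast
  show ?thesis
    by (rule left_moduleI)
       (simp_all add: D neg R.ring_axioms M.a_assoc smult_l_distr smult_r_distr smult_assoc smult_one,
        simp add: D M.a_comm)
qed

lemma submodule_submod_iff:
  assumes H: "submodule H R M"
  shows "submodule N R (submod M H) \<longleftrightarrow> submodule N R M \<and> N \<subseteq> H"
proof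
  interpret S: left_module R "submod M H" by (rule left_module_submod[OF H])
  show "submodule N R (submod M H) \<Longrightarrow> submodule N R M \<and> N \<subseteq> H"
    using submoduleD[of N R "submod M H"] submoduleD[OF H] by (auto intro!: submoduleI)
  show "submodule N R M \<and> N \<subseteq> H \<Longrightarrow> submodule N R (submod M H)"
    using submoduleD[of N R M] by (auto intro!: S.submoduleI)
qed

lemma submodule_zero: "submodule {\<zero>\<^bsub>M\<^esub>} R M"
  by (rule submoduleI) auto

lemma submodule_carrier: "submodule (carrier M) R M"
  by (rule submoduleI) (auto simp: smult_closed)

lemma submodule_Int: "submodule N R M \<Longrightarrow> submodule K R M \<Longrightarrow> submodule (N \<inter> K) R M"
  using submoduleD[of N R M] submoduleD[of K R M] by (intro submoduleI) auto

lemma submodule_set_add: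
  assumes N: "submodule N R M" and K: "submodule K R M"
  shows "submodule (N <+>\<^bsub>M\<^esub> K) R M"
proof (rule submoduleI)
  note D = submoduleD[OF N] submoduleD[OF K]
  show "N <+>\<^bsub>M\<^esub> K \<subseteq> carrier M" using D by (auto simp: set_add_iff)
  show "\<zero>\<^bsub>M\<^esub> \<in> N <+>\<^bsub>M\<^esub> K"
    unfolding set_add_iff by (intro bexI[of _ "\<zero>\<^bsub>M\<^esub>"]) (simp_all add: D)
  fix x y assume "x \<in> N <+>\<^bsub>M\<^esub> K" "y \<in> N <+>\<^bsub>M\<^esub> K"
  then obtain n k n' k' where *: "n \<in> N" "k \<in> K" "n' \<in> N" "k' \<in> K" "x = n \<oplus>\<^bsub>M\<^esub> k" "y = n' \<oplus>\<^bsub>M\<^esub> k'"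
    by (auto simp: set_add_iff)
  moreover have "n \<in> carrier M" "k \<in> carrier M" "n' \<in> carrier M" "k' \<in> carrier M" using * D by auto
  ultimately have "x \<oplus>\<^bsub>M\<^esub> y = (n \<oplus>\<^bsub>M\<^esub> n') \<oplus>\<^bsub>M\<^esub> (k \<oplus>\<^bsub>M\<^esub> k')" by (simp add: M.a_ac)
  moreover have "n \<oplus>\<^bsub>M\<^esub> n' \<in> N" "k \<oplus>\<^bsub>M\<^esub> k' \<in> K" using * D by simp_all
  ultimately show "x \<oplus>\<^bsub>M\<^esub> y \<in> N <+>\<^bsub>M\<^esub> K" unfolding set_add_iff by blast
next
  note D = submoduleD[OF N] submoduleD[OF K]
  fix a x assume a: "a \<in> carrier R" and "x \<in> N <+>\<^bsub>M\<^esub> K"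
  then obtain n k where *: "n \<in> N" "k \<in> K" "x = n \<oplus>\<^bsub>M\<^esub> k" by (auto simp: set_add_iff)
  then have "a \<odot>\<^bsub>M\<^esub> x = a \<odot>\<^bsub>M\<^esub> n \<oplus>\<^bsub>M\<^esub> a \<odot>\<^bsub>M\<^esub> k" using a D by (simp add: smult_r_distr)
  moreover have "a \<odot>\<^bsub>M\<^esub> n \<in> N" "a \<odot>\<^bsub>M\<^esub> k \<in> K" using * a D by simp_all
  ultimately show "a \<odot>\<^bsub>M\<^esub> x \<in> N <+>\<^bsub>M\<^esub> K" unfolding set_add_iff by blast
qed

lemma set_add_upper:
  assumes N: "submodule N R M" and K: "submodule K R M"
  shows "N \<subseteq> N <+>\<^bsub>M\<^esub> K" "K \<subseteq> N <+>\<^bsub>M\<^esub> K"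
proof -
  note D = submoduleD[OF N] submoduleD[OF K]
  show "N \<subseteq> N <+>\<^bsub>M\<^esub> K"
  proof
    fix x assume "x \<in> N"
    then have "x = x \<oplus>\<^bsub>M\<^esub> \<zero>\<^bsub>M\<^esub>" using D by simp
    then show "x \<in> N <+>\<^bsub>M\<^esub> K" using \<open>x \<in> N\<close> D unfolding set_add_iff by blast
  qed
  show "K \<subseteq> N <+>\<^bsub>M\<^esub> K"
  proof
    fix x assume "x \<in> K"
    then have "x = \<zero>\<^bsub>M\<^esub> \<oplus>\<^bsub>M\<^esub> x" using D by simp
    then show "x \<in> N <+>\<^bsub>M\<^esub> K" using \<open>x \<in> K\<close> D unfolding set_add_iff by blast
  qed
qed

lemma set_add_least:
  "submodule S R M \<Longrightarrow> N \<subseteq> S \<Longrightarrow> K \<subseteq> S \<Longrightarrow> N <+>\<^bsub>M\<^esub> K \<subseteq> S"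
  unfolding subset_iff set_add_iff by (metis submoduleD(4))

lemma submodule_Union_chain:
  assumes "C \<noteq> {}" "subset.chain {N. submodule N R M} C"
  shows "submodule (\<Union>C) R M"
proof (rule submoduleI)
  have C: "\<And>N. N \<in> C \<Longrightarrow> submodule N R M" and tot: "\<And>N K. N \<in> C \<Longrightarrow> K \<in> C \<Longrightarrow> N \<subseteq> K \<or> K \<subseteq> N"
    using assms(2) by (auto simp: subset.chain_def)
  show "\<Union>C \<subseteq> carrier M" using submoduleD(2)[OF C] by blast
  show "\<zero>\<^bsub>M\<^esub> \<in> \<Union>C" using submoduleD(3)[OF C] assms(1) by blast
  show "a \<odot>\<^bsub>M\<^esub> x \<in> \<Union>C" if a: "a \<in> carrier R" and x: "x \<in> \<Union>C" for a x
  proof -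
    obtain N where "N \<in> C" "x \<in> N" using x by blast
    then show ?thesis using submoduleD(5)[OF C a] by blast
  qed
  fix x y assume "x \<in> \<Union>C" "y \<in> \<Union>C"
  then obtain N K where "N \<in> C" "K \<in> C" "x \<in> N" "y \<in> K" by blast
  then obtain L where "L \<in> C" "x \<in> L" "y \<in> L" using tot by blast
  then show "x \<oplus>\<^bsub>M\<^esub> y \<in> \<Union>C" using submoduleD(4)[OF C] by blast
qed

lemma submodule_cyclic:
  assumes L: "submodule L R (regular_module R)" and v: "v \<in> carrier M"
  shows "submodule ((\<lambda>l. l \<odot>\<^bsub>M\<^esub> v) ` L) R M"
proof (rule submoduleI)
  note D = submoduleD[OF L, simplified]
  show "(\<lambda>l. l \<odot>\<^bsub>M\<^esub> v) ` L \<subseteq> carrier M" using D v smult_closed by auto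
  have "\<zero>\<^bsub>M\<^esub> = \<zero>\<^bsub>R\<^esub> \<odot>\<^bsub>M\<^esub> v" using v by simp
  then show "\<zero>\<^bsub>M\<^esub> \<in> (\<lambda>l. l \<odot>\<^bsub>M\<^esub> v) ` L" using D(3) by blast
  fix x assume "x \<in> (\<lambda>l. l \<odot>\<^bsub>M\<^esub> v) ` L"
  then obtain l where l: "l \<in> L" "x = l \<odot>\<^bsub>M\<^esub> v" by blast
  show "x \<oplus>\<^bsub>M\<^esub> y \<in> (\<lambda>l. l \<odot>\<^bsub>M\<^esub> v) ` L" if y: "y \<in> (\<lambda>l. l \<odot>\<^bsub>M\<^esub> v) ` L" for y
  proof -
    obtain l' where l': "l' \<in> L" "y = l' \<odot>\<^bsub>M\<^esub> v" using y by blast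
    have "x \<oplus>\<^bsub>M\<^esub> y = (l \<oplus>\<^bsub>R\<^esub> l') \<odot>\<^bsub>M\<^esub> v" using l l' v D(1) by (simp add: smult_l_distr)
    then show ?thesis using D(4) l l' by blast
  qed
  show "a \<odot>\<^bsub>M\<^esub> x \<in> (\<lambda>l. l \<odot>\<^bsub>M\<^esub> v) ` L" if "a \<in> carrier R" for a
  proof -
    have "a \<odot>\<^bsub>M\<^esub> x = (a \<otimes>\<^bsub>R\<^esub> l) \<odot>\<^bsub>M\<^esub> v" using l that v D(1) by (simp add: smult_assoc)
    then show ?thesis using D(5) l that by blast
  qed
qed

lemma submodule_ann_into:
  assumes W: "submodule W R M" and L: "submodule L R (regular_module R)" and v: "v \<in> carrier M"
  shows "submodule {l \<in> L. l \<odot>\<^bsub>M\<^esub> v \<in> W} R (regular_module R)"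
proof -
  interpret reg: left_module R "regular_module R" by (rule regular_left_module[OF R.ring_axioms])
  show ?thesis
    using submoduleD[OF W] submoduleD[OF L, simplified] v
    by (intro reg.submoduleI) (auto simp: smult_l_distr smult_assoc)
qed

lemma submodule_ideal: "submodule (carrier R) R (regular_module R)"
  using left_module.submodule_carrier[OF regular_left_module[OF R.ring_axioms]] by simp

end

lemma mod_homI:
  assumes "\<And>x. x \<in> carrier M \<Longrightarrow> f x \<in> carrier N"
    "\<And>x y. x \<in> carrier M \<Longrightarrow> y \<in> carrier M \<Longrightarrow> f (x \<oplus>\<^bsub>M\<^esub> y) = f x \<oplus>\<^bsub>N\<^esub> f y"
    "\<And>r x. r \<in> carrier R \<Longrightarrow> x \<in> carrier M \<Longrightarrow> f (r \<odot>\<^bsub>M\<^esub> x) = r \<odot>\<^bsub>N\<^esub> f x"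
  shows "f \<in> mod_hom R M N"
  using assms by (auto simp: mod_hom_def)

lemma mod_homD:
  assumes "f \<in> mod_hom R M N"
  shows "x \<in> carrier M \<Longrightarrow> f x \<in> carrier N"
    "x \<in> carrier M \<Longrightarrow> y \<in> carrier M \<Longrightarrow> f (x \<oplus>\<^bsub>M\<^esub> y) = f x \<oplus>\<^bsub>N\<^esub> f y"
    "r \<in> carrier R \<Longrightarrow> x \<in> carrier M \<Longrightarrow> f (r \<odot>\<^bsub>M\<^esub> x) = r \<odot>\<^bsub>N\<^esub> f x"
  using assms by (auto simp: mod_hom_def)

lemma mod_hom_zero:
  assumes "left_module R M" "left_module R N" "f \<in> mod_hom R M N"
  shows "f \<zero>\<^bsub>M\<^esub> = \<zero>\<^bsub>N\<^esub>"
proof -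
  interpret M: left_module R M by fact
  interpret N: left_module R N by fact
  have "f (\<zero>\<^bsub>R\<^esub> \<odot>\<^bsub>M\<^esub> \<zero>\<^bsub>M\<^esub>) = \<zero>\<^bsub>R\<^esub> \<odot>\<^bsub>N\<^esub> f \<zero>\<^bsub>M\<^esub>"
    by (rule mod_homD(3)[OF assms(3)]) auto
  then show ?thesis using mod_homD(1)[OF assms(3)] by simp
qed

lemma mod_hom_neg:
  assumes "left_module R M" "left_module R N" "f \<in> mod_hom R M N" "x \<in> carrier M"
  shows "f (\<ominus>\<^bsub>M\<^esub> x) = \<ominus>\<^bsub>N\<^esub> f x"
proof -
  interpret M: left_module R M by fact
  interpret N: left_module R N by fact
  have "f ((\<ominus>\<^bsub>R\<^esub> \<one>\<^bsub>R\<^esub>) \<odot>\<^bsub>M\<^esub> x) = (\<ominus>\<^bsub>R\<^esub> \<one>\<^bsub>R\<^esub>) \<odot>\<^bsub>N\<^esub> f x"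
    by (rule mod_homD(3)[OF assms(3)]) (use assms in auto)
  then show ?thesis
    using mod_homD(1)[OF assms(3,4)] assms(4) M.minus_one_smult N.minus_one_smult by metis
qed

lemma mod_hom_minus:
  assumes "left_module R M" "left_module R N" "f \<in> mod_hom R M N" "x \<in> carrier M" "y \<in> carrier M"
  shows "f (x \<ominus>\<^bsub>M\<^esub> y) = f x \<ominus>\<^bsub>N\<^esub> f y"
proof -
  interpret M: left_module R M by fact
  show ?thesis
    using mod_hom_neg[OF assms(1-3)] mod_homD(2)[OF assms(3)] assms(4,5) by (simp add: a_minus_def)
qed

lemma mod_hom_comp:
  "f \<in> mod_hom R M N \<Longrightarrow> g \<in> mod_hom R N P \<Longrightarrow> (\<lambda>x. g (f x)) \<in> mod_hom R M P"
  by (auto simp: mod_hom_def Pi_iff)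

lemma mod_hom_id: "(\<lambda>x. x) \<in> mod_hom R M M"
  by (auto simp: mod_hom_def)

lemma mod_hom_restrict: "f \<in> mod_hom R M N \<Longrightarrow> H \<subseteq> carrier M \<Longrightarrow> f \<in> mod_hom R (submod M H) N"
  by (auto simp: mod_hom_def Pi_iff subset_iff)

lemma mod_hom_corestrict:
  "f \<in> mod_hom R M N \<Longrightarrow> (\<And>x. x \<in> carrier M \<Longrightarrow> f x \<in> H) \<Longrightarrow> f \<in> mod_hom R M (submod N H)"
  by (auto simp: mod_hom_def Pi_iff)

lemma mod_hom_incl: "H \<subseteq> carrier M \<Longrightarrow> (\<lambda>x. x) \<in> mod_hom R (submod M H) M"
  by (auto simp: mod_hom_def)

lemma mod_hom_expand: "f \<in> mod_hom R M (submod N H) \<Longrightarrow> H \<subseteq> carrier N \<Longrightarrow> f \<in> mod_hom R M N"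
  by (auto simp: mod_hom_def Pi_iff)

lemma mod_hom_zero_map: "left_module R N \<Longrightarrow> (\<lambda>x. \<zero>\<^bsub>N\<^esub>) \<in> mod_hom R M N"
proof -
  assume "left_module R N"
  then interpret left_module R N .
  show ?thesis by (rule mod_homI) auto
qed

lemma mod_hom_inv_into:
  assumes "left_module R M" "f \<in> mod_hom R M N" "bij_betw f (carrier M) (carrier N)"
  shows "inv_into (carrier M) f \<in> mod_hom R N M"
proof -
  interpret left_module R M by fact
  let ?g = "inv_into (carrier M) f"
  have g: "?g y \<in> carrier M" "f (?g y) = y" if "y \<in> carrier N" for y
    using that assms(3) by (auto simp: bij_betw_def intro: inv_into_into f_inv_into_f)
  have gf: "?g (f x) = x" if "x \<in> carrier M" for x
    using that assms(3) by (auto simp: bij_betw_def)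
  show ?thesis
  proof (rule mod_homI)
    fix x y assume xy: "x \<in> carrier N" "y \<in> carrier N"
    then have "f (?g x \<oplus>\<^bsub>M\<^esub> ?g y) = x \<oplus>\<^bsub>N\<^esub> y" using g mod_homD(2)[OF assms(2)] by simp
    then show "?g (x \<oplus>\<^bsub>N\<^esub> y) = ?g x \<oplus>\<^bsub>M\<^esub> ?g y" using gf[of "?g x \<oplus>\<^bsub>M\<^esub> ?g y"] g xy by simp
  next
    fix r x assume rx: "r \<in> carrier R" "x \<in> carrier N"
    then have "f (r \<odot>\<^bsub>M\<^esub> ?g x) = r \<odot>\<^bsub>N\<^esub> x" using g mod_homD(3)[OF assms(2)] by simp
    then show "?g (r \<odot>\<^bsub>N\<^esub> x) = r \<odot>\<^bsub>M\<^esub> ?g x" using gf[of "r \<odot>\<^bsub>M\<^esub> ?g x"] g rx smult_closed by simp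
  qed (use g in auto)
qed

lemma submodule_image:
  assumes "left_module R M" "left_module R N" "f \<in> mod_hom R M N" "submodule H R M"
  shows "submodule (f ` H) R N"
proof -
  interpret N: left_module R N by fact
  note D = submoduleD[OF assms(4)] and F = mod_homD[OF assms(3)]
  show ?thesis
  proof (rule N.submoduleI)
    show "f ` H \<subseteq> carrier N" using D F by auto
    show "\<zero>\<^bsub>N\<^esub> \<in> f ` H" using mod_hom_zero[OF assms(1-3)] D(3) by force
    show "x \<oplus>\<^bsub>N\<^esub> y \<in> f ` H" if xy: "x \<in> f ` H" "y \<in> f ` H" for x y
    proof -
      obtain a b where ab: "a \<in> H" "b \<in> H" "x = f a" "y = f b" using xy by blast
      then have "x \<oplus>\<^bsub>N\<^esub> y = f (a \<oplus>\<^bsub>M\<^esub> b)" using F(2) D(1) by simp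
      then show ?thesis using D(4) ab by blast
    qed
    show "r \<odot>\<^bsub>N\<^esub> x \<in> f ` H" if rx: "r \<in> carrier R" "x \<in> f ` H" for r x
    proof -
      obtain a where a: "a \<in> H" "x = f a" using rx by blast
      then have "r \<odot>\<^bsub>N\<^esub> x = f (r \<odot>\<^bsub>M\<^esub> a)" using F(3) D(1) rx by simp
      then show ?thesis using D(5) a rx by blast
    qed
  qed
qed

lemma submodule_vimage:
  assumes "left_module R M" "left_module R N" "f \<in> mod_hom R M N" "submodule H R N"
  shows "submodule {x \<in> carrier M. f x \<in> H} R M"
proof -
  interpret M: left_module R M by fact
  note D = submoduleD[OF assms(4)] and F = mod_homD[OF assms(3)]
  show ?thesis
    by (rule M.submoduleI) (use D F mod_hom_zero[OF assms(1-3)] M.smult_closed in auto)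
qed

lemma submodule_kernel:
  assumes "left_module R M" "left_module R N" "f \<in> mod_hom R M N"
  shows "submodule (a_kernel M N f) R M"
proof -
  have "a_kernel M N f = {x \<in> carrier M. f x \<in> {\<zero>\<^bsub>N\<^esub>}}" by (auto simp: a_kernel_iff)
  then show ?thesis
    using submodule_vimage[OF assms left_module.submodule_zero[OF assms(2)]] by simp
qed

lemma inj_on_kernel:
  assumes "left_module R M" "left_module R N" "f \<in> mod_hom R M N"
    "\<And>x. x \<in> carrier M \<Longrightarrow> f x = \<zero>\<^bsub>N\<^esub> \<Longrightarrow> x = \<zero>\<^bsub>M\<^esub>"
  shows "inj_on f (carrier M)"
proof (rule inj_onI)
  interpret M: left_module R M by fact
  interpret N: left_module R N by fact
  fix x y assume xy: "x \<in> carrier M" "y \<in> carrier M" "f x = f y"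
  then have "f (x \<ominus>\<^bsub>M\<^esub> y) = \<zero>\<^bsub>N\<^esub>"
    using mod_hom_minus[OF assms(1-3)] mod_homD(1)[OF assms(3)] by (simp add: N.r_neg a_minus_def)
  then have "x \<ominus>\<^bsub>M\<^esub> y = \<zero>\<^bsub>M\<^esub>" using assms(4) xy by simp
  then show "x = y" using xy M.diff_eq_zeroD by blast
qed


section \<open>The radical of a left artinian ring\<close>

text \<open>The additive span of the products \<open>j x\<close>, generated one product at a time so that induction
  replaces bookkeeping with finite sums. For a left ideal \<open>J\<close> it is the submodule \<open>J N\<close>.\<close>

inductive_set ideal_mult :: "'r set \<Rightarrow> ('r, 'm) module \<Rightarrow> 'm set \<Rightarrow> 'm set"
  for J :: "'r set" and M :: "('r, 'm) module" and N :: "'m set" where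
  zero: "\<zero>\<^bsub>M\<^esub> \<in> ideal_mult J M N"
| step: "\<lbrakk>j \<in> J; x \<in> N; y \<in> ideal_mult J M N\<rbrakk> \<Longrightarrow> (j \<odot>\<^bsub>M\<^esub> x) \<oplus>\<^bsub>M\<^esub> y \<in> ideal_mult J M N"

context left_module
begin

lemma ideal_mult_closed:
  "x \<in> ideal_mult J M N \<Longrightarrow> J \<subseteq> carrier R \<Longrightarrow> N \<subseteq> carrier M \<Longrightarrow> x \<in> carrier M"
  by (induction rule: ideal_mult.induct) (auto intro!: smult_closed M.a_closed)

lemma ideal_mult_single:
  "J \<subseteq> carrier R \<Longrightarrow> N \<subseteq> carrier M \<Longrightarrow> j \<in> J \<Longrightarrow> x \<in> N \<Longrightarrow> j \<odot>\<^bsub>M\<^esub> x \<in> ideal_mult J M N"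
  using ideal_mult.step[OF _ _ ideal_mult.zero, of j J x N M] smult_closed[of j x] by (auto simp: subset_iff)

lemma ideal_mult_add:
  assumes "J \<subseteq> carrier R" "N \<subseteq> carrier M" "x \<in> ideal_mult J M N" "y \<in> ideal_mult J M N"
  shows "x \<oplus>\<^bsub>M\<^esub> y \<in> ideal_mult J M N"
  using assms(3)
proof induction
  case zero
  then show ?case using ideal_mult_closed[OF assms(4,1,2)] assms(4) by simp
next
  case (step j x z)
  then have "j \<odot>\<^bsub>M\<^esub> x \<in> carrier M" "z \<in> carrier M" "y \<in> carrier M"
    using assms ideal_mult_closed by (auto intro!: smult_closed)
  then have "(j \<odot>\<^bsub>M\<^esub> x \<oplus>\<^bsub>M\<^esub> z) \<oplus>\<^bsub>M\<^esub> y = j \<odot>\<^bsub>M\<^esub> x \<oplus>\<^bsub>M\<^esub> (z \<oplus>\<^bsub>M\<^esub> y)" by (simp add: M.a_assoc)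
  then show ?case using step ideal_mult.step by metis
qed

lemma ideal_mult_least:
  assumes S: "submodule S R M" and "\<And>j x. j \<in> J \<Longrightarrow> x \<in> N \<Longrightarrow> j \<odot>\<^bsub>M\<^esub> x \<in> S"
  shows "ideal_mult J M N \<subseteq> S"
proof
  fix x assume "x \<in> ideal_mult J M N"
  then show "x \<in> S"
    by induction (simp_all add: submoduleD[OF S] assms(2))
qed

lemma ideal_mult_submodule:
  assumes "J \<subseteq> carrier R" "N \<subseteq> carrier M" "\<And>r j. r \<in> carrier R \<Longrightarrow> j \<in> J \<Longrightarrow> r \<otimes>\<^bsub>R\<^esub> j \<in> J"
  shows "submodule (ideal_mult J M N) R M"
proof (rule submoduleI)
  fix r x assume r: "r \<in> carrier R" and "x \<in> ideal_mult J M N"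
  from this(2) show "r \<odot>\<^bsub>M\<^esub> x \<in> ideal_mult J M N"
  proof induction
    case zero then show ?case using r by (simp add: ideal_mult.zero)
  next
    case (step j x y)
    then have c: "j \<in> carrier R" "x \<in> carrier M" "y \<in> carrier M" using assms ideal_mult_closed by auto
    then have "r \<odot>\<^bsub>M\<^esub> (j \<odot>\<^bsub>M\<^esub> x \<oplus>\<^bsub>M\<^esub> y) = (r \<otimes>\<^bsub>R\<^esub> j) \<odot>\<^bsub>M\<^esub> x \<oplus>\<^bsub>M\<^esub> r \<odot>\<^bsub>M\<^esub> y"
      using r by (simp add: smult_r_distr smult_assoc smult_closed)
    then show ?case using step assms(3)[OF r] ideal_mult.step by metis
  qed
qed (use assms ideal_mult_closed ideal_mult.zero ideal_mult_add in auto)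

lemma ideal_mult_hom:
  assumes "left_module R N" "f \<in> mod_hom R M N" "J \<subseteq> carrier R" "H \<subseteq> carrier M"
    and x: "x \<in> ideal_mult J M H" and "\<And>y. y \<in> H \<Longrightarrow> f y \<in> K"
  shows "f x \<in> ideal_mult J N K"
  using x
proof induction
  case zero
  then show ?case using mod_hom_zero[OF left_module_axioms assms(1,2)] ideal_mult.zero by metis
next
  case (step j x y)
  then have c: "j \<in> carrier R" "x \<in> carrier M" "y \<in> carrier M" using assms ideal_mult_closed by auto
  then have "f (j \<odot>\<^bsub>M\<^esub> x \<oplus>\<^bsub>M\<^esub> y) = j \<odot>\<^bsub>N\<^esub> f x \<oplus>\<^bsub>N\<^esub> f y"
    using mod_homD[OF assms(2)] smult_closed by simp
  then show ?case using step assms(6) ideal_mult.step by metis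
qed

end

locale base_ring = ring R for R :: "'r ring"
begin

text \<open>Zorn's lemma applied to the left ideals above \<open>L\<close> that omit \<open>1\<close>.\<close>

lemma maximal_left_ideal_exists:
  assumes L: "submodule L R (regular_module R)" "L \<noteq> carrier R"
  shows "\<exists>I. maximal_left_ideal R I \<and> L \<subseteq> I"
proof -
  interpret reg: left_module R "regular_module R" by (rule regular_left_module[OF ring_axioms])
  have one: "K = carrier R" if "submodule K R (regular_module R)" "\<one>\<^bsub>R\<^esub> \<in> K" for K
  proof -
    have "x \<in> K" if "x \<in> carrier R" for x
      using submoduleD(5)[OF \<open>submodule K R _\<close> that \<open>\<one>\<^bsub>R\<^esub> \<in> K\<close>] that by simp
    then show ?thesis using submoduleD(2)[OF that(1)] by auto
  qed
  let ?A = "{K. submodule K R (regular_module R) \<and> L \<subseteq> K \<and> \<one>\<^bsub>R\<^esub> \<notin> K}"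
  have "\<exists>M\<in>?A. \<forall>X\<in>?A. M \<subseteq> X \<longrightarrow> X = M"
  proof (rule subset_Zorn_nonempty)
    show "?A \<noteq> {}" using L one[OF L(1)] by blast
    fix C assume C: "C \<noteq> {}" "subset.chain ?A C"
    then have "subset.chain {N. submodule N R (regular_module R)} C" by (auto simp: subset.chain_def)
    then have "submodule (\<Union>C) R (regular_module R)" by (rule reg.submodule_Union_chain[OF C(1)])
    then show "\<Union>C \<in> ?A" using C by (auto simp: subset.chain_def)
  qed
  then obtain I where "I \<in> ?A" "\<forall>X\<in>?A. I \<subseteq> X \<longrightarrow> X = I" by (rule bexE)
  then have I: "I \<in> ?A" "\<And>X. X \<in> ?A \<Longrightarrow> I \<subseteq> X \<Longrightarrow> X = I" by simp_all
  have "maximal_left_ideal R I"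
    unfolding maximal_left_ideal_def
  proof (intro conjI allI impI)
    show "submodule I R (regular_module R)" "I \<noteq> carrier R" using I(1) by auto
    fix K assume K: "submodule K R (regular_module R) \<and> I \<subseteq> K"
    show "K = I \<or> K = carrier R"
    proof (cases "\<one>\<^bsub>R\<^esub> \<in> K")
      case True then show ?thesis using one K by blast
    next
      case False
      then have "K \<in> ?A" using K I(1) by blast
      then show ?thesis using I(2) K by blast
    qed
  qed
  then show ?thesis using I(1) by blast
qed

lemma jacobson_subset: "jacobson_radical R \<subseteq> carrier R"
  by (auto simp: jacobson_radical_def)

lemma jacobson_submodule: "submodule (jacobson_radical R) R (regular_module R)"
proof -
  interpret reg: left_module R "regular_module R" by (rule regular_left_module[OF ring_axioms])
  have *: "submodule I R (regular_module R)" if "maximal_left_ideal R I" for I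
    using that by (simp add: maximal_left_ideal_def)
  show ?thesis
    by (rule reg.submoduleI)
       (auto simp: jacobson_radical_def dest: * intro: submoduleD(3)[OF *, simplified]
          submoduleD(4)[OF *, simplified] submoduleD(5)[OF *, simplified])
qed

lemma jacobson_l_mult: "r \<in> carrier R \<Longrightarrow> j \<in> jacobson_radical R \<Longrightarrow> r \<otimes>\<^bsub>R\<^esub> j \<in> jacobson_radical R"
  using submoduleD(5)[OF jacobson_submodule] by simp

text \<open>The left ideal in question is the annihilator of the class of \<open>r\<close> in the simple module \<open>R/I\<close>, which is
  maximal since \<open>R/I\<close> is generated by every nonzero element. It makes \<open>J\<close> a right ideal.\<close>

lemma maximal_left_ideal_quotient:
  assumes I: "maximal_left_ideal R I" and r: "r \<in> carrier R" "r \<notin> I"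
  shows "maximal_left_ideal R {y \<in> carrier R. y \<otimes>\<^bsub>R\<^esub> r \<in> I}" (is "maximal_left_ideal R ?K")
proof -
  interpret reg: left_module R "regular_module R" by (rule regular_left_module[OF ring_axioms])
  have Is: "submodule I R (regular_module R)" using I by (simp add: maximal_left_ideal_def)
  have Ks: "submodule ?K R (regular_module R)"
    using reg.submodule_ann_into[OF Is reg.submodule_ideal, of r] r by simp
  have "\<one>\<^bsub>R\<^esub> \<notin> ?K" using r by simp
  then have "?K \<noteq> carrier R" by blast
  moreover have "K' = carrier R" if K': "submodule K' R (regular_module R)" "?K \<subseteq> K'" "K' \<noteq> ?K" for K'
  proof -
    note D = submoduleD[OF K'(1), simplified]
    obtain y where y: "y \<in> K'" "y \<in> carrier R" "y \<otimes>\<^bsub>R\<^esub> r \<notin> I" using K' D(1) by blast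
    \<comment> \<open>\<open>I + R(yr)\<close> is all of \<open>R\<close>, so modulo \<open>I\<close> every \<open>zr\<close> is a multiple of \<open>yr\<close>.\<close>
    let ?L = "I <+>\<^bsub>regular_module R\<^esub> ((\<lambda>l. l \<odot>\<^bsub>regular_module R\<^esub> (y \<otimes>\<^bsub>R\<^esub> r)) ` carrier R)"
    have C: "submodule ((\<lambda>l. l \<odot>\<^bsub>regular_module R\<^esub> (y \<otimes>\<^bsub>R\<^esub> r)) ` carrier R) R (regular_module R)"
      using reg.submodule_cyclic[OF reg.submodule_ideal, of "y \<otimes>\<^bsub>R\<^esub> r"] y r by simp
    have "submodule ?L R (regular_module R)" by (rule reg.submodule_set_add[OF Is C])
    moreover have "I \<subseteq> ?L" using reg.set_add_upper[OF Is C] by simp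
    moreover have "y \<otimes>\<^bsub>R\<^esub> r \<in> ?L"
    proof -
      have "y \<otimes>\<^bsub>R\<^esub> r = \<one>\<^bsub>R\<^esub> \<odot>\<^bsub>regular_module R\<^esub> (y \<otimes>\<^bsub>R\<^esub> r)" using y r by simp
      then show ?thesis using reg.set_add_upper(2)[OF Is C] one_closed by blast
    qed
    ultimately have L: "?L = carrier R" using I y(3) unfolding maximal_left_ideal_def by metis
    show ?thesis
    proof
      show "K' \<subseteq> carrier R" using D by blast
      show "carrier R \<subseteq> K'"
      proof
        fix z assume z: "z \<in> carrier R"
        then have "z \<otimes>\<^bsub>R\<^esub> r \<in> ?L" using L r by simp
        then obtain i s where it: "i \<in> I" "s \<in> carrier R" "z \<otimes>\<^bsub>R\<^esub> r = i \<oplus>\<^bsub>R\<^esub> s \<otimes>\<^bsub>R\<^esub> (y \<otimes>\<^bsub>R\<^esub> r)"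
          by (auto simp: set_add_iff)
        have ic: "i \<in> carrier R" using submoduleD(1)[OF Is it(1)] by simp
        have "(z \<ominus>\<^bsub>R\<^esub> s \<otimes>\<^bsub>R\<^esub> y) \<otimes>\<^bsub>R\<^esub> r = z \<otimes>\<^bsub>R\<^esub> r \<ominus>\<^bsub>R\<^esub> s \<otimes>\<^bsub>R\<^esub> (y \<otimes>\<^bsub>R\<^esub> r)"
          using z y it r by (simp add: l_distr a_minus_def l_minus m_assoc)
        also have "\<dots> = i" using it ic y r by (simp add: a_minus_def a_assoc r_neg)
        finally have "z \<ominus>\<^bsub>R\<^esub> s \<otimes>\<^bsub>R\<^esub> y \<in> K'" using it(1,2) z y K'(2) by auto
        moreover have "s \<otimes>\<^bsub>R\<^esub> y \<in> K'" using D(5) it y by simp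
        ultimately have "s \<otimes>\<^bsub>R\<^esub> y \<oplus>\<^bsub>R\<^esub> (z \<ominus>\<^bsub>R\<^esub> s \<otimes>\<^bsub>R\<^esub> y) \<in> K'" using D(4) by blast
        moreover have "s \<otimes>\<^bsub>R\<^esub> y \<oplus>\<^bsub>R\<^esub> (z \<ominus>\<^bsub>R\<^esub> s \<otimes>\<^bsub>R\<^esub> y) = z"
          using reg.add_diff_cancel[of z "s \<otimes>\<^bsub>R\<^esub> y"] z it y by (simp add: a_minus_def a_lcomm r_neg)
        ultimately show "z \<in> K'" by simp
      qed
    qed
  qed
  ultimately show ?thesis using Ks unfolding maximal_left_ideal_def by blast
qed

lemma jacobson_r_mult:
  assumes "j \<in> jacobson_radical R" "r \<in> carrier R"
  shows "j \<otimes>\<^bsub>R\<^esub> r \<in> jacobson_radical R"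
proof -
  have j: "j \<in> carrier R" using assms by (simp add: jacobson_radical_def)
  have "j \<otimes>\<^bsub>R\<^esub> r \<in> I" if I: "maximal_left_ideal R I" for I
  proof (cases "r \<in> I")
    case True
    have "submodule I R (regular_module R)" using I by (simp add: maximal_left_ideal_def)
    from submoduleD(5)[OF this j True] show ?thesis by simp
  next
    case False
    from maximal_left_ideal_quotient[OF I assms(2) False] assms(1) show ?thesis
      by (auto simp: jacobson_radical_def)
  qed
  then show ?thesis using assms j by (simp add: jacobson_radical_def)
qed

end

text \<open>The annihilator of \<open>x\<close> contains \<open>1 - j\<close>, which lies in no maximal left ideal.\<close>

lemma (in left_module) jacobson_fixes_zero:
  assumes j: "j \<in> jacobson_radical R" and x: "x \<in> carrier M" "x = j \<odot>\<^bsub>M\<^esub> x"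
  shows "x = \<zero>\<^bsub>M\<^esub>"
proof (rule ccontr)
  assume nz: "x \<noteq> \<zero>\<^bsub>M\<^esub>"
  have jc: "j \<in> carrier R" using j by (simp add: jacobson_radical_def)
  let ?L = "{l \<in> carrier R. l \<odot>\<^bsub>M\<^esub> x \<in> {\<zero>\<^bsub>M\<^esub>}}"
  have L: "submodule ?L R (regular_module R)"
    by (rule submodule_ann_into[OF submodule_zero submodule_ideal x(1)])
  have "\<one>\<^bsub>R\<^esub> \<notin> ?L" using nz x by (simp add: smult_one)
  then have "?L \<noteq> carrier R" by blast
  then obtain I where I: "maximal_left_ideal R I" "?L \<subseteq> I"
    using base_ring.maximal_left_ideal_exists[OF base_ring.intro[OF R.ring_axioms] L] by blast
  have Is: "submodule I R (regular_module R)" "I \<noteq> carrier R"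
    using I by (auto simp: maximal_left_ideal_def)
  have "(\<one>\<^bsub>R\<^esub> \<ominus>\<^bsub>R\<^esub> j) \<odot>\<^bsub>M\<^esub> x = \<zero>\<^bsub>M\<^esub>"
    using smult_l_distr[of "\<one>\<^bsub>R\<^esub>" "\<ominus>\<^bsub>R\<^esub> j" x] x jc
    by (simp add: a_minus_def smult_one smult_l_minus M.r_neg)
  then have "\<one>\<^bsub>R\<^esub> \<ominus>\<^bsub>R\<^esub> j \<in> I" using I(2) jc by auto
  moreover have "j \<in> I" using I(1) j by (simp add: jacobson_radical_def)
  ultimately have "j \<oplus>\<^bsub>R\<^esub> (\<one>\<^bsub>R\<^esub> \<ominus>\<^bsub>R\<^esub> j) \<in> I" using submoduleD(4)[OF Is(1)] by simp
  then have "\<one>\<^bsub>R\<^esub> \<in> I"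
    using jc R.r_neg2[of j "\<one>\<^bsub>R\<^esub>"] R.a_comm[of "\<one>\<^bsub>R\<^esub>" "\<ominus>\<^bsub>R\<^esub> j"] by (simp add: a_minus_def)
  then have "x \<in> I" if "x \<in> carrier R" for x
    using submoduleD(5)[OF Is(1) that, of "\<one>\<^bsub>R\<^esub>"] that by simp
  then have "I = carrier R" using submoduleD(2)[OF Is(1)] by auto
  with Is show False by blast
qed

locale left_artinian = base_ring R for R :: "'r ring" +
  assumes artinian: "artinian_module R (regular_module R)"
begin

abbreviation J where "J \<equiv> jacobson_radical R"

text \<open>The minimum condition for left ideals, from the descending chain condition by dependent choice.\<close>

lemma minimal_left_ideal_exists:
  assumes "submodule L R (regular_module R)" "P L"
  shows "\<exists>L. submodule L R (regular_module R) \<and> P L \<and>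
    (\<forall>L'. submodule L' R (regular_module R) \<and> P L' \<and> L' \<subseteq> L \<longrightarrow> L' = L)"
proof (rule ccontr)
  let ?Q = "\<lambda>K. submodule K R (regular_module R) \<and> P K"
  assume "\<not> ?thesis"
  then have "\<And>K. ?Q K \<Longrightarrow> \<exists>K'. ?Q K' \<and> K' \<subset> K" by blast
  then have "\<exists>f. \<forall>n. ?Q (f n) \<and> f (Suc n) \<subset> f n"
    using dependent_nat_choice[of "\<lambda>n. ?Q" "\<lambda>n K K'. K' \<subset> K"] assms by blast
  then obtain f where f: "\<And>n. submodule (f n) R (regular_module R)" "\<And>n. f (Suc n) \<subset> f n" by blast
  then obtain n where "\<forall>m\<ge>n. f m = f n"
    using artinian unfolding artinian_module_def by (metis psubset_imp_subset)
  then have "f (Suc n) = f n" by (metis le_SucI order_refl)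
  with f(2) show False by blast
qed

text \<open>The powers \<open>J\<^sup>n\<close>, as iterated left multiples.\<close>

definition rad_pow :: "nat \<Rightarrow> 'r set" where
  "rad_pow n = ((\<lambda>N. ideal_mult J (regular_module R) N) ^^ n) (carrier R)"

lemma rad_pow_simps: "rad_pow 0 = carrier R" "rad_pow (Suc n) = ideal_mult J (regular_module R) (rad_pow n)"
  by (simp_all add: rad_pow_def)

lemma rad_pow_submodule: "submodule (rad_pow n) R (regular_module R)"
proof -
  interpret reg: left_module R "regular_module R" by (rule regular_left_module[OF ring_axioms])
  show ?thesis
  proof (induction n)
    case 0 then show ?case using reg.submodule_carrier by (simp add: rad_pow_simps)
  next
    case (Suc n)
    then show ?case unfolding rad_pow_simps
      using submoduleD(2)[OF Suc] by (intro reg.ideal_mult_submodule) (auto simp: jacobson_subset jacobson_l_mult)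
  qed
qed

lemma rad_pow_Suc_subset: "rad_pow (Suc n) \<subseteq> rad_pow n"
proof -
  interpret reg: left_module R "regular_module R" by (rule regular_left_module[OF ring_axioms])
  have "j \<odot>\<^bsub>regular_module R\<^esub> x \<in> rad_pow n" if "j \<in> J" "x \<in> rad_pow n" for j x
    using submoduleD(5)[OF rad_pow_submodule] that jacobson_subset by blast
  from reg.ideal_mult_least[OF rad_pow_submodule this] show ?thesis by (simp add: rad_pow_simps)
qed

text \<open>The powers are built by multiplying with \<open>J\<close> on the left; the nilpotence proof needs a factor \<open>J\<close>
  on the right.\<close>

lemma rad_pow_Suc_right: "rad_pow (Suc n) \<subseteq> ideal_mult (rad_pow n) (regular_module R) J"
proof -
  interpret reg: left_module R "regular_module R" by (rule regular_left_module[OF ring_axioms])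
  have sub: "rad_pow n \<subseteq> carrier R" for n using submoduleD(2)[OF rad_pow_submodule] by simp
  have l: "r \<otimes>\<^bsub>R\<^esub> x \<in> rad_pow n" if "r \<in> carrier R" "x \<in> rad_pow n" for r x n
    using submoduleD(5)[OF rad_pow_submodule that] by simp
  have S: "submodule (ideal_mult (rad_pow n) (regular_module R) J) R (regular_module R)" for n
    using sub jacobson_subset l by (intro reg.ideal_mult_submodule) auto
  show ?thesis
  proof (induction n)
    case 0
    show ?case unfolding rad_pow_simps
    proof (rule reg.ideal_mult_least[OF S[of 0, unfolded rad_pow_simps]])
      fix j r assume "j \<in> J" "r \<in> carrier R"
      then have "j \<otimes>\<^bsub>R\<^esub> r \<in> J" by (rule jacobson_r_mult)
      then have "\<one>\<^bsub>R\<^esub> \<odot>\<^bsub>regular_module R\<^esub> (j \<otimes>\<^bsub>R\<^esub> r) \<in> ideal_mult (carrier R) (regular_module R) J"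
        using jacobson_subset by (intro reg.ideal_mult_single) auto
      then show "j \<odot>\<^bsub>regular_module R\<^esub> r \<in> ideal_mult (carrier R) (regular_module R) J"
        using \<open>j \<otimes>\<^bsub>R\<^esub> r \<in> J\<close> jacobson_subset by auto
    qed
  next
    case (Suc n)
    show ?case unfolding rad_pow_simps(2)[of "Suc n"]
    proof (rule reg.ideal_mult_least[OF S])
      fix j y assume j: "j \<in> J" and "y \<in> rad_pow (Suc n)"
      then have jc: "j \<in> carrier R" using jacobson_subset by auto
      from \<open>y \<in> rad_pow (Suc n)\<close> Suc have "y \<in> ideal_mult (rad_pow n) (regular_module R) J" by blast
      then show "j \<odot>\<^bsub>regular_module R\<^esub> y \<in> ideal_mult (rad_pow (Suc n)) (regular_module R) J"
      proof induction
        case zero then show ?case using jc ideal_mult.zero[of "regular_module R"] by simp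
      next
        case (step i k y)
        then have c: "i \<in> carrier R" "k \<in> carrier R" "y \<in> carrier R"
          using sub jacobson_subset reg.ideal_mult_closed[of y "rad_pow n" J] by auto
        have "j \<otimes>\<^bsub>R\<^esub> i \<in> rad_pow (Suc n)" unfolding rad_pow_simps
          using reg.ideal_mult_single[of J "rad_pow n" j i] jacobson_subset sub j step by auto
        from ideal_mult.step[OF this step(2) step(4)]
        show ?case using jc c by (simp add: r_distr m_assoc)
      qed
    qed
  qed
qed

text \<open>If the stable power \<open>I = J\<^sup>n\<close> is nonzero, choose a left ideal \<open>L\<close> minimal with \<open>I L \<noteq> 0\<close>, and \<open>x\<close> in \<open>L\<close>
  with \<open>I x \<noteq> 0\<close>. As \<open>I = I J\<close>, also \<open>I (J x) \<noteq> 0\<close>, so \<open>J x = L\<close> contains \<open>x\<close>, and \<open>x = j x\<close> forces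
  \<open>x = 0\<close>.\<close>

lemma rad_pow_nilpotent: "\<exists>n. rad_pow n = {\<zero>\<^bsub>R\<^esub>}"
proof -
  interpret reg: left_module R "regular_module R" by (rule regular_left_module[OF ring_axioms])
  have sub: "rad_pow n \<subseteq> carrier R" for n using submoduleD(2)[OF rad_pow_submodule] by simp
  obtain n where "\<forall>m\<ge>n. rad_pow m = rad_pow n"
    using artinian rad_pow_submodule rad_pow_Suc_subset unfolding artinian_module_def by metis
  then have n: "rad_pow (Suc n) = rad_pow n" by (metis le_SucI order_refl)
  have "rad_pow n = {\<zero>\<^bsub>R\<^esub>}"
  proof (rule ccontr)
    assume "rad_pow n \<noteq> {\<zero>\<^bsub>R\<^esub>}"
    moreover have "\<zero>\<^bsub>R\<^esub> \<in> rad_pow n" using submoduleD(3)[OF rad_pow_submodule] by simp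
    ultimately obtain i0 where i0: "i0 \<in> rad_pow n" "i0 \<noteq> \<zero>\<^bsub>R\<^esub>" by blast
    let ?P = "\<lambda>L. \<exists>i\<in>rad_pow n. \<exists>x\<in>L. i \<otimes>\<^bsub>R\<^esub> x \<noteq> \<zero>\<^bsub>R\<^esub>"
    have "i0 \<in> carrier R" using i0(1) sub by blast
    then have "?P (carrier R)" using i0 r_one one_closed by metis
    from minimal_left_ideal_exists[of _ ?P, OF reg.submodule_ideal this]
    obtain L where L: "submodule L R (regular_module R)" "?P L"
      "\<And>L'. submodule L' R (regular_module R) \<Longrightarrow> ?P L' \<Longrightarrow> L' \<subseteq> L \<Longrightarrow> L' = L" by blast
    obtain i x where ix: "i \<in> rad_pow n" "x \<in> L" "i \<otimes>\<^bsub>R\<^esub> x \<noteq> \<zero>\<^bsub>R\<^esub>" using L(2) by blast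
    have xc: "x \<in> carrier R" using submoduleD(1)[OF L(1) ix(2)] by simp
    let ?K = "(\<lambda>l. l \<odot>\<^bsub>regular_module R\<^esub> x) ` J"
    have K: "submodule ?K R (regular_module R)"
      using reg.submodule_cyclic[OF jacobson_submodule, of x] xc by simp
    have "?P ?K"
    proof (rule ccontr)
      assume nP: "\<not> ?P ?K"
      have "y \<otimes>\<^bsub>R\<^esub> x = \<zero>\<^bsub>R\<^esub>" if "y \<in> ideal_mult (rad_pow n) (regular_module R) J" for y
        using that
      proof induction
        case zero then show ?case using xc by simp
      next
        case (step k j y)
        then have c: "k \<in> carrier R" "j \<in> carrier R" "y \<in> carrier R"
          using sub jacobson_subset reg.ideal_mult_closed[of y "rad_pow n" J] by auto
        have "k \<otimes>\<^bsub>R\<^esub> (j \<otimes>\<^bsub>R\<^esub> x) = \<zero>\<^bsub>R\<^esub>" using nP step by auto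
        then show ?case using step c xc by (simp add: l_distr m_assoc)
      qed
      moreover have "i \<in> ideal_mult (rad_pow n) (regular_module R) J"
        using ix(1) n rad_pow_Suc_right[of n] by blast
      ultimately show False using ix(3) by blast
    qed
    moreover have "?K \<subseteq> L"
    proof
      fix y assume "y \<in> ?K"
      then obtain j where "j \<in> J" "y = j \<odot>\<^bsub>regular_module R\<^esub> x" by blast
      then show "y \<in> L" using submoduleD(5)[OF L(1) _ ix(2), of j] jacobson_subset by auto
    qed
    ultimately have "?K = L" using L(3)[OF K] by blast
    then obtain j where "j \<in> J" "x = j \<odot>\<^bsub>regular_module R\<^esub> x" using ix(2) by blast
    then have "x = \<zero>\<^bsub>R\<^esub>" using reg.jacobson_fixes_zero[of j x] xc by simp
    then show False using ix(3) subsetD[OF sub ix(1)] by simp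
  qed
  then show ?thesis by blast
qed

definition rad_length :: nat where "rad_length = (SOME n. rad_pow n = {\<zero>\<^bsub>R\<^esub>})"

lemma rad_pow_length: "rad_pow rad_length = {\<zero>\<^bsub>R\<^esub>}"
  unfolding rad_length_def by (rule someI_ex[OF rad_pow_nilpotent])


definition rad_mod :: "('r, 'm) module \<Rightarrow> nat \<Rightarrow> 'm set" where
  "rad_mod M n = ((\<lambda>N. ideal_mult J M N) ^^ n) (carrier M)"

lemma rad_mod_simps: "rad_mod M 0 = carrier M" "rad_mod M (Suc n) = ideal_mult J M (rad_mod M n)"
  by (simp_all add: rad_mod_def)

lemma rad_mod_submodule: "left_module R M \<Longrightarrow> submodule (rad_mod M n) R M"
proof (induction n)
  case 0 then show ?case by (simp add: rad_mod_simps left_module.submodule_carrier)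
next
  case (Suc n)
  then interpret left_module R M by simp
  show ?case unfolding rad_mod_simps
    using submoduleD(2)[OF Suc.IH[OF Suc.prems]]
    by (intro ideal_mult_submodule) (auto simp: jacobson_subset jacobson_l_mult)
qed

lemma rad_mod_subset_rad_pow:
  assumes "left_module R M"
  shows "rad_mod M n \<subseteq> ideal_mult (rad_pow n) M (carrier M)"
proof -
  interpret left_module R M by fact
  have sub: "rad_pow n \<subseteq> carrier R" for n using submoduleD(2)[OF rad_pow_submodule] by simp
  have l: "r \<otimes>\<^bsub>R\<^esub> x \<in> rad_pow n" if "r \<in> carrier R" "x \<in> rad_pow n" for r x n
    using submoduleD(5)[OF rad_pow_submodule that] by simp
  show ?thesis
  proof (induction n)
    case 0
    show ?case
    proof
      fix x assume "x \<in> rad_mod M 0"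
      then have x: "x \<in> carrier M" by (simp add: rad_mod_simps)
      then have "\<one>\<^bsub>R\<^esub> \<odot>\<^bsub>M\<^esub> x \<in> ideal_mult (rad_pow 0) M (carrier M)"
        by (intro ideal_mult_single) (auto simp: rad_pow_simps)
      then show "x \<in> ideal_mult (rad_pow 0) M (carrier M)" using x by (simp add: smult_one)
    qed
  next
    case (Suc n)
    have S: "submodule (ideal_mult (rad_pow (Suc n)) M (carrier M)) R M"
      using sub l by (intro ideal_mult_submodule) auto
    show ?case unfolding rad_mod_simps
    proof (rule ideal_mult_least[OF S])
      fix j x assume j: "j \<in> J" and "x \<in> rad_mod M n"
      then have jc: "j \<in> carrier R" using jacobson_subset by auto
      from \<open>x \<in> rad_mod M n\<close> Suc have "x \<in> ideal_mult (rad_pow n) M (carrier M)" by blast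
      then show "j \<odot>\<^bsub>M\<^esub> x \<in> ideal_mult (rad_pow (Suc n)) M (carrier M)"
      proof induction
        case zero then show ?case using jc ideal_mult.zero[of M] by simp
      next
        case (step i x y)
        then have c: "i \<in> carrier R" "x \<in> carrier M" "y \<in> carrier M"
          using sub ideal_mult_closed[of y "rad_pow n" "carrier M"] by auto
        interpret reg: left_module R "regular_module R" by (rule regular_left_module[OF ring_axioms])
        have "j \<otimes>\<^bsub>R\<^esub> i \<in> rad_pow (Suc n)" unfolding rad_pow_simps
          using reg.ideal_mult_single[of J "rad_pow n" j i] jacobson_subset sub j step by auto
        from ideal_mult.step[OF this step(2) step(4)]
        show ?case using jc c by (simp add: smult_r_distr smult_assoc smult_closed)
      qed
    qed
  qed
qed

lemma rad_mod_nilpotent: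
  assumes "left_module R M"
  shows "rad_mod M rad_length = {\<zero>\<^bsub>M\<^esub>}"
proof -
  interpret left_module R M by fact
  have "ideal_mult {\<zero>\<^bsub>R\<^esub>} M (carrier M) \<subseteq> {\<zero>\<^bsub>M\<^esub>}"
    by (rule ideal_mult_least[OF submodule_zero]) auto
  then have "rad_mod M rad_length \<subseteq> {\<zero>\<^bsub>M\<^esub>}"
    using rad_mod_subset_rad_pow[OF assms, of rad_length] rad_pow_length by simp
  then show ?thesis using submoduleD(3)[OF rad_mod_submodule[OF assms, of rad_length]] by blast
qed

text \<open>Multiplying \<open>M = N + JM\<close> by \<open>J\<close> repeatedly gives \<open>M = N + J\<^sup>kM\<close> for all \<open>k\<close>. Nilpotence of \<open>J\<close>
  makes this work without any finiteness assumption on \<open>M\<close>.\<close>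

lemma nakayama:
  assumes M: "left_module R M" and N: "submodule N R M"
    and eq: "N <+>\<^bsub>M\<^esub> ideal_mult J M (carrier M) = carrier M"
  shows "N = carrier M"
proof -
  interpret left_module R M by fact
  have JM: "submodule (ideal_mult J M (carrier M)) R M"
    using rad_mod_submodule[OF M, of 1] by (simp add: rad_mod_simps)
  have "carrier M \<subseteq> N <+>\<^bsub>M\<^esub> rad_mod M k" for k
  proof (induction k)
    case 0
    show ?case using set_add_upper(2)[OF N submodule_carrier] by (simp add: rad_mod_simps)
  next
    case (Suc k)
    note R = rad_mod_submodule[OF M]
    have S: "submodule (N <+>\<^bsub>M\<^esub> rad_mod M (Suc k)) R M" by (rule submodule_set_add[OF N R])
    have "ideal_mult J M (carrier M) \<subseteq> N <+>\<^bsub>M\<^esub> rad_mod M (Suc k)"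
    proof (rule ideal_mult_least[OF S])
      fix j x assume j: "j \<in> J" and "x \<in> carrier M"
      then obtain n y where ny: "n \<in> N" "y \<in> rad_mod M k" "x = n \<oplus>\<^bsub>M\<^esub> y"
        using Suc by (auto simp: set_add_iff subset_iff)
      have c: "j \<in> carrier R" "n \<in> carrier M" "y \<in> carrier M"
        using j jacobson_subset submoduleD(1)[OF N ny(1)] submoduleD(1)[OF R ny(2)] by auto
      then have "j \<odot>\<^bsub>M\<^esub> x = j \<odot>\<^bsub>M\<^esub> n \<oplus>\<^bsub>M\<^esub> j \<odot>\<^bsub>M\<^esub> y" using ny by (simp add: smult_r_distr)
      moreover have "j \<odot>\<^bsub>M\<^esub> n \<in> N" using submoduleD(5)[OF N c(1) ny(1)] .
      moreover have "j \<odot>\<^bsub>M\<^esub> y \<in> rad_mod M (Suc k)" unfolding rad_mod_simps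
        using ideal_mult_single[OF jacobson_subset submoduleD(2)[OF R] j ny(2)] .
      ultimately show "j \<odot>\<^bsub>M\<^esub> x \<in> N <+>\<^bsub>M\<^esub> rad_mod M (Suc k)" unfolding set_add_iff by blast
    qed
    then show ?case using set_add_least[OF S set_add_upper(1)[OF N R], of "ideal_mult J M (carrier M)"] eq by simp
  qed
  from this[of rad_length] have "carrier M \<subseteq> N <+>\<^bsub>M\<^esub> {\<zero>\<^bsub>M\<^esub>}" using rad_mod_nilpotent[OF M] by simp
  also have "\<dots> \<subseteq> N" by (rule set_add_least[OF N]) (use submoduleD(3)[OF N] in auto)
  finally show ?thesis using submoduleD(2)[OF N] by blast
qed

lemma superfluous_if:
  assumes M: "left_module R M" and K: "submodule K R M" "K \<subseteq> ideal_mult J M (carrier M)"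
  shows "superfluous R M K"
  unfolding superfluous_def
proof (intro conjI allI impI)
  interpret left_module R M by fact
  have JM: "submodule (ideal_mult J M (carrier M)) R M"
    using rad_mod_submodule[OF M, of 1] by (simp add: rad_mod_simps)
  fix N assume N: "submodule N R M \<and> N <+>\<^bsub>M\<^esub> K = carrier M"
  have "N <+>\<^bsub>M\<^esub> K \<subseteq> N <+>\<^bsub>M\<^esub> ideal_mult J M (carrier M)"
    using K(2) unfolding subset_iff set_add_iff by blast
  then have "carrier M \<subseteq> N <+>\<^bsub>M\<^esub> ideal_mult J M (carrier M)" using N by simp
  then have "N <+>\<^bsub>M\<^esub> ideal_mult J M (carrier M) = carrier M"
    using submoduleD(2)[OF submodule_set_add[OF _ JM]] N by blast
  then show "N = carrier M" using nakayama[OF M] N by blast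
qed (rule K)

text \<open>This is the semisimplicity of \<open>M/JM\<close>. Take \<open>X\<close> maximal among the submodules that meet \<open>K\<close> in \<open>JM\<close>. If
  \<open>v\<close> were outside \<open>W = X + K\<close>, choose a left ideal \<open>L\<close> minimal with \<open>L v\<close> not inside \<open>W\<close>. Every proper left
  subideal of \<open>L\<close> then lies in the left ideal \<open>L'\<close> of those \<open>l\<close> in \<open>L\<close> with \<open>l v\<close> in \<open>W\<close>; in particular
  \<open>L \<inter> I \<subseteq> L'\<close> for each maximal left ideal \<open>I\<close> not containing \<open>L\<close>. If \<open>L'\<close> were not inside \<open>I\<close>, then
  \<open>I + L' = R\<close> would give \<open>L = L'\<close>. Hence \<open>L' \<subseteq> J\<close>, the cyclic module \<open>L v\<close> meets \<open>W\<close> only in \<open>JM\<close>, and \<open>X\<close>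
  can be enlarged by it.\<close>

lemma complement_mod_rad:
  assumes M: "left_module R M" and K: "submodule K R M" "ideal_mult J M (carrier M) \<subseteq> K"
  shows "\<exists>X. submodule X R M \<and> X \<inter> K = ideal_mult J M (carrier M) \<and> X <+>\<^bsub>M\<^esub> K = carrier M"
proof -
  interpret left_module R M by fact
  let ?JM = "ideal_mult J M (carrier M)"
  have JM: "submodule ?JM R M"
    using rad_mod_submodule[OF M, of 1] by (simp add: rad_mod_simps)
  let ?A = "{X. submodule X R M \<and> X \<inter> K = ?JM}"
  have "\<exists>X\<in>?A. \<forall>Y\<in>?A. X \<subseteq> Y \<longrightarrow> Y = X"
  proof (rule subset_Zorn_nonempty)
    show "?A \<noteq> {}" using JM K by blast
    fix C assume C: "C \<noteq> {}" "subset.chain ?A C"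
    then have "subset.chain {N. submodule N R M} C" by (auto simp: subset.chain_def)
    then have "submodule (\<Union>C) R M" by (rule submodule_Union_chain[OF C(1)])
    then show "\<Union>C \<in> ?A" using C by (fastforce simp: subset.chain_def)
  qed
  then obtain X where "X \<in> ?A" "\<forall>Y\<in>?A. X \<subseteq> Y \<longrightarrow> Y = X" by (rule bexE)
  then have X: "submodule X R M" "X \<inter> K = ?JM"
    and max: "\<And>Y. submodule Y R M \<Longrightarrow> Y \<inter> K = ?JM \<Longrightarrow> X \<subseteq> Y \<Longrightarrow> Y = X" by simp_all
  let ?W = "X <+>\<^bsub>M\<^esub> K"
  have W: "submodule ?W R M" by (rule submodule_set_add[OF X(1) K(1)])
  have "v \<in> ?W" if v: "v \<in> carrier M" for v
  proof (rule ccontr)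
    assume "v \<notin> ?W"
    let ?P = "\<lambda>L. \<exists>l\<in>L. l \<odot>\<^bsub>M\<^esub> v \<notin> ?W"
    have "?P (carrier R)" using \<open>v \<notin> ?W\<close> v by (intro bexI[of _ "\<one>\<^bsub>R\<^esub>"]) (auto simp: smult_one)
    from minimal_left_ideal_exists[of _ ?P, OF submodule_ideal this]
    obtain L where L: "submodule L R (regular_module R)" "?P L"
      "\<And>L'. submodule L' R (regular_module R) \<Longrightarrow> ?P L' \<Longrightarrow> L' \<subseteq> L \<Longrightarrow> L' = L" by blast
    interpret reg: left_module R "regular_module R" by (rule regular_left_module[OF ring_axioms])
    let ?L' = "{l \<in> L. l \<odot>\<^bsub>M\<^esub> v \<in> ?W}"
    have L': "submodule ?L' R (regular_module R)" by (rule submodule_ann_into[OF W L(1) v])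
    have rad: "l \<in> J" if l: "l \<in> ?L'" for l
    proof -
      have "l \<in> I" if I: "maximal_left_ideal R I" for I
      proof (cases "L \<subseteq> I")
        case True then show ?thesis using l by blast
      next
        case False
        have Is: "submodule I R (regular_module R)"
          and Imax: "\<And>K. submodule K R (regular_module R) \<Longrightarrow> I \<subseteq> K \<Longrightarrow> K = I \<or> K = carrier R"
          using I by (auto simp: maximal_left_ideal_def)
        have LI: "submodule (L \<inter> I) R (regular_module R)" by (rule reg.submodule_Int[OF L(1) Is])
        have "\<not> ?P (L \<inter> I)" using L(3)[OF LI] False by blast
        then have sub: "L \<inter> I \<subseteq> ?L'" by blast
        show ?thesis
        proof (rule ccontr)
          assume "l \<notin> I"
          let ?S = "I <+>\<^bsub>regular_module R\<^esub> ?L'"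
          have S: "submodule ?S R (regular_module R)" by (rule reg.submodule_set_add[OF Is L'])
          have "?S = carrier R"
            using Imax[OF S] reg.set_add_upper[OF Is L'] l \<open>l \<notin> I\<close> by blast
          have "L \<subseteq> ?L'"
          proof
            fix z assume z: "z \<in> L"
            then have zc: "z \<in> carrier R" using submoduleD(1)[OF L(1)] by simp
            then have "z \<in> ?S" using \<open>?S = carrier R\<close> by simp
            then obtain i k where "i \<in> I" "k \<in> ?L'" "z = i \<oplus>\<^bsub>regular_module R\<^esub> k"
              unfolding set_add_iff by blast
            then have ik: "i \<in> I" "k \<in> ?L'" "z = i \<oplus>\<^bsub>R\<^esub> k" by simp_all
            have ikc: "i \<in> carrier R" "k \<in> carrier R"
              using submoduleD(1)[OF Is ik(1)] submoduleD(1)[OF L' ik(2)] by auto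
            have "z \<ominus>\<^bsub>regular_module R\<^esub> k \<in> L" using reg.submodule_minus[OF L(1) z] ik(2) by blast
            moreover have "z \<ominus>\<^bsub>regular_module R\<^esub> k = i"
            proof -
              have "z = i \<oplus>\<^bsub>regular_module R\<^esub> k" using ik by simp
              then show ?thesis using ikc reg.add.m_assoc[of i k "\<ominus>\<^bsub>regular_module R\<^esub> k"] reg.r_neg[of k] reg.M.add.inv_closed[of k]
                by (simp add: a_minus_def)
            qed
            ultimately have "i \<in> ?L'" using ik sub by auto
            then show "z \<in> ?L'" using submoduleD(4)[OF L' _ ik(2), of i] ik(3) by simp
          qed
          then show False using L(2) by blast
        qed
      qed
      moreover have "l \<in> carrier R" using submoduleD(1)[OF L' l] by simp
      ultimately show ?thesis by (simp add: jacobson_radical_def)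
    qed
    let ?C = "(\<lambda>l. l \<odot>\<^bsub>M\<^esub> v) ` L"
    have C: "submodule ?C R M" by (rule submodule_cyclic[OF L(1) v])
    let ?Y = "X <+>\<^bsub>M\<^esub> ?C"
    have Y: "submodule ?Y R M" by (rule submodule_set_add[OF X(1) C])
    have "?Y \<inter> K = ?JM"
    proof
      show "?JM \<subseteq> ?Y \<inter> K" using X(2) K(2) set_add_upper(1)[OF X(1) C] by blast
      show "?Y \<inter> K \<subseteq> ?JM"
      proof
        fix y assume y: "y \<in> ?Y \<inter> K"
        then obtain x l where xl: "x \<in> X" "l \<in> L" "y = x \<oplus>\<^bsub>M\<^esub> l \<odot>\<^bsub>M\<^esub> v" by (auto simp: set_add_iff)
        have c: "x \<in> carrier M" "l \<in> carrier R" "y \<in> carrier M" "l \<odot>\<^bsub>M\<^esub> v \<in> carrier M"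
          using submoduleD(1)[OF X(1) xl(1)] submoduleD(1)[OF L(1) xl(2)] submoduleD(1)[OF K(1)] y v smult_closed by auto
        have "l \<odot>\<^bsub>M\<^esub> v = (\<ominus>\<^bsub>M\<^esub> x) \<oplus>\<^bsub>M\<^esub> y" using xl c by (simp add: M.r_neg1)
        moreover have "\<ominus>\<^bsub>M\<^esub> x \<in> X" using submodule_neg[OF X(1) xl(1)] .
        ultimately have "l \<odot>\<^bsub>M\<^esub> v \<in> ?W" unfolding set_add_iff using y by blast
        then have "l \<in> J" using rad xl by blast
        then have "l \<odot>\<^bsub>M\<^esub> v \<in> ?JM" using ideal_mult_single[OF jacobson_subset _ _ v] by simp
        then have "l \<odot>\<^bsub>M\<^esub> v \<in> X" using X(2) by blast
        then have "y \<in> X" using submoduleD(4)[OF X(1)] xl by simp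
        then show "y \<in> ?JM" using X(2) y by blast
      qed
    qed
    then have "?Y = X" using max[OF Y] set_add_upper(1)[OF X(1) C] by blast
    then have "?C \<subseteq> X" using set_add_upper(2)[OF X(1) C] by blast
    then have "?C \<subseteq> ?W" using set_add_upper(1)[OF X(1) K(1)] by blast
    then show False using L(2) by blast
  qed
  then have "?W = carrier M" using submoduleD(2)[OF W] by blast
  then show ?thesis using X by blast
qed

text \<open>Modulo \<open>JM\<close> the submodule \<open>K\<close> has a complement, and a superfluous submodule leaves no room for one.\<close>

lemma superfluous_subset_rad:
  assumes M: "left_module R M" and K: "superfluous R M K"
  shows "K \<subseteq> ideal_mult J M (carrier M)"
proof -
  interpret left_module R M by fact
  let ?JM = "ideal_mult J M (carrier M)"
  have JM: "submodule ?JM R M"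
    using rad_mod_submodule[OF M, of 1] by (simp add: rad_mod_simps)
  have Ks: "submodule K R M" and sup: "\<And>N. submodule N R M \<Longrightarrow> N <+>\<^bsub>M\<^esub> K = carrier M \<Longrightarrow> N = carrier M"
    using K by (auto simp: superfluous_def)
  let ?K' = "K <+>\<^bsub>M\<^esub> ?JM"
  have K': "submodule ?K' R M" by (rule submodule_set_add[OF Ks JM])
  obtain X where X: "submodule X R M" "X \<inter> ?K' = ?JM" "X <+>\<^bsub>M\<^esub> ?K' = carrier M"
    using complement_mod_rad[OF M K'] set_add_upper[OF Ks JM] by blast
  have XK: "submodule (X <+>\<^bsub>M\<^esub> K) R M" by (rule submodule_set_add[OF X(1) Ks])
  have "?K' \<subseteq> X <+>\<^bsub>M\<^esub> K"
    using set_add_least[OF XK, of K ?JM] set_add_upper[OF X(1) Ks] X(2) by blast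
  then have "carrier M \<subseteq> X <+>\<^bsub>M\<^esub> K"
    using set_add_least[OF XK, of X ?K'] set_add_upper[OF X(1) Ks] X(3) by blast
  then have "X = carrier M" using sup[OF X(1)] submoduleD(2)[OF XK] by blast
  then have "?K' = ?JM" using X(2) submoduleD(2)[OF K'] by blast
  then show ?thesis using set_add_upper(1)[OF Ks JM] by blast
qed

end


section \<open>Direct sums of families, free modules and projective modules\<close>

text \<open>The external direct sum over a whole index type. Smaller index sets are obtained by filling the
  other places with zero modules.\<close>

definition ext_sum :: "('i \<Rightarrow> ('r, 'm) module) \<Rightarrow> ('r, 'i \<Rightarrow> 'm) module" where
  "ext_sum C = \<lparr>carrier = {f. (\<forall>i. f i \<in> carrier (C i)) \<and> finite {i. f i \<noteq> \<zero>\<^bsub>C i\<^esub>}},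
     monoid.mult = undefined, one = undefined, ring.zero = (\<lambda>i. \<zero>\<^bsub>C i\<^esub>),
     ring.add = (\<lambda>f g i. f i \<oplus>\<^bsub>C i\<^esub> g i), smult = (\<lambda>r f i. r \<odot>\<^bsub>C i\<^esub> f i)\<rparr>"

definition single :: "('i \<Rightarrow> ('r, 'm) module) \<Rightarrow> 'i \<Rightarrow> 'm \<Rightarrow> 'i \<Rightarrow> 'm" where
  "single C i c = (\<lambda>j. \<zero>\<^bsub>C j\<^esub>)(i := c)"

lemma ext_sum_simps [simp]:
  "f \<in> carrier (ext_sum C) \<longleftrightarrow> (\<forall>i. f i \<in> carrier (C i)) \<and> finite {i. f i \<noteq> \<zero>\<^bsub>C i\<^esub>}"
  "\<zero>\<^bsub>ext_sum C\<^esub> = (\<lambda>i. \<zero>\<^bsub>C i\<^esub>)" "f \<oplus>\<^bsub>ext_sum C\<^esub> g = (\<lambda>i. f i \<oplus>\<^bsub>C i\<^esub> g i)"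
  "r \<odot>\<^bsub>ext_sum C\<^esub> f = (\<lambda>i. r \<odot>\<^bsub>C i\<^esub> f i)"
  by (simp_all add: ext_sum_def)

locale module_family =
  fixes R :: "'r ring" and C :: "'i \<Rightarrow> ('r, 'm) module"
  assumes family: "left_module R (C i)"
begin

lemma ext_sum_left_module: "left_module R (ext_sum C)"
proof -
  interpret C: left_module R "C k" for k by (rule family)
  show ?thesis
  proof (rule left_moduleI)
    show "ring R" by (rule C.R.ring_axioms)
    fix f g assume fg: "f \<in> carrier (ext_sum C)" "g \<in> carrier (ext_sum C)"
    have "{i. f i \<oplus>\<^bsub>C i\<^esub> g i \<noteq> \<zero>\<^bsub>C i\<^esub>} \<subseteq> {i. f i \<noteq> \<zero>\<^bsub>C i\<^esub>} \<union> {i. g i \<noteq> \<zero>\<^bsub>C i\<^esub>}" by auto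
    then show "f \<oplus>\<^bsub>ext_sum C\<^esub> g \<in> carrier (ext_sum C)"
      using fg by (auto intro: finite_subset)
  next
    fix f assume f: "f \<in> carrier (ext_sum C)"
    let ?g = "\<lambda>i. \<ominus>\<^bsub>C i\<^esub> f i"
    have "{i. ?g i \<noteq> \<zero>\<^bsub>C i\<^esub>} \<subseteq> {i. f i \<noteq> \<zero>\<^bsub>C i\<^esub>}" by auto
    then have "?g \<in> carrier (ext_sum C)" using f by (auto intro: finite_subset)
    moreover have "?g \<oplus>\<^bsub>ext_sum C\<^esub> f = \<zero>\<^bsub>ext_sum C\<^esub>" using f by (auto simp: C.M.l_neg)
    ultimately show "\<exists>g\<in>carrier (ext_sum C). g \<oplus>\<^bsub>ext_sum C\<^esub> f = \<zero>\<^bsub>ext_sum C\<^esub>" by blast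
  next
    fix r f assume r: "r \<in> carrier R" and f: "f \<in> carrier (ext_sum C)"
    have "{i. r \<odot>\<^bsub>C i\<^esub> f i \<noteq> \<zero>\<^bsub>C i\<^esub>} \<subseteq> {i. f i \<noteq> \<zero>\<^bsub>C i\<^esub>}" using r by auto
    then show "r \<odot>\<^bsub>ext_sum C\<^esub> f \<in> carrier (ext_sum C)"
      using r f by (auto intro: finite_subset C.smult_closed)
  qed (auto simp: C.M.a_ac C.smult_l_distr C.smult_r_distr C.smult_assoc C.smult_one)
qed

lemma single_hom: "single C i \<in> mod_hom R (C i) (ext_sum C)"
proof -
  interpret C: left_module R "C k" for k by (rule family)
  have "single C i x \<in> carrier (ext_sum C)" if x: "x \<in> carrier (C i)" for x
  proof -
    have "{j. single C i x j \<noteq> \<zero>\<^bsub>C j\<^esub>} \<subseteq> {i}" by (auto simp: single_def)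
    then have "finite {j. single C i x j \<noteq> \<zero>\<^bsub>C j\<^esub>}" by (rule finite_subset) simp
    then show ?thesis using x by (auto simp: single_def)
  qed
  then show ?thesis by (rule mod_homI) (auto simp: single_def)
qed

lemma proj_hom: "(\<lambda>f. f i) \<in> mod_hom R (ext_sum C) (C i)"
  by (rule mod_homI) auto

lemma ext_sum_induct:
  assumes f: "f \<in> carrier (ext_sum C)" and S: "submodule S R (ext_sum C)"
    and s: "\<And>i. single C i (f i) \<in> S"
  shows "f \<in> S"
proof -
  interpret C: left_module R "C k" for k by (rule family)
  have "(\<lambda>i. if i \<in> F then f i else \<zero>\<^bsub>C i\<^esub>) \<in> S" if "finite F" for F
    using that
  proof induction
    case empty
    then show ?case using submoduleD(3)[OF S] by simp
  next
    case (insert a F)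
    have "(\<lambda>i. if i \<in> insert a F then f i else \<zero>\<^bsub>C i\<^esub>) =
        single C a (f a) \<oplus>\<^bsub>ext_sum C\<^esub> (\<lambda>i. if i \<in> F then f i else \<zero>\<^bsub>C i\<^esub>)"
      using f insert by (auto simp: single_def fun_eq_iff)
    then show ?case using submoduleD(4)[OF S s[of a] insert.IH] by simp
  qed
  from this[of "{i. f i \<noteq> \<zero>\<^bsub>C i\<^esub>}"] f have "(\<lambda>i. if f i \<noteq> \<zero>\<^bsub>C i\<^esub> then f i else \<zero>\<^bsub>C i\<^esub>) \<in> S" by simp
  moreover have "(\<lambda>i. if f i \<noteq> \<zero>\<^bsub>C i\<^esub> then f i else \<zero>\<^bsub>C i\<^esub>) = f" by auto
  ultimately show ?thesis by simp
qed

lemma ext_sum_ideal_mult: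
  assumes f: "f \<in> carrier (ext_sum C)" and J: "J \<subseteq> carrier R"
    "\<And>r j. r \<in> carrier R \<Longrightarrow> j \<in> J \<Longrightarrow> r \<otimes>\<^bsub>R\<^esub> j \<in> J"
    and fi: "\<And>i. f i \<in> ideal_mult J (C i) (carrier (C i))"
  shows "f \<in> ideal_mult J (ext_sum C) (carrier (ext_sum C))"
proof -
  interpret C: left_module R "C k" for k by (rule family)
  interpret E: left_module R "ext_sum C" by (rule ext_sum_left_module)
  show ?thesis
  proof (rule ext_sum_induct[OF f])
    show "submodule (ideal_mult J (ext_sum C) (carrier (ext_sum C))) R (ext_sum C)"
      using J by (intro E.ideal_mult_submodule) auto
    show "single C i (f i) \<in> ideal_mult J (ext_sum C) (carrier (ext_sum C))" for i
      by (rule C.ideal_mult_hom[OF ext_sum_left_module single_hom J(1) subset_refl fi])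
         (rule mod_homD(1)[OF single_hom])
  qed
qed

text \<open>The universal property of the direct sum, with an explicit formula that is needed to compare
  with internal direct sums.\<close>

lemma ext_sum_finsum_hom:
  assumes Y: "left_module R Y" and h: "\<And>i. h i \<in> mod_hom R (C i) Y"
  shows "(\<lambda>f. \<Oplus>\<^bsub>Y\<^esub>i\<in>{i. f i \<noteq> \<zero>\<^bsub>C i\<^esub>}. h i (f i)) \<in> mod_hom R (ext_sum C) Y"
    and "c \<in> carrier (C i) \<Longrightarrow> (\<Oplus>\<^bsub>Y\<^esub>k\<in>{k. single C i c k \<noteq> \<zero>\<^bsub>C k\<^esub>}. h k (single C i c k)) = h i c"
proof -
  interpret C: left_module R "C k" for k by (rule family)
  interpret Y: left_module R Y by fact
  have h0: "h i \<zero>\<^bsub>C i\<^esub> = \<zero>\<^bsub>Y\<^esub>" for i by (rule mod_hom_zero[OF family Y h])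
  let ?H = "\<lambda>f. \<Oplus>\<^bsub>Y\<^esub>i\<in>{i. f i \<noteq> \<zero>\<^bsub>C i\<^esub>}. h i (f i)"
  have hc: "h i (f i) \<in> carrier Y" if "f \<in> carrier (ext_sum C)" for f i
    using that by (auto intro: mod_homD(1)[OF h])
  have H: "?H f = (\<Oplus>\<^bsub>Y\<^esub>i\<in>F. h i (f i))"
    if "finite F" "{i. f i \<noteq> \<zero>\<^bsub>C i\<^esub>} \<subseteq> F" "f \<in> carrier (ext_sum C)" for f F
    by (rule Y.add.finprod_mono_neutral_cong_left) (use that hc h0 in \<open>auto simp: Pi_iff\<close>)
  show "?H \<in> mod_hom R (ext_sum C) Y"
  proof (rule mod_homI)
    fix f assume f: "f \<in> carrier (ext_sum C)"
    show "?H f \<in> carrier Y" by (rule Y.finsum_closed) (use hc[OF f] in auto)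
    fix g assume g: "g \<in> carrier (ext_sum C)"
    let ?F = "{i. f i \<noteq> \<zero>\<^bsub>C i\<^esub>} \<union> {i. g i \<noteq> \<zero>\<^bsub>C i\<^esub>}"
    have F: "finite ?F" using f g by simp
    have fg: "f \<oplus>\<^bsub>ext_sum C\<^esub> g \<in> carrier (ext_sum C)"
      using left_module.axioms(2)[OF ext_sum_left_module] f g by (rule abelian_monoid.a_closed[OF abelian_group.axioms(1)])
    have "?H (f \<oplus>\<^bsub>ext_sum C\<^esub> g) = (\<Oplus>\<^bsub>Y\<^esub>i\<in>?F. h i ((f \<oplus>\<^bsub>ext_sum C\<^esub> g) i))"
      by (rule H[OF F _ fg]) auto
    also have "\<dots> = (\<Oplus>\<^bsub>Y\<^esub>i\<in>?F. h i (f i) \<oplus>\<^bsub>Y\<^esub> h i (g i))"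
      by (rule Y.finsum_cong') (use f g hc[OF f] hc[OF g] in \<open>auto intro!: mod_homD(2)[OF h]\<close>)
    also have "\<dots> = (\<Oplus>\<^bsub>Y\<^esub>i\<in>?F. h i (f i)) \<oplus>\<^bsub>Y\<^esub> (\<Oplus>\<^bsub>Y\<^esub>i\<in>?F. h i (g i))"
      by (rule Y.finsum_addf) (use hc[OF f] hc[OF g] in auto)
    also have "\<dots> = ?H f \<oplus>\<^bsub>Y\<^esub> ?H g" using H[OF F _ f] H[OF F _ g] by auto
    finally show "?H (f \<oplus>\<^bsub>ext_sum C\<^esub> g) = ?H f \<oplus>\<^bsub>Y\<^esub> ?H g" .
  next
    fix r f assume r: "r \<in> carrier R" and f: "f \<in> carrier (ext_sum C)"
    let ?F = "{i. f i \<noteq> \<zero>\<^bsub>C i\<^esub>}"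
    have F: "finite ?F" using f by simp
    have rf: "r \<odot>\<^bsub>ext_sum C\<^esub> f \<in> carrier (ext_sum C)"
      by (rule left_module.smult_closed[OF ext_sum_left_module r f])
    have "?H (r \<odot>\<^bsub>ext_sum C\<^esub> f) = (\<Oplus>\<^bsub>Y\<^esub>i\<in>?F. h i ((r \<odot>\<^bsub>ext_sum C\<^esub> f) i))"
      by (rule H[OF F _ rf]) (use r in auto)
    also have "\<dots> = (\<Oplus>\<^bsub>Y\<^esub>i\<in>?F. r \<odot>\<^bsub>Y\<^esub> h i (f i))"
      by (rule Y.finsum_cong') (use f r hc[OF f] in \<open>auto intro!: mod_homD(3)[OF h] Y.smult_closed\<close>)
    also have "\<dots> = r \<odot>\<^bsub>Y\<^esub> (\<Oplus>\<^bsub>Y\<^esub>i\<in>?F. h i (f i))"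
      using F
    proof (induction rule: finite_induct)
      case empty then show ?case using r by simp
    next
      case (insert a F)
      have c: "(\<lambda>i. h i (f i)) \<in> F \<rightarrow> carrier Y" "(\<lambda>i. r \<odot>\<^bsub>Y\<^esub> h i (f i)) \<in> F \<rightarrow> carrier Y"
        using hc[OF f] r by (auto intro: Y.smult_closed)
      show ?case
        using insert c hc[OF f] r by (simp add: Y.finsum_insert Y.smult_closed Y.smult_r_distr Y.finsum_closed)
    qed
    finally show "?H (r \<odot>\<^bsub>ext_sum C\<^esub> f) = r \<odot>\<^bsub>Y\<^esub> ?H f" .
  qed
  assume c: "c \<in> carrier (C i)"
  show "?H (single C i c) = h i c"
  proof -
    have "?H (single C i c) = (\<Oplus>\<^bsub>Y\<^esub>k\<in>{i}. h k (single C i c k))"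
      by (rule H[OF _ _ mod_homD(1)[OF single_hom c]]) (auto simp: single_def)
    also have "\<dots> = h i (single C i c i) \<oplus>\<^bsub>Y\<^esub> \<zero>\<^bsub>Y\<^esub>"
      using mod_homD(1)[OF h c] by (subst Y.finsum_insert) (auto simp: single_def)
    also have "\<dots> = h i c" using mod_homD(1)[OF h c] by (simp add: single_def)
    finally show ?thesis .
  qed
qed

lemma ext_sum_hom:
  assumes Y: "left_module R Y" and h: "\<And>i. h i \<in> mod_hom R (C i) Y"
  shows "\<exists>H\<in>mod_hom R (ext_sum C) Y. \<forall>i. \<forall>c\<in>carrier (C i). H (single C i c) = h i c"
  by (rule bexI[OF _ ext_sum_finsum_hom(1)[OF Y, of h, OF h]], intro allI ballI, rule ext_sum_finsum_hom(2)[OF Y, of h, OF h])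

end

subsection \<open>Free modules\<close>

definition free_mod :: "'r ring \<Rightarrow> ('r, 'x \<Rightarrow> 'r) module" where
  "free_mod R = ext_sum (\<lambda>_. regular_module R)"

definition free_basis :: "'r ring \<Rightarrow> 'x \<Rightarrow> 'x \<Rightarrow> 'r" where
  "free_basis R x = single (\<lambda>_. regular_module R) x \<one>\<^bsub>R\<^esub>"

lemma module_family_regular: "ring R \<Longrightarrow> module_family R (\<lambda>_. regular_module R)"
  by (rule module_family.intro) (rule regular_left_module)

lemma free_left_module: "ring R \<Longrightarrow> left_module R (free_mod R)"
  unfolding free_mod_def by (rule module_family.ext_sum_left_module[OF module_family_regular])

lemma free_carrier_iff: "f \<in> carrier (free_mod R) \<longleftrightarrow> (\<forall>x. f x \<in> carrier R) \<and> finite {x. f x \<noteq> \<zero>\<^bsub>R\<^esub>}"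
  by (simp add: free_mod_def)

lemma free_single: "ring R \<Longrightarrow> r \<in> carrier R \<Longrightarrow>
  single (\<lambda>_. regular_module R) x r = r \<odot>\<^bsub>free_mod R\<^esub> free_basis R x"
proof -
  assume "ring R" "r \<in> carrier R"
  then interpret ring R by simp
  show ?thesis using \<open>r \<in> carrier R\<close>
    by (auto simp: single_def free_basis_def free_mod_def fun_eq_iff)
qed

lemma free_basis_closed: "ring R \<Longrightarrow> free_basis R x \<in> carrier (free_mod R)"
proof -
  assume R: "ring R"
  then interpret ring R .
  show ?thesis
    using mod_homD(1)[OF module_family.single_hom[OF module_family_regular[OF R]], of "\<one>\<^bsub>R\<^esub>" x]
    by (simp add: free_basis_def free_mod_def)
qed

lemma free_induct:
  assumes R: "ring R" and f: "f \<in> carrier (free_mod R)" and S: "submodule S R (free_mod R)"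
    and b: "\<And>x. free_basis R x \<in> S"
  shows "f \<in> S"
proof (rule module_family.ext_sum_induct[OF module_family_regular[OF R]])
  show "f \<in> carrier (ext_sum (\<lambda>_. regular_module R))" "submodule S R (ext_sum (\<lambda>_. regular_module R))"
    using f S by (simp_all add: free_mod_def)
  fix x
  have fx: "f x \<in> carrier R" using f by (simp add: free_carrier_iff)
  show "single (\<lambda>_. regular_module R) x (f x) \<in> S"
    unfolding free_single[OF R fx] by (rule submoduleD(5)[OF S fx b])
qed

lemma free_hom:
  assumes R: "ring R" and Y: "left_module R Y" and b: "\<And>x. b x \<in> carrier Y"
  shows "\<exists>H\<in>mod_hom R (free_mod R) Y. \<forall>x. H (free_basis R x) = b x"
proof -
  interpret Y: left_module R Y by fact
  have "(\<lambda>r. r \<odot>\<^bsub>Y\<^esub> b x) \<in> mod_hom R (regular_module R) Y" for x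
    using b by (intro mod_homI) (auto simp: Y.smult_closed Y.smult_l_distr Y.smult_assoc)
  from module_family.ext_sum_hom[OF module_family_regular[OF R] Y, of "\<lambda>x r. r \<odot>\<^bsub>Y\<^esub> b x", OF this]
  obtain H where H: "H \<in> mod_hom R (free_mod R) Y"
    "\<And>x r. r \<in> carrier R \<Longrightarrow> H (single (\<lambda>_. regular_module R) x r) = r \<odot>\<^bsub>Y\<^esub> b x"
    by (auto simp: free_mod_def)
  have "H (free_basis R x) = b x" for x
    using H(2)[of "\<one>\<^bsub>R\<^esub>" x] b by (simp add: free_basis_def Y.smult_one)
  then show ?thesis using H(1) by blast
qed

lemma submodule_equalizer:
  assumes M: "left_module R M" and N: "left_module R N" and f: "f \<in> mod_hom R M N" and g: "g \<in> mod_hom R M N"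
  shows "submodule {x \<in> carrier M. f x = g x} R M"
proof -
  interpret M: left_module R M by fact
  show ?thesis
    by (rule M.submoduleI)
       (auto simp: mod_hom_zero[OF M N f] mod_hom_zero[OF M N g] mod_homD[OF f] mod_homD[OF g] M.smult_closed)
qed

text \<open>The equalizer of \<open>f\<close> and \<open>g\<close> is a submodule containing the basis.\<close>

lemma free_hom_eqI:
  assumes R: "ring R" and N: "left_module R N" and f: "f \<in> mod_hom R (free_mod R) N"
    and g: "g \<in> mod_hom R (free_mod R) N" and eq: "\<And>x. f (free_basis R x) = g (free_basis R x)"
    and z: "z \<in> carrier (free_mod R)"
  shows "f z = g z"
proof -
  have "z \<in> {x \<in> carrier (free_mod R). f x = g x}"
    by (rule free_induct[OF R z submodule_equalizer[OF free_left_module[OF R] N f g]])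
       (use eq free_basis_closed[OF R] in simp)
  then show ?thesis by blast
qed

subsection \<open>Copies of modules\<close>

lemma left_module_bij:
  assumes M: "left_module R M" and bij: "bij_betw f (carrier M) (carrier N)"
    and add: "\<And>x y. x \<in> carrier M \<Longrightarrow> y \<in> carrier M \<Longrightarrow> f (x \<oplus>\<^bsub>M\<^esub> y) = f x \<oplus>\<^bsub>N\<^esub> f y"
    and sm: "\<And>r x. r \<in> carrier R \<Longrightarrow> x \<in> carrier M \<Longrightarrow> f (r \<odot>\<^bsub>M\<^esub> x) = r \<odot>\<^bsub>N\<^esub> f x"
    and zero: "f \<zero>\<^bsub>M\<^esub> = \<zero>\<^bsub>N\<^esub>"
  shows "left_module R N"
proof -
  interpret M: left_module R M by fact
  have c: "carrier N = f ` carrier M" using bij by (simp add: bij_betw_def)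
  show ?thesis
  proof (rule left_moduleI)
    fix x assume "x \<in> carrier N"
    then obtain a where a: "a \<in> carrier M" "x = f a" using c by blast
    have "f (\<ominus>\<^bsub>M\<^esub> a) \<oplus>\<^bsub>N\<^esub> x = \<zero>\<^bsub>N\<^esub>" using a add[of "\<ominus>\<^bsub>M\<^esub> a" a] zero by (simp add: M.l_neg)
    then show "\<exists>y\<in>carrier N. y \<oplus>\<^bsub>N\<^esub> x = \<zero>\<^bsub>N\<^esub>" using a c by blast
  qed (auto simp: c M.R.ring_axioms M.smult_closed M.M.a_ac M.smult_l_distr M.smult_r_distr
      M.smult_assoc M.smult_one add[symmetric] sm[symmetric] zero[symmetric])
qed

definition transport :: "('m \<Rightarrow> 'n) \<Rightarrow> ('r, 'm) module \<Rightarrow> ('r, 'n) module" where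
  "transport j M = (let dec = inv_into (carrier M) j in
    \<lparr>carrier = j ` carrier M, monoid.mult = undefined, one = undefined, ring.zero = j \<zero>\<^bsub>M\<^esub>,
     ring.add = (\<lambda>x y. j (dec x \<oplus>\<^bsub>M\<^esub> dec y)), smult = (\<lambda>r x. j (r \<odot>\<^bsub>M\<^esub> dec x))\<rparr>)"

lemma transport_iso:
  assumes M: "left_module R M" and inj: "inj_on j (carrier M)"
  shows "left_module R (transport j M)" "j \<in> mod_hom R M (transport j M)"
    "bij_betw j (carrier M) (carrier (transport j M))"
proof -
  interpret M: left_module R M by fact
  have dec: "inv_into (carrier M) j (j x) = x" if "x \<in> carrier M" for x using inj that by simp
  show bij: "bij_betw j (carrier M) (carrier (transport j M))"
    using inj by (simp add: bij_betw_def transport_def Let_def)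
  show "left_module R (transport j M)"
    by (rule left_module_bij[OF M bij]) (auto simp: transport_def Let_def dec)
  show "j \<in> mod_hom R M (transport j M)"
    by (rule mod_homI) (auto simp: transport_def Let_def dec)
qed

lemma univ_copy_iso:
  assumes M: "left_module R M"
  shows "left_module R (univ_copy M)" "Base \<in> mod_hom R M (univ_copy M)"
    "bij_betw Base (carrier M) (carrier (univ_copy M))"
proof -
  have dec: "inv_into UNIV Base (Base x :: ('a, 'b) mod_univ) = x" for x by (rule inv_f_f) (auto intro: injI)
  show bij: "bij_betw Base (carrier M) (carrier (univ_copy M))"
    by (auto simp: bij_betw_def univ_copy_def Let_def intro: inj_onI)
  show "left_module R (univ_copy M)"
    by (rule left_module_bij[OF M bij]) (auto simp: univ_copy_def Let_def dec)
  show "Base \<in> mod_hom R M (univ_copy M)"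
    by (rule mod_homI) (auto simp: univ_copy_def Let_def dec)
qed

text \<open>A formal linear combination is stored as a list of its terms, in an arbitrarily chosen order. This
  realises the free module on the universe inside the universe itself.\<close>

definition encode :: "'r ring \<Rightarrow> (('r, 'm) mod_univ \<Rightarrow> 'r) \<Rightarrow> ('r, 'm) mod_univ" where
  "encode R f = Comb (SOME l. set l = {(f x, x) | x. f x \<noteq> \<zero>\<^bsub>R\<^esub>})"

lemma inj_on_encode:
  fixes R :: "'r ring"
  shows "inj_on (encode R) (carrier (free_mod R :: ('r, ('r, 'm) mod_univ \<Rightarrow> 'r) module))"
proof (rule inj_onI)
  fix f g :: "('r, 'm) mod_univ \<Rightarrow> 'r"
  assume fg: "f \<in> carrier (free_mod R)" "g \<in> carrier (free_mod R)" and eq: "encode R f = encode R g"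
  define graph :: "(('r, 'm) mod_univ \<Rightarrow> 'r) \<Rightarrow> ('r \<times> ('r, 'm) mod_univ) set"
    where "graph f = {(f x, x) | x. f x \<noteq> \<zero>\<^bsub>R\<^esub>}" for f
  have *: "set (SOME l. set l = graph f) = graph f" if "f \<in> carrier (free_mod R)" for f
  proof (rule someI_ex[of "\<lambda>l. set l = graph f"])
    have "finite {x. f x \<noteq> \<zero>\<^bsub>R\<^esub>}" using that by (simp add: free_carrier_iff)
    then have "finite (graph f)" by (simp add: graph_def)
    then show "\<exists>l. set l = graph f" by (rule finite_list)
  qed
  have "(SOME l. set l = graph f) = (SOME l. set l = graph g)"
    using eq by (simp add: encode_def graph_def)
  then have e: "graph f = graph g" using *[OF fg(1)] *[OF fg(2)] by metis
  have "(a, x) \<in> graph f \<longleftrightarrow> a = f x \<and> f x \<noteq> \<zero>\<^bsub>R\<^esub>" for a x f by (auto simp: graph_def)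
  then have "a = f x \<and> f x \<noteq> \<zero>\<^bsub>R\<^esub> \<longleftrightarrow> a = g x \<and> g x \<noteq> \<zero>\<^bsub>R\<^esub>" for a x using e by metis
  then show "f = g" by (intro ext) metis
qed

definition free_univ :: "'r ring \<Rightarrow> ('r, ('r, 'm) mod_univ) module" where
  "free_univ R = transport (encode R) (free_mod R)"

lemma free_univ_iso:
  assumes "ring R"
  shows "left_module R (free_univ R)" "encode R \<in> mod_hom R (free_mod R) (free_univ R)"
    "bij_betw (encode R) (carrier (free_mod R)) (carrier (free_univ R))"
  unfolding free_univ_def by (rule transport_iso[OF free_left_module[OF assms] inj_on_encode])+

subsection \<open>Projective modules\<close>

text \<open>A direct summand of a free module has the lifting property for modules over arbitrary types.\<close>

lemma retract_free_lift:
  assumes i: "i \<in> mod_hom R P (free_mod R)" and p: "p \<in> mod_hom R (free_mod R) P"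
    and pi: "\<And>x. x \<in> carrier P \<Longrightarrow> p (i x) = x"
    and X: "left_module R X" and Y: "left_module R Y"
    and g: "g \<in> mod_hom R X Y" "g ` carrier X = carrier Y" and f: "f \<in> mod_hom R P Y"
  shows "\<exists>h\<in>mod_hom R P X. \<forall>x\<in>carrier P. g (h x) = f x"
proof -
  interpret X: left_module R X by fact
  have R: "ring R" by (rule X.R.ring_axioms)
  have "\<exists>y\<in>carrier X. g y = f (p (free_basis R x))" for x
    using mod_homD(1)[OF f mod_homD(1)[OF p free_basis_closed[OF R]], of x] g(2)
    by (metis imageE)
  then obtain b where b: "\<And>x. b x \<in> carrier X" "\<And>x. g (b x) = f (p (free_basis R x))" by metis
  obtain H where H: "H \<in> mod_hom R (free_mod R) X" "\<And>x. H (free_basis R x) = b x"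
    using free_hom[OF R X, of b] b(1) by blast
  have "g (H z) = f (p z)" if "z \<in> carrier (free_mod R)" for z
    by (rule free_hom_eqI[OF R Y mod_hom_comp[OF H(1) g(1)] mod_hom_comp[OF p f] _ that]) (simp add: H b)
  then show ?thesis
    using mod_hom_comp[OF i H(1)] mod_homD(1)[OF i] pi by (intro bexI[of _ "\<lambda>x. H (i x)"]) auto
qed

lemma retract_free_projective:
  assumes "left_module R P" "i \<in> mod_hom R P (free_mod R)" "p \<in> mod_hom R (free_mod R) P"
    "\<And>x. x \<in> carrier P \<Longrightarrow> p (i x) = x"
  shows "projective R P"
  unfolding projective_def using assms(1) retract_free_lift[OF assms(2-4)] by blast

lemma projective_left_module: "projective R P \<Longrightarrow> left_module R P"
  by (simp add: projective_def)

lemma projectiveD: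
  fixes P :: "('r, 'p) module" and X Y :: "('r, ('r, 'p) mod_univ) module"
  assumes "projective R P" "left_module R X" "left_module R Y" "g \<in> mod_hom R X Y"
    "g ` carrier X = carrier Y" "f \<in> mod_hom R P Y"
  shows "\<exists>h\<in>mod_hom R P X. \<forall>x\<in>carrier P. g (h x) = f x"
  using assms(1)[unfolded projective_def] assms(2-) by simp

text \<open>The definition of projectivity tests liftings only in the universe of \<open>P\<close>; it is applied to the epimorphism
  from the free module onto the copy of \<open>P\<close>, which therefore splits.\<close>

lemma projective_retract_free:
  fixes P :: "('r, 'p) module"
  assumes P: "projective R P"
  shows "\<exists>i p. i \<in> mod_hom R P (free_mod R :: ('r, ('r, 'p) mod_univ \<Rightarrow> 'r) module) \<and>
    p \<in> mod_hom R (free_mod R) P \<and> (\<forall>x\<in>carrier P. p (i x) = x)"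
proof -
  interpret P: left_module R P using P by (rule projective_left_module)
  have R: "ring R" by (rule P.R.ring_axioms)
  let ?F = "free_mod R :: ('r, ('r, 'p) mod_univ \<Rightarrow> 'r) module"
  let ?U = "free_univ R :: ('r, ('r, 'p) mod_univ) module"
  let ?b = "\<lambda>x :: ('r, 'p) mod_univ. if x \<in> Base ` carrier P then inv_into UNIV Base x else \<zero>\<^bsub>P\<^esub>"
  have dec: "inv_into UNIV Base (Base x :: ('r, 'p) mod_univ) = x" for x by (rule inv_f_f) (auto intro: injI)
  have "?b x \<in> carrier P" for x using dec by auto
  from free_hom[OF R P.left_module_axioms, of ?b, OF this]
  obtain p where p: "p \<in> mod_hom R ?F P" "\<And>x. p (free_basis R x) = ?b x" by blast
  let ?d = "inv_into (carrier ?F) (encode R)"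
  have d: "?d \<in> mod_hom R ?U ?F"
    by (rule mod_hom_inv_into[OF free_left_module[OF R] free_univ_iso(2,3)[OF R]])
  note copy = univ_copy_iso[OF P.left_module_axioms]
  let ?g = "\<lambda>x. Base (p (?d x)) :: ('r, 'p) mod_univ"
  have g: "?g \<in> mod_hom R ?U (univ_copy P)"
    by (rule mod_hom_comp[OF mod_hom_comp[OF d p(1)] copy(2)])
  have "?g ` carrier ?U = carrier (univ_copy P)"
  proof
    show "?g ` carrier ?U \<subseteq> carrier (univ_copy P)" using mod_homD(1)[OF g] by blast
    show "carrier (univ_copy P) \<subseteq> ?g ` carrier ?U"
    proof
      fix y assume "y \<in> carrier (univ_copy P)"
      then obtain x where x: "x \<in> carrier P" "y = Base x" using copy(3) by (auto simp: bij_betw_def)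
      let ?e = "free_basis R (Base x :: ('r, 'p) mod_univ)"
      have e: "?e \<in> carrier ?F" by (rule free_basis_closed[OF R])
      have "?g (encode R ?e) = y" using x inv_into_f_f[OF inj_on_encode e] by (simp add: p dec)
      moreover have "encode R ?e \<in> carrier ?U" using mod_homD(1)[OF free_univ_iso(2)[OF R] e] .
      ultimately show "y \<in> ?g ` carrier ?U" by blast
    qed
  qed
  note surj = this
  have "\<exists>h\<in>mod_hom R P ?U. \<forall>x\<in>carrier P. ?g (h x) = Base x"
    by (rule projectiveD[OF P free_univ_iso(1)[OF R] copy(1) g surj copy(2)])
  then obtain h where h: "h \<in> mod_hom R P ?U" "\<And>x. x \<in> carrier P \<Longrightarrow> ?g (h x) = Base x"
    by (rule bexE) simp
  have "p (?d (h x)) = x" if "x \<in> carrier P" for x using h(2)[OF that] by simp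
  then show ?thesis using mod_hom_comp[OF h(1) d] p(1) by (intro exI[of _ "\<lambda>x. ?d (h x)"] exI[of _ p]) auto
qed

lemma projective_lift:
  assumes P: "projective R P" and X: "left_module R X" "left_module R Y"
    and g: "g \<in> mod_hom R X Y" "g ` carrier X = carrier Y" and f: "f \<in> mod_hom R P Y"
  obtains h where "h \<in> mod_hom R P X" "\<And>x. x \<in> carrier P \<Longrightarrow> g (h x) = f x"
proof -
  obtain i p where ip: "i \<in> mod_hom R P (free_mod R :: ('a, ('a, 'b) mod_univ \<Rightarrow> 'a) module)"
    "p \<in> mod_hom R (free_mod R) P" "\<And>x. x \<in> carrier P \<Longrightarrow> p (i x) = x"
    using projective_retract_free[OF P] by blast
  show thesis using retract_free_lift[OF ip X g f] that by blast
qed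

lemma projective_retract:
  fixes P :: "('r, 'p) module"
  assumes P: "projective R P" and Q: "left_module R Q" and a: "a \<in> mod_hom R Q P"
    and b: "b \<in> mod_hom R P Q" and ba: "\<And>x. x \<in> carrier Q \<Longrightarrow> b (a x) = x"
  shows "projective R Q"
proof -
  obtain i p where ip: "i \<in> mod_hom R P (free_mod R :: ('r, ('r, 'p) mod_univ \<Rightarrow> 'r) module)"
    "p \<in> mod_hom R (free_mod R) P" "\<And>x. x \<in> carrier P \<Longrightarrow> p (i x) = x"
    using projective_retract_free[OF P] by blast
  show ?thesis
    by (rule retract_free_projective[OF Q mod_hom_comp[OF a ip(1)] mod_hom_comp[OF ip(2) b]])
       (simp add: ip(3) mod_homD(1)[OF a] ba)
qed

lemma projective_iso:
  assumes P: "projective R P" and Q: "left_module R Q" and f: "f \<in> mod_hom R P Q"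
    "bij_betw f (carrier P) (carrier Q)"
  shows "projective R Q"
  by (rule projective_retract[OF P Q mod_hom_inv_into[OF projective_left_module[OF P] f] f(1)])
     (use f(2) in \<open>auto simp: bij_betw_def f_inv_into_f\<close>)

lemma projective_free_univ:
  assumes "ring R" shows "projective R (free_univ R :: ('r, ('r, 'm) mod_univ) module)"
proof (rule projective_iso[OF _ free_univ_iso[OF assms]])
  show "projective R (free_mod R :: ('r, ('r, 'm) mod_univ \<Rightarrow> 'r) module)"
    by (rule retract_free_projective[OF free_left_module[OF assms] mod_hom_id mod_hom_id]) simp
qed

lemma projective_zero:
  assumes M: "left_module R M" and z: "carrier M = {\<zero>\<^bsub>M\<^esub>}"
  shows "projective R M"
proof -
  interpret left_module R M by fact
  have F: "left_module R (free_mod R :: ('a, 'b \<Rightarrow> 'a) module)"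
    by (rule free_left_module[OF R.ring_axioms])
  show ?thesis
    by (rule retract_free_projective[OF M mod_hom_zero_map[OF F] mod_hom_zero_map[OF M]]) (use z in simp)
qed


section \<open>Projective covers\<close>

lemma mod_hom_add_map:
  assumes M: "left_module R M" and N: "left_module R N" and f: "f \<in> mod_hom R M N" and g: "g \<in> mod_hom R M N"
  shows "(\<lambda>x. f x \<oplus>\<^bsub>N\<^esub> g x) \<in> mod_hom R M N" "(\<lambda>x. f x \<ominus>\<^bsub>N\<^esub> g x) \<in> mod_hom R M N"
proof -
  interpret N: left_module R N by fact
  note F = mod_homD[OF f] and G = mod_homD[OF g]
  show "(\<lambda>x. f x \<oplus>\<^bsub>N\<^esub> g x) \<in> mod_hom R M N"
    by (rule mod_homI) (simp_all add: F G N.M.a_ac N.smult_r_distr)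
  have neg: "\<ominus>\<^bsub>N\<^esub> (r \<odot>\<^bsub>N\<^esub> y) = r \<odot>\<^bsub>N\<^esub> (\<ominus>\<^bsub>N\<^esub> y)" if "r \<in> carrier R" "y \<in> carrier N" for r y
    by (rule N.M.minus_equality) (use that in \<open>simp_all add: N.smult_closed N.smult_r_distr[symmetric] N.M.l_neg\<close>)
  show "(\<lambda>x. f x \<ominus>\<^bsub>N\<^esub> g x) \<in> mod_hom R M N"
    by (rule mod_homI) (simp_all add: F G a_minus_def N.M.minus_add N.M.a_ac N.smult_r_distr neg)
qed

lemma direct_sum2_projection:
  assumes M: "left_module R M" and XY: "direct_sum2 M R X Y"
  shows "\<exists>e\<in>mod_hom R M M. (\<forall>z\<in>carrier M. e z \<in> X \<and> z \<ominus>\<^bsub>M\<^esub> e z \<in> Y) \<and> (\<forall>x\<in>X. e x = x)"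
proof -
  interpret M: left_module R M by fact
  have X: "submodule X R M" and Y: "submodule Y R M" and int: "X \<inter> Y = {\<zero>\<^bsub>M\<^esub>}"
    and sum: "X <+>\<^bsub>M\<^esub> Y = carrier M" using XY by (auto simp: direct_sum2_def)
  note DX = submoduleD[OF X] and DY = submoduleD[OF Y]
  have uniq: "x = x'" if "x \<in> X" "x' \<in> X" "z \<in> carrier M" "z \<ominus>\<^bsub>M\<^esub> x \<in> Y" "z \<ominus>\<^bsub>M\<^esub> x' \<in> Y" for x x' z
  proof -
    have c: "x \<in> carrier M" "x' \<in> carrier M" using that DX(1) by auto
    have "(z \<ominus>\<^bsub>M\<^esub> x) \<ominus>\<^bsub>M\<^esub> (z \<ominus>\<^bsub>M\<^esub> x') \<in> Y" by (rule M.submodule_minus[OF Y that(4,5)])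
    moreover have "(z \<ominus>\<^bsub>M\<^esub> x) \<ominus>\<^bsub>M\<^esub> (z \<ominus>\<^bsub>M\<^esub> x') = x' \<ominus>\<^bsub>M\<^esub> x"
    proof -
      have "(z \<ominus>\<^bsub>M\<^esub> x) \<ominus>\<^bsub>M\<^esub> (z \<ominus>\<^bsub>M\<^esub> x') = (z \<oplus>\<^bsub>M\<^esub> \<ominus>\<^bsub>M\<^esub> z) \<oplus>\<^bsub>M\<^esub> (x' \<oplus>\<^bsub>M\<^esub> \<ominus>\<^bsub>M\<^esub> x)"
        using c that(3) by (simp add: a_minus_def M.M.minus_add M.M.a_ac)
      then show ?thesis using c that(3) by (simp add: a_minus_def M.M.r_neg)
    qed
    moreover have "x' \<ominus>\<^bsub>M\<^esub> x \<in> X" by (rule M.submodule_minus[OF X that(2,1)])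
    ultimately have "x' \<ominus>\<^bsub>M\<^esub> x = \<zero>\<^bsub>M\<^esub>" using int by auto
    then show ?thesis using M.diff_eq_zeroD c by metis
  qed
  have ex: "\<exists>x. x \<in> X \<and> z \<ominus>\<^bsub>M\<^esub> x \<in> Y" if z: "z \<in> carrier M" for z
  proof -
    obtain x y where xy: "x \<in> X" "y \<in> Y" "z = x \<oplus>\<^bsub>M\<^esub> y" using sum z set_add_iff[of z M X Y] by auto
    then have "z \<ominus>\<^bsub>M\<^esub> x = y"
      using DX(1)[of x] DY(1)[of y] M.M.r_neg1[of x y] M.M.a_comm[of "x \<oplus>\<^bsub>M\<^esub> y" "\<ominus>\<^bsub>M\<^esub> x"]
      by (simp add: a_minus_def)
    then show ?thesis using xy by blast
  qed
  define e where "e z = (SOME x. x \<in> X \<and> z \<ominus>\<^bsub>M\<^esub> x \<in> Y)" for z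
  have e: "e z \<in> X" "z \<ominus>\<^bsub>M\<^esub> e z \<in> Y" if "z \<in> carrier M" for z
    using someI_ex[OF ex[OF that]] by (auto simp: e_def)
  have ec: "e z \<in> carrier M" if "z \<in> carrier M" for z using e(1)[OF that] DX(1) by blast
  have hom: "e \<in> mod_hom R M M"
  proof (rule mod_homI)
    fix x y assume xy: "x \<in> carrier M" "y \<in> carrier M"
    have "(x \<oplus>\<^bsub>M\<^esub> y) \<ominus>\<^bsub>M\<^esub> (e x \<oplus>\<^bsub>M\<^esub> e y) = (x \<ominus>\<^bsub>M\<^esub> e x) \<oplus>\<^bsub>M\<^esub> (y \<ominus>\<^bsub>M\<^esub> e y)"
      using xy ec by (simp add: a_minus_def M.M.minus_add M.M.a_ac)
    then have "(x \<oplus>\<^bsub>M\<^esub> y) \<ominus>\<^bsub>M\<^esub> (e x \<oplus>\<^bsub>M\<^esub> e y) \<in> Y" using DY(4) e xy by simp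
    then show "e (x \<oplus>\<^bsub>M\<^esub> y) = e x \<oplus>\<^bsub>M\<^esub> e y"
      using uniq[of "e (x \<oplus>\<^bsub>M\<^esub> y)" "e x \<oplus>\<^bsub>M\<^esub> e y" "x \<oplus>\<^bsub>M\<^esub> y"] e DX(4) xy by simp
  next
    fix r x assume rx: "r \<in> carrier R" "x \<in> carrier M"
    have "r \<odot>\<^bsub>M\<^esub> x \<ominus>\<^bsub>M\<^esub> r \<odot>\<^bsub>M\<^esub> e x = r \<odot>\<^bsub>M\<^esub> (x \<ominus>\<^bsub>M\<^esub> e x)"
    proof -
      have "\<ominus>\<^bsub>M\<^esub> (r \<odot>\<^bsub>M\<^esub> e x) = r \<odot>\<^bsub>M\<^esub> (\<ominus>\<^bsub>M\<^esub> e x)"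
        by (rule M.M.minus_equality) (use rx ec in \<open>simp_all add: M.smult_closed M.smult_r_distr[symmetric] M.M.l_neg\<close>)
      then show ?thesis using rx ec by (simp add: a_minus_def M.smult_r_distr)
    qed
    then have "r \<odot>\<^bsub>M\<^esub> x \<ominus>\<^bsub>M\<^esub> r \<odot>\<^bsub>M\<^esub> e x \<in> Y" using DY(5) e rx by simp
    then show "e (r \<odot>\<^bsub>M\<^esub> x) = r \<odot>\<^bsub>M\<^esub> e x"
      using uniq[of "e (r \<odot>\<^bsub>M\<^esub> x)" "r \<odot>\<^bsub>M\<^esub> e x" "r \<odot>\<^bsub>M\<^esub> x"] e DX(5) rx M.smult_closed by simp
  qed (use ec in simp)
  have "e x = x" if "x \<in> X" for x
  proof -
    have "x \<ominus>\<^bsub>M\<^esub> x \<in> Y" using DX(1)[OF that] DY(3) by (simp add: a_minus_def M.M.r_neg)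
    then show ?thesis using uniq[of "e x" x x] e DX(1) that by simp
  qed
  then show ?thesis using hom e by blast
qed

text \<open>If \<open>P = X + K\<close>, the identity of \<open>P\<close> lifts along the epimorphism from \<open>X \<oplus> K\<close> to \<open>P\<close>; the first component
  of the lifting is \<open>\<phi>\<close>.\<close>

lemma projective_decomp:
  assumes P: "projective R P" and X: "submodule X R P" and K: "submodule K R P"
    and sum: "X <+>\<^bsub>P\<^esub> K = carrier P"
  shows "\<exists>\<phi>\<in>mod_hom R P P. \<forall>z\<in>carrier P. \<phi> z \<in> X \<and> z \<ominus>\<^bsub>P\<^esub> \<phi> z \<in> K"
proof -
  have Pm: "left_module R P" using P by (rule projective_left_module)
  interpret P: left_module R P by fact
  define C where "C b = (if b then submod P X else submod P K)" for b
  have C: "module_family R C"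
    by (rule module_family.intro) (simp add: C_def P.left_module_submod X K)
  interpret C: module_family R C by fact
  have E: "left_module R (ext_sum C)" by (rule C.ext_sum_left_module)
  note DX = submoduleD[OF X] and DK = submoduleD[OF K]
  have cc: "f True \<in> X" "f False \<in> K" "f b \<in> carrier P" if "f \<in> carrier (ext_sum C)" for f b
  proof -
    have *: "f b \<in> carrier (C b)" for b using that by simp
    show "f True \<in> X" using *[of True] by (simp add: C_def)
    moreover show "f False \<in> K" using *[of False] by (simp add: C_def)
    ultimately show "f b \<in> carrier P" using DX(1) DK(1) by (cases b) auto
  qed
  have ops: "x \<oplus>\<^bsub>C b\<^esub> y = x \<oplus>\<^bsub>P\<^esub> y" "r \<odot>\<^bsub>C b\<^esub> x = r \<odot>\<^bsub>P\<^esub> x" "\<zero>\<^bsub>C b\<^esub> = \<zero>\<^bsub>P\<^esub>" for x y r b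
    by (simp_all add: C_def)
  let ?H = "\<lambda>f. f True \<oplus>\<^bsub>P\<^esub> f False"
  have H: "?H \<in> mod_hom R (ext_sum C) P"
    by (rule mod_homI) (simp_all only: ext_sum_simps(3,4) ops, simp_all add: cc P.M.a_ac P.smult_closed P.smult_r_distr del: ext_sum_simps(1))
  have "?H ` carrier (ext_sum C) = carrier P"
  proof
    show "?H ` carrier (ext_sum C) \<subseteq> carrier P" using mod_homD(1)[OF H] by blast
    show "carrier P \<subseteq> ?H ` carrier (ext_sum C)"
    proof
      fix z assume "z \<in> carrier P"
      then obtain x k where xk: "x \<in> X" "k \<in> K" "z = x \<oplus>\<^bsub>P\<^esub> k" using sum set_add_iff[of z P X K] by auto
      have "(\<lambda>b. if b then x else k) \<in> carrier (ext_sum C)" using xk by (simp add: C_def)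
      then show "z \<in> ?H ` carrier (ext_sum C)" using xk by (intro image_eqI[of _ _ "\<lambda>b. if b then x else k"]) auto
    qed
  qed
  from projective_lift[OF P E Pm H this mod_hom_id]
  obtain h where h: "h \<in> mod_hom R P (ext_sum C)" "\<And>x. x \<in> carrier P \<Longrightarrow> h x True \<oplus>\<^bsub>P\<^esub> h x False = x" by auto
  let ?\<phi> = "\<lambda>z. h z True"
  have hc: "h z \<in> carrier (ext_sum C)" if "z \<in> carrier P" for z using mod_homD(1)[OF h(1) that] .
  have "?\<phi> \<in> mod_hom R P P"
    by (rule mod_homI) (auto simp: mod_homD[OF h(1)] ops intro: cc[OF hc])
  moreover have "z \<ominus>\<^bsub>P\<^esub> ?\<phi> z = h z False" if z: "z \<in> carrier P" for z
  proof -
    have c: "h z True \<in> carrier P" "h z False \<in> carrier P" using cc[OF hc[OF z]] by auto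
    have "(h z True \<oplus>\<^bsub>P\<^esub> h z False) \<ominus>\<^bsub>P\<^esub> h z True = h z False"
      using c P.M.r_neg1[of "h z True" "h z False"] P.M.a_comm[of "h z True \<oplus>\<^bsub>P\<^esub> h z False" "\<ominus>\<^bsub>P\<^esub> h z True"]
      by (simp add: a_minus_def)
    then show ?thesis using h(2)[OF z] by simp
  qed
  ultimately show ?thesis using cc[OF hc] by (intro bexI[of _ ?\<phi>]) auto
qed

lemma mod_hom_funpow: "\<phi> \<in> mod_hom R M M \<Longrightarrow> \<phi> ^^ n \<in> mod_hom R M M"
proof (induction n)
  case 0 then show ?case using mod_hom_id by (simp add: id_def)
next
  case (Suc n)
  then show ?case using mod_hom_comp[of "\<phi> ^^ n" R M M \<phi>] by (simp add: comp_def)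
qed

text \<open>Fitting's lemma for endomorphisms \<open>\<phi>\<close> and \<open>\<psi> = 1 - \<phi>\<close> with nilpotent product. Since \<open>\<phi> + \<psi> = 1\<close>, powers of
  \<open>\<phi>\<close> and \<open>\<psi>\<close> are comaximal in the ring they generate: their images add up to \<open>M\<close> and their kernels meet
  in zero, both by induction on the sum of the exponents. Nilpotence puts the intersection of the images into both kernels. This
  takes the place of lifting an idempotent.\<close>

lemma fitting_decomposition:
  assumes M: "left_module R M" and phi: "\<phi> \<in> mod_hom R M M" and psi: "\<psi> \<in> mod_hom R M M"
    and sum: "\<And>z. z \<in> carrier M \<Longrightarrow> z = \<phi> z \<oplus>\<^bsub>M\<^esub> \<psi> z"
    and comm: "\<And>z. z \<in> carrier M \<Longrightarrow> \<phi> (\<psi> z) = \<psi> (\<phi> z)"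
    and nil: "\<And>z. z \<in> carrier M \<Longrightarrow> (\<phi> ^^ n) ((\<psi> ^^ n) z) = \<zero>\<^bsub>M\<^esub>"
  shows "direct_sum2 M R ((\<phi> ^^ n) ` carrier M) ((\<psi> ^^ n) ` carrier M)"
proof -
  interpret M: left_module R M by fact
  note P = mod_homD[OF mod_hom_funpow[OF phi]] and Q = mod_homD[OF mod_hom_funpow[OF psi]]
  note p = mod_homD[OF phi] and q = mod_homD[OF psi]
  have c1: "(\<phi> ^^ a) (\<psi> z) = \<psi> ((\<phi> ^^ a) z)" if "z \<in> carrier M" for a z
    by (induction a) (simp_all add: comm P that)
  have c2: "(\<psi> ^^ a) (\<phi> z) = \<phi> ((\<psi> ^^ a) z)" if "z \<in> carrier M" for a z
    by (induction a) (simp_all add: comm Q that)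
  have c3: "(\<phi> ^^ a) ((\<psi> ^^ b) z) = (\<psi> ^^ b) ((\<phi> ^^ a) z)" if "z \<in> carrier M" for a b z
    by (induction b) (simp_all add: c1 Q that)
  have S: "\<exists>x\<in>carrier M. \<exists>y\<in>carrier M. z = (\<phi> ^^ a) x \<oplus>\<^bsub>M\<^esub> (\<psi> ^^ b) y" if "z \<in> carrier M" for a b z
    using that
  proof (induction "a + b" arbitrary: a b z)
    case 0
    then have ab: "a = 0" "b = 0" by simp_all
    show ?case by (rule bexI[OF _ 0(2)], rule bexI[OF _ M.M.zero_closed]) (simp add: ab 0(2))
  next
    case (Suc n)
    show ?case
    proof (cases a)
      case 0
      then show ?thesis using Suc.prems Q(1)[of "\<zero>\<^bsub>M\<^esub>" b] mod_hom_zero[OF M M mod_hom_funpow[OF psi], of b]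
        by (intro bexI[of _ z] bexI[of _ "\<zero>\<^bsub>M\<^esub>"]) auto
    next
      case (Suc a')
      note a = Suc
      show ?thesis
      proof (cases b)
        case 0
        then show ?thesis using Suc.prems mod_hom_zero[OF M M mod_hom_funpow[OF phi], of a]
          by (intro bexI[of _ z] bexI[of _ "\<zero>\<^bsub>M\<^esub>"]) auto
      next
        case (Suc b')
        obtain x y where xy: "x \<in> carrier M" "y \<in> carrier M" "z = (\<phi> ^^ a') x \<oplus>\<^bsub>M\<^esub> (\<psi> ^^ b) y"
          using Suc.hyps(1)[of a' b z] Suc.hyps(2) Suc.prems a by auto
        obtain x' y' where xy': "x' \<in> carrier M" "y' \<in> carrier M" "z = (\<phi> ^^ a) x' \<oplus>\<^bsub>M\<^esub> (\<psi> ^^ b') y'"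
          using Suc.hyps(1)[of a b' z] Suc.hyps(2) Suc.prems Suc by auto
        have "\<phi> z = (\<phi> ^^ a) x \<oplus>\<^bsub>M\<^esub> (\<psi> ^^ b) (\<phi> y)"
          using xy a by (simp add: p P Q c2 funpow_swap1[of \<phi>])
        moreover have "\<psi> z = (\<phi> ^^ a) (\<psi> x') \<oplus>\<^bsub>M\<^esub> (\<psi> ^^ b) y'"
          using xy' Suc by (simp add: q P Q c1)
        ultimately have "z = ((\<phi> ^^ a) x \<oplus>\<^bsub>M\<^esub> (\<psi> ^^ b) (\<phi> y)) \<oplus>\<^bsub>M\<^esub> ((\<phi> ^^ a) (\<psi> x') \<oplus>\<^bsub>M\<^esub> (\<psi> ^^ b) y')"
          using sum[OF Suc.prems] by simp
        also have "\<dots> = (\<phi> ^^ a) (x \<oplus>\<^bsub>M\<^esub> \<psi> x') \<oplus>\<^bsub>M\<^esub> (\<psi> ^^ b) (\<phi> y \<oplus>\<^bsub>M\<^esub> y')"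
          using xy xy' by (simp add: p q P Q M.M.a_ac)
        finally show ?thesis using xy xy' p(1) q(1) M.M.a_closed by blast
      qed
    qed
  qed
  have N: "y = \<zero>\<^bsub>M\<^esub>" if "y \<in> carrier M" "(\<phi> ^^ a) y = \<zero>\<^bsub>M\<^esub>" "(\<psi> ^^ b) y = \<zero>\<^bsub>M\<^esub>" for a b y
    using that
  proof (induction "a + b" arbitrary: a b y)
    case 0
    then show ?case by simp
  next
    case (Suc n)
    show ?case
    proof (cases "a = 0 \<or> b = 0")
      case True
      then show ?thesis using Suc.prems by auto
    next
      case False
      then obtain a' b' where ab: "a = Suc a'" "b = Suc b'" by (metis not0_implies_Suc)
      have z: "\<phi> \<zero>\<^bsub>M\<^esub> = \<zero>\<^bsub>M\<^esub>" "\<psi> \<zero>\<^bsub>M\<^esub> = \<zero>\<^bsub>M\<^esub>" using mod_hom_zero[OF M M] phi psi by auto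
      have "\<phi> y = \<zero>\<^bsub>M\<^esub>"
      proof (rule Suc.hyps(1)[of a' b])
        show "(\<phi> ^^ a') (\<phi> y) = \<zero>\<^bsub>M\<^esub>" using Suc.prems(2) ab by (simp add: funpow_swap1)
        show "(\<psi> ^^ b) (\<phi> y) = \<zero>\<^bsub>M\<^esub>" using Suc.prems z by (simp add: c2)
      qed (use Suc ab p in auto)
      moreover have "\<psi> y = \<zero>\<^bsub>M\<^esub>"
      proof (rule Suc.hyps(1)[of a b'])
        show "(\<psi> ^^ b') (\<psi> y) = \<zero>\<^bsub>M\<^esub>" using Suc.prems(3) ab by (simp add: funpow_swap1)
        show "(\<phi> ^^ a) (\<psi> y) = \<zero>\<^bsub>M\<^esub>" using Suc.prems z by (simp add: c1)
      qed (use Suc ab q in auto)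
      ultimately show ?thesis using sum[OF Suc.prems(1)] by simp
    qed
  qed
  have X: "submodule ((\<phi> ^^ n) ` carrier M) R M" "submodule ((\<psi> ^^ n) ` carrier M) R M"
    by (rule submodule_image[OF M M _ M.submodule_carrier], rule mod_hom_funpow, fact)+
  have "y = \<zero>\<^bsub>M\<^esub>" if y: "y \<in> (\<phi> ^^ n) ` carrier M" "y \<in> (\<psi> ^^ n) ` carrier M" for y
  proof -
    obtain a where a: "y = (\<phi> ^^ n) a" "a \<in> carrier M" using y(1) by (rule imageE)
    obtain b where b: "y = (\<psi> ^^ n) b" "b \<in> carrier M" using y(2) by (rule imageE)
    show ?thesis
    proof (rule N)
      show "y \<in> carrier M" unfolding a(1) by (rule P(1)[OF a(2)])
      show "(\<phi> ^^ n) y = \<zero>\<^bsub>M\<^esub>" unfolding b(1) by (rule nil[OF b(2)])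
      show "(\<psi> ^^ n) y = \<zero>\<^bsub>M\<^esub>" unfolding a(1) using nil[OF a(2)] c3[OF a(2), of n n] by simp
    qed
  qed
  note zero = this
  have "(\<phi> ^^ n) ` carrier M \<inter> (\<psi> ^^ n) ` carrier M = {\<zero>\<^bsub>M\<^esub>}"
  proof (rule equalityI)
    show "(\<phi> ^^ n) ` carrier M \<inter> (\<psi> ^^ n) ` carrier M \<subseteq> {\<zero>\<^bsub>M\<^esub>}"
    proof
      fix y assume "y \<in> (\<phi> ^^ n) ` carrier M \<inter> (\<psi> ^^ n) ` carrier M"
      then have "y = \<zero>\<^bsub>M\<^esub>" by (elim IntE) (rule zero)
      then show "y \<in> {\<zero>\<^bsub>M\<^esub>}" by (rule ssubst) (rule singletonI)
    qed
    show "{\<zero>\<^bsub>M\<^esub>} \<subseteq> (\<phi> ^^ n) ` carrier M \<inter> (\<psi> ^^ n) ` carrier M"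
      using submoduleD(3)[OF X(1)] submoduleD(3)[OF X(2)] by (simp only: Int_subset_iff insert_subset empty_subsetI simp_thms)
  qed
  moreover have "(\<phi> ^^ n) ` carrier M <+>\<^bsub>M\<^esub> (\<psi> ^^ n) ` carrier M = carrier M"
  proof
    show "(\<phi> ^^ n) ` carrier M <+>\<^bsub>M\<^esub> (\<psi> ^^ n) ` carrier M \<subseteq> carrier M"
      using submoduleD(2)[OF M.submodule_set_add[OF X]] .
    show "carrier M \<subseteq> (\<phi> ^^ n) ` carrier M <+>\<^bsub>M\<^esub> (\<psi> ^^ n) ` carrier M"
    proof
      fix z assume "z \<in> carrier M"
      from S[OF this, of n n] show "z \<in> (\<phi> ^^ n) ` carrier M <+>\<^bsub>M\<^esub> (\<psi> ^^ n) ` carrier M"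
        unfolding set_add_iff by blast
    qed
  qed
  ultimately show ?thesis using X by (simp add: direct_sum2_def)
qed

context left_artinian
begin

lemma rad_mod_hom:
  assumes M: "left_module R M" and f: "f \<in> mod_hom R M M"
    and fJ: "\<And>z. z \<in> carrier M \<Longrightarrow> f z \<in> ideal_mult J M (carrier M)" and z: "z \<in> rad_mod M n"
  shows "f z \<in> rad_mod M (Suc n)"
  using z
proof (induction n arbitrary: z)
  case 0 then show ?case using fJ by (simp add: rad_mod_simps)
next
  case (Suc n)
  from Suc.prems have "z \<in> ideal_mult J M (rad_mod M n)" by (simp only: rad_mod_simps)
  from left_module.ideal_mult_hom[OF M M f jacobson_subset submoduleD(2)[OF rad_mod_submodule[OF M]] this Suc.IH]
  show ?case by (simp only: rad_mod_simps)
qed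

text \<open>Modulo \<open>JF\<close> the kernel \<open>K\<close> of \<open>q\<close> has a complement \<open>Y\<close>. An endomorphism \<open>\<phi>\<close> of \<open>F\<close> that induces the
  projection onto \<open>Y\<close> along \<open>K\<close> modulo \<open>JF\<close> has \<open>\<phi>(1 - \<phi>)\<close> with image in \<open>JF\<close>, hence nilpotent, so \<open>F\<close> splits
  off the image \<open>Q\<close> of a high power of \<open>\<phi>\<close>. This \<open>Q\<close> agrees with \<open>Y\<close> modulo \<open>JF\<close>; thus it maps onto \<open>X\<close> by Nakayama's lemma, and
  \<open>Q \<inter> K\<close> lies in \<open>Q \<inter> JF = JQ\<close>.\<close>

lemma projective_cover_in_epi:
  assumes F: "projective R F" and X: "left_module R X" and q: "q \<in> mod_hom R F X" "q ` carrier F = carrier X"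
  shows "\<exists>Q. submodule Q R F \<and> projective_cover R (submod F Q) q X"
proof -
  have Fm: "left_module R F" using F by (rule projective_left_module)
  interpret F: left_module R F by fact
  let ?JF = "ideal_mult J F (carrier F)"
  have JF: "submodule ?JF R F" using rad_mod_submodule[OF Fm, of 1] by (simp add: rad_mod_simps)
  let ?K = "a_kernel F X q"
  have K: "submodule ?K R F" by (rule submodule_kernel[OF Fm X q(1)])
  let ?K' = "?K <+>\<^bsub>F\<^esub> ?JF"
  have K': "submodule ?K' R F" by (rule F.submodule_set_add[OF K JF])
  obtain Y where Y: "submodule Y R F" "Y \<inter> ?K' = ?JF" "Y <+>\<^bsub>F\<^esub> ?K' = carrier F"
    using complement_mod_rad[OF Fm K'] F.set_add_upper[OF K JF] by blast
  obtain \<phi> where phi: "\<phi> \<in> mod_hom R F F" "\<And>z. z \<in> carrier F \<Longrightarrow> \<phi> z \<in> Y"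
    "\<And>z. z \<in> carrier F \<Longrightarrow> z \<ominus>\<^bsub>F\<^esub> \<phi> z \<in> ?K'"
    using projective_decomp[OF F Y(1) K' Y(3)] by blast
  note p = mod_homD[OF phi(1)]
  define \<psi> where "\<psi> z = z \<ominus>\<^bsub>F\<^esub> \<phi> z" for z
  have psi: "\<psi> \<in> mod_hom R F F" unfolding \<psi>_def by (rule mod_hom_add_map(2)[OF Fm Fm mod_hom_id phi(1)])
  note s = mod_homD[OF psi]
  have sum: "z = \<phi> z \<oplus>\<^bsub>F\<^esub> \<psi> z" if "z \<in> carrier F" for z
    using F.add_diff_cancel[OF that p(1)[OF that]] by (simp add: \<psi>_def)
  have comm: "\<phi> (\<psi> z) = \<psi> (\<phi> z)" if "z \<in> carrier F" for z
    unfolding \<psi>_def by (rule mod_hom_minus[OF Fm Fm phi(1) that p(1)[OF that]])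
  have psiK: "\<psi> z \<in> ?K'" if "z \<in> carrier F" for z using phi(3)[OF that] by (simp add: \<psi>_def)
  have phipsi: "\<phi> (\<psi> z) \<in> ?JF" if z: "z \<in> carrier F" for z
  proof -
    have "\<psi> z \<ominus>\<^bsub>F\<^esub> \<psi> (\<psi> z) \<in> ?K'" by (rule F.submodule_minus[OF K' psiK[OF z] psiK[OF s(1)[OF z]]])
    moreover have "\<psi> z \<ominus>\<^bsub>F\<^esub> \<psi> (\<psi> z) = \<phi> (\<psi> z)"
    proof -
      have c: "\<psi> z \<in> carrier F" "\<phi> (\<psi> z) \<in> carrier F" "\<psi> (\<psi> z) \<in> carrier F" using z s p by auto
      have "\<psi> z = \<phi> (\<psi> z) \<oplus>\<^bsub>F\<^esub> \<psi> (\<psi> z)" by (rule sum[OF c(1)])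
      then have "\<psi> z \<ominus>\<^bsub>F\<^esub> \<psi> (\<psi> z) = (\<phi> (\<psi> z) \<oplus>\<^bsub>F\<^esub> \<psi> (\<psi> z)) \<ominus>\<^bsub>F\<^esub> \<psi> (\<psi> z)" by simp
      then show ?thesis using c by (simp add: a_minus_def F.M.a_assoc F.M.r_neg)
    qed
    ultimately show ?thesis using phi(2)[OF s(1)[OF z]] Y(2) by auto
  qed
  \<comment> \<open>One more than the nilpotence index, so that \<open>\<phi>\<^sup>n\<close> has a factor \<open>\<phi>\<close> and its image lies in \<open>Y\<close>.\<close>
  define n where "n = Suc rad_length"
  have comm': "(\<phi> ^^ m) (\<psi> z) = \<psi> ((\<phi> ^^ m) z)" if "z \<in> carrier F" for m z
    by (induction m) (simp_all add: comm that mod_homD(1)[OF mod_hom_funpow[OF phi(1)]])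
  have nil_step: "(\<phi> ^^ m) ((\<psi> ^^ m) z) \<in> rad_mod F m" if z: "z \<in> carrier F" for m z
  proof (induction m)
    case 0 then show ?case using z by (simp add: rad_mod_simps)
  next
    case (Suc m)
    have c: "(\<psi> ^^ m) z \<in> carrier F" by (rule mod_homD(1)[OF mod_hom_funpow[OF psi] z])
    have "(\<phi> ^^ Suc m) ((\<psi> ^^ Suc m) z) = \<phi> (\<psi> ((\<phi> ^^ m) ((\<psi> ^^ m) z)))"
      using c by (simp add: comm')
    then show ?case
      using rad_mod_hom[OF Fm mod_hom_comp[OF psi phi(1)] phipsi Suc.IH] by simp
  qed
  have "rad_mod F n = {\<zero>\<^bsub>F\<^esub>}"
  proof -
    have "ideal_mult J F {\<zero>\<^bsub>F\<^esub>} \<subseteq> {\<zero>\<^bsub>F\<^esub>}"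
      by (rule F.ideal_mult_least[OF F.submodule_zero]) (use jacobson_subset in auto)
    then show ?thesis
      using rad_mod_nilpotent[OF Fm] ideal_mult.zero[of F J] by (auto simp: n_def rad_mod_simps)
  qed
  then have nil: "(\<phi> ^^ n) ((\<psi> ^^ n) z) = \<zero>\<^bsub>F\<^esub>" if "z \<in> carrier F" for z
    using nil_step[OF that, of n] by simp
  have ds: "direct_sum2 F R ((\<phi> ^^ n) ` carrier F) ((\<psi> ^^ n) ` carrier F)"
    by (rule fitting_decomposition[OF Fm phi(1) psi sum comm nil])
  define Q where "Q = (\<phi> ^^ n) ` carrier F"
  have Q: "submodule Q R F" using ds by (simp add: direct_sum2_def Q_def)
  obtain e where e: "e \<in> mod_hom R F F" "\<And>z. z \<in> carrier F \<Longrightarrow> e z \<in> Q" "\<And>x. x \<in> Q \<Longrightarrow> e x = x"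
    using direct_sum2_projection[OF Fm ds] by (auto simp: Q_def)
  have eQ: "e \<in> mod_hom R F (submod F Q)" by (rule mod_hom_corestrict[OF e(1,2)])
  have Qm: "left_module R (submod F Q)" by (rule F.left_module_submod[OF Q])
  have Qp: "projective R (submod F Q)"
    by (rule projective_retract[OF F Qm mod_hom_incl[OF submoduleD(2)[OF Q]] eQ]) (simp add: e(3))
  have QY: "Q \<subseteq> Y"
  proof
    fix y assume "y \<in> Q"
    then obtain a where "a \<in> carrier F" "y = \<phi> ((\<phi> ^^ rad_length) a)" by (auto simp: Q_def n_def)
    then show "y \<in> Y" using phi(2) mod_homD(1)[OF mod_hom_funpow[OF phi(1)]] by simp
  qed
  have ker: "a_kernel (submod F Q) X q = Q \<inter> ?K" using submoduleD(1)[OF Q] by (auto simp: a_kernel_iff)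
  have "Q \<inter> ?K \<subseteq> ideal_mult J (submod F Q) Q"
  proof
    fix y assume y: "y \<in> Q \<inter> ?K"
    then have "y \<in> ?K'" using F.set_add_upper(1)[OF K JF] by blast
    then have "y \<in> ?JF" using y QY Y(2) by blast
    from F.ideal_mult_hom[OF Qm eQ jacobson_subset subset_refl this, of Q]
    show "y \<in> ideal_mult J (submod F Q) Q" using e(2,3) y by auto
  qed
  then have sup: "superfluous R (submod F Q) (a_kernel (submod F Q) X q)"
    using superfluous_if[OF Qm submodule_kernel[OF Qm X mod_hom_restrict[OF q(1) submoduleD(2)[OF Q]]]] ker by simp
  have step: "z \<ominus>\<^bsub>F\<^esub> (\<phi> ^^ m) z \<in> ?K'" if z: "z \<in> carrier F" for z m
  proof (induction m)
    case 0
    then show ?case using z submoduleD(3)[OF K'] by (simp add: a_minus_def F.M.r_neg)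
  next
    case (Suc m)
    let ?w = "(\<phi> ^^ m) z"
    have c: "?w \<in> carrier F" "\<phi> ?w \<in> carrier F" using z p(1) mod_homD(1)[OF mod_hom_funpow[OF phi(1)]] by auto
    have "(z \<ominus>\<^bsub>F\<^esub> ?w) \<oplus>\<^bsub>F\<^esub> \<psi> ?w \<in> ?K'" by (rule submoduleD(4)[OF K' Suc psiK[OF c(1)]])
    moreover have "(z \<ominus>\<^bsub>F\<^esub> ?w) \<oplus>\<^bsub>F\<^esub> \<psi> ?w = z \<ominus>\<^bsub>F\<^esub> \<phi> ?w"
      using c z by (simp add: \<psi>_def a_minus_def F.M.a_assoc F.M.r_neg1)
    ultimately show ?case by simp
  qed
  have QK: "submodule (Q <+>\<^bsub>F\<^esub> ?K) R F" by (rule F.submodule_set_add[OF Q K])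
  have "carrier F \<subseteq> (Q <+>\<^bsub>F\<^esub> ?K) <+>\<^bsub>F\<^esub> ?JF"
  proof
    fix z assume z: "z \<in> carrier F"
    let ?S = "(Q <+>\<^bsub>F\<^esub> ?K) <+>\<^bsub>F\<^esub> ?JF"
    have S: "submodule ?S R F" by (rule F.submodule_set_add[OF QK JF])
    have up: "Q \<subseteq> ?S" "?K \<subseteq> ?S" "?JF \<subseteq> ?S"
      using F.set_add_upper[OF Q K] F.set_add_upper[OF QK JF] by blast+
    have "?K' \<subseteq> ?S" by (rule F.set_add_least[OF S up(2,3)])
    then have "z \<ominus>\<^bsub>F\<^esub> (\<phi> ^^ n) z \<in> ?S" using step[OF z] by blast
    moreover have "(\<phi> ^^ n) z \<in> ?S" using up(1) z by (auto simp: Q_def)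
    ultimately have "(\<phi> ^^ n) z \<oplus>\<^bsub>F\<^esub> (z \<ominus>\<^bsub>F\<^esub> (\<phi> ^^ n) z) \<in> ?S" using submoduleD(4)[OF S] by blast
    then show "z \<in> ?S" using F.add_diff_cancel[OF z mod_homD(1)[OF mod_hom_funpow[OF phi(1)] z]] by simp
  qed
  then have "(Q <+>\<^bsub>F\<^esub> ?K) <+>\<^bsub>F\<^esub> ?JF = carrier F"
    using submoduleD(2)[OF F.submodule_set_add[OF QK JF]] by blast
  then have FQK: "Q <+>\<^bsub>F\<^esub> ?K = carrier F" by (rule nakayama[OF Fm QK])
  have "q ` Q = carrier X"
  proof
    show "q ` Q \<subseteq> carrier X" using submoduleD(1)[OF Q] mod_homD(1)[OF q(1)] by blast
    show "carrier X \<subseteq> q ` Q"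
    proof
      fix x assume "x \<in> carrier X"
      then obtain z where z: "z \<in> carrier F" "x = q z" using q(2) by blast
      then have "z \<in> Q <+>\<^bsub>F\<^esub> ?K" using FQK by simp
      then obtain y k where yk: "y \<in> Q" "k \<in> ?K" "z = y \<oplus>\<^bsub>F\<^esub> k" unfolding set_add_iff by blast
      interpret X: left_module R X by fact
      have "x = q y"
        using yk z submoduleD(1)[OF Q yk(1)] mod_homD[OF q(1)] by (auto simp: a_kernel_iff)
      then show "x \<in> q ` Q" using yk by blast
    qed
  qed
  then have "projective_cover R (submod F Q) q X"
    using Qp sup mod_hom_restrict[OF q(1) submoduleD(2)[OF Q]] by (simp add: projective_cover_def)
  then show ?thesis using Q by blast
qed

lemma projective_cover_exists:
  fixes X :: "('r, ('r, 'm) mod_univ) module"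
  assumes X: "left_module R X"
  shows "\<exists>(P :: ('r, ('r, 'm) mod_univ) module) f. projective_cover R P f X"
proof -
  interpret X: left_module R X by fact
  let ?F = "free_mod R :: ('r, ('r, 'm) mod_univ \<Rightarrow> 'r) module"
  let ?U = "free_univ R :: ('r, ('r, 'm) mod_univ) module"
  let ?b = "\<lambda>x. if x \<in> carrier X then x else \<zero>\<^bsub>X\<^esub>"
  have "?b x \<in> carrier X" for x by auto
  from free_hom[OF ring_axioms X, of ?b, OF this]
  obtain p where p: "p \<in> mod_hom R ?F X" "\<And>x. p (free_basis R x) = ?b x" by blast
  note iso = free_univ_iso[OF ring_axioms]
  let ?d = "inv_into (carrier ?F) (encode R)"
  have d: "?d \<in> mod_hom R ?U ?F"
    by (rule mod_hom_inv_into[OF free_left_module[OF ring_axioms] iso(2,3)])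
  have q: "(\<lambda>x. p (?d x)) \<in> mod_hom R ?U X" by (rule mod_hom_comp[OF d p(1)])
  have "(\<lambda>x. p (?d x)) ` carrier ?U = carrier X"
  proof
    show "(\<lambda>x. p (?d x)) ` carrier ?U \<subseteq> carrier X" using mod_homD(1)[OF q] by blast
    show "carrier X \<subseteq> (\<lambda>x. p (?d x)) ` carrier ?U"
    proof
      fix x assume x: "x \<in> carrier X"
      let ?e = "free_basis R x"
      have e: "?e \<in> carrier ?F" by (rule free_basis_closed[OF ring_axioms])
      have "p (?d (encode R ?e)) = x" using x inv_into_f_f[OF inj_on_encode e] by (simp add: p)
      moreover have "encode R ?e \<in> carrier ?U" using mod_homD(1)[OF iso(2) e] .
      ultimately show "x \<in> (\<lambda>x. p (?d x)) ` carrier ?U" by (metis image_eqI)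
    qed
  qed
  from projective_cover_in_epi[OF projective_free_univ[OF ring_axioms] X q this] show ?thesis by blast
qed

end


section \<open>Syzygies, retracts and biproducts\<close>

text \<open>The image of \<open>g\<close> and the kernel of \<open>f\<close> together span \<open>P\<close>.\<close>

lemma superfluous_epi:
  assumes P': "left_module R P'" and P: "left_module R P" and M: "left_module R M"
    and f: "f \<in> mod_hom R P M" and sup: "superfluous R P (a_kernel P M f)"
    and g: "g \<in> mod_hom R P' P" and onto: "\<And>p. p \<in> carrier P \<Longrightarrow> \<exists>x\<in>carrier P'. f (g x) = f p"
  shows "g ` carrier P' = carrier P"
proof -
  interpret P: left_module R P by fact
  interpret M: left_module R M by fact
  have S: "submodule (g ` carrier P') R P"
    by (rule submodule_image[OF P' P g left_module.submodule_carrier[OF P']])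
  have K: "submodule (a_kernel P M f) R P" by (rule submodule_kernel[OF P M f])
  have "carrier P \<subseteq> g ` carrier P' <+>\<^bsub>P\<^esub> a_kernel P M f"
  proof
    fix p assume p: "p \<in> carrier P"
    then obtain x where x: "x \<in> carrier P'" "f (g x) = f p" using onto by blast
    have gx: "g x \<in> carrier P" by (rule mod_homD(1)[OF g x(1)])
    have "f (p \<ominus>\<^bsub>P\<^esub> g x) = \<zero>\<^bsub>M\<^esub>"
      using mod_hom_minus[OF P M f p gx] x(2) mod_homD(1)[OF f p] by (simp add: a_minus_def M.M.r_neg)
    then have "p \<ominus>\<^bsub>P\<^esub> g x \<in> a_kernel P M f" using p gx by (simp add: a_kernel_iff)
    moreover have "p = g x \<oplus>\<^bsub>P\<^esub> (p \<ominus>\<^bsub>P\<^esub> g x)" using P.add_diff_cancel[OF p gx] by simp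
    ultimately show "p \<in> g ` carrier P' <+>\<^bsub>P\<^esub> a_kernel P M f"
      unfolding set_add_iff using x(1) by blast
  qed
  then have "g ` carrier P' <+>\<^bsub>P\<^esub> a_kernel P M f = carrier P"
    using submoduleD(2)[OF P.submodule_set_add[OF S K]] by blast
  then show ?thesis using sup S unfolding superfluous_def by blast
qed

text \<open>Such a \<open>u\<close> is onto, so it has a section because \<open>P\<close> is projective. The section has the same
  property, so it is onto as well, and \<open>u\<close> is injective.\<close>

lemma cover_auto:
  assumes cov: "projective_cover R P f M" and M: "left_module R M"
    and u: "u \<in> mod_hom R P P" "\<And>x. x \<in> carrier P \<Longrightarrow> f (u x) = f x"
  shows "bij_betw u (carrier P) (carrier P)"
proof -
  have proj: "projective R P" and f: "f \<in> mod_hom R P M" and sup: "superfluous R P (a_kernel P M f)"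
    using cov by (auto simp: projective_cover_def)
  have P: "left_module R P" using proj by (rule projective_left_module)
  have surj: "u ` carrier P = carrier P"
    by (rule superfluous_epi[OF P P M f sup u(1)]) (use u(2) in blast)
  obtain h where h: "h \<in> mod_hom R P P" "\<And>x. x \<in> carrier P \<Longrightarrow> u (h x) = x"
    using projective_lift[OF proj P P u(1) surj mod_hom_id] by blast
  have "f (h x) = f x" if "x \<in> carrier P" for x
    using u(2)[OF mod_homD(1)[OF h(1) that]] h(2)[OF that] by simp
  then have hs: "h ` carrier P = carrier P"
    by (intro superfluous_epi[OF P P M f sup h(1)]) blast
  have "inj_on u (carrier P)"
  proof (rule inj_onI)
    fix x y assume xy: "x \<in> carrier P" "y \<in> carrier P" "u x = u y"
    have "x \<in> h ` carrier P" using xy(1) hs by simp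
    then obtain a where a: "x = h a" "a \<in> carrier P" by (rule imageE)
    have "y \<in> h ` carrier P" using xy(2) hs by simp
    then obtain b where b: "y = h b" "b \<in> carrier P" by (rule imageE)
    show "x = y" using h(2)[OF a(2)] h(2)[OF b(2)] xy(3) a(1) b(1) by simp
  qed
  then show ?thesis using surj by (simp add: bij_betw_def)
qed

definition retract :: "'r ring \<Rightarrow> ('r, 'a) module \<Rightarrow> ('r, 'm) module \<Rightarrow> bool" where
  "retract R A X \<longleftrightarrow> (\<exists>i\<in>mod_hom R A X. \<exists>p\<in>mod_hom R X A. \<forall>x\<in>carrier A. p (i x) = x)"

lemma retract_refl: "retract R A A"
  unfolding retract_def by (rule bexI[OF _ mod_hom_id], rule bexI[OF _ mod_hom_id]) simp

lemma retract_trans: "retract R A B \<Longrightarrow> retract R B C \<Longrightarrow> retract R A C"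
proof -
  assume "retract R A B" "retract R B C"
  then obtain i p j q where "i \<in> mod_hom R A B" "p \<in> mod_hom R B A" "\<forall>x\<in>carrier A. p (i x) = x"
    "j \<in> mod_hom R B C" "q \<in> mod_hom R C B" "\<forall>x\<in>carrier B. q (j x) = x"
    unfolding retract_def by blast
  then show ?thesis unfolding retract_def
    by (intro bexI[OF _ mod_hom_comp[of i R A B j C]] bexI[OF _ mod_hom_comp[of q R C B p A]])
       (auto simp: mod_homD(1)[of i])
qed

lemma mod_iso_retract: "left_module R A \<Longrightarrow> mod_iso R A B \<Longrightarrow> retract R A B \<and> retract R B A"
proof -
  assume A: "left_module R A" and "mod_iso R A B"
  then obtain f where f: "f \<in> mod_hom R A B" "bij_betw f (carrier A) (carrier B)" by (auto simp: mod_iso_def)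
  have g: "inv_into (carrier A) f \<in> mod_hom R B A" by (rule mod_hom_inv_into[OF A f])
  have "inv_into (carrier A) f (f x) = x" if "x \<in> carrier A" for x using f(2) that by (simp add: bij_betw_def)
  moreover have "f (inv_into (carrier A) f y) = y" if "y \<in> carrier B" for y
    using f(2) that by (simp add: bij_betw_def f_inv_into_f)
  ultimately show ?thesis using f(1) g unfolding retract_def by blast
qed

text \<open>Lift inclusion and retraction to the projective modules. Their composite is an endomorphism of the projective
  cover over the identity of \<open>A\<close>, hence an automorphism, and correcting by its inverse gives a retraction that respects the
  kernels. Only the module \<open>A\<close> is presented minimally; this generality is used to compare with
  arbitrary projective resolutions.\<close>

lemma kernel_retract:
  assumes cov: "projective_cover R P f A" and A: "left_module R A" and X: "left_module R X"
    and Q: "projective R Q" and g: "g \<in> mod_hom R Q X" "g ` carrier Q = carrier X"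
    and ret: "retract R A X"
  shows "retract R (submod P (a_kernel P A f)) (submod Q (a_kernel Q X g))"
proof -
  have P: "projective R P" and f: "f \<in> mod_hom R P A" "f ` carrier P = carrier A"
    using cov by (auto simp: projective_cover_def)
  note Pm = projective_left_module[OF P] and Qm = projective_left_module[OF Q]
  obtain i p where i: "i \<in> mod_hom R A X" and p: "p \<in> mod_hom R X A" and pi: "\<And>x. x \<in> carrier A \<Longrightarrow> p (i x) = x"
    using ret unfolding retract_def by blast
  obtain i' where i': "i' \<in> mod_hom R P Q" "\<And>x. x \<in> carrier P \<Longrightarrow> g (i' x) = i (f x)"
    using projective_lift[OF P Qm X g mod_hom_comp[OF f(1) i]] by blast
  obtain p' where p': "p' \<in> mod_hom R Q P" "\<And>x. x \<in> carrier Q \<Longrightarrow> f (p' x) = p (g x)"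
    using projective_lift[OF Q Pm A f mod_hom_comp[OF g(1) p]] by blast
  let ?u = "\<lambda>x. p' (i' x)"
  have u: "?u \<in> mod_hom R P P" by (rule mod_hom_comp[OF i'(1) p'(1)])
  have fu: "f (?u x) = f x" if "x \<in> carrier P" for x
    using that p'(2)[OF mod_homD(1)[OF i'(1) that]] i'(2)[OF that] pi mod_homD(1)[OF f(1)] by simp
  have bij: "bij_betw ?u (carrier P) (carrier P)" by (rule cover_auto[OF cov A u fu])
  let ?v = "inv_into (carrier P) ?u"
  have v: "?v \<in> mod_hom R P P" by (rule mod_hom_inv_into[OF Pm u bij])
  have vu: "?v (?u x) = x" if "x \<in> carrier P" for x by (rule inv_into_f_f[OF bij_betw_imp_inj_on[OF bij] that])
  have uv: "?u (?v x) = x" if "x \<in> carrier P" for x using bij that by (simp add: bij_betw_def f_inv_into_f[of x ?u])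
  have fv: "f (?v x) = f x" if "x \<in> carrier P" for x
    using fu[OF mod_homD(1)[OF v that]] uv[OF that] by simp
  let ?KP = "a_kernel P A f" and ?KQ = "a_kernel Q X g"
  have sub: "?KP \<subseteq> carrier P" "?KQ \<subseteq> carrier Q" by (auto simp: a_kernel_iff)
  have 1: "i' \<in> mod_hom R (submod P ?KP) (submod Q ?KQ)"
  proof (rule mod_hom_corestrict[OF mod_hom_restrict[OF i'(1) sub(1)]])
    fix x assume "x \<in> carrier (submod P ?KP)"
    then have x: "x \<in> carrier P" "f x = \<zero>\<^bsub>A\<^esub>" by (auto simp: a_kernel_iff)
    then show "i' x \<in> ?KQ" using i'(2) mod_homD(1)[OF i'(1)] mod_hom_zero[OF A X i] by (simp add: a_kernel_iff)
  qed
  have 2: "(\<lambda>y. ?v (p' y)) \<in> mod_hom R (submod Q ?KQ) (submod P ?KP)"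
  proof (rule mod_hom_corestrict[OF mod_hom_restrict[OF mod_hom_comp[OF p'(1) v] sub(2)]])
    fix y assume "y \<in> carrier (submod Q ?KQ)"
    then have y: "y \<in> carrier Q" "g y = \<zero>\<^bsub>X\<^esub>" by (auto simp: a_kernel_iff)
    have c: "p' y \<in> carrier P" by (rule mod_homD(1)[OF p'(1) y(1)])
    have "f (?v (p' y)) = \<zero>\<^bsub>A\<^esub>" using fv[OF c] p'(2)[OF y(1)] y(2) mod_hom_zero[OF X A p] by simp
    then show "?v (p' y) \<in> ?KP" using mod_homD(1)[OF v c] by (simp add: a_kernel_iff)
  qed
  show ?thesis unfolding retract_def
    by (rule bexI[OF _ 1], rule bexI[OF _ 2]) (use vu sub in auto)
qed


definition syz :: "'r ring \<Rightarrow> ('r, ('r, 'm) mod_univ) module \<Rightarrow> ('r, ('r, 'm) mod_univ) module" where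
  "syz R X = (let (P :: ('r, ('r, 'm) mod_univ) module, f) = (SOME (P, f). projective_cover R P f X)
    in submod P (a_kernel P X f))"

lemma syzygy_Suc: "syzygy R M (Suc j) = syz R (syzygy R M j)"
  by (simp add: syz_def)

lemma (in left_artinian) cover_some:
  fixes X :: "('r, ('r, 'm) mod_univ) module"
  assumes X: "left_module R X"
  obtains P :: "('r, ('r, 'm) mod_univ) module" and f where
    "projective_cover R P f X" "(SOME (P :: ('r, ('r, 'm) mod_univ) module, f). projective_cover R P f X) = (P, f)"
    "syz R X = submod P (a_kernel P X f)"
proof -
  let ?s = "SOME (P :: ('r, ('r, 'm) mod_univ) module, f). projective_cover R P f X"
  obtain P0 :: "('r, ('r, 'm) mod_univ) module" and f0 where "projective_cover R P0 f0 X"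
    using projective_cover_exists[OF X] by blast
  then have "case (P0, f0) of (P :: ('r, ('r, 'm) mod_univ) module, f) \<Rightarrow> projective_cover R P f X" by simp
  then have "case ?s of (P, f) \<Rightarrow> projective_cover R P f X" by (rule someI)
  moreover obtain P f where "?s = (P, f)" by (cases ?s)
  ultimately show thesis using that[of P f] by (simp add: syz_def)
qed

lemma (in left_artinian) syz_left_module: "left_module R X \<Longrightarrow> left_module R (syz R X)"
proof -
  assume X: "left_module R X"
  obtain P f where cov: "projective_cover R P f X" and s: "syz R X = submod P (a_kernel P X f)"
    using cover_some[OF X] by blast
  have P: "left_module R P" and f: "f \<in> mod_hom R P X"
    using cov by (auto simp: projective_cover_def projective_left_module)
  show ?thesis unfolding s by (rule left_module.left_module_submod[OF P submodule_kernel[OF P X f]])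
qed

lemma (in left_artinian) syzygy_left_module: "left_module R M \<Longrightarrow> left_module R (syzygy R M j)"
  by (induction j) (simp_all only: syzygy.simps(1) syzygy_Suc univ_copy_iso(1) syz_left_module)

lemma (in left_artinian) retract_syz:
  assumes A: "left_module R A" and X: "left_module R X" and ret: "retract R A X"
  shows "retract R (syz R A) (syz R X)"
proof -
  obtain P f where cov: "projective_cover R P f A" and s: "syz R A = submod P (a_kernel P A f)"
    using cover_some[OF A] by blast
  obtain Q g where cov': "projective_cover R Q g X" and s': "syz R X = submod Q (a_kernel Q X g)"
    using cover_some[OF X] by blast
  have Q: "projective R Q" "g \<in> mod_hom R Q X" "g ` carrier Q = carrier X"
    using cov' by (auto simp: projective_cover_def)
  show ?thesis unfolding s s' by (rule kernel_retract[OF cov A X Q ret])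
qed

subsection \<open>Biproducts\<close>

text \<open>\<open>X\<close> as the direct sum of the modules \<open>C i\<close>, given by injections and projections. The last axiom says that
  every \<open>x\<close> is a finite sum of its components \<open>\<iota> i (\<pi> i x)\<close>, phrased without finite sums: every submodule that contains
  the components contains \<open>x\<close>. In this pointwise form it passes to kernels.\<close>

locale biproduct =
  fixes R :: "'r ring" and X :: "('r, 'm) module" and C :: "'i \<Rightarrow> ('r, 'c) module"
    and \<iota> :: "'i \<Rightarrow> 'c \<Rightarrow> 'm" and \<pi> :: "'i \<Rightarrow> 'm \<Rightarrow> 'c"
  assumes total: "left_module R X"
    and summand: "left_module R (C i)"
    and inj: "\<iota> i \<in> mod_hom R (C i) X"
    and proj: "\<pi> i \<in> mod_hom R X (C i)"
    and proj_inj: "c \<in> carrier (C i) \<Longrightarrow> \<pi> i (\<iota> i c) = c"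
    and proj_inj_neq: "i \<noteq> j \<Longrightarrow> c \<in> carrier (C j) \<Longrightarrow> \<pi> i (\<iota> j c) = \<zero>\<^bsub>C i\<^esub>"
    and gen: "x \<in> carrier X \<Longrightarrow> submodule S R X \<Longrightarrow> (\<And>i. \<iota> i (\<pi> i x) \<in> S) \<Longrightarrow> x \<in> S"
begin

lemma retract_term: "retract R (C i) X"
  unfolding retract_def using inj proj proj_inj by blast

end

lemma (in module_family) ext_sum_biproduct: "biproduct R (ext_sum C) C (single C) (\<lambda>i f. f i)"
  by (rule biproduct.intro)
     (simp_all only: ext_sum_left_module family single_hom proj_hom,
      auto simp: single_def simp del: ext_sum_simps intro: ext_sum_induct)

lemma biproduct_iso:
  assumes b: "biproduct R X C \<iota> \<pi>" and Y: "left_module R Y" and g: "g \<in> mod_hom R X Y"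
    "bij_betw g (carrier X) (carrier Y)"
  shows "biproduct R Y C (\<lambda>i c. g (\<iota> i c)) (\<lambda>i y. \<pi> i (inv_into (carrier X) g y))"
proof -
  interpret biproduct R X C \<iota> \<pi> by fact
  let ?h = "inv_into (carrier X) g"
  have h: "?h \<in> mod_hom R Y X" by (rule mod_hom_inv_into[OF total g])
  have hg: "?h (g x) = x" if "x \<in> carrier X" for x using g(2) that by (simp add: bij_betw_def)
  have gh: "g (?h y) = y" if "y \<in> carrier Y" for y using g(2) that by (simp add: bij_betw_def f_inv_into_f)
  show ?thesis
  proof (rule biproduct.intro)
    fix y S assume y: "y \<in> carrier Y" and S: "submodule S R Y" and *: "\<And>i. g (\<iota> i (\<pi> i (?h y))) \<in> S"
    have hy: "?h y \<in> carrier X" by (rule mod_homD(1)[OF h y])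
    have "\<iota> i (\<pi> i (?h y)) \<in> {x \<in> carrier X. g x \<in> S}" for i
      using * mod_homD(1)[OF inj mod_homD(1)[OF proj hy]] by simp
    from gen[OF hy submodule_vimage[OF total Y g(1) S] this] show "y \<in> S" using gh[OF y] by simp
  qed (simp_all add: Y summand mod_hom_comp[OF inj g(1)] mod_hom_comp[OF h proj] hg mod_homD(1)[OF inj] proj_inj proj_inj_neq)
qed

lemma biproduct_trans:
  assumes b: "biproduct R X C \<iota> \<pi>" and d: "\<And>i. biproduct R (C i) (D i) (\<kappa> i) (\<rho> i)"
  shows "biproduct R X (\<lambda>(i, k). D i k) (\<lambda>(i, k) c. \<iota> i (\<kappa> i k c)) (\<lambda>(i, k) x. \<rho> i k (\<pi> i x))"
proof -
  interpret biproduct R X C \<iota> \<pi> by fact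
  interpret D: biproduct R "C l" "D l" "\<kappa> l" "\<rho> l" for l by (rule d)
  have z: "\<rho> i k \<zero>\<^bsub>C i\<^esub> = \<zero>\<^bsub>D i k\<^esub>" for i k
    by (rule mod_hom_zero[OF D.total D.summand D.proj])
  show ?thesis
  proof (rule biproduct.intro)
    fix x S assume x: "x \<in> carrier X" and S: "submodule S R X"
      and *: "\<And>ik. (case ik of (i, k) \<Rightarrow> \<lambda>c. \<iota> i (\<kappa> i k c)) ((case ik of (i, k) \<Rightarrow> \<lambda>x. \<rho> i k (\<pi> i x)) x) \<in> S"
    show "x \<in> S"
    proof (rule gen[OF x S])
      fix i
      have c: "\<pi> i x \<in> carrier (C i)" by (rule mod_homD(1)[OF proj x])
      have "\<kappa> i k (\<rho> i k (\<pi> i x)) \<in> {c \<in> carrier (C i). \<iota> i c \<in> S}" for k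
        using *[of "(i, k)"] mod_homD(1)[OF D.inj mod_homD(1)[OF D.proj c]] by simp
      from D.gen[OF c submodule_vimage[OF summand total inj S] this] show "\<iota> i (\<pi> i x) \<in> S" by simp
    qed
  next
    fix ik jl :: "'c \<times> 'e" and c
    assume "ik \<noteq> jl" and "c \<in> carrier (case jl of (i, k) \<Rightarrow> D i k)"
    moreover obtain i k j l where "ik = (i, k)" "jl = (j, l)" by (cases ik, cases jl)
    ultimately show "(case ik of (i, k) \<Rightarrow> \<lambda>x. \<rho> i k (\<pi> i x)) ((case jl of (i, k) \<Rightarrow> \<lambda>c. \<iota> i (\<kappa> i k c)) c) =
        \<zero>\<^bsub>case ik of (i, k) \<Rightarrow> D i k\<^esub>"
      by (cases "i = j") (auto simp: proj_inj proj_inj_neq D.proj_inj_neq mod_homD(1)[OF D.inj] z)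
  qed (auto simp: total D.summand mod_hom_comp[OF D.inj inj] mod_hom_comp[OF proj D.proj] proj_inj
        D.proj_inj mod_homD(1)[OF D.inj] split: prod.splits)
qed

text \<open>A homomorphism that is diagonal with respect to two direct decompositions has as its kernel the
  direct sum of the kernels.\<close>

lemma biproduct_kernel:
  assumes b: "biproduct R P D \<kappa> \<rho>" and c: "biproduct R X C \<iota> \<pi>"
    and f: "f \<in> mod_hom R P X" and fi: "\<And>i. fi i \<in> mod_hom R (D i) (C i)"
    and inj: "\<And>i p. p \<in> carrier (D i) \<Longrightarrow> f (\<kappa> i p) = \<iota> i (fi i p)"
    and proj: "\<And>i x. x \<in> carrier P \<Longrightarrow> fi i (\<rho> i x) = \<pi> i (f x)"
  shows "biproduct R (submod P (a_kernel P X f)) (\<lambda>i. submod (D i) (a_kernel (D i) (C i) (fi i))) \<kappa> \<rho>"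
proof -
  interpret P: biproduct R P D \<kappa> \<rho> by fact
  interpret X: biproduct R X C \<iota> \<pi> by fact
  let ?K = "a_kernel P X f" and ?Ki = "\<lambda>i. a_kernel (D i) (C i) (fi i)"
  have K: "submodule ?K R P" by (rule submodule_kernel[OF P.total X.total f])
  have Ki: "submodule (?Ki i) R (D i)" for i by (rule submodule_kernel[OF P.summand X.summand fi])
  note sub = submoduleD(2)[OF K] and subi = submoduleD(2)[OF Ki]
  have 1: "\<kappa> i c \<in> ?K" if "c \<in> ?Ki i" for i c
    using that inj[of c i] mod_homD(1)[OF P.inj] mod_hom_zero[OF X.summand X.total X.inj] by (auto simp: a_kernel_iff)
  have 2: "\<rho> i x \<in> ?Ki i" if "x \<in> ?K" for i x
    using that proj[of x i] mod_homD(1)[OF P.proj] mod_hom_zero[OF X.total X.summand X.proj] by (auto simp: a_kernel_iff)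
  show ?thesis
  proof (rule biproduct.intro)
    show "left_module R (submod P ?K)" by (rule left_module.left_module_submod[OF P.total K])
    show "left_module R (submod (D i) (?Ki i))" for i by (rule left_module.left_module_submod[OF P.summand Ki])
    show "\<kappa> i \<in> mod_hom R (submod (D i) (?Ki i)) (submod P ?K)" for i
      by (rule mod_hom_corestrict[OF mod_hom_restrict[OF P.inj subi]]) (simp add: 1)
    show "\<rho> i \<in> mod_hom R (submod P ?K) (submod (D i) (?Ki i))" for i
      by (rule mod_hom_corestrict[OF mod_hom_restrict[OF P.proj sub]]) (simp add: 2)
    fix x S assume x: "x \<in> carrier (submod P ?K)" and S: "submodule S R (submod P ?K)"
      and *: "\<And>i. \<kappa> i (\<rho> i x) \<in> S"
    have "submodule S R P" using S left_module.submodule_submod_iff[OF P.total K] by blast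
    then show "x \<in> S" using P.gen[of x S] x sub * by auto
  qed (use subi in \<open>auto intro: P.proj_inj P.proj_inj_neq\<close>)
qed

lemma (in module_family) ext_sum_hom_eqI:
  assumes Y: "left_module R Y" and F: "F \<in> mod_hom R (ext_sum C) Y" and G: "G \<in> mod_hom R (ext_sum C) Y"
    and eq: "\<And>i c. c \<in> carrier (C i) \<Longrightarrow> F (single C i c) = G (single C i c)" and e: "e \<in> carrier (ext_sum C)"
  shows "F e = G e"
proof -
  have "e \<in> {e \<in> carrier (ext_sum C). F e = G e}"
  proof (rule ext_sum_induct[OF e submodule_equalizer[OF ext_sum_left_module Y F G]])
    fix i
    have c: "e i \<in> carrier (C i)" using e by simp
    show "single C i (e i) \<in> {e \<in> carrier (ext_sum C). F e = G e}"
      using mod_homD(1)[OF single_hom c] eq[OF c] by blast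
  qed
  then show ?thesis by blast
qed

text \<open>Syzygies commute with arbitrary direct sums. The sum \<open>E\<close> of the projective covers \<open>Q i\<close> of the summands maps
  onto \<open>X\<close>, and its kernel is superfluous because componentwise it lies in \<open>J (Q i)\<close>. Lifting back and
  forth between \<open>E\<close> and the projective cover of \<open>X\<close> identifies the two, compatibly with the maps to \<open>X\<close>.\<close>

lemma (in left_artinian) biproduct_syz:
  fixes X :: "('r, ('r, 'm) mod_univ) module" and C :: "'i \<Rightarrow> ('r, ('r, 'm) mod_univ) module"
  assumes b: "biproduct R X C \<iota> \<pi>"
  shows "\<exists>\<kappa> \<rho>. biproduct R (syz R X) (\<lambda>i. syz R (C i)) \<kappa> \<rho>"
proof -
  interpret biproduct R X C \<iota> \<pi> by fact
  have "\<exists>(P :: ('r, ('r, 'm) mod_univ) module) f. projective_cover R P f (C i) \<and> syz R (C i) = submod P (a_kernel P (C i) f)" for i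
    using cover_some[OF summand] by blast
  then obtain Q :: "'i \<Rightarrow> ('r, ('r, 'm) mod_univ) module" and q where
    cov: "\<And>i. projective_cover R (Q i) (q i) (C i)" and s: "\<And>i. syz R (C i) = submod (Q i) (a_kernel (Q i) (C i) (q i))"
    by metis
  obtain P f where covX: "projective_cover R P f X" and sX: "syz R X = submod P (a_kernel P X f)"
    using cover_some[OF total] by blast
  have P: "projective R P" and f: "f \<in> mod_hom R P X" "f ` carrier P = carrier X"
    using covX by (auto simp: projective_cover_def)
  have Q: "projective R (Q i)" and q: "q i \<in> mod_hom R (Q i) (C i)" "q i ` carrier (Q i) = carrier (C i)" 
    and qsup: "superfluous R (Q i) (a_kernel (Q i) (C i) (q i))" for i
    using cov[of i] by (auto simp: projective_cover_def)
  note Pm = projective_left_module[OF P] and Qm = projective_left_module[OF Q]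
  interpret F: module_family R Q by (rule module_family.intro) (rule Qm)
  let ?E = "ext_sum Q"
  have E: "left_module R ?E" by (rule F.ext_sum_left_module)
  have iq: "(\<lambda>p. \<iota> i (q i p)) \<in> mod_hom R (Q i) X" for i by (rule mod_hom_comp[OF q(1) inj])
  obtain F where F: "F \<in> mod_hom R ?E X" "\<And>i p. p \<in> carrier (Q i) \<Longrightarrow> F (single Q i p) = \<iota> i (q i p)"
    using F.ext_sum_hom[OF total, of "\<lambda>i p. \<iota> i (q i p)", OF iq] by blast
  have Fpi: "\<pi> i (F e) = q i (e i)" if e: "e \<in> carrier ?E" for i e
  proof (rule F.ext_sum_hom_eqI[OF summand mod_hom_comp[OF F(1) proj] mod_hom_comp[OF F.proj_hom q(1)] _ e])
    fix j p assume p: "p \<in> carrier (Q j)"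
    show "\<pi> i (F (single Q j p)) = q i (single Q j p i)"
      using p mod_homD(1)[OF q(1) p] F(2)[OF p] mod_hom_zero[OF Qm summand q(1), of i]
      by (cases "i = j") (simp_all add: proj_inj proj_inj_neq single_def)
  qed
  have Fsurj: "F ` carrier ?E = carrier X"
  proof
    show "F ` carrier ?E \<subseteq> carrier X" using mod_homD(1)[OF F(1)] by blast
    show "carrier X \<subseteq> F ` carrier ?E"
    proof
      fix x assume x: "x \<in> carrier X"
      show "x \<in> F ` carrier ?E"
      proof (rule gen[OF x submodule_image[OF E total F(1) left_module.submodule_carrier[OF E]]])
        fix i
        have "\<pi> i x \<in> q i ` carrier (Q i)" using mod_homD(1)[OF proj x] q(2) by simp
        then obtain p where p: "\<pi> i x = q i p" "p \<in> carrier (Q i)" by (rule imageE)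
        then show "\<iota> i (\<pi> i x) \<in> F ` carrier ?E"
          using F(2)[OF p(2)] mod_homD(1)[OF F.single_hom p(2)] by (metis image_eqI)
      qed
    qed
  qed
  have Fsup: "superfluous R ?E (a_kernel ?E X F)"
  proof (rule superfluous_if[OF E submodule_kernel[OF E total F(1)]], rule subsetI)
    fix e assume "e \<in> a_kernel ?E X F"
    then have e: "e \<in> carrier ?E" "F e = \<zero>\<^bsub>X\<^esub>" by (simp_all only: a_kernel_iff simp_thms)
    show "e \<in> ideal_mult J ?E (carrier ?E)"
    proof (rule F.ext_sum_ideal_mult[OF e(1) jacobson_subset jacobson_l_mult])
      fix i
      have ei: "e i \<in> carrier (Q i)" by (rule mod_homD(1)[OF F.proj_hom e(1)])
      have "q i (e i) = \<zero>\<^bsub>C i\<^esub>" using Fpi[OF e(1)] e(2) mod_hom_zero[OF total summand proj] by metis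
      then have "e i \<in> a_kernel (Q i) (C i) (q i)" using ei by (simp add: a_kernel_iff)
      then show "e i \<in> ideal_mult J (Q i) (carrier (Q i))" using superfluous_subset_rad[OF Qm qsup] by blast
    qed
  qed
  obtain h where h: "h \<in> mod_hom R P ?E" "\<And>x. x \<in> carrier P \<Longrightarrow> F (h x) = f x"
    using projective_lift[OF P E total F(1) Fsurj f(1)] by blast
  have "\<exists>l\<in>mod_hom R (Q i) P. \<forall>p\<in>carrier (Q i). f (l p) = \<iota> i (q i p)" for i
    by (rule projective_lift[OF Q Pm total f iq]) (rule bexI, simp_all)
  then obtain l where l: "\<And>i. l i \<in> mod_hom R (Q i) P" "\<And>i p. p \<in> carrier (Q i) \<Longrightarrow> f (l i p) = \<iota> i (q i p)"
    by metis
  obtain g where g: "g \<in> mod_hom R ?E P" "\<And>i p. p \<in> carrier (Q i) \<Longrightarrow> g (single Q i p) = l i p"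
    using F.ext_sum_hom[OF Pm, of l, OF l(1)] by blast
  have fg: "f (g e) = F e" if "e \<in> carrier ?E" for e
    by (rule F.ext_sum_hom_eqI[OF total mod_hom_comp[OF g(1) f(1)] F(1) _ that]) (simp add: g(2) l(2) F(2))
  \<comment> \<open>\<open>g h\<close> covers the identity of \<open>X\<close>, and \<open>h\<close> is onto because the kernel of \<open>F\<close> is superfluous; so \<open>g\<close> is bijective.\<close>
  have gh: "bij_betw (\<lambda>x. g (h x)) (carrier P) (carrier P)"
  proof (rule cover_auto[OF covX total mod_hom_comp[OF h(1) g(1)]])
    fix x assume x: "x \<in> carrier P"
    show "f (g (h x)) = f x" using fg[OF mod_homD(1)[OF h(1) x]] h(2)[OF x] by simp
  qed
  have hsurj: "h ` carrier P = carrier ?E"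
  proof (rule superfluous_epi[OF Pm E total F(1) Fsup h(1)])
    fix e assume e: "e \<in> carrier ?E"
    have "F e \<in> f ` carrier P" using mod_homD(1)[OF F(1) e] f(2) by simp
    then obtain x where "F e = f x" "x \<in> carrier P" by (rule imageE)
    then show "\<exists>x\<in>carrier P. F (h x) = F e" using h(2) by metis
  qed
  have gbij: "bij_betw g (carrier ?E) (carrier P)"
    unfolding bij_betw_def
  proof
    show "inj_on g (carrier ?E)"
    proof (rule inj_onI)
      fix x y assume xy: "x \<in> carrier ?E" "y \<in> carrier ?E" "g x = g y"
      have "x \<in> h ` carrier P" using xy(1) hsurj by (simp only:)
      then obtain a where a: "x = h a" "a \<in> carrier P" by (rule imageE)
      have "y \<in> h ` carrier P" using xy(2) hsurj by (simp only:)
      then obtain b where b: "y = h b" "b \<in> carrier P" by (rule imageE)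
      have "inj_on (\<lambda>x. g (h x)) (carrier P)" using gh by (rule bij_betw_imp_inj_on)
      then have "a = b" by (rule inj_onD) (use a b xy(3) in simp_all)
      then show "x = y" using a b by simp
    qed
    have "(\<lambda>x. g (h x)) ` carrier P = carrier P" using gh by (rule bij_betw_imp_surj_on)
    then have "g ` (h ` carrier P) = carrier P" by (simp only: image_image)
    then show "g ` carrier ?E = carrier P" by (simp only: hsurj)
  qed
  note bP = biproduct_iso[OF F.ext_sum_biproduct Pm g(1) gbij]
  let ?\<kappa> = "\<lambda>i c. g (single Q i c)" and ?\<rho> = "\<lambda>i y. inv_into (carrier ?E) g y i"
  have "biproduct R (submod P (a_kernel P X f)) (\<lambda>i. submod (Q i) (a_kernel (Q i) (C i) (q i))) ?\<kappa> ?\<rho>"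
  proof (rule biproduct_kernel[OF bP b f(1) q(1)])
    show "f (g (single Q i p)) = \<iota> i (q i p)" if "p \<in> carrier (Q i)" for i p
      using fg[OF mod_homD(1)[OF F.single_hom that]] F(2)[OF that] by simp
    fix i x assume x: "x \<in> carrier P"
    let ?e = "inv_into (carrier ?E) g x"
    have e: "?e \<in> carrier ?E" "g ?e = x"
      using gbij x by (auto simp: bij_betw_def inv_into_into f_inv_into_f simp del: ext_sum_simps)
    show "q i (?e i) = \<pi> i (f x)" using Fpi[OF e(1), of i] fg[OF e(1)] e(2) by simp
  qed
  then show ?thesis unfolding sX s by blast
qed


section \<open>Tensor products and flatness\<close>

text \<open>The subgroups of formal sums; a set that is closed under differences and contains 0.\<close>

definition diff_closed :: "'a::ab_group_add set \<Rightarrow> bool" where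
  "diff_closed S \<longleftrightarrow> 0 \<in> S \<and> (\<forall>x\<in>S. \<forall>y\<in>S. x - y \<in> S)"

lemma diff_closedD:
  assumes "diff_closed S"
  shows "0 \<in> S" "x \<in> S \<Longrightarrow> y \<in> S \<Longrightarrow> x - y \<in> S" "x \<in> S \<Longrightarrow> - x \<in> S"
    "x \<in> S \<Longrightarrow> y \<in> S \<Longrightarrow> x + y \<in> S" "(\<And>i. i \<in> F \<Longrightarrow> h i \<in> S) \<Longrightarrow> sum h F \<in> S"
proof -
  show 0: "0 \<in> S" and d: "\<And>x y. x \<in> S \<Longrightarrow> y \<in> S \<Longrightarrow> x - y \<in> S" using assms by (auto simp: diff_closed_def)
  show m: "\<And>x. x \<in> S \<Longrightarrow> - x \<in> S" using d[OF 0] by simp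
  show a: "\<And>x y. x \<in> S \<Longrightarrow> y \<in> S \<Longrightarrow> x + y \<in> S" using d[OF _ m] by fastforce
  show "(\<And>i. i \<in> F \<Longrightarrow> h i \<in> S) \<Longrightarrow> sum h F \<in> S"
    by (induction F rule: infinite_finite_induct) (auto simp: 0 a)
qed

text \<open>The map \<open>f \<otimes> g\<close> on formal sums. The functions need not be homomorphisms: it is also applied to
  set-theoretic sections, to lift formal sums along epimorphisms.\<close>

definition tmap :: "('a \<Rightarrow> 'b) \<Rightarrow> ('m \<Rightarrow> 'n) \<Rightarrow> ('a \<times> 'm \<Rightarrow>\<^sub>0 int) \<Rightarrow> ('b \<times> 'n \<Rightarrow>\<^sub>0 int)" where
  "tmap f g = frag_extend (\<lambda>(a, m). frag_of (f a, g m))"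

definition tswap :: "('a \<times> 'm \<Rightarrow>\<^sub>0 int) \<Rightarrow> ('m \<times> 'a \<Rightarrow>\<^sub>0 int)" where
  "tswap = frag_extend (\<lambda>(a, m). frag_of (m, a))"

lemma tmap_simps [simp]: "tmap f g 0 = 0" "tmap f g (frag_of (a, m)) = frag_of (f a, g m)"
  "tmap f g (x - y) = tmap f g x - tmap f g y"
  by (simp_all add: tmap_def frag_extend_diff)

lemma tswap_simps [simp]: "tswap 0 = 0" "tswap (frag_of (a, m)) = frag_of (m, a)"
  "tswap (x - y) = tswap x - tswap y"
  by (simp_all add: tswap_def frag_extend_diff)

lemma tmap_comp: "tmap f g (tmap f' g' z) = tmap (\<lambda>a. f (f' a)) (\<lambda>m. g (g' m)) z"
  by (rule free_Abelian_group_induct[of z UNIV]) (auto)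

lemma tswap_tswap [simp]: "tswap (tswap z) = z"
  by (rule free_Abelian_group_induct[of z UNIV]) (auto)

lemma tswap_tmap: "tswap (tmap f g z) = tmap g f (tswap z)"
  by (rule free_Abelian_group_induct[of z UNIV]) (auto)

lemma tmap_cong:
  "Poly_Mapping.keys z \<subseteq> S \<times> U \<Longrightarrow> (\<And>a. a \<in> S \<Longrightarrow> f a = f' a) \<Longrightarrow> (\<And>m. m \<in> U \<Longrightarrow> g m = g' m) \<Longrightarrow>
    tmap f g z = tmap f' g' z"
  unfolding tmap_def by (rule frag_extend_eq) auto

lemma tmap_ident: "tmap (\<lambda>a. a) (\<lambda>m. m) z = z"
  by (rule free_Abelian_group_induct[of z UNIV]) (auto)

lemma tmap_id_on:
  "Poly_Mapping.keys z \<subseteq> S \<times> U \<Longrightarrow> (\<And>a. a \<in> S \<Longrightarrow> f a = a) \<Longrightarrow> (\<And>m. m \<in> U \<Longrightarrow> g m = m) \<Longrightarrow> tmap f g z = z"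
  using tmap_cong[of z S U f "\<lambda>a. a" g "\<lambda>m. m"] by (simp add: tmap_ident)

lemma keys_tmap:
  assumes "Poly_Mapping.keys z \<subseteq> S \<times> U" "\<And>a. a \<in> S \<Longrightarrow> f a \<in> S'" "\<And>m. m \<in> U \<Longrightarrow> g m \<in> U'"
  shows "Poly_Mapping.keys (tmap f g z) \<subseteq> S' \<times> U'"
  using assms keys_frag_extend[of "\<lambda>(a, m). frag_of (f a, g m)" z] unfolding tmap_def
  by (fastforce simp: keys_frag_of)

lemma keys_tswap: "Poly_Mapping.keys z \<subseteq> S \<times> U \<Longrightarrow> Poly_Mapping.keys (tswap z) \<subseteq> U \<times> S"
  using keys_frag_extend[of "\<lambda>(a, m). frag_of (m, a)" z] unfolding tswap_def
  by (fastforce simp: keys_frag_of)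

lemma keys_diffI: "Poly_Mapping.keys x \<subseteq> S \<Longrightarrow> Poly_Mapping.keys y \<subseteq> S \<Longrightarrow> Poly_Mapping.keys (x - y) \<subseteq> S"
  using keys_diff[of x y] by blast

lemma diff_closed_tmap: "diff_closed H \<Longrightarrow> diff_closed {y. tmap f g y \<in> H}"
  by (auto simp: diff_closed_def)

lemma diff_closed_keys: "diff_closed {z. Poly_Mapping.keys z \<subseteq> S}"
  by (auto simp: diff_closed_def dest: subsetD[OF keys_diff])

lemma tensor_rels_intros:
  "a \<in> carrier A \<Longrightarrow> a' \<in> carrier A \<Longrightarrow> m \<in> carrier M \<Longrightarrow>
     frag_of (a \<oplus>\<^bsub>A\<^esub> a', m) - frag_of (a, m) - frag_of (a', m) \<in> tensor_rels R A M"
  "a \<in> carrier A \<Longrightarrow> m \<in> carrier M \<Longrightarrow> m' \<in> carrier M \<Longrightarrow>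
     frag_of (a, m \<oplus>\<^bsub>M\<^esub> m') - frag_of (a, m) - frag_of (a, m') \<in> tensor_rels R A M"
  "r \<in> carrier R \<Longrightarrow> a \<in> carrier A \<Longrightarrow> m \<in> carrier M \<Longrightarrow>
     frag_of (r \<odot>\<^bsub>A\<^esub> a, m) - frag_of (a, r \<odot>\<^bsub>M\<^esub> m) \<in> tensor_rels R A M"
  unfolding tensor_rels_def
  by (rule UnI1, rule UnI1, intro CollectI exI conjI, rule refl, assumption+)
     (rule UnI1, rule UnI2, intro CollectI exI conjI, rule refl, assumption+,
      rule UnI2, intro CollectI exI conjI, rule refl, assumption+)

lemma tensor_rels_cases:
  assumes "z \<in> tensor_rels R A M"
  obtains a a' m where "a \<in> carrier A" "a' \<in> carrier A" "m \<in> carrier M"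
      "z = frag_of (a \<oplus>\<^bsub>A\<^esub> a', m) - frag_of (a, m) - frag_of (a', m)"
    | a m m' where "a \<in> carrier A" "m \<in> carrier M" "m' \<in> carrier M"
      "z = frag_of (a, m \<oplus>\<^bsub>M\<^esub> m') - frag_of (a, m) - frag_of (a, m')"
    | r a m where "r \<in> carrier R" "a \<in> carrier A" "m \<in> carrier M"
      "z = frag_of (r \<odot>\<^bsub>A\<^esub> a, m) - frag_of (a, r \<odot>\<^bsub>M\<^esub> m)"
  using assms unfolding tensor_rels_def by (elim UnE CollectE exE conjE) metis+

locale tensor_pair =
  fixes R :: "'r ring" and A :: "('r, 'a) module" and M :: "('r, 'm) module"
  assumes A: "left_module (opp_ring R) A" and M: "left_module R M"
begin

sublocale A: left_module "opp_ring R" A by (rule A)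
sublocale M: left_module R M by (rule M)

abbreviation null where "null \<equiv> tensor_null R A M"

lemma rels_keys: "tensor_rels R A M \<subseteq> {z. Poly_Mapping.keys z \<subseteq> carrier A \<times> carrier M}"
proof
  have k: "Poly_Mapping.keys (frag_of (a, m)) \<subseteq> carrier A \<times> carrier M" if "a \<in> carrier A" "m \<in> carrier M" for a m
    using that by (simp add: keys_frag_of)
  fix z assume "z \<in> tensor_rels R A M"
  then show "z \<in> {z. Poly_Mapping.keys z \<subseteq> carrier A \<times> carrier M}"
    by (cases rule: tensor_rels_cases) (simp_all add: keys_diffI k A.smult_closed M.smult_closed)
qed

lemma null_subgroup: "subgroup null (free_Abelian_group (carrier A \<times> carrier M))"
  unfolding tensor_null_def
  by (rule group.generate_is_subgroup[OF group_free_Abelian_group]) (use rels_keys in auto)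

lemma null_keys: "z \<in> null \<Longrightarrow> Poly_Mapping.keys z \<subseteq> carrier A \<times> carrier M"
  using subgroup.mem_carrier[OF null_subgroup] by simp

lemma null_diff_closed: "diff_closed null"
  unfolding diff_closed_def
proof (intro conjI ballI)
  show "0 \<in> null" using subgroup.one_closed[OF null_subgroup] by simp
  fix x y assume xy: "x \<in> null" "y \<in> null"
  have "x \<otimes>\<^bsub>free_Abelian_group (carrier A \<times> carrier M)\<^esub> (inv\<^bsub>free_Abelian_group (carrier A \<times> carrier M)\<^esub> y) \<in> null"
    by (rule subgroup.m_closed[OF null_subgroup xy(1) subgroup.m_inv_closed[OF null_subgroup xy(2)]])
  then show "x - y \<in> null" using null_keys[OF xy(2)] by simp
qed

lemmas nullD = diff_closedD[OF null_diff_closed]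

text \<open>The principle by which membership of a null element in a subgroup is proved: only the defining
  relations have to be checked.\<close>

lemma null_least:
  assumes S: "diff_closed S" and "tensor_rels R A M \<subseteq> S"
  shows "null \<subseteq> S"
proof
  fix z assume "z \<in> null"
  then show "z \<in> S"
    unfolding tensor_null_def
  proof induction
    case one then show ?case using diff_closedD(1)[OF S] by simp
  next
    case (incl h) then show ?case using assms(2) by blast
  next
    case (inv h)
    then have "Poly_Mapping.keys h \<subseteq> carrier A \<times> carrier M" using rels_keys by blast
    then show ?case using diff_closedD(3)[OF S] inv assms(2) by auto
  next
    case (eng x y) then show ?case using diff_closedD(4)[OF S] by simp
  qed
qed

lemma null_rels:
  "a \<in> carrier A \<Longrightarrow> a' \<in> carrier A \<Longrightarrow> m \<in> carrier M \<Longrightarrow>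
     frag_of (a \<oplus>\<^bsub>A\<^esub> a', m) - frag_of (a, m) - frag_of (a', m) \<in> null"
  "a \<in> carrier A \<Longrightarrow> m \<in> carrier M \<Longrightarrow> m' \<in> carrier M \<Longrightarrow>
     frag_of (a, m \<oplus>\<^bsub>M\<^esub> m') - frag_of (a, m) - frag_of (a, m') \<in> null"
  "r \<in> carrier R \<Longrightarrow> a \<in> carrier A \<Longrightarrow> m \<in> carrier M \<Longrightarrow>
     frag_of (r \<odot>\<^bsub>A\<^esub> a, m) - frag_of (a, r \<odot>\<^bsub>M\<^esub> m) \<in> null"
  unfolding tensor_null_def by (rule generate.incl, rule tensor_rels_intros, assumption+)+

lemma null_zero:
  "m \<in> carrier M \<Longrightarrow> frag_of (\<zero>\<^bsub>A\<^esub>, m) \<in> null" "a \<in> carrier A \<Longrightarrow> frag_of (a, \<zero>\<^bsub>M\<^esub>) \<in> null"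
proof -
  show "m \<in> carrier M \<Longrightarrow> frag_of (\<zero>\<^bsub>A\<^esub>, m) \<in> null"
    using null_rels(1)[of "\<zero>\<^bsub>A\<^esub>" "\<zero>\<^bsub>A\<^esub>" m] nullD(3) by fastforce
  show "a \<in> carrier A \<Longrightarrow> frag_of (a, \<zero>\<^bsub>M\<^esub>) \<in> null"
    using null_rels(2)[of a "\<zero>\<^bsub>M\<^esub>" "\<zero>\<^bsub>M\<^esub>"] nullD(3) by fastforce
qed

lemma null_trans: "x - y \<in> null \<Longrightarrow> y - z \<in> null \<Longrightarrow> x - z \<in> null"
  using nullD(4)[of "x - y" "y - z"] by simp

lemma null_sym: "x - y \<in> null \<Longrightarrow> y - x \<in> null"
  using nullD(3)[of "x - y"] by simp

lemma tmap_null: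
  assumes B: "left_module (opp_ring R) B" and N: "left_module R N"
    and f: "f \<in> mod_hom (opp_ring R) A B" and g: "g \<in> mod_hom R M N" and z: "z \<in> null"
  shows "tmap f g z \<in> tensor_null R B N"
proof -
  interpret BN: tensor_pair R B N by (rule tensor_pair.intro[OF B N])
  have "diff_closed {z. tmap f g z \<in> BN.null}"
    by (auto simp: diff_closed_def BN.nullD(1) intro: BN.nullD(2))
  moreover have "tensor_rels R A M \<subseteq> {z. tmap f g z \<in> BN.null}"
  proof
    fix z assume "z \<in> tensor_rels R A M"
    then show "z \<in> {z. tmap f g z \<in> BN.null}"
      by (cases rule: tensor_rels_cases) (simp_all add: mod_homD[OF f] mod_homD[OF g] BN.null_rels)
  qed
  ultimately show ?thesis using null_least z by blast
qed

lemma tswap_null: "z \<in> null \<Longrightarrow> tswap z \<in> tensor_null (opp_ring R) M A"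
proof -
  assume z: "z \<in> null"
  interpret S: tensor_pair "opp_ring R" M A by (rule tensor_pair.intro) (simp_all add: A M)
  have "diff_closed {z. tswap z \<in> S.null}"
    by (auto simp: diff_closed_def S.nullD(1) intro: S.nullD(2))
  moreover have "tensor_rels R A M \<subseteq> {z. tswap z \<in> S.null}"
  proof
    fix z assume "z \<in> tensor_rels R A M"
    then show "z \<in> {z. tswap z \<in> S.null}"
      by (cases rule: tensor_rels_cases) (simp_all add: S.null_rels S.null_sym[OF S.null_rels(3)])
  qed
  ultimately show ?thesis using null_least z by blast
qed

end

lemma opp_pair: "tensor_pair R A M \<Longrightarrow> tensor_pair (opp_ring R) M A"
  by (simp add: tensor_pair_def)

lemma tswap_null_iff:
  assumes "tensor_pair R A M"
  shows "tswap z \<in> tensor_null (opp_ring R) M A \<longleftrightarrow> z \<in> tensor_null R A M"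
  using tensor_pair.tswap_null[OF assms, of z] tensor_pair.tswap_null[OF opp_pair[OF assms], of "tswap z"] by auto

text \<open>The isomorphism from \<open>A \<otimes> R\<close> to \<open>A\<close> on formal sums, for a right module \<open>A\<close>. It detects nonzero tensors: a
  formal sum that is null is mapped to zero.\<close>

lemma contraction:
  assumes R: "ring R" and A: "left_module (opp_ring R) A"
  obtains c where "\<And>z. Poly_Mapping.keys z \<subseteq> carrier A \<times> carrier R \<Longrightarrow> c z \<in> carrier A"
    "\<And>a r. a \<in> carrier A \<Longrightarrow> r \<in> carrier R \<Longrightarrow> c (frag_of (a, r)) = r \<odot>\<^bsub>A\<^esub> a"
    "\<And>x y. Poly_Mapping.keys x \<subseteq> carrier A \<times> carrier R \<Longrightarrow> Poly_Mapping.keys y \<subseteq> carrier A \<times> carrier R \<Longrightarrow>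
       c (x - y) = c x \<ominus>\<^bsub>A\<^esub> c y"
    "\<And>z. z \<in> tensor_null R A (regular_module R) \<Longrightarrow> c z = \<zero>\<^bsub>A\<^esub>"
proof -
  interpret tensor_pair R A "regular_module R" by (rule tensor_pair.intro[OF A regular_left_module[OF R]])
  let ?S = "carrier A \<times> carrier R"
  let ?G = "add_monoid A"
  have G: "comm_group ?G" by (rule A.M.a_comm_group)
  have "(\<lambda>(a, r). r \<odot>\<^bsub>A\<^esub> a) ` ?S \<subseteq> carrier ?G" by (auto intro: A.smult_closed)
  from comm_group.free_Abelian_group_universal[OF G this]
  obtain c where c: "c \<in> hom (free_Abelian_group ?S) ?G" "\<And>x. x \<in> ?S \<Longrightarrow> c (frag_of x) = (\<lambda>(a, r). r \<odot>\<^bsub>A\<^esub> a) x"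
    by blast
  have cl: "c z \<in> carrier A" if "Poly_Mapping.keys z \<subseteq> ?S" for z
    using hom_in_carrier[OF c(1), of z] that by simp
  have add: "c (x + y) = c x \<oplus>\<^bsub>A\<^esub> c y" if "Poly_Mapping.keys x \<subseteq> ?S" "Poly_Mapping.keys y \<subseteq> ?S" for x y
    using hom_mult[OF c(1), of x y] that by simp
  have diff: "c (x - y) = c x \<ominus>\<^bsub>A\<^esub> c y" if xy: "Poly_Mapping.keys x \<subseteq> ?S" "Poly_Mapping.keys y \<subseteq> ?S" for x y
  proof -
    have k: "Poly_Mapping.keys (x - y) \<subseteq> ?S" by (rule keys_diffI[OF xy])
    have "c x = c (x - y) \<oplus>\<^bsub>A\<^esub> c y" using add[OF k xy(2)] by simp
    then show ?thesis using cl[OF k] cl[OF xy(2)] by (simp add: a_minus_def A.M.a_assoc A.M.r_neg)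
  qed
  have gen: "c (frag_of (a, r)) = r \<odot>\<^bsub>A\<^esub> a" if "a \<in> carrier A" "r \<in> carrier R" for a r
    using c(2)[of "(a, r)"] that by simp
  have c0: "c 0 = \<zero>\<^bsub>A\<^esub>" using diff[of 0 0] cl[of 0] by (simp add: a_minus_def A.M.r_neg)
  let ?N = "{z. Poly_Mapping.keys z \<subseteq> ?S \<and> c z = \<zero>\<^bsub>A\<^esub>}"
  have "diff_closed ?N"
    unfolding diff_closed_def
  proof (intro conjI ballI)
    show "0 \<in> ?N" using c0 by simp
    fix x y assume "x \<in> ?N" "y \<in> ?N"
    then show "x - y \<in> ?N" using diff[of x y] keys_diffI[of x ?S y] by (simp add: a_minus_def)
  qed
  moreover have "tensor_rels R A (regular_module R) \<subseteq> ?N"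
  proof
    fix z assume z: "z \<in> tensor_rels R A (regular_module R)"
    then have k: "Poly_Mapping.keys z \<subseteq> ?S" using rels_keys by auto
    have kf: "Poly_Mapping.keys (frag_of (a, r)) \<subseteq> ?S" if "a \<in> carrier A" "r \<in> carrier R" for a r
      using that by (simp add: keys_frag_of)
    have "c z = \<zero>\<^bsub>A\<^esub>"
    proof -
      from z show ?thesis
      proof (cases rule: tensor_rels_cases)
        case (1 a a' m)
        then have "c z = m \<odot>\<^bsub>A\<^esub> (a \<oplus>\<^bsub>A\<^esub> a') \<ominus>\<^bsub>A\<^esub> m \<odot>\<^bsub>A\<^esub> a \<ominus>\<^bsub>A\<^esub> m \<odot>\<^bsub>A\<^esub> a'"
          by (simp add: diff keys_diffI kf gen)
        also have "\<dots> = m \<odot>\<^bsub>A\<^esub> a \<oplus>\<^bsub>A\<^esub> (\<ominus>\<^bsub>A\<^esub> (m \<odot>\<^bsub>A\<^esub> a) \<oplus>\<^bsub>A\<^esub> (m \<odot>\<^bsub>A\<^esub> a' \<oplus>\<^bsub>A\<^esub> \<ominus>\<^bsub>A\<^esub> (m \<odot>\<^bsub>A\<^esub> a')))"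
          using 1 by (simp add: A.smult_r_distr a_minus_def A.smult_closed A.M.a_ac)
        finally show ?thesis using 1 by (simp add: A.M.r_neg A.smult_closed)
      next
        case (2 a m m')
        then have "c z = (m \<oplus>\<^bsub>R\<^esub> m') \<odot>\<^bsub>A\<^esub> a \<ominus>\<^bsub>A\<^esub> m \<odot>\<^bsub>A\<^esub> a \<ominus>\<^bsub>A\<^esub> m' \<odot>\<^bsub>A\<^esub> a"
          using ring.ring_simprules(1)[OF R] by (simp add: diff keys_diffI kf gen)
        also have "\<dots> = m \<odot>\<^bsub>A\<^esub> a \<oplus>\<^bsub>A\<^esub> (\<ominus>\<^bsub>A\<^esub> (m \<odot>\<^bsub>A\<^esub> a) \<oplus>\<^bsub>A\<^esub> (m' \<odot>\<^bsub>A\<^esub> a \<oplus>\<^bsub>A\<^esub> \<ominus>\<^bsub>A\<^esub> (m' \<odot>\<^bsub>A\<^esub> a)))"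
          using 2 A.smult_l_distr[of m m' a] by (simp add: a_minus_def A.smult_closed A.M.a_ac)
        finally show ?thesis using 2 by (simp add: A.M.r_neg A.smult_closed)
      next
        case (3 r a m)
        then have "c z = m \<odot>\<^bsub>A\<^esub> (r \<odot>\<^bsub>A\<^esub> a) \<ominus>\<^bsub>A\<^esub> (r \<otimes>\<^bsub>R\<^esub> m) \<odot>\<^bsub>A\<^esub> a"
          using ring.ring_simprules(5)[OF R] by (simp add: diff keys_diffI kf gen A.smult_closed)
        then show ?thesis using 3 A.smult_assoc[of m r a] by (simp add: a_minus_def A.M.r_neg A.smult_closed)
      qed
    qed
    then show "z \<in> ?N" using k by blast
  qed
  ultimately have "null \<subseteq> ?N" by (rule null_least)
  then show thesis using that[OF cl gen diff] by blast
qed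

subsection \<open>Right exactness\<close>

text \<open>A section \<open>s\<close> of \<open>g\<close> turns the relations of \<open>A \<otimes> M\<close> into relations of \<open>A \<otimes> Q\<close>, up to formal sums over
  \<open>A \<times> ker g\<close>, since \<open>s\<close> is a homomorphism up to elements of the kernel. Hence lifting a formal sum that
  is null in \<open>A \<otimes> M\<close> leaves only such a correction term.\<close>

lemma tensor_right_exact:
  assumes A: "left_module (opp_ring R) A" and Q: "left_module R Q" and M: "left_module R M"
    and g: "g \<in> mod_hom R Q M" "g ` carrier Q = carrier M"
    and z: "Poly_Mapping.keys z \<subseteq> carrier A \<times> carrier Q" and null: "tmap (\<lambda>a. a) g z \<in> tensor_null R A M"
  shows "\<exists>w. Poly_Mapping.keys w \<subseteq> carrier A \<times> a_kernel Q M g \<and> z - w \<in> tensor_null R A Q"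
proof -
  interpret AQ: tensor_pair R A Q by (rule tensor_pair.intro[OF A Q])
  interpret AM: tensor_pair R A M by (rule tensor_pair.intro[OF A M])
  let ?N = "a_kernel Q M g"
  have N: "submodule ?N R Q" by (rule submodule_kernel[OF Q M g(1)])
  note G = mod_homD[OF g(1)]
  have "\<forall>m\<in>carrier M. \<exists>q\<in>carrier Q. g q = m" using g(2) by (metis imageE)
  then obtain s where s: "\<And>m. m \<in> carrier M \<Longrightarrow> s m \<in> carrier Q" "\<And>m. m \<in> carrier M \<Longrightarrow> g (s m) = m" by metis
  \<comment> \<open>The formal sums that represent elements of the image of \<open>A \<otimes> ker g\<close>.\<close>
  let ?H = "{z. \<exists>w. Poly_Mapping.keys w \<subseteq> carrier A \<times> ?N \<and> z - w \<in> AQ.null}"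
  have H: "diff_closed ?H"
    unfolding diff_closed_def
  proof (intro conjI ballI)
    show "0 \<in> ?H" using AQ.nullD(1) by (intro CollectI exI[of _ 0]) simp
    fix x y assume "x \<in> ?H" "y \<in> ?H"
    then obtain v w where vw: "Poly_Mapping.keys v \<subseteq> carrier A \<times> ?N" "x - v \<in> AQ.null"
      "Poly_Mapping.keys w \<subseteq> carrier A \<times> ?N" "y - w \<in> AQ.null" by blast
    have "(x - y) - (v - w) \<in> AQ.null" using AQ.nullD(2)[OF vw(2,4)] by (simp add: algebra_simps)
    then show "x - y \<in> ?H" using keys_diffI[OF vw(1,3)] by blast
  qed
  note HD = diff_closedD[OF H]
  have nullH: "z \<in> ?H" if "z \<in> AQ.null" for z using that by (intro CollectI exI[of _ 0]) simp
  have kerH: "frag_of (a, k) \<in> ?H" if "a \<in> carrier A" "k \<in> ?N" for a k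
    using that AQ.nullD(1) by (intro CollectI exI[of _ "frag_of (a, k)"]) (simp add: keys_frag_of)
  have congH: "frag_of (a, x) - frag_of (a, y) \<in> ?H" if a: "a \<in> carrier A" and xy: "x \<in> carrier Q" "y \<in> carrier Q" "g x = g y" for a x y
  proof -
    have "g (x \<ominus>\<^bsub>Q\<^esub> y) = \<zero>\<^bsub>M\<^esub>"
      using mod_hom_minus[OF Q M g(1) xy(1,2)] xy(3) G(1)[OF xy(2)] by (simp add: a_minus_def AM.M.M.r_neg)
    then have k: "x \<ominus>\<^bsub>Q\<^esub> y \<in> ?N" using xy by (simp add: a_kernel_iff)
    have "frag_of (a, y \<oplus>\<^bsub>Q\<^esub> (x \<ominus>\<^bsub>Q\<^esub> y)) - frag_of (a, y) - frag_of (a, x \<ominus>\<^bsub>Q\<^esub> y) \<in> ?H"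
      by (rule nullH, rule AQ.null_rels(2)) (use a xy in auto)
    then have "frag_of (a, x) - frag_of (a, y) - frag_of (a, x \<ominus>\<^bsub>Q\<^esub> y) \<in> ?H"
      by (simp only: AQ.M.add_diff_cancel[OF xy(1,2)])
    from HD(4)[OF this kerH[OF a k]] show ?thesis by (simp only: diff_add_cancel)
  qed
  have "diff_closed {y. tmap (\<lambda>a. a) s y \<in> ?H}"
    by (rule diff_closed_tmap[OF H])
  moreover have "tensor_rels R A M \<subseteq> {y. tmap (\<lambda>a. a) s y \<in> ?H}"
  proof
    fix y assume "y \<in> tensor_rels R A M"
    then have "tmap (\<lambda>a. a) s y \<in> ?H"
    proof (cases rule: tensor_rels_cases)
      case (1 a a' m)
      have "frag_of (a \<oplus>\<^bsub>A\<^esub> a', s m) - frag_of (a, s m) - frag_of (a', s m) \<in> ?H"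
        by (rule nullH, rule AQ.null_rels(1)) (use 1 s in auto)
      then show ?thesis using 1 by (simp only: tmap_simps)
    next
      case (2 a m m')
      have "frag_of (a, s (m \<oplus>\<^bsub>M\<^esub> m')) - frag_of (a, s m \<oplus>\<^bsub>Q\<^esub> s m') \<in> ?H"
        by (rule congH) (use 2 s G in auto)
      moreover have "frag_of (a, s m \<oplus>\<^bsub>Q\<^esub> s m') - frag_of (a, s m) - frag_of (a, s m') \<in> ?H"
        by (rule nullH, rule AQ.null_rels(2)) (use 2 s in auto)
      ultimately have "(frag_of (a, s (m \<oplus>\<^bsub>M\<^esub> m')) - frag_of (a, s m \<oplus>\<^bsub>Q\<^esub> s m')) +
          (frag_of (a, s m \<oplus>\<^bsub>Q\<^esub> s m') - frag_of (a, s m) - frag_of (a, s m')) \<in> ?H" by (rule HD(4))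
      moreover have "(frag_of (a, s (m \<oplus>\<^bsub>M\<^esub> m')) - frag_of (a, s m \<oplus>\<^bsub>Q\<^esub> s m')) +
          (frag_of (a, s m \<oplus>\<^bsub>Q\<^esub> s m') - frag_of (a, s m) - frag_of (a, s m')) = tmap (\<lambda>a. a) s y"
        using 2 by simp
      ultimately show ?thesis by (simp only:)
    next
      case (3 r a m)
      have "frag_of (a, r \<odot>\<^bsub>Q\<^esub> s m) - frag_of (a, s (r \<odot>\<^bsub>M\<^esub> m)) \<in> ?H"
        by (rule congH) (use 3 s G AQ.M.smult_closed AM.M.smult_closed in auto)
      moreover have "frag_of (r \<odot>\<^bsub>A\<^esub> a, s m) - frag_of (a, r \<odot>\<^bsub>Q\<^esub> s m) \<in> ?H"
        by (rule nullH, rule AQ.null_rels(3)) (use 3 s in auto)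
      ultimately have "(frag_of (a, r \<odot>\<^bsub>Q\<^esub> s m) - frag_of (a, s (r \<odot>\<^bsub>M\<^esub> m))) +
         (frag_of (r \<odot>\<^bsub>A\<^esub> a, s m) - frag_of (a, r \<odot>\<^bsub>Q\<^esub> s m)) \<in> ?H" by (rule HD(4))
      moreover have "(frag_of (a, r \<odot>\<^bsub>Q\<^esub> s m) - frag_of (a, s (r \<odot>\<^bsub>M\<^esub> m))) +
         (frag_of (r \<odot>\<^bsub>A\<^esub> a, s m) - frag_of (a, r \<odot>\<^bsub>Q\<^esub> s m)) = tmap (\<lambda>a. a) s y"
        using 3 by simp
      ultimately show ?thesis by (simp only:)
    qed
    then show "y \<in> {y. tmap (\<lambda>a. a) s y \<in> ?H}" by (rule CollectI)
  qed
  ultimately have "AM.null \<subseteq> {y. tmap (\<lambda>a. a) s y \<in> ?H}" by (rule AM.null_least)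
  then have 1: "tmap (\<lambda>a. a) s (tmap (\<lambda>a. a) g z) \<in> ?H" using null by (rule subsetD[THEN CollectD])
  have 2: "tmap (\<lambda>a. a) s (tmap (\<lambda>a. a) g z) - z \<in> ?H"
  proof (rule free_Abelian_group_induct[OF z])
    show "tmap (\<lambda>a. a) s (tmap (\<lambda>a. a) g 0) - 0 \<in> ?H" using HD(1) by (simp only: tmap_simps diff_self)
    fix x y assume *: "tmap (\<lambda>a. a) s (tmap (\<lambda>a. a) g x) - x \<in> ?H" "tmap (\<lambda>a. a) s (tmap (\<lambda>a. a) g y) - y \<in> ?H"
    have "tmap (\<lambda>a. a) s (tmap (\<lambda>a. a) g (x - y)) - (x - y) =
        (tmap (\<lambda>a. a) s (tmap (\<lambda>a. a) g x) - x) - (tmap (\<lambda>a. a) s (tmap (\<lambda>a. a) g y) - y)" by simp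
    then show "tmap (\<lambda>a. a) s (tmap (\<lambda>a. a) g (x - y)) - (x - y) \<in> ?H" using HD(2)[OF *] by (simp only:)
  next
    fix aq assume "aq \<in> carrier A \<times> carrier Q"
    then obtain a q where aq: "aq = (a, q)" "a \<in> carrier A" "q \<in> carrier Q" by blast
    have "frag_of (a, s (g q)) - frag_of (a, q) \<in> ?H" by (rule congH) (use aq s G in auto)
    then show "tmap (\<lambda>a. a) s (tmap (\<lambda>a. a) g (frag_of aq)) - frag_of aq \<in> ?H" using aq(1) by (simp only: tmap_simps)
  qed
  have "z = tmap (\<lambda>a. a) s (tmap (\<lambda>a. a) g z) - (tmap (\<lambda>a. a) s (tmap (\<lambda>a. a) g z) - z)" by simp
  then have "z \<in> ?H" using HD(2)[OF 1 2] by (simp only:)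
  then show ?thesis by (rule CollectD)
qed

text \<open>Interchanging the two factors reduces this to the preceding case.\<close>

lemma tensor_right_exact':
  assumes M: "left_module R M" and P: "left_module (opp_ring R) P" and A: "left_module (opp_ring R) A"
    and f: "f \<in> mod_hom (opp_ring R) P A" "f ` carrier P = carrier A"
    and z: "Poly_Mapping.keys z \<subseteq> carrier P \<times> carrier M" and null: "tmap f (\<lambda>m. m) z \<in> tensor_null R A M"
  shows "\<exists>w. Poly_Mapping.keys w \<subseteq> a_kernel P A f \<times> carrier M \<and> z - w \<in> tensor_null R P M"
proof -
  have "tmap (\<lambda>m. m) f (tswap z) \<in> tensor_null (opp_ring R) M A"
    using tensor_pair.tswap_null[OF tensor_pair.intro[OF A M] null] by (simp add: tswap_tmap)
  then obtain w where w: "Poly_Mapping.keys w \<subseteq> carrier M \<times> a_kernel P A f" "tswap z - w \<in> tensor_null (opp_ring R) M P"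
    using tensor_right_exact[of "opp_ring R" M P A f "tswap z"] keys_tswap[OF z] M P A f by auto
  have "tswap (tswap z - w) \<in> tensor_null R P M"
    using tensor_pair.tswap_null[of "opp_ring R" M P, OF _ w(2)] M P by (simp add: tensor_pair_def)
  then show ?thesis using keys_tswap[OF w(1)] by (intro exI[of _ "tswap w"]) simp
qed

subsection \<open>Injectivity of the map induced by an inclusion\<close>

text \<open>The map from \<open>K \<otimes> M\<close> to \<open>P \<otimes> M\<close> is injective. Elements of both groups are represented by the same
  formal sums, so injectivity compares two null relations on formal sums over \<open>K \<times> M\<close>.\<close>

definition tens_inj :: "'r ring \<Rightarrow> ('r, 'p) module \<Rightarrow> 'p set \<Rightarrow> ('r, 'm) module \<Rightarrow> bool" where
  "tens_inj R P K M \<longleftrightarrow> (\<forall>z. Poly_Mapping.keys z \<subseteq> K \<times> carrier M \<longrightarrow> z \<in> tensor_null R P M \<longrightarrow>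
     z \<in> tensor_null R (submod P K) M)"

lemma tens_injD:
  "tens_inj R P K M \<Longrightarrow> Poly_Mapping.keys z \<subseteq> K \<times> carrier M \<Longrightarrow> z \<in> tensor_null R P M \<Longrightarrow>
     z \<in> tensor_null R (submod P K) M"
  by (simp add: tens_inj_def)

lemma tensor_null_incl:
  assumes P: "left_module (opp_ring R) P" and M: "left_module R M" and K: "submodule K (opp_ring R) P"
    and z: "z \<in> tensor_null R (submod P K) M"
  shows "z \<in> tensor_null R P M"
proof -
  have Km: "left_module (opp_ring R) (submod P K)" by (rule left_module.left_module_submod[OF P K])
  have "tmap (\<lambda>a. a) (\<lambda>m. m) z \<in> tensor_null R P M"
    by (rule tensor_pair.tmap_null[OF tensor_pair.intro[OF Km M] P M mod_hom_incl[OF submoduleD(2)[OF K]] mod_hom_id z])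
  then show ?thesis by (simp add: tmap_ident)
qed

lemma tensor_null_incl':
  assumes A: "left_module (opp_ring R) A" and Q: "left_module R Q" and N: "submodule N R Q"
    and z: "z \<in> tensor_null R A (submod Q N)"
  shows "z \<in> tensor_null R A Q"
proof -
  have Nm: "left_module R (submod Q N)" by (rule left_module.left_module_submod[OF Q N])
  have "tmap (\<lambda>a. a) (\<lambda>m. m) z \<in> tensor_null R A Q"
    by (rule tensor_pair.tmap_null[OF tensor_pair.intro[OF A Nm] A Q mod_hom_id mod_hom_incl[OF submoduleD(2)[OF N]] z])
  then show ?thesis by (simp add: tmap_ident)
qed

lemma tens_inj_retract:
  assumes P: "left_module (opp_ring R) P" and K: "submodule K (opp_ring R) P"
    and X: "left_module R X" and M: "left_module R M" and ret: "retract R M X" and inj: "tens_inj R P K X"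
  shows "tens_inj R P K M"
  unfolding tens_inj_def
proof (intro allI impI)
  have Km: "left_module (opp_ring R) (submod P K)" by (rule left_module.left_module_submod[OF P K])
  obtain i p where i: "i \<in> mod_hom R M X" and p: "p \<in> mod_hom R X M" and pi: "\<And>x. x \<in> carrier M \<Longrightarrow> p (i x) = x"
    using ret unfolding retract_def by blast
  fix z assume z: "Poly_Mapping.keys z \<subseteq> K \<times> carrier M" "z \<in> tensor_null R P M"
  have "tmap (\<lambda>a. a) i z \<in> tensor_null R P X"
    by (rule tensor_pair.tmap_null[OF tensor_pair.intro[OF P M] P X mod_hom_id i z(2)])
  then have "tmap (\<lambda>a. a) i z \<in> tensor_null R (submod P K) X"
    by (rule tens_injD[OF inj keys_tmap[OF z(1)], rotated 2]) (simp_all add: mod_homD(1)[OF i])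
  then have "tmap (\<lambda>a. a) p (tmap (\<lambda>a. a) i z) \<in> tensor_null R (submod P K) M"
    by (rule tensor_pair.tmap_null[OF tensor_pair.intro[OF Km X] Km M mod_hom_id p])
  then show "z \<in> tensor_null R (submod P K) M"
    unfolding tmap_comp using tmap_id_on[OF z(1), of "\<lambda>a. a" "\<lambda>m. p (i m)"] pi by simp
qed

text \<open>In \<open>A \<otimes> X\<close> a formal sum is congruent to the sum of its components. The elements \<open>x\<close> for which the tensors
  \<open>a \<otimes> x\<close> have this property for all large finite index sets, uniformly in \<open>a\<close>, form a submodule that contains the components of every element.
  Allowing all larger index sets makes the condition additive, and uniformity in \<open>a\<close> makes it
  stable under scalars, which move to the other tensor factor.\<close>

lemma biproduct_tensor_decomp:
  assumes b: "biproduct R X C \<iota> \<pi>" and A: "left_module (opp_ring R) A"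
    and z: "Poly_Mapping.keys z \<subseteq> carrier A \<times> carrier X"
  shows "\<exists>F. finite F \<and> z - (\<Sum>i\<in>F. tmap (\<lambda>a. a) (\<lambda>x. \<iota> i (\<pi> i x)) z) \<in> tensor_null R A X"
proof -
  interpret biproduct R X C \<iota> \<pi> by fact
  interpret AX: tensor_pair R A X by (rule tensor_pair.intro[OF A total])
  let ?e = "\<lambda>i x. \<iota> i (\<pi> i x)"
  have e: "?e i \<in> mod_hom R X X" for i by (rule mod_hom_comp[OF proj inj])
  note E = mod_homD[OF e]
  have e0: "?e i \<zero>\<^bsub>X\<^esub> = \<zero>\<^bsub>X\<^esub>" for i by (rule mod_hom_zero[OF total total e])
  define good where "good x F \<longleftrightarrow> finite F \<and>
    (\<forall>G. finite G \<and> F \<subseteq> G \<longrightarrow> (\<forall>a\<in>carrier A. frag_of (a, x) - (\<Sum>i\<in>G. frag_of (a, ?e i x)) \<in> AX.null))" for x F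
  let ?S = "{x \<in> carrier X. \<exists>F. good x F}"
  have S: "submodule ?S R X"
  proof (rule AX.M.submoduleI)
    show "?S \<subseteq> carrier X" by blast
    have "good \<zero>\<^bsub>X\<^esub> {}"
      unfolding good_def e0 by (auto intro!: AX.nullD(2,5) AX.null_zero)
    then show "\<zero>\<^bsub>X\<^esub> \<in> ?S" by blast
  next
    fix x y assume "x \<in> ?S" "y \<in> ?S"
    then obtain F F' where xy: "x \<in> carrier X" "y \<in> carrier X" and F: "good x F" "good y F'" by blast
    have "good (x \<oplus>\<^bsub>X\<^esub> y) (F \<union> F')"
      unfolding good_def
    proof (intro conjI allI impI ballI)
      show "finite (F \<union> F')" using F by (simp add: good_def)
      fix G a assume G: "finite G \<and> F \<union> F' \<subseteq> G" and a: "a \<in> carrier A"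
      have 1: "frag_of (a, x) - (\<Sum>i\<in>G. frag_of (a, ?e i x)) \<in> AX.null" "frag_of (a, y) - (\<Sum>i\<in>G. frag_of (a, ?e i y)) \<in> AX.null"
        using F G a unfolding good_def by blast+
      have 2: "frag_of (a, x \<oplus>\<^bsub>X\<^esub> y) - frag_of (a, x) - frag_of (a, y) \<in> AX.null"
        by (rule AX.null_rels(2)[OF a xy])
      have 3: "(\<Sum>i\<in>G. frag_of (a, ?e i (x \<oplus>\<^bsub>X\<^esub> y)) - frag_of (a, ?e i x) - frag_of (a, ?e i y)) \<in> AX.null"
        by (rule AX.nullD(5)) (simp add: E xy AX.null_rels(2)[OF a])
      have "(frag_of (a, x \<oplus>\<^bsub>X\<^esub> y) - frag_of (a, x) - frag_of (a, y)) +
          ((frag_of (a, x) - (\<Sum>i\<in>G. frag_of (a, ?e i x))) + (frag_of (a, y) - (\<Sum>i\<in>G. frag_of (a, ?e i y)))) -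
          (\<Sum>i\<in>G. frag_of (a, ?e i (x \<oplus>\<^bsub>X\<^esub> y)) - frag_of (a, ?e i x) - frag_of (a, ?e i y)) \<in> AX.null"
        by (intro AX.nullD(2,4) 1 2 3)
      then show "frag_of (a, x \<oplus>\<^bsub>X\<^esub> y) - (\<Sum>i\<in>G. frag_of (a, ?e i (x \<oplus>\<^bsub>X\<^esub> y))) \<in> AX.null"
        by (simp add: sum_subtractf sum.distrib algebra_simps)
    qed
    then show "x \<oplus>\<^bsub>X\<^esub> y \<in> ?S" using xy by blast
  next
    fix r x assume r: "r \<in> carrier R" and "x \<in> ?S"
    then obtain F where x: "x \<in> carrier X" and F: "good x F" by blast
    have "good (r \<odot>\<^bsub>X\<^esub> x) F"
      unfolding good_def
    proof (intro conjI allI impI ballI)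
      show "finite F" using F by (simp add: good_def)
      fix G a assume G: "finite G \<and> F \<subseteq> G" and a: "a \<in> carrier A"
      have ra: "r \<odot>\<^bsub>A\<^esub> a \<in> carrier A" using AX.A.smult_closed r a by simp
      have 1: "frag_of (r \<odot>\<^bsub>A\<^esub> a, x) - (\<Sum>i\<in>G. frag_of (r \<odot>\<^bsub>A\<^esub> a, ?e i x)) \<in> AX.null"
        using F G ra unfolding good_def by blast
      have 2: "frag_of (r \<odot>\<^bsub>A\<^esub> a, x) - frag_of (a, r \<odot>\<^bsub>X\<^esub> x) \<in> AX.null" by (rule AX.null_rels(3)[OF r a x])
      have 3: "(\<Sum>i\<in>G. frag_of (r \<odot>\<^bsub>A\<^esub> a, ?e i x) - frag_of (a, ?e i (r \<odot>\<^bsub>X\<^esub> x))) \<in> AX.null"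
        by (rule AX.nullD(5)) (simp add: E x r a AX.null_rels(3))
      have "(frag_of (r \<odot>\<^bsub>A\<^esub> a, x) - (\<Sum>i\<in>G. frag_of (r \<odot>\<^bsub>A\<^esub> a, ?e i x))) -
          (frag_of (r \<odot>\<^bsub>A\<^esub> a, x) - frag_of (a, r \<odot>\<^bsub>X\<^esub> x)) +
          (\<Sum>i\<in>G. frag_of (r \<odot>\<^bsub>A\<^esub> a, ?e i x) - frag_of (a, ?e i (r \<odot>\<^bsub>X\<^esub> x))) \<in> AX.null"
        by (intro AX.nullD(2,4) 1 2 3)
      then show "frag_of (a, r \<odot>\<^bsub>X\<^esub> x) - (\<Sum>i\<in>G. frag_of (a, ?e i (r \<odot>\<^bsub>X\<^esub> x))) \<in> AX.null"
        by (simp add: sum_subtractf sum.distrib algebra_simps)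
    qed
    then show "r \<odot>\<^bsub>X\<^esub> x \<in> ?S" using AX.M.smult_closed r x by blast
  qed
  have "x \<in> ?S" if x: "x \<in> carrier X" for x
  proof (rule gen[OF x S])
    fix i
    have c: "\<pi> i x \<in> carrier (C i)" by (rule mod_homD(1)[OF proj x])
    have ee: "?e j (?e i x) = (if j = i then ?e i x else \<zero>\<^bsub>X\<^esub>)" for j
      using c proj_inj[OF c] proj_inj_neq[OF _ c, of j] mod_hom_zero[OF summand total inj] by auto
    have "good (?e i x) {i}"
      unfolding good_def
    proof (intro conjI allI impI ballI)
      fix G a assume G: "finite G \<and> {i} \<subseteq> G" and a: "a \<in> carrier A"
      have "(\<Sum>j\<in>G. frag_of (a, ?e j (?e i x))) = frag_of (a, ?e i x) + (\<Sum>j\<in>G - {i}. frag_of (a, ?e j (?e i x)))"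
        using G by (subst sum.remove[of G i]) (auto simp: ee)
      moreover have "(\<Sum>j\<in>G - {i}. frag_of (a, ?e j (?e i x))) \<in> AX.null"
        by (rule AX.nullD(5)) (simp add: ee AX.null_zero a)
      ultimately show "frag_of (a, ?e i x) - (\<Sum>j\<in>G. frag_of (a, ?e j (?e i x))) \<in> AX.null"
        using AX.nullD(3) by simp
    qed simp
    then show "?e i x \<in> ?S" using E(1)[OF x] by blast
  qed
  then have pt: "\<exists>F. good x F" if "x \<in> carrier X" for x using that by blast
  define fine where "fine z F \<longleftrightarrow> finite F \<and>
    (\<forall>G. finite G \<and> F \<subseteq> G \<longrightarrow> z - (\<Sum>i\<in>G. tmap (\<lambda>a. a) (?e i) z) \<in> AX.null)" for z F
  have fineD: "z - (\<Sum>i\<in>G. tmap (\<lambda>a. a) (?e i) z) \<in> AX.null" if "fine z F" "finite G" "F \<subseteq> G" for z F G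
    using that by (simp add: fine_def)
  have "\<exists>F. fine z F"
  proof (rule free_Abelian_group_induct[OF z])
    have "fine 0 {}" using AX.nullD(1) by (simp add: fine_def)
    then show "\<exists>F. fine 0 F" by (rule exI)
  next
    fix x y assume "\<exists>F. fine x F" and "\<exists>F. fine y F"
    then obtain F F' where F: "fine x F" "fine y F'" by (elim exE)
    have "fine (x - y) (F \<union> F')"
      unfolding fine_def
    proof (intro conjI allI impI)
      show "finite (F \<union> F')" using F by (simp add: fine_def)
      fix G assume G: "finite G \<and> F \<union> F' \<subseteq> G"
      have "(x - (\<Sum>i\<in>G. tmap (\<lambda>a. a) (?e i) x)) - (y - (\<Sum>i\<in>G. tmap (\<lambda>a. a) (?e i) y)) \<in> AX.null"
        by (rule AX.nullD(2); rule fineD[OF F(1)] fineD[OF F(2)]) (use G in auto)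
      then show "(x - y) - (\<Sum>i\<in>G. tmap (\<lambda>a. a) (?e i) (x - y)) \<in> AX.null"
        by (simp add: sum_subtractf algebra_simps)
    qed
    then show "\<exists>F. fine (x - y) F" by (rule exI)
  next
    fix ax assume "ax \<in> carrier A \<times> carrier X"
    then obtain a x where ax: "ax = (a, x)" "a \<in> carrier A" "x \<in> carrier X" by blast
    then obtain F where "good x F" using pt by blast
    then have "fine (frag_of ax) F" using ax unfolding good_def fine_def by simp
    then show "\<exists>F. fine (frag_of ax) F" by (rule exI)
  qed
  then obtain F where F: "fine z F" by (rule exE)
  then have "finite F" by (simp add: fine_def)
  then show ?thesis using fineD[OF F _ subset_refl] by blast
qed

text \<open>Injectivity can be checked on components, since every tensor is the sum of its components.\<close>

lemma tens_inj_biproduct: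
  assumes P: "left_module (opp_ring R) P" and K: "submodule K (opp_ring R) P"
    and b: "biproduct R X C \<iota> \<pi>" and inj: "\<And>i. tens_inj R P K (C i)"
  shows "tens_inj R P K X"
  unfolding tens_inj_def
proof (intro allI impI)
  interpret b: biproduct R X C \<iota> \<pi> by fact
  have Km: "left_module (opp_ring R) (submod P K)" by (rule left_module.left_module_submod[OF P K])
  interpret KX: tensor_pair R "submod P K" X by (rule tensor_pair.intro[OF Km b.total])
  fix z assume z: "Poly_Mapping.keys z \<subseteq> K \<times> carrier X" "z \<in> tensor_null R P X"
  have *: "tmap (\<lambda>a. a) (\<lambda>x. \<iota> i (\<pi> i x)) z \<in> KX.null" for i
  proof -
    have "tmap (\<lambda>a. a) (\<pi> i) z \<in> tensor_null R P (C i)"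
      by (rule tensor_pair.tmap_null[OF tensor_pair.intro[OF P b.total] P b.summand mod_hom_id b.proj z(2)])
    then have "tmap (\<lambda>a. a) (\<pi> i) z \<in> tensor_null R (submod P K) (C i)"
      by (rule tens_injD[OF inj keys_tmap[OF z(1)], rotated 2]) (simp_all add: mod_homD(1)[OF b.proj])
    then have "tmap (\<lambda>a. a) (\<iota> i) (tmap (\<lambda>a. a) (\<pi> i) z) \<in> KX.null"
      by (rule tensor_pair.tmap_null[OF tensor_pair.intro[OF Km b.summand] Km b.total mod_hom_id b.inj])
    then show ?thesis by (simp add: tmap_comp)
  qed
  obtain F where F: "finite F" "z - (\<Sum>i\<in>F. tmap (\<lambda>a. a) (\<lambda>x. \<iota> i (\<pi> i x)) z) \<in> KX.null"
    using biproduct_tensor_decomp[OF b Km, of z] z(1) by auto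
  have "(\<Sum>i\<in>F. tmap (\<lambda>a. a) (\<lambda>x. \<iota> i (\<pi> i x)) z) \<in> KX.null" by (rule KX.nullD(5)) (rule *)
  from KX.nullD(4)[OF F(2) this] show "z \<in> KX.null" by simp
qed

text \<open>Over \<open>R\<close>, a formal sum \<open>z\<close> is congruent to \<open>c z \<otimes> 1\<close> for the contraction \<open>c\<close>, already in \<open>K \<otimes> R\<close>, and
  \<open>c z\<close> is zero when \<open>z\<close> is null in \<open>P \<otimes> R\<close>.\<close>

lemma tens_inj_regular:
  assumes R: "ring R" and P: "left_module (opp_ring R) P" and K: "submodule K (opp_ring R) P"
  shows "tens_inj R P K (regular_module R)"
  unfolding tens_inj_def
proof (intro allI impI)
  interpret R: ring R by (rule R)
  interpret P: left_module "opp_ring R" P by fact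
  note reg = regular_left_module[OF R]
  have Km: "left_module (opp_ring R) (submod P K)" by (rule left_module.left_module_submod[OF P K])
  interpret KR: tensor_pair R "submod P K" "regular_module R" by (rule tensor_pair.intro[OF Km reg])
  note D = submoduleD[OF K]
  fix z assume z: "Poly_Mapping.keys z \<subseteq> K \<times> carrier (regular_module R)" "z \<in> tensor_null R P (regular_module R)"
  obtain c where "\<And>z. Poly_Mapping.keys z \<subseteq> carrier P \<times> carrier R \<Longrightarrow> c z \<in> carrier P"
    and c: "\<And>a r. a \<in> carrier P \<Longrightarrow> r \<in> carrier R \<Longrightarrow> c (frag_of (a, r)) = r \<odot>\<^bsub>P\<^esub> a"
    "\<And>x y. Poly_Mapping.keys x \<subseteq> carrier P \<times> carrier R \<Longrightarrow> Poly_Mapping.keys y \<subseteq> carrier P \<times> carrier R \<Longrightarrow>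
       c (x - y) = c x \<ominus>\<^bsub>P\<^esub> c y"
    "\<And>z. z \<in> tensor_null R P (regular_module R) \<Longrightarrow> c z = \<zero>\<^bsub>P\<^esub>"
    by (rule contraction[OF R P], rule that) assumption+
  have "c z \<in> K \<and> z - frag_of (c z, \<one>\<^bsub>R\<^esub>) \<in> KR.null"
    using z(1)
  proof (rule free_Abelian_group_induct)
    have "c 0 = \<zero>\<^bsub>P\<^esub>" by (rule c(3)) (rule tensor_pair.nullD(1)[OF tensor_pair.intro[OF P reg]])
    then show "c 0 \<in> K \<and> 0 - frag_of (c 0, \<one>\<^bsub>R\<^esub>) \<in> KR.null"
      using D(3) KR.nullD(3)[OF KR.null_zero(1)[of "\<one>\<^bsub>R\<^esub>"]] by simp
  next
    fix x y assume k: "Poly_Mapping.keys x \<subseteq> K \<times> carrier (regular_module R)" "Poly_Mapping.keys y \<subseteq> K \<times> carrier (regular_module R)"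
      and xy: "c x \<in> K \<and> x - frag_of (c x, \<one>\<^bsub>R\<^esub>) \<in> KR.null" "c y \<in> K \<and> y - frag_of (c y, \<one>\<^bsub>R\<^esub>) \<in> KR.null"
    have "Poly_Mapping.keys x \<subseteq> carrier P \<times> carrier R" "Poly_Mapping.keys y \<subseteq> carrier P \<times> carrier R"
      using k D(2) by auto
    then have cxy: "c (x - y) = c x \<ominus>\<^bsub>P\<^esub> c y" by (rule c(2))
    have m: "c x \<ominus>\<^bsub>P\<^esub> c y \<in> K" using P.submodule_minus[OF K] xy by blast
    have "frag_of (c y \<oplus>\<^bsub>submod P K\<^esub> (c x \<ominus>\<^bsub>P\<^esub> c y), \<one>\<^bsub>R\<^esub>) - frag_of (c y, \<one>\<^bsub>R\<^esub>) - frag_of (c x \<ominus>\<^bsub>P\<^esub> c y, \<one>\<^bsub>R\<^esub>) \<in> KR.null"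
      by (rule KR.null_rels(1)) (use xy m in auto)
    moreover have "c y \<oplus>\<^bsub>P\<^esub> (c x \<ominus>\<^bsub>P\<^esub> c y) = c x" by (rule P.add_diff_cancel) (use xy D(1) in auto)
    ultimately have *: "frag_of (c x, \<one>\<^bsub>R\<^esub>) - frag_of (c y, \<one>\<^bsub>R\<^esub>) - frag_of (c x \<ominus>\<^bsub>P\<^esub> c y, \<one>\<^bsub>R\<^esub>) \<in> KR.null" by simp
    have x: "x - frag_of (c x, \<one>\<^bsub>R\<^esub>) \<in> KR.null" and y: "y - frag_of (c y, \<one>\<^bsub>R\<^esub>) \<in> KR.null"
      using xy by blast+
    have "(x - frag_of (c x, \<one>\<^bsub>R\<^esub>)) - (y - frag_of (c y, \<one>\<^bsub>R\<^esub>)) +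
       (frag_of (c x, \<one>\<^bsub>R\<^esub>) - frag_of (c y, \<one>\<^bsub>R\<^esub>) - frag_of (c x \<ominus>\<^bsub>P\<^esub> c y, \<one>\<^bsub>R\<^esub>)) \<in> KR.null"
      by (rule KR.nullD(4)[OF KR.nullD(2)[OF x y] *])
    then show "c (x - y) \<in> K \<and> (x - y) - frag_of (c (x - y), \<one>\<^bsub>R\<^esub>) \<in> KR.null"
      using m cxy by (simp add: algebra_simps)
  next
    fix ar assume "ar \<in> K \<times> carrier (regular_module R)"
    then obtain a r where ar: "ar = (a, r)" "a \<in> K" "r \<in> carrier R" by auto
    have ca: "c (frag_of (a, r)) = r \<odot>\<^bsub>P\<^esub> a" using c(1) ar D(1) by simp
    have ra: "r \<odot>\<^bsub>P\<^esub> a \<in> K" using D(5)[of r a] ar by simp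
    have "frag_of (r \<odot>\<^bsub>submod P K\<^esub> a, \<one>\<^bsub>R\<^esub>) - frag_of (a, r \<odot>\<^bsub>regular_module R\<^esub> \<one>\<^bsub>R\<^esub>) \<in> KR.null"
      by (rule KR.null_rels(3)) (use ar in auto)
    then have "frag_of (a, r) - frag_of (r \<odot>\<^bsub>P\<^esub> a, \<one>\<^bsub>R\<^esub>) \<in> KR.null" using KR.null_sym ar by simp
    then show "c (frag_of ar) \<in> K \<and> frag_of ar - frag_of (c (frag_of ar), \<one>\<^bsub>R\<^esub>) \<in> KR.null"
      using ca ra ar by simp
  qed
  moreover have "c z = \<zero>\<^bsub>P\<^esub>" by (rule c(3)[OF z(2)])
  ultimately have "z - frag_of (\<zero>\<^bsub>P\<^esub>, \<one>\<^bsub>R\<^esub>) \<in> KR.null" by simp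
  moreover have "frag_of (\<zero>\<^bsub>P\<^esub>, \<one>\<^bsub>R\<^esub>) \<in> KR.null" using KR.null_zero(1)[of "\<one>\<^bsub>R\<^esub>"] by simp
  ultimately show "z \<in> KR.null" using KR.nullD(4) by fastforce
qed

text \<open>Projective modules are flat, being retracts of direct sums of copies of the regular module.\<close>

lemma tens_inj_projective:
  assumes P: "left_module (opp_ring R) P" and K: "submodule K (opp_ring R) P" and M: "projective R M"
  shows "tens_inj R P K M"
proof -
  note Mm = projective_left_module[OF M]
  interpret M: left_module R M by (rule Mm)
  note R = M.R.ring_axioms
  obtain i p where ip: "i \<in> mod_hom R M (free_mod R :: ('a, ('a, 'c) mod_univ \<Rightarrow> 'a) module)"
    "p \<in> mod_hom R (free_mod R) M" "\<And>x. x \<in> carrier M \<Longrightarrow> p (i x) = x"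
    using projective_retract_free[OF M] by blast
  have "retract R M (free_mod R :: ('a, ('a, 'c) mod_univ \<Rightarrow> 'a) module)"
    unfolding retract_def by (rule bexI[OF _ ip(1)], rule bexI[OF _ ip(2)]) (simp add: ip(3))
  moreover have "tens_inj R P K (free_mod R :: ('a, ('a, 'c) mod_univ \<Rightarrow> 'a) module)"
    unfolding free_mod_def
    by (rule tens_inj_biproduct[OF P K module_family.ext_sum_biproduct[OF module_family_regular[OF R]] tens_inj_regular[OF R P K]])
  ultimately show ?thesis by (intro tens_inj_retract[OF P K free_left_module[OF R] Mm])
qed


section \<open>Balancing the first torsion product\<close>

lemma tens_inj_swap:
  assumes A: "left_module (opp_ring R) A" and Q: "left_module R Q" and N: "submodule N R Q"
  shows "tens_inj (opp_ring R) Q N A \<longleftrightarrow> (\<forall>z. Poly_Mapping.keys z \<subseteq> carrier A \<times> N \<longrightarrow>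
    z \<in> tensor_null R A Q \<longrightarrow> z \<in> tensor_null R A (submod Q N))" (is "?L \<longleftrightarrow> ?R")
proof -
  have Nm: "left_module R (submod Q N)" by (rule left_module.left_module_submod[OF Q N])
  have AQ: "tensor_pair R A Q" and AN: "tensor_pair R A (submod Q N)"
    by (rule tensor_pair.intro[OF A Q], rule tensor_pair.intro[OF A Nm])
  note sw = tswap_null_iff[OF AQ] and sw' = tswap_null_iff[OF AN]
  show ?thesis
  proof
    assume L: ?L
    show ?R
    proof (intro allI impI)
      fix z assume z: "Poly_Mapping.keys z \<subseteq> carrier A \<times> N" "z \<in> tensor_null R A Q"
      have "tswap z \<in> tensor_null (opp_ring R) (submod Q N) A"
        by (rule tens_injD[OF L keys_tswap[OF z(1)]]) (simp add: sw z(2))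
      then show "z \<in> tensor_null R A (submod Q N)" by (simp add: sw')
    qed
  next
    assume R: ?R
    show ?L unfolding tens_inj_def
    proof (intro allI impI)
      fix z assume z: "Poly_Mapping.keys z \<subseteq> N \<times> carrier A" "z \<in> tensor_null (opp_ring R) Q A"
      have "tswap z \<in> tensor_null R A Q" using sw[of "tswap z"] z(2) by simp
      then have "tswap z \<in> tensor_null R A (submod Q N)" using R keys_tswap[OF z(1)] by blast
      then show "z \<in> tensor_null (opp_ring R) (submod Q N) A" using sw'[of "tswap z"] by simp
    qed
  qed
qed

lemma flat_left:
  assumes P: "left_module (opp_ring R) P" and K: "submodule K (opp_ring R) P" and Q: "projective R Q"
    and z: "Poly_Mapping.keys z \<subseteq> K \<times> carrier Q"
  shows "z \<in> tensor_null R (submod P K) Q \<longleftrightarrow> z \<in> tensor_null R P Q"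
  using tensor_null_incl[OF P projective_left_module[OF Q] K] tens_injD[OF tens_inj_projective[OF P K Q] z] by blast

lemma flat_right:
  assumes P: "projective (opp_ring R) P" and Q: "left_module R Q" and N: "submodule N R Q"
    and z: "Poly_Mapping.keys z \<subseteq> carrier P \<times> N"
  shows "z \<in> tensor_null R P (submod Q N) \<longleftrightarrow> z \<in> tensor_null R P Q"
proof -
  note Pm = projective_left_module[OF P]
  have "tens_inj (opp_ring R) Q N P"
    using tens_inj_projective[of "opp_ring R" Q N P] Q N P by simp
  then show ?thesis
    using tens_inj_swap[OF Pm Q N] tensor_null_incl'[OF Pm Q N] z by blast
qed

text \<open>In \<open>P \<otimes> Q\<close>, the images of \<open>K \<otimes> Q\<close> and \<open>P \<otimes> N\<close> meet in the image of \<open>K \<otimes> N\<close>. This condition is symmetric in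
  the two sides, and it mediates between presentations of the two modules.\<close>

definition tens_meet :: "'r ring \<Rightarrow> ('r, 'p) module \<Rightarrow> 'p set \<Rightarrow> ('r, 'q) module \<Rightarrow> 'q set \<Rightarrow> bool" where
  "tens_meet R P K Q N \<longleftrightarrow> (\<forall>u w. Poly_Mapping.keys u \<subseteq> K \<times> carrier Q \<longrightarrow>
     Poly_Mapping.keys w \<subseteq> carrier P \<times> N \<longrightarrow> u - w \<in> tensor_null R P Q \<longrightarrow>
     (\<exists>v. Poly_Mapping.keys v \<subseteq> K \<times> N \<and> u - v \<in> tensor_null R P Q))"

lemma tens_meetD:
  assumes "tens_meet R P K Q N" "Poly_Mapping.keys u \<subseteq> K \<times> carrier Q" "Poly_Mapping.keys w \<subseteq> carrier P \<times> N"
    "u - w \<in> tensor_null R P Q"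
  obtains v where "Poly_Mapping.keys v \<subseteq> K \<times> N" "u - v \<in> tensor_null R P Q"
proof -
  have "\<exists>v. Poly_Mapping.keys v \<subseteq> K \<times> N \<and> u - v \<in> tensor_null R P Q"
    by (rule assms(1)[unfolded tens_meet_def, rule_format, OF assms(2-4)])
  then show thesis by (elim exE conjE) (rule that)
qed

lemma tens_meet_swap:
  assumes P: "left_module (opp_ring R) P" and Q: "left_module R Q" and meet: "tens_meet R P K Q N"
  shows "tens_meet (opp_ring R) Q N P K"
  unfolding tens_meet_def
proof (intro allI impI)
  interpret PQ: tensor_pair R P Q by (rule tensor_pair.intro[OF P Q])
  note sw = tswap_null_iff[OF PQ.tensor_pair_axioms]
  fix u w assume u: "Poly_Mapping.keys u \<subseteq> N \<times> carrier P" and w: "Poly_Mapping.keys w \<subseteq> carrier Q \<times> K"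
    and uw: "u - w \<in> tensor_null (opp_ring R) Q P"
  have "tswap u - tswap w \<in> PQ.null" using sw[of "tswap (u - w)"] uw by simp
  then have wu: "tswap w - tswap u \<in> PQ.null" by (rule PQ.null_sym)
  obtain v where v: "Poly_Mapping.keys v \<subseteq> K \<times> N" "tswap w - v \<in> PQ.null"
    by (rule tens_meetD[OF meet keys_tswap[OF w] keys_tswap[OF u] wu])
  have "tswap u - v \<in> PQ.null" by (rule PQ.null_trans[OF PQ.null_sym[OF wu] v(2)])
  then have "u - tswap v \<in> tensor_null (opp_ring R) Q P" using sw[of "tswap u - v"] by simp
  then show "\<exists>v. Poly_Mapping.keys v \<subseteq> N \<times> K \<and> u - v \<in> tensor_null (opp_ring R) Q P"
    using keys_tswap[OF v(1)] by blast
qed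

text \<open>With \<open>N\<close> the kernel of \<open>g\<close>, right exactness presents \<open>K \<otimes> M\<close> and \<open>P \<otimes> M\<close> as the quotients of
  \<open>K \<otimes> Q\<close> and \<open>P \<otimes> Q\<close> by the images of \<open>K \<otimes> N\<close> and \<open>P \<otimes> N\<close>. As \<open>Q\<close> is flat, \<open>K \<otimes> Q\<close> is a subgroup of
  \<open>P \<otimes> Q\<close>, so that injectivity of \<open>K \<otimes> M \<rightarrow> P \<otimes> M\<close> is a statement about an intersection.\<close>

lemma tens_inj_iff_meet:
  assumes P: "left_module (opp_ring R) P" and K: "submodule K (opp_ring R) P"
    and Q: "projective R Q" and M: "left_module R M" and g: "g \<in> mod_hom R Q M" "g ` carrier Q = carrier M"
  shows "tens_inj R P K M \<longleftrightarrow> tens_meet R P K Q (a_kernel Q M g)"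
proof
  note Qm = projective_left_module[OF Q]
  have Km: "left_module (opp_ring R) (submod P K)" by (rule left_module.left_module_submod[OF P K])
  interpret PQ: tensor_pair R P Q by (rule tensor_pair.intro[OF P Qm])
  interpret PM: tensor_pair R P M by (rule tensor_pair.intro[OF P M])
  interpret KQ: tensor_pair R "submod P K" Q by (rule tensor_pair.intro[OF Km Qm])
  interpret KM: tensor_pair R "submod P K" M by (rule tensor_pair.intro[OF Km M])
  let ?N = "a_kernel Q M g"
  note Ksub = submoduleD(2)[OF K] and G = mod_homD[OF g(1)]
  have Nsub: "?N \<subseteq> carrier Q" by (auto simp: a_kernel_iff)
  have kill: "tmap (\<lambda>a. a) g w \<in> tensor_null R B M"
    if "left_module (opp_ring R) B" "Poly_Mapping.keys w \<subseteq> carrier B \<times> ?N" for w and B :: "('a, 'b) module"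
  proof -
    interpret BM: tensor_pair R B M by (rule tensor_pair.intro[OF that(1) M])
    show ?thesis using that(2)
    proof (rule free_Abelian_group_induct)
      fix an assume "an \<in> carrier B \<times> ?N"
      then show "tmap (\<lambda>a. a) g (frag_of an) \<in> BM.null"
        using BM.null_zero(2) by (cases an) (simp add: a_kernel_iff)
    qed (simp_all add: BM.nullD(1,2))
  qed
  show "tens_meet R P K Q ?N" if inj: "tens_inj R P K M"
    unfolding tens_meet_def
  proof (intro allI impI)
    fix u w assume u: "Poly_Mapping.keys u \<subseteq> K \<times> carrier Q" and w: "Poly_Mapping.keys w \<subseteq> carrier P \<times> ?N"
      and uw: "u - w \<in> PQ.null"
    have "tmap (\<lambda>a. a) g (u - w) \<in> PM.null" by (rule PQ.tmap_null[OF P M mod_hom_id g(1) uw])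
    then have "tmap (\<lambda>a. a) g u - tmap (\<lambda>a. a) g w \<in> PM.null" by simp
    from PM.nullD(4)[OF this kill[OF P w]] have "tmap (\<lambda>a. a) g u \<in> PM.null" by simp
    then have "tmap (\<lambda>a. a) g u \<in> KM.null"
      by (rule tens_injD[OF inj keys_tmap[OF u], rotated 2]) (simp_all add: G)
    then obtain v where v: "Poly_Mapping.keys v \<subseteq> K \<times> ?N" "u - v \<in> KQ.null"
      using tensor_right_exact[OF Km Qm M g, of u] u by auto
    then show "\<exists>v. Poly_Mapping.keys v \<subseteq> K \<times> ?N \<and> u - v \<in> PQ.null"
      using tensor_null_incl[OF P Qm K] by blast
  qed
  show "tens_inj R P K M" if meet: "tens_meet R P K Q ?N"
    unfolding tens_inj_def
  proof (intro allI impI)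
    fix z assume z: "Poly_Mapping.keys z \<subseteq> K \<times> carrier M" "z \<in> PM.null"
    have "\<forall>m\<in>carrier M. \<exists>q\<in>carrier Q. g q = m" using g(2) by (metis imageE)
    then obtain s where s: "\<And>m. m \<in> carrier M \<Longrightarrow> s m \<in> carrier Q" "\<And>m. m \<in> carrier M \<Longrightarrow> g (s m) = m" by metis
    let ?u = "tmap (\<lambda>a. a) s z"
    have u: "Poly_Mapping.keys ?u \<subseteq> K \<times> carrier Q" by (rule keys_tmap[OF z(1)]) (simp_all add: s)
    have gu: "tmap (\<lambda>a. a) g ?u = z" unfolding tmap_comp by (rule tmap_id_on[OF z(1)]) (simp_all add: s)
    have uP: "Poly_Mapping.keys ?u \<subseteq> carrier P \<times> carrier Q" using u Ksub by blast
    obtain w where w: "Poly_Mapping.keys w \<subseteq> carrier P \<times> ?N" "?u - w \<in> PQ.null"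
      using tensor_right_exact[OF P Qm M g uP] z(2) gu by auto
    obtain v where v: "Poly_Mapping.keys v \<subseteq> K \<times> ?N" "?u - v \<in> PQ.null"
      by (rule tens_meetD[OF meet u w])
    have vK: "Poly_Mapping.keys v \<subseteq> K \<times> carrier Q" using v(1) Nsub by blast
    have "?u - v \<in> KQ.null" using flat_left[OF P K Q keys_diffI[OF u vK]] v(2) by simp
    then have "tmap (\<lambda>a. a) g (?u - v) \<in> KM.null" by (rule KQ.tmap_null[OF Km M mod_hom_id g(1)])
    then have *: "z - tmap (\<lambda>a. a) g v \<in> KM.null" using gu by simp
    have "tmap (\<lambda>a. a) g v \<in> KM.null" by (rule kill[OF Km]) (simp add: v(1))
    from KM.nullD(4)[OF * this] show "z \<in> KM.null" by simp
  qed
qed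

text \<open>\<open>Tor\<^sub>1(A, M)\<close> is the kernel of \<open>K \<otimes> M \<rightarrow> P \<otimes> M\<close> and, computed from the other side, the kernel of
  \<open>A \<otimes> N \<rightarrow> A \<otimes> Q\<close>. That one vanishes iff the other does is the symmetry of \<open>tens_meet\<close>.\<close>

lemma tens_inj_balanced:
  assumes P: "projective (opp_ring R) P" and A: "left_module (opp_ring R) A"
    and f: "f \<in> mod_hom (opp_ring R) P A" "f ` carrier P = carrier A"
    and Q: "projective R Q" and M: "left_module R M" and g: "g \<in> mod_hom R Q M" "g ` carrier Q = carrier M"
  shows "tens_inj R P (a_kernel P A f) M \<longleftrightarrow> tens_inj (opp_ring R) Q (a_kernel Q M g) A"
proof -
  note Pm = projective_left_module[OF P] and Qm = projective_left_module[OF Q]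
  have K: "submodule (a_kernel P A f) (opp_ring R) P" by (rule submodule_kernel[OF Pm A f(1)])
  have N: "submodule (a_kernel Q M g) R Q" by (rule submodule_kernel[OF Qm M g(1)])
  have 1: "tens_inj R P (a_kernel P A f) M \<longleftrightarrow> tens_meet R P (a_kernel P A f) Q (a_kernel Q M g)"
    by (rule tens_inj_iff_meet[OF Pm K Q M g])
  have 2: "tens_inj (opp_ring R) Q (a_kernel Q M g) A \<longleftrightarrow> tens_meet (opp_ring R) Q (a_kernel Q M g) P (a_kernel P A f)"
    by (rule tens_inj_iff_meet[OF _ _ P A f]) (simp_all add: Qm N)
  have 3: "tens_meet R P (a_kernel P A f) Q (a_kernel Q M g) \<longleftrightarrow> tens_meet (opp_ring R) Q (a_kernel Q M g) P (a_kernel P A f)"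
    using tens_meet_swap[OF Pm Qm] tens_meet_swap[of "opp_ring R" Q P] Qm Pm by auto
  show ?thesis using 1 2 3 by blast
qed

subsection \<open>Vanishing of the first torsion product\<close>

definition canon_epi :: "'r ring \<Rightarrow> ('r, 'm) module \<Rightarrow> ('m \<Rightarrow> 'r) \<Rightarrow> 'm" where
  "canon_epi R M = (SOME H. H \<in> mod_hom R (free_mod R) M \<and> H ` carrier (free_mod R) = carrier M)"

lemma canon_epi:
  fixes R :: "'r ring" and M :: "('r, 'm) module"
  assumes M: "left_module R M"
  shows "canon_epi R M \<in> mod_hom R (free_mod R) M" "canon_epi R M ` carrier (free_mod R) = carrier M"
proof -
  interpret M: left_module R M by fact
  note R = M.R.ring_axioms
  let ?b = "\<lambda>x. if x \<in> carrier M then x else \<zero>\<^bsub>M\<^esub>"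
  have "?b x \<in> carrier M" for x by simp
  from free_hom[OF R M, of ?b, OF this]
  obtain H where H: "H \<in> mod_hom R (free_mod R) M" "\<And>x. H (free_basis R x) = ?b x" by blast
  have "H ` carrier (free_mod R) = carrier M"
  proof
    show "H ` carrier (free_mod R) \<subseteq> carrier M" using mod_homD(1)[OF H(1)] by blast
    show "carrier M \<subseteq> H ` carrier (free_mod R)"
    proof
      fix x assume x: "x \<in> carrier M"
      show "x \<in> H ` carrier (free_mod R)"
        by (rule image_eqI[of _ _ "free_basis R x"]) (simp_all add: H x free_basis_closed[OF R])
    qed
  qed
  with H(1) have "\<exists>H :: ('m \<Rightarrow> 'r) \<Rightarrow> 'm. H \<in> mod_hom R (free_mod R) M \<and> H ` carrier (free_mod R) = carrier M"
    by (rule exI[of _ H, OF conjI])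
  from someI_ex[OF this] show "canon_epi R M \<in> mod_hom R (free_mod R) M" "canon_epi R M ` carrier (free_mod R) = carrier M"
    by (simp_all add: canon_epi_def)
qed

lemma projective_free_mod: "ring R \<Longrightarrow> projective R (free_mod R)"
  by (rule retract_free_projective[OF free_left_module mod_hom_id mod_hom_id]) simp_all

text \<open>\<open>Tor\<^sub>1(A, M) = 0\<close>, in terms of a fixed free presentation of \<open>M\<close>. With \<open>M\<close> fixed, it is a condition on \<open>A\<close> in which
  \<open>A\<close> occurs only as a tensor factor; behaviour under direct sums and summands is then immediate. By
  balancing, any projective presentation of either module may be used instead.\<close>

definition tor_zero :: "'r ring \<Rightarrow> ('r, 'a) module \<Rightarrow> ('r, 'm) module \<Rightarrow> bool" where
  "tor_zero R A M \<longleftrightarrow> tens_inj (opp_ring R) (free_mod R :: ('r, 'm \<Rightarrow> 'r) module)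
     (a_kernel (free_mod R) M (canon_epi R M)) A"

lemma tor_zero_iff_left:
  assumes P: "projective (opp_ring R) P" and A: "left_module (opp_ring R) A"
    and f: "f \<in> mod_hom (opp_ring R) P A" "f ` carrier P = carrier A" and M: "left_module R M"
  shows "tor_zero R A M \<longleftrightarrow> tens_inj R P (a_kernel P A f) M"
  unfolding tor_zero_def
  using tens_inj_balanced[OF P A f projective_free_mod M canon_epi[OF M]] left_module.axioms(1)[OF M] by blast

lemma tor_zero_iff_right:
  assumes A: "left_module (opp_ring R) A" and Q: "projective R Q" and M: "left_module R M"
    and g: "g \<in> mod_hom R Q M" "g ` carrier Q = carrier M"
  shows "tor_zero R A M \<longleftrightarrow> tens_inj (opp_ring R) Q (a_kernel Q M g) A"
proof -
  have P: "projective (opp_ring R) (free_mod (opp_ring R) :: ('a, 'b \<Rightarrow> 'a) module)"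
    by (rule projective_free_mod) (rule left_module.axioms(1)[OF A])
  show ?thesis
    using tor_zero_iff_left[OF P A canon_epi[OF A] M] tens_inj_balanced[OF P A canon_epi[OF A] Q M g] by blast
qed

lemma tor_zero_retract:
  assumes X: "left_module (opp_ring R) X" and A: "left_module (opp_ring R) A" and M: "left_module R M"
    and ret: "retract (opp_ring R) A X" and tz: "tor_zero R X M"
  shows "tor_zero R A M"
  using tz unfolding tor_zero_def
  by (rule tens_inj_retract[OF _ _ X A ret, rotated 2])
     (simp_all add: free_left_module[OF left_module.axioms(1)[OF M]]
       submodule_kernel[OF free_left_module[OF left_module.axioms(1)[OF M]] M canon_epi(1)[OF M]])

lemma tor_zero_biproduct:
  assumes b: "biproduct (opp_ring R) X C \<iota> \<pi>" and M: "left_module R M" and tz: "\<And>i. tor_zero R (C i) M"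
  shows "tor_zero R X M"
  using tz unfolding tor_zero_def
  by (intro tens_inj_biproduct[OF _ _ b])
     (simp_all add: free_left_module[OF left_module.axioms(1)[OF M]]
       submodule_kernel[OF free_left_module[OF left_module.axioms(1)[OF M]] M canon_epi(1)[OF M]])

lemma tor_zero_projective_left:
  assumes A: "projective (opp_ring R) A" and M: "left_module R M"
  shows "tor_zero R A M"
  unfolding tor_zero_def
  by (rule tens_inj_projective[OF _ _ A])
     (simp_all add: free_left_module[OF left_module.axioms(1)[OF M]]
       submodule_kernel[OF free_left_module[OF left_module.axioms(1)[OF M]] M canon_epi(1)[OF M]])

lemma tor_zero_projective_right:
  assumes A: "left_module (opp_ring R) A" and M: "projective R M"
  shows "tor_zero R A M"
proof -
  note Ro = left_module.axioms(1)[OF A] and Mm = projective_left_module[OF M]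
  show ?thesis
    unfolding tor_zero_iff_left[OF projective_free_mod[OF Ro] A canon_epi[OF A] Mm]
    by (rule tens_inj_projective[OF free_left_module[OF Ro] submodule_kernel[OF free_left_module[OF Ro] A canon_epi(1)[OF A]] M])
qed

text \<open>Dimension shifting: both conditions say that \<open>K \<otimes> N \<rightarrow> P \<otimes> Q\<close> is injective, as this map factors
  through \<open>K \<otimes> Q\<close> and through \<open>P \<otimes> N\<close>, which are subgroups of \<open>P \<otimes> Q\<close> by flatness.\<close>

lemma tor_zero_shift:
  assumes P: "projective (opp_ring R) P" and A: "left_module (opp_ring R) A"
    and f: "f \<in> mod_hom (opp_ring R) P A" "f ` carrier P = carrier A"
    and Q: "projective R Q" and M: "left_module R M" and g: "g \<in> mod_hom R Q M" "g ` carrier Q = carrier M"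
  shows "tor_zero R (submod P (a_kernel P A f)) M \<longleftrightarrow> tor_zero R A (submod Q (a_kernel Q M g))"
proof -
  note Pm = projective_left_module[OF P] and Qm = projective_left_module[OF Q]
  let ?K = "a_kernel P A f" and ?N = "a_kernel Q M g"
  have K: "submodule ?K (opp_ring R) P" by (rule submodule_kernel[OF Pm A f(1)])
  have N: "submodule ?N R Q" by (rule submodule_kernel[OF Qm M g(1)])
  have Km: "left_module (opp_ring R) (submod P ?K)" by (rule left_module.left_module_submod[OF Pm K])
  have Nm: "left_module R (submod Q ?N)" by (rule left_module.left_module_submod[OF Qm N])
  note sub = submoduleD(2)[OF K] submoduleD(2)[OF N]
  have keys: "Poly_Mapping.keys z \<subseteq> ?K \<times> carrier Q" "Poly_Mapping.keys z \<subseteq> carrier P \<times> ?N"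
    if "Poly_Mapping.keys z \<subseteq> ?K \<times> ?N" for z using that sub by blast+
  have "tor_zero R (submod P ?K) M \<longleftrightarrow> (\<forall>z. Poly_Mapping.keys z \<subseteq> ?K \<times> ?N \<longrightarrow>
      z \<in> tensor_null R (submod P ?K) Q \<longrightarrow> z \<in> tensor_null R (submod P ?K) (submod Q ?N))"
    unfolding tor_zero_iff_right[OF Km Q M g] tens_inj_swap[OF Km Qm N] by simp
  also have "\<dots> \<longleftrightarrow> (\<forall>z. Poly_Mapping.keys z \<subseteq> ?K \<times> ?N \<longrightarrow>
      z \<in> tensor_null R P (submod Q ?N) \<longrightarrow> z \<in> tensor_null R (submod P ?K) (submod Q ?N))"
    using flat_left[OF Pm K Q keys(1)] flat_right[OF P Qm N keys(2)] by blast
  also have "\<dots> \<longleftrightarrow> tor_zero R A (submod Q ?N)"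
    unfolding tor_zero_iff_left[OF P A f Nm] tens_inj_def by simp
  finally show ?thesis .
qed

text \<open>Embed \<open>L\<close> into a free module. Each coordinate of \<open>l\<close> annihilates \<open>t\<close> by contraction, so it lies in \<open>J\<close>, and
  retracting to \<open>L\<close> gives \<open>l\<close> in \<open>JL\<close>.\<close>

lemma (in left_artinian) tensor_null_in_rad:
  assumes T: "left_module (opp_ring R) T" and t: "t \<in> carrier T"
    and ann: "\<And>r. r \<in> carrier R \<Longrightarrow> r \<odot>\<^bsub>T\<^esub> t = \<zero>\<^bsub>T\<^esub> \<Longrightarrow> r \<in> J"
    and L: "projective R L" and l: "l \<in> carrier L" and null: "frag_of (t, l) \<in> tensor_null R T L"
  shows "l \<in> ideal_mult J L (carrier L)"
proof -
  note Lm = projective_left_module[OF L] and reg = regular_left_module[OF ring_axioms]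
  let ?F = "free_mod R :: ('r, ('r, 'b) mod_univ \<Rightarrow> 'r) module"
  note Fm = free_left_module[OF ring_axioms]
  obtain i p where i: "i \<in> mod_hom R L ?F" and p: "p \<in> mod_hom R ?F L" and pi: "\<And>x. x \<in> carrier L \<Longrightarrow> p (i x) = x"
    using projective_retract_free[OF L] by blast
  interpret MF: module_family R "\<lambda>_. regular_module R" by (rule module_family_regular[OF ring_axioms])
  obtain c where "\<And>z. Poly_Mapping.keys z \<subseteq> carrier T \<times> carrier R \<Longrightarrow> c z \<in> carrier T"
    and c: "\<And>a r. a \<in> carrier T \<Longrightarrow> r \<in> carrier R \<Longrightarrow> c (frag_of (a, r)) = r \<odot>\<^bsub>T\<^esub> a"
    "\<And>x y. Poly_Mapping.keys x \<subseteq> carrier T \<times> carrier R \<Longrightarrow> Poly_Mapping.keys y \<subseteq> carrier T \<times> carrier R \<Longrightarrow>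
       c (x - y) = c x \<ominus>\<^bsub>T\<^esub> c y"
    "\<And>z. z \<in> tensor_null R T (regular_module R) \<Longrightarrow> c z = \<zero>\<^bsub>T\<^esub>"
    by (rule contraction[OF ring_axioms T], rule that) assumption+
  have il: "i l \<in> carrier ?F" by (rule mod_homD(1)[OF i l])
  have J: "i l x \<in> J" for x
  proof -
    have co: "(\<lambda>l. i l x) \<in> mod_hom R L (regular_module R)"
      by (rule mod_hom_comp[OF i]) (unfold free_mod_def, rule MF.proj_hom)
    have "tmap (\<lambda>a. a) (\<lambda>l. i l x) (frag_of (t, l)) \<in> tensor_null R T (regular_module R)"
      by (rule tensor_pair.tmap_null[OF tensor_pair.intro[OF T Lm] T reg mod_hom_id co null])
    then have "c (frag_of (t, i l x)) = \<zero>\<^bsub>T\<^esub>" using c(3) by simp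
    moreover have "i l x \<in> carrier R" using il by (simp add: free_carrier_iff)
    ultimately show ?thesis using c(1)[OF t] ann by simp
  qed
  have "i l \<in> ideal_mult J ?F (carrier ?F)"
    unfolding free_mod_def
  proof (rule MF.ext_sum_ideal_mult)
    show "i l \<in> carrier (ext_sum (\<lambda>_. regular_module R))" using il by (simp only: free_mod_def)
    fix x
    interpret reg: left_module R "regular_module R" by (rule reg)
    have "i l x \<odot>\<^bsub>regular_module R\<^esub> \<one>\<^bsub>R\<^esub> \<in> ideal_mult J (regular_module R) (carrier (regular_module R))"
      by (rule reg.ideal_mult_single) (simp_all add: J jacobson_subset)
    then show "i l x \<in> ideal_mult J (regular_module R) (carrier (regular_module R))"
      using J[of x] jacobson_subset by auto
  qed (use jacobson_subset jacobson_l_mult in auto)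
  from left_module.ideal_mult_hom[OF Fm Lm p jacobson_subset subset_refl this, of "carrier L"]
  show ?thesis using pi[OF l] mod_homD(1)[OF p] by simp
qed

text \<open>The kernel \<open>L\<close> of the cover lies in \<open>JQ\<close>, so \<open>t \<otimes> l\<close> vanishes in \<open>T \<otimes> Q\<close> for all \<open>l\<close> in \<open>L\<close>. If it vanished
  in \<open>T \<otimes> L\<close> as well, then \<open>L = JL\<close>, and \<open>L = 0\<close> by Nakayama's lemma.\<close>

lemma (in left_artinian) tor_nonzero:
  assumes T: "left_module (opp_ring R) T" and t: "t \<in> carrier T"
    and ann: "\<And>r. r \<in> carrier R \<Longrightarrow> r \<odot>\<^bsub>T\<^esub> t = \<zero>\<^bsub>T\<^esub> \<longleftrightarrow> r \<in> J"
    and M: "left_module R M" and cov: "projective_cover R Q g M"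
    and L: "projective R (submod Q (a_kernel Q M g))" and nz: "a_kernel Q M g \<noteq> {\<zero>\<^bsub>Q\<^esub>}"
  shows "\<not> tor_zero R T M"
proof
  assume tz: "tor_zero R T M"
  have Q: "projective R Q" and g: "g \<in> mod_hom R Q M" "g ` carrier Q = carrier M"
    and sup: "superfluous R Q (a_kernel Q M g)" using cov by (auto simp: projective_cover_def)
  note Qm = projective_left_module[OF Q] and Lm = projective_left_module[OF L]
  let ?L = "a_kernel Q M g"
  have Ls: "submodule ?L R Q" by (rule submodule_kernel[OF Qm M g(1)])
  interpret TQ: tensor_pair R T Q by (rule tensor_pair.intro[OF T Qm])
  have inj: "\<And>z. Poly_Mapping.keys z \<subseteq> carrier T \<times> ?L \<Longrightarrow> z \<in> TQ.null \<Longrightarrow> z \<in> tensor_null R T (submod Q ?L)"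
    using tz unfolding tor_zero_iff_right[OF T Q M g] tens_inj_swap[OF T Qm Ls] by blast
  have null: "frag_of (t, y) \<in> TQ.null" if "y \<in> ideal_mult J Q (carrier Q)" for y
    using that
  proof induction
    case zero
    show ?case by (rule TQ.null_zero(2)[OF t])
  next
    case (step j x y)
    have c: "j \<in> carrier R" "x \<in> carrier Q" "y \<in> carrier Q"
      using step jacobson_subset TQ.M.ideal_mult_closed[of y J "carrier Q"] by auto
    have "j \<odot>\<^bsub>T\<^esub> t = \<zero>\<^bsub>T\<^esub>" using ann[OF c(1)] step(1) by simp
    then have "frag_of (\<zero>\<^bsub>T\<^esub>, x) - frag_of (t, j \<odot>\<^bsub>Q\<^esub> x) \<in> TQ.null" using TQ.null_rels(3)[OF c(1) t c(2)] by simp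
    from TQ.nullD(2)[OF TQ.null_zero(1)[OF c(2)] this] have "frag_of (t, j \<odot>\<^bsub>Q\<^esub> x) \<in> TQ.null" by simp
    from TQ.nullD(4)[OF this step.IH]
    have *: "frag_of (t, j \<odot>\<^bsub>Q\<^esub> x) + frag_of (t, y) \<in> TQ.null" .
    have "frag_of (t, j \<odot>\<^bsub>Q\<^esub> x \<oplus>\<^bsub>Q\<^esub> y) - frag_of (t, j \<odot>\<^bsub>Q\<^esub> x) - frag_of (t, y) \<in> TQ.null"
      by (rule TQ.null_rels(2)[OF t TQ.M.smult_closed[OF c(1,2)] c(3)])
    from TQ.nullD(4)[OF this *] show ?case by simp
  qed
  have "?L \<subseteq> ideal_mult J (submod Q ?L) (carrier (submod Q ?L))"
  proof
    fix l assume l: "l \<in> ?L"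
    then have "l \<in> ideal_mult J Q (carrier Q)" using superfluous_subset_rad[OF Qm sup] by blast
    then have "frag_of (t, l) \<in> tensor_null R T (submod Q ?L)"
      using inj[of "frag_of (t, l)"] null t l by (simp add: keys_frag_of)
    from tensor_null_in_rad[OF T t _ L _ this] show "l \<in> ideal_mult J (submod Q ?L) (carrier (submod Q ?L))"
      using ann l by simp
  qed
  then have "superfluous R (submod Q ?L) ?L"
    using superfluous_if[OF Lm left_module.submodule_carrier[OF Lm]] by simp
  moreover have "{\<zero>\<^bsub>Q\<^esub>} <+>\<^bsub>submod Q ?L\<^esub> ?L = ?L"
  proof -
    have "\<zero>\<^bsub>Q\<^esub> \<oplus>\<^bsub>Q\<^esub> l = l" if "l \<in> ?L" for l using submoduleD(1)[OF Ls that] by simp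
    then show ?thesis by (auto simp: set_add_def')
  qed
  moreover have "submodule {\<zero>\<^bsub>Q\<^esub>} R (submod Q ?L)" using left_module.submodule_zero[OF Lm] by simp
  ultimately have "{\<zero>\<^bsub>Q\<^esub>} = ?L" unfolding superfluous_def by simp
  then show False using nz by simp
qed

section \<open>The homology group \<open>Tor\<^sub>1\<close>\<close>

lemma (in tensor_pair) null_normal: "normal null (free_Abelian_group (carrier A \<times> carrier M))"
  by (rule comm_group.normal_iff_subgroup[THEN iffD2, OF abelian_free_Abelian_group null_subgroup])


definition tclass :: "'r ring \<Rightarrow> ('r, 'a) module \<Rightarrow> ('r, 'm) module \<Rightarrow> ('a \<times> 'm \<Rightarrow>\<^sub>0 int) \<Rightarrow> ('a \<times> 'm \<Rightarrow>\<^sub>0 int) set" where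
  "tclass R A M z = tensor_null R A M #>\<^bsub>free_Abelian_group (carrier A \<times> carrier M)\<^esub> z"

lemma tclass_iff: "x \<in> tclass R A M z \<longleftrightarrow> (\<exists>n\<in>tensor_null R A M. x = n + z)"
  by (auto simp: tclass_def r_coset_def)

context tensor_pair
begin

lemma tclass_eq_iff: "tclass R A M x = tclass R A M y \<longleftrightarrow> x - y \<in> null"
proof
  assume "tclass R A M x = tclass R A M y"
  moreover have "x \<in> tclass R A M x" unfolding tclass_iff by (rule bexI[of _ 0]) (simp_all add: nullD(1))
  ultimately have "x \<in> tclass R A M y" by simp
  then show "x - y \<in> null" unfolding tclass_iff by (elim bexE) simp
next
  assume xy: "x - y \<in> null"
  have "tclass R A M x \<subseteq> tclass R A M y" if "x - y \<in> null" for x y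
  proof
    fix z assume "z \<in> tclass R A M x"
    then obtain n where n: "n \<in> null" "z = n + x" unfolding tclass_iff by (elim bexE)
    show "z \<in> tclass R A M y" unfolding tclass_iff
      by (rule bexI[of _ "n + (x - y)"]) (simp_all add: n nullD(4) that)
  qed
  from this[OF xy] this[OF null_sym[OF xy]] show "tclass R A M x = tclass R A M y" by blast
qed

lemma tclass_zero: "tclass R A M 0 = null"
proof -
  have "x \<in> tclass R A M 0 \<longleftrightarrow> x \<in> null" for x unfolding tclass_iff by simp
  then show ?thesis by blast
qed

lemma tensor_carrier: "carrier (tensor R A M) = tclass R A M ` {z. Poly_Mapping.keys z \<subseteq> carrier A \<times> carrier M}"
  by (auto simp: tensor_def FactGroup_def RCOSETS_def tclass_def)

lemma tensor_one: "\<one>\<^bsub>tensor R A M\<^esub> = tclass R A M 0"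
  by (simp add: tensor_def FactGroup_def tclass_zero)

lemma tensor_mult:
  assumes "Poly_Mapping.keys x \<subseteq> carrier A \<times> carrier M" "Poly_Mapping.keys y \<subseteq> carrier A \<times> carrier M"
  shows "tclass R A M x \<otimes>\<^bsub>tensor R A M\<^esub> tclass R A M y = tclass R A M (x + y)"
  using normal.rcos_sum[OF null_normal, of x y] assms by (simp add: tensor_def FactGroup_def tclass_def)

lemma tensor_map_tclass:
  assumes B: "left_module (opp_ring R) B" and f: "f \<in> mod_hom (opp_ring R) A B"
  shows "tensor_map R B M f (tclass R A M z) = tclass R B M (tmap f (\<lambda>m. m) z)"
proof -
  interpret B: tensor_pair R B M by (rule tensor_pair.intro[OF B M])
  have fe: "frag_extend (\<lambda>(a, m). frag_of (f a, m)) = tmap f (\<lambda>m. m)" by (simp add: tmap_def)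
  have *: "tclass R B M (tmap f (\<lambda>m. m) c) = tclass R B M (tmap f (\<lambda>m. m) z)" if "c \<in> tclass R A M z" for c
  proof -
    obtain n where n: "n \<in> null" "c = n + z" using \<open>c \<in> tclass R A M z\<close> unfolding tclass_iff by (elim bexE)
    then have "tmap f (\<lambda>m. m) c - tmap f (\<lambda>m. m) z = tmap f (\<lambda>m. m) n" by (simp flip: tmap_simps(3))
    then show ?thesis unfolding B.tclass_eq_iff using tmap_null[OF B M f mod_hom_id n(1)] by simp
  qed
  have "z \<in> tclass R A M z" unfolding tclass_iff by (rule bexI[of _ 0]) (simp_all add: nullD(1))
  then have ne: "tclass R A M z \<noteq> {}" by blast
  have "tensor_map R B M f (tclass R A M z) = (\<Union>c\<in>tclass R A M z. tclass R B M (tmap f (\<lambda>m. m) c))"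
    by (simp add: tensor_map_def tclass_def fe)
  also have "\<dots> = (\<Union>c\<in>tclass R A M z. tclass R B M (tmap f (\<lambda>m. m) z))" by (rule SUP_cong[OF refl *])
  also have "\<dots> = tclass R B M (tmap f (\<lambda>m. m) z)" using ne by simp
  finally show ?thesis .
qed

end

text \<open>The homology of the complex \<open>P\<^sub>2 \<otimes> M \<rightarrow> P\<^sub>1 \<otimes> M \<rightarrow> P\<^sub>0 \<otimes> M\<close> at the middle term is the kernel of
  \<open>K \<otimes> M \<rightarrow> P\<^sub>0 \<otimes> M\<close>, where \<open>K\<close> is the image of \<open>P\<^sub>1\<close>: by right exactness, \<open>K \<otimes> M\<close> is the quotient of
  \<open>P\<^sub>1 \<otimes> M\<close> by the image of \<open>P\<^sub>2 \<otimes> M\<close>.\<close>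

lemma tensor_homology_trivial_iff:
  assumes P0: "left_module (opp_ring R) P0" and P1: "left_module (opp_ring R) P1" and P2: "left_module (opp_ring R) P2"
    and M: "left_module R M" and d0: "d0 \<in> mod_hom (opp_ring R) P1 P0" and d1: "d1 \<in> mod_hom (opp_ring R) P2 P1"
    and ex: "d1 ` carrier P2 = a_kernel P1 P0 d0"
  defines "H \<equiv> (tensor R P1 M)\<lparr>carrier := kernel (tensor R P1 M) (tensor R P0 M) (tensor_map R P0 M d0)\<rparr>
      Mod (tensor_map R P1 M d1 ` carrier (tensor R P2 M))"
  shows "carrier H = {\<one>\<^bsub>H\<^esub>} \<longleftrightarrow> tens_inj R P0 (d0 ` carrier P1) M"
proof -
  interpret T0: tensor_pair R P0 M by (rule tensor_pair.intro[OF P0 M])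
  interpret T1: tensor_pair R P1 M by (rule tensor_pair.intro[OF P1 M])
  interpret T2: tensor_pair R P2 M by (rule tensor_pair.intro[OF P2 M])
  let ?F = "\<lambda>P. {z :: _ \<Rightarrow>\<^sub>0 int. Poly_Mapping.keys z \<subseteq> carrier P \<times> carrier M}"
  let ?t = "\<lambda>d. tmap d (\<lambda>m. m)"
  let ?K = "d0 ` carrier P1"
  have K: "submodule ?K (opp_ring R) P0" by (rule submodule_image[OF P1 P0 d0 left_module.submodule_carrier[OF P1]])
  have Km: "left_module (opp_ring R) (submod P0 ?K)" by (rule left_module.left_module_submod[OF P0 K])
  interpret TK: tensor_pair R "submod P0 ?K" M by (rule tensor_pair.intro[OF Km M])
  have d0K: "d0 \<in> mod_hom (opp_ring R) P1 (submod P0 ?K)" by (rule mod_hom_corestrict[OF d0]) blast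
  define Z where "Z = kernel (tensor R P1 M) (tensor R P0 M) (tensor_map R P0 M d0)"
  define B where "B = tensor_map R P1 M d1 ` carrier (tensor R P2 M)"
  have "tensor_map R P0 M d0 (tclass R P1 M z) = \<one>\<^bsub>tensor R P0 M\<^esub> \<longleftrightarrow> ?t d0 z \<in> T0.null" for z
    unfolding T1.tensor_map_tclass[OF P0 d0] T0.tensor_one T0.tclass_eq_iff by simp
  then have Z: "Z = tclass R P1 M ` {z \<in> ?F P1. ?t d0 z \<in> T0.null}"
    unfolding Z_def kernel_def T1.tensor_carrier by auto
  have B: "B = (\<lambda>y. tclass R P1 M (?t d1 y)) ` ?F P2"
    unfolding B_def T2.tensor_carrier by (simp add: image_image T2.tensor_map_tclass[OF P1 d1])
  have t1: "?t d1 y \<in> ?F P1" if "y \<in> ?F P2" for y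
    using keys_tmap[of y "carrier P2" "carrier M" d1 "carrier P1" "\<lambda>m. m"] that mod_homD(1)[OF d1] by simp
  have d0d1: "d0 (d1 x) = \<zero>\<^bsub>P0\<^esub>" if "x \<in> carrier P2" for x
    using ex that by (auto simp: a_kernel_iff set_eq_iff image_iff)
  have carrier: "carrier H = (\<lambda>c. B #>\<^bsub>tensor R P1 M\<^esub> c) ` Z" and one: "\<one>\<^bsub>H\<^esub> = B"
    by (auto simp: H_def FactGroup_def RCOSETS_def r_coset_def Z_def B_def)
  have zero_B: "tclass R P1 M 0 \<in> B" unfolding B by (rule image_eqI[of _ _ 0]) simp_all
  have Bz: "B #>\<^bsub>tensor R P1 M\<^esub> tclass R P1 M z = (\<lambda>y. tclass R P1 M (?t d1 y + z)) ` ?F P2" if "z \<in> ?F P1" for z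
    unfolding B r_coset_def using T1.tensor_mult[of _ z] t1 that by auto
  have plus: "?t d1 (y + y') = ?t d1 y + ?t d1 y'" for y y'
    by (simp add: tmap_def frag_extend_add)
  \<comment> \<open>Cycles and boundaries are first expressed by formal sums; triviality of the quotient then becomes exactness.\<close>
  have "carrier H = {\<one>\<^bsub>H\<^esub>} \<longleftrightarrow> Z \<subseteq> B"
  proof
    assume triv: "carrier H = {\<one>\<^bsub>H\<^esub>}"
    show "Z \<subseteq> B"
    proof
      fix c assume c: "c \<in> Z"
      then obtain z where z: "z \<in> ?F P1" "c = tclass R P1 M z" unfolding Z by blast
      have "B #>\<^bsub>tensor R P1 M\<^esub> c = B" using triv c unfolding carrier one by blast
      moreover have "tclass R P1 M (?t d1 0 + z) \<in> B #>\<^bsub>tensor R P1 M\<^esub> c"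
        unfolding z(2) Bz[OF z(1)] by (rule imageI) simp
      ultimately show "c \<in> B" using z(2) by simp
    qed
  next
    assume sub: "Z \<subseteq> B"
    have "B #>\<^bsub>tensor R P1 M\<^esub> c = B" if "c \<in> Z" for c
    proof -
      obtain y where y: "y \<in> ?F P2" "c = tclass R P1 M (?t d1 y)" using sub \<open>c \<in> Z\<close> unfolding B by blast
      have "(\<lambda>y'. tclass R P1 M (?t d1 y' + ?t d1 y)) ` ?F P2 = (\<lambda>y. tclass R P1 M (?t d1 y)) ` ?F P2"
      proof
        show "(\<lambda>y'. tclass R P1 M (?t d1 y' + ?t d1 y)) ` ?F P2 \<subseteq> (\<lambda>y. tclass R P1 M (?t d1 y)) ` ?F P2"
        proof (rule image_subsetI)
          fix y' assume "y' \<in> ?F P2"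
          then have "y' + y \<in> ?F P2" using diff_closedD(4)[OF diff_closed_keys, of y' "carrier P2 \<times> carrier M" y] y(1) by simp
          then show "tclass R P1 M (?t d1 y' + ?t d1 y) \<in> (\<lambda>y. tclass R P1 M (?t d1 y)) ` ?F P2"
            unfolding plus[symmetric] by (rule imageI)
        qed
        show "(\<lambda>y. tclass R P1 M (?t d1 y)) ` ?F P2 \<subseteq> (\<lambda>y'. tclass R P1 M (?t d1 y' + ?t d1 y)) ` ?F P2"
        proof (rule image_subsetI)
          fix y' assume "y' \<in> ?F P2"
          then have "y' - y \<in> ?F P2" using keys_diffI[of y' "carrier P2 \<times> carrier M" y] y(1) by simp
          then show "tclass R P1 M (?t d1 y') \<in> (\<lambda>y'. tclass R P1 M (?t d1 y' + ?t d1 y)) ` ?F P2"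
            by (intro image_eqI[of _ _ "y' - y"]) simp_all
        qed
      qed
      then show ?thesis using Bz[OF t1[OF y(1)]] unfolding y(2) B by simp
    qed
    moreover have "tclass R P1 M 0 \<in> Z" unfolding Z by (rule imageI) (simp add: T0.nullD(1))
    ultimately show "carrier H = {\<one>\<^bsub>H\<^esub>}" unfolding carrier one by blast
  qed
  also have "\<dots> \<longleftrightarrow> (\<forall>z\<in>?F P1. ?t d0 z \<in> T0.null \<longrightarrow> (\<exists>y\<in>?F P2. z - ?t d1 y \<in> T1.null))"
    unfolding Z B image_subset_iff by (auto simp: image_iff T1.tclass_eq_iff)
  also have "\<dots> \<longleftrightarrow> tens_inj R P0 ?K M"
  proof
    assume E: "\<forall>z\<in>?F P1. ?t d0 z \<in> T0.null \<longrightarrow> (\<exists>y\<in>?F P2. z - ?t d1 y \<in> T1.null)"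
    show "tens_inj R P0 ?K M"
      unfolding tens_inj_def
    proof (intro allI impI)
      fix z assume z: "Poly_Mapping.keys z \<subseteq> ?K \<times> carrier M" "z \<in> T0.null"
      have "\<forall>k\<in>?K. \<exists>p\<in>carrier P1. d0 p = k" by blast
      then obtain s where s: "\<And>k. k \<in> ?K \<Longrightarrow> s k \<in> carrier P1" "\<And>k. k \<in> ?K \<Longrightarrow> d0 (s k) = k" by metis
      have keys: "?t s z \<in> ?F P1" using keys_tmap[OF z(1), of s "carrier P1" "\<lambda>m. m" "carrier M"] s(1) by simp
      have lift: "?t d0 (?t s z) = z" unfolding tmap_comp by (rule tmap_id_on[OF z(1)]) (simp_all add: s(2))
      obtain y where y: "y \<in> ?F P2" "?t s z - ?t d1 y \<in> T1.null" using E keys z(2) lift by auto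
      have "?t d0 (?t s z - ?t d1 y) \<in> TK.null" by (rule T1.tmap_null[OF Km M d0K mod_hom_id y(2)])
      then have *: "z - ?t d0 (?t d1 y) \<in> TK.null" using lift by simp
      have "?t d0 (?t d1 y) \<in> TK.null"
        unfolding tmap_comp
      proof (rule free_Abelian_group_induct[of y "carrier P2 \<times> carrier M"])
        show "Poly_Mapping.keys y \<subseteq> carrier P2 \<times> carrier M" using y(1) by simp
        fix a assume "a \<in> carrier P2 \<times> carrier M"
        then show "tmap (\<lambda>a. d0 (d1 a)) (\<lambda>m. m) (frag_of a) \<in> TK.null"
          using TK.null_zero(1) by (cases a) (simp add: d0d1)
      qed (simp_all add: TK.nullD(1,2))
      from TK.nullD(4)[OF * this] show "z \<in> TK.null" by simp
    qed
  next
    assume inj: "tens_inj R P0 ?K M"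
    show "\<forall>z\<in>?F P1. ?t d0 z \<in> T0.null \<longrightarrow> (\<exists>y\<in>?F P2. z - ?t d1 y \<in> T1.null)"
    proof (intro ballI impI)
      fix z assume z: "z \<in> ?F P1" "?t d0 z \<in> T0.null"
      then have zk: "Poly_Mapping.keys z \<subseteq> carrier P1 \<times> carrier M" by simp
      have "?t d0 z \<in> TK.null" by (rule tens_injD[OF inj keys_tmap[OF zk] z(2)]) simp_all
      then obtain w where w: "Poly_Mapping.keys w \<subseteq> a_kernel P1 (submod P0 ?K) d0 \<times> carrier M" "z - w \<in> T1.null"
        using tensor_right_exact'[OF M P1 Km d0K _ zk] by auto
      have wk: "Poly_Mapping.keys w \<subseteq> d1 ` carrier P2 \<times> carrier M" using w(1) unfolding ex by (auto simp: a_kernel_iff)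
      have "\<forall>k\<in>d1 ` carrier P2. \<exists>p\<in>carrier P2. d1 p = k" by blast
      then obtain s where s: "\<And>k. k \<in> d1 ` carrier P2 \<Longrightarrow> s k \<in> carrier P2" "\<And>k. k \<in> d1 ` carrier P2 \<Longrightarrow> d1 (s k) = k" by metis
      have "?t s w \<in> ?F P2" using keys_tmap[OF wk, of s "carrier P2" "\<lambda>m. m" "carrier M"] s(1) by simp
      moreover have "?t d1 (?t s w) = w" unfolding tmap_comp by (rule tmap_id_on[OF wk]) (simp_all add: s(2))
      ultimately show "\<exists>y\<in>?F P2. z - ?t d1 y \<in> T1.null" using w(2) by (intro bexI[of _ "?t s w"]) simp_all
    qed
  qed
  finally show ?thesis .
qed

lemma Tor_1_trivial_iff:
  fixes R :: "'r ring" and A :: "('r, 'a) module"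
  assumes A: "left_module (opp_ring R) A" and M: "left_module R M"
    and ex: "\<exists>(P :: nat \<Rightarrow> ('r, ('r, 'a) mod_univ) module) \<epsilon> d. proj_resolution (opp_ring R) A P \<epsilon> d"
  shows "carrier (Tor R 1 A M) = {\<one>\<^bsub>Tor R 1 A M\<^esub>} \<longleftrightarrow> tor_zero R A M"
proof -
  let ?s = "SOME (P :: nat \<Rightarrow> ('r, ('r, 'a) mod_univ) module, \<epsilon>, d). proj_resolution (opp_ring R) A P \<epsilon> d"
  obtain P0 :: "nat \<Rightarrow> ('r, ('r, 'a) mod_univ) module" and \<epsilon>0 d0 where "proj_resolution (opp_ring R) A P0 \<epsilon>0 d0"
    using ex by blast
  then have "case (P0, \<epsilon>0, d0) of (P, \<epsilon>, d) \<Rightarrow> proj_resolution (opp_ring R) A P \<epsilon> d" by simp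
  then have "case ?s of (P, \<epsilon>, d) \<Rightarrow> proj_resolution (opp_ring R) A P \<epsilon> d" by (rule someI)
  moreover obtain P \<epsilon> d where s: "?s = (P, \<epsilon>, d)" by (cases ?s)
  ultimately have res: "proj_resolution (opp_ring R) A P \<epsilon> d" by simp
  have P: "projective (opp_ring R) (P n)" and e: "\<epsilon> \<in> mod_hom (opp_ring R) (P 0) A" "\<epsilon> ` carrier (P 0) = carrier A"
    and d: "d n \<in> mod_hom (opp_ring R) (P (Suc n)) (P n)" and ex0: "d 0 ` carrier (P 1) = a_kernel (P 0) A \<epsilon>"
    and ex1: "d (Suc n) ` carrier (P (Suc (Suc n))) = a_kernel (P (Suc n)) (P n) (d n)" for n
    using res unfolding proj_resolution_def by simp_all
  note Pm = projective_left_module[OF P]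
  have T: "Tor R 1 A M = (tensor R (P 1) M)\<lparr>carrier := kernel (tensor R (P 1) M) (tensor R (P 0) M) (tensor_map R (P 0) M (d 0))\<rparr>
      Mod (tensor_map R (P 1) M (d 1) ` carrier (tensor R (P 2) M))"
    unfolding Tor_def s by (simp add: numeral_2_eq_2)
  have "carrier (Tor R 1 A M) = {\<one>\<^bsub>Tor R 1 A M\<^esub>} \<longleftrightarrow> tens_inj R (P 0) (d 0 ` carrier (P 1)) M"
    unfolding T
    by (rule tensor_homology_trivial_iff[OF Pm Pm Pm M])
       (use d[of 0] d[of 1] ex1[of 0] in \<open>simp_all add: numeral_2_eq_2\<close>)
  then show ?thesis using tor_zero_iff_left[OF P A e M] ex0 by simp
qed


section \<open>Direct sums, direct summands and biproducts\<close>

lemma is_summand_retract: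
  assumes A: "left_module R A" and M: "left_module R M"
  shows "is_summand R A M \<longleftrightarrow> retract R A M"
proof
  interpret M: left_module R M by fact
  assume "is_summand R A M"
  then obtain X Y where ds: "direct_sum2 M R X Y" and iso: "mod_iso R A (submod M X)" by (auto simp: is_summand_def)
  have X: "submodule X R M" using ds by (simp add: direct_sum2_def)
  obtain e where e: "e \<in> mod_hom R M M" "\<And>z. z \<in> carrier M \<Longrightarrow> e z \<in> X" "\<And>x. x \<in> X \<Longrightarrow> e x = x"
    using direct_sum2_projection[OF M ds] by blast
  have "retract R (submod M X) M"
    unfolding retract_def
    by (rule bexI[OF _ mod_hom_incl[OF submoduleD(2)[OF X]]], rule bexI[OF _ mod_hom_corestrict[OF e(1,2)]]) (simp_all add: e(3))
  then show "retract R A M" using mod_iso_retract[OF A iso] retract_trans by blast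
next
  interpret M: left_module R M by fact
  interpret A: left_module R A by fact
  assume "retract R A M"
  then obtain i p where i: "i \<in> mod_hom R A M" and p: "p \<in> mod_hom R M A" and pi: "\<And>x. x \<in> carrier A \<Longrightarrow> p (i x) = x"
    unfolding retract_def by blast
  let ?X = "i ` carrier A" and ?Y = "a_kernel M A p"
  have X: "submodule ?X R M" by (rule submodule_image[OF A M i A.submodule_carrier])
  have Y: "submodule ?Y R M" by (rule submodule_kernel[OF M A p])
  have i0: "i \<zero>\<^bsub>A\<^esub> = \<zero>\<^bsub>M\<^esub>" by (rule mod_hom_zero[OF A M i])
  have "?X \<inter> ?Y = {\<zero>\<^bsub>M\<^esub>}"
  proof
    show "?X \<inter> ?Y \<subseteq> {\<zero>\<^bsub>M\<^esub>}" using pi i0 by (auto simp: a_kernel_iff)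
    show "{\<zero>\<^bsub>M\<^esub>} \<subseteq> ?X \<inter> ?Y" using submoduleD(3)[OF X] submoduleD(3)[OF Y] by simp
  qed
  moreover have "?X <+>\<^bsub>M\<^esub> ?Y = carrier M"
  proof
    show "?X <+>\<^bsub>M\<^esub> ?Y \<subseteq> carrier M" by (rule submoduleD(2)[OF M.submodule_set_add[OF X Y]])
    show "carrier M \<subseteq> ?X <+>\<^bsub>M\<^esub> ?Y"
    proof
      fix z assume z: "z \<in> carrier M"
      have pz: "p z \<in> carrier A" by (rule mod_homD(1)[OF p z])
      have ipz: "i (p z) \<in> carrier M" by (rule mod_homD(1)[OF i pz])
      have "p (z \<ominus>\<^bsub>M\<^esub> i (p z)) = \<zero>\<^bsub>A\<^esub>"
        using mod_hom_minus[OF M A p z ipz] pi[OF pz] pz by (simp add: a_minus_def A.M.r_neg)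
      then have "z \<ominus>\<^bsub>M\<^esub> i (p z) \<in> ?Y" using z ipz by (simp add: a_kernel_iff)
      moreover have "z = i (p z) \<oplus>\<^bsub>M\<^esub> (z \<ominus>\<^bsub>M\<^esub> i (p z))" using M.add_diff_cancel[OF z ipz] by simp
      ultimately show "z \<in> ?X <+>\<^bsub>M\<^esub> ?Y" unfolding set_add_iff using pz by blast
    qed
  qed
  ultimately have "direct_sum2 M R ?X ?Y" using X Y by (simp add: direct_sum2_def)
  moreover have "mod_iso R A (submod M ?X)"
    unfolding mod_iso_def
  proof (rule bexI)
    show "i \<in> mod_hom R A (submod M ?X)" by (rule mod_hom_corestrict[OF i]) blast
    have "inj_on i (carrier A)" by (rule inj_on_inverseI[of _ p]) (rule pi)
    then show "bij_betw i (carrier A) (carrier (submod M ?X))" by (simp add: bij_betw_def)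
  qed
  ultimately show "is_summand R A M" unfolding is_summand_def by blast
qed

lemma direct_sum2_biproduct:
  assumes M: "left_module R M" and ds: "direct_sum2 M R X Y"
  shows "\<exists>\<pi>. biproduct R M (\<lambda>b. submod M (if b then X else Y)) (\<lambda>b x. x) \<pi>"
proof -
  interpret M: left_module R M by fact
  have X: "submodule X R M" and Y: "submodule Y R M" and int: "X \<inter> Y = {\<zero>\<^bsub>M\<^esub>}"
    using ds by (auto simp: direct_sum2_def)
  obtain e where e: "e \<in> mod_hom R M M" "\<And>z. z \<in> carrier M \<Longrightarrow> e z \<in> X"
    "\<And>z. z \<in> carrier M \<Longrightarrow> z \<ominus>\<^bsub>M\<^esub> e z \<in> Y" "\<And>x. x \<in> X \<Longrightarrow> e x = x"
    using direct_sum2_projection[OF M ds] by blast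
  note E = mod_homD[OF e(1)] and DX = submoduleD[OF X] and DY = submoduleD[OF Y]
  have eY: "e y = \<zero>\<^bsub>M\<^esub>" if y: "y \<in> Y" for y
  proof -
    have yc: "y \<in> carrier M" by (rule DY(1)[OF y])
    have "y \<ominus>\<^bsub>M\<^esub> (y \<ominus>\<^bsub>M\<^esub> e y) \<in> Y" by (rule M.submodule_minus[OF Y y e(3)[OF yc]])
    moreover have "y \<ominus>\<^bsub>M\<^esub> (y \<ominus>\<^bsub>M\<^esub> e y) = e y"
      using yc E(1)[OF yc] by (simp add: a_minus_def M.M.minus_add M.M.r_neg2)
    ultimately show ?thesis using e(2)[OF yc] int by auto
  qed
  let ?\<pi> = "\<lambda>b z. if b then e z else z \<ominus>\<^bsub>M\<^esub> e z"
  have "biproduct R M (\<lambda>b. submod M (if b then X else Y)) (\<lambda>b x. x) ?\<pi>"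
  proof (rule biproduct.intro)
    show "left_module R (submod M (if b then X else Y))" for b by (cases b) (simp_all add: M.left_module_submod X Y)
    show "(\<lambda>x. x) \<in> mod_hom R (submod M (if b then X else Y)) M" for b
      by (cases b) (simp_all add: mod_hom_incl DX(2) DY(2))
    have "(\<lambda>z. z \<ominus>\<^bsub>M\<^esub> e z) \<in> mod_hom R M M" by (rule mod_hom_add_map(2)[OF M M mod_hom_id e(1)])
    then show "?\<pi> b \<in> mod_hom R M (submod M (if b then X else Y))" for b
      using mod_hom_corestrict[OF e(1,2)] mod_hom_corestrict[of "\<lambda>z. z \<ominus>\<^bsub>M\<^esub> e z" R M M Y] e(3) by (cases b) simp_all
    fix x S assume x: "x \<in> carrier M" and S: "submodule S R M" and *: "\<And>b. ?\<pi> b x \<in> S"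
    from submoduleD(4)[OF S *[of True] *[of False]] show "x \<in> S"
      using M.add_diff_cancel[OF x E(1)[OF x]] by simp
  qed (use DX(1) DY(1) in \<open>auto simp: M e(4) eY a_minus_def M.M.r_neg split: if_splits\<close>)
  then show ?thesis by blast
qed

text \<open>The members of \<open>\<B>\<close> as a family indexed by all subsets of \<open>M\<close>, as required by \<open>ext_sum\<close>.\<close>

definition terms :: "('r, 'm) module \<Rightarrow> 'm set set \<Rightarrow> 'm set \<Rightarrow> ('r, 'm) module" where
  "terms M \<B> B = submod M (if B \<in> \<B> then B else {\<zero>\<^bsub>M\<^esub>})"

lemma terms_family:
  assumes M: "left_module R M" and B: "\<forall>B\<in>\<B>. submodule B R M"
  shows "module_family R (terms M \<B>)"
  by (rule module_family.intro)
     (simp add: terms_def left_module.left_module_submod[OF M] B left_module.submodule_zero[OF M])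

lemma terms_incl:
  assumes M: "left_module R M" and B: "\<forall>B\<in>\<B>. submodule B R M"
  shows "(\<lambda>x. x) \<in> mod_hom R (terms M \<B> B) M"
  unfolding terms_def
  by (rule mod_hom_incl) (use submoduleD(2)[OF B[rule_format]] left_module.submodule_zero[OF M, THEN submoduleD(2)] in \<open>simp split: if_splits\<close>)

lemma terms_zero [simp]: "\<zero>\<^bsub>terms M \<B> B\<^esub> = \<zero>\<^bsub>M\<^esub>"
  by (simp add: terms_def)


abbreviation sum_map :: "('r, 'm) module \<Rightarrow> ('m set \<Rightarrow> 'm) \<Rightarrow> 'm" where
  "sum_map M e \<equiv> (\<Oplus>\<^bsub>M\<^esub>B\<in>{B. e B \<noteq> \<zero>\<^bsub>M\<^esub>}. e B)"

lemma sum_map_hom: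
  assumes M: "left_module R M" and B: "\<forall>B\<in>\<B>. submodule B R M"
  shows "sum_map M \<in> mod_hom R (ext_sum (terms M \<B>)) M"
    "c \<in> carrier (terms M \<B> B) \<Longrightarrow> sum_map M (single (terms M \<B>) B c) = c"
  using module_family.ext_sum_finsum_hom[OF terms_family[OF M B] M, of "\<lambda>B x. x", OF terms_incl[OF M B]] by simp_all

text \<open>Restriction to \<open>\<B>\<close> identifies the finitely supported families over all subsets with the partial
  functions used in the definition of internal direct sums.\<close>

lemma direct_sum_iff_sum_map:
  assumes M: "left_module R M" and B: "\<forall>B\<in>\<B>. submodule B R M"
  shows "direct_sum M R \<B> \<longleftrightarrow> bij_betw (sum_map M) (carrier (ext_sum (terms M \<B>))) (carrier M)"
proof -
  let ?E = "carrier (ext_sum (terms M \<B>))"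
  let ?D = "{f \<in> \<Pi>\<^sub>E B\<in>\<B>. B. finite {B \<in> \<B>. f B \<noteq> \<zero>\<^bsub>M\<^esub>}}"
  let ?g = "\<lambda>f. \<Oplus>\<^bsub>M\<^esub>B\<in>{B \<in> \<B>. f B \<noteq> \<zero>\<^bsub>M\<^esub>}. f B"
  let ?r = "\<lambda>e. restrict e \<B>"
  let ?r' = "\<lambda>f B. if B \<in> \<B> then f B else \<zero>\<^bsub>M\<^esub>"
  have E: "e \<in> ?E \<longleftrightarrow> (\<forall>B\<in>\<B>. e B \<in> B) \<and> (\<forall>B. B \<notin> \<B> \<longrightarrow> e B = \<zero>\<^bsub>M\<^esub>) \<and> finite {B. e B \<noteq> \<zero>\<^bsub>M\<^esub>}" for e
    by (auto simp: terms_def split: if_splits)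
  have supp: "{B. e B \<noteq> \<zero>\<^bsub>M\<^esub>} = {B \<in> \<B>. e B \<noteq> \<zero>\<^bsub>M\<^esub>}" if "e \<in> ?E" for e using that unfolding E by blast
  have bij: "bij_betw ?r ?E ?D"
  proof (rule bij_betw_byWitness[where f' = ?r'])
    show "\<forall>e\<in>?E. ?r' (?r e) = e"
    proof
      fix e assume "e \<in> ?E"
      then have "\<forall>B. B \<notin> \<B> \<longrightarrow> e B = \<zero>\<^bsub>M\<^esub>" unfolding E by blast
      then show "?r' (?r e) = e" by (intro ext) simp
    qed
    show "\<forall>f\<in>?D. ?r (?r' f) = f" by (auto simp: PiE_def extensional_def)
    show "?r ` ?E \<subseteq> ?D"
    proof
      fix f assume "f \<in> ?r ` ?E"
      then obtain e where e: "e \<in> ?E" "f = ?r e" by blast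
      have "{B \<in> \<B>. f B \<noteq> \<zero>\<^bsub>M\<^esub>} = {B. e B \<noteq> \<zero>\<^bsub>M\<^esub>}" using supp[OF e(1)] e(2) by auto
      then show "f \<in> ?D" using e unfolding E by auto
    qed
    show "?r' ` ?D \<subseteq> ?E"
    proof
      fix e assume "e \<in> ?r' ` ?D"
      then obtain f where f: "f \<in> ?D" "e = ?r' f" by blast
      have "{B. e B \<noteq> \<zero>\<^bsub>M\<^esub>} = {B \<in> \<B>. f B \<noteq> \<zero>\<^bsub>M\<^esub>}" using f(2) by auto
      then show "e \<in> ?E" using f unfolding E by auto
    qed
  qed
  have eq: "?g (?r e) = sum_map M e" if e: "e \<in> ?E" for e
  proof -
    interpret M: left_module R M by fact
    have s: "{B \<in> \<B>. ?r e B \<noteq> \<zero>\<^bsub>M\<^esub>} = {B. e B \<noteq> \<zero>\<^bsub>M\<^esub>}" using supp[OF e] by auto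
    show ?thesis
      by (rule M.M.finsum_cong'[OF s]) (use e supp[OF e] submoduleD(1)[OF B[rule_format]] in \<open>unfold E, auto\<close>)
  qed
  have "direct_sum M R \<B> \<longleftrightarrow> bij_betw ?g ?D (carrier M)"
    unfolding direct_sum_def using B by blast
  also have "\<dots> \<longleftrightarrow> bij_betw (?g \<circ> ?r) ?E (carrier M)" by (rule bij_betw_comp_iff[OF bij])
  also have "\<dots> \<longleftrightarrow> bij_betw (sum_map M) ?E (carrier M)" 
  proof (rule bij_betw_cong)
    fix e assume "e \<in> ?E"
    then show "(?g \<circ> ?r) e = sum_map M e" unfolding comp_apply by (rule eq)
  qed
  finally show ?thesis .
qed

lemma direct_sum_biproduct:
  assumes M: "left_module R M" and ds: "direct_sum M R \<B>"
  shows "\<exists>\<iota> \<pi>. biproduct R M (terms M \<B>) \<iota> \<pi>"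
proof -
  have B: "\<forall>B\<in>\<B>. submodule B R M" using ds by (simp add: direct_sum_def)
  show ?thesis
    using biproduct_iso[OF module_family.ext_sum_biproduct[OF terms_family[OF M B]] M sum_map_hom(1)[OF M B]]
      direct_sum_iff_sum_map[OF M B] ds by blast
qed

text \<open>The images of the nonzero summands are pairwise distinct, so they may be indexed by themselves.\<close>

lemma biproduct_direct_sum:
  fixes M :: "('r, 'm) module" and C :: "'i \<Rightarrow> ('r, 'c) module"
  assumes b: "biproduct R M C \<iota> \<pi>"
  shows "direct_sum M R {\<iota> i ` carrier (C i) | i. carrier (C i) \<noteq> {\<zero>\<^bsub>C i\<^esub>}}" (is "direct_sum M R ?\<B>")
proof -
  interpret biproduct R M C \<iota> \<pi> by fact
  interpret M: left_module R M by (rule total)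
  interpret C: left_module R "C k" for k by (rule summand)
  let ?N = "\<lambda>i. carrier (C i) \<noteq> {\<zero>\<^bsub>C i\<^esub>}"
  let ?I = "\<lambda>i. \<iota> i ` carrier (C i)"
  have sub: "submodule (?I i) R M" for i by (rule submodule_image[OF summand total inj C.submodule_carrier])
  have B: "\<forall>B\<in>?\<B>. submodule B R M" using sub by blast
  have inc0: "\<iota> i \<zero>\<^bsub>C i\<^esub> = \<zero>\<^bsub>M\<^esub>" for i by (rule mod_hom_zero[OF summand total inj])
  have pr0: "\<pi> i \<zero>\<^bsub>M\<^esub> = \<zero>\<^bsub>C i\<^esub>" for i by (rule mod_hom_zero[OF total summand proj])
  have neq: "?I i \<noteq> ?I j" if ij: "i \<noteq> j" and nz: "?N i" for i j
  proof
    assume eq: "?I i = ?I j"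
    obtain c where c: "c \<in> carrier (C i)" "c \<noteq> \<zero>\<^bsub>C i\<^esub>" using nz C.M.zero_closed[of i] by blast
    have "\<iota> i c \<in> ?I j" using c(1) unfolding eq[symmetric] by (rule imageI)
    then obtain c' where c': "\<iota> i c = \<iota> j c'" "c' \<in> carrier (C j)" by (rule imageE)
    have "c = \<pi> i (\<iota> j c')" using proj_inj[OF c(1)] c'(1) by simp
    then show False using proj_inj_neq[OF ij c'(2)] c(2) by simp
  qed
  let ?T = "terms M ?\<B>"
  let ?E = "ext_sum ?T"
  interpret F: module_family R ?T by (rule terms_family[OF total B])
  note H = sum_map_hom[OF total B]
  have T0: "carrier (?T B) = {\<zero>\<^bsub>M\<^esub>}" if "B \<notin> ?\<B>" for B
    using that by (simp only: terms_def if_False submod_simps simp_thms)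
  have T: "carrier (?T (?I i)) = ?I i" if "?N i" for i using that by (auto simp: terms_def)
  have pi_sum: "\<pi> i (sum_map M e) = \<pi> i (e (?I i))" if ni: "?N i" and e: "e \<in> carrier ?E" for i e
  proof (rule F.ext_sum_hom_eqI[OF summand mod_hom_comp[OF H(1) proj] mod_hom_comp[OF F.proj_hom] _ e])
    show "\<pi> i \<in> mod_hom R (?T (?I i)) (C i)"
      unfolding terms_def by (rule mod_hom_restrict[OF proj]) (use submoduleD(2)[OF sub] in simp)
    fix B c assume c: "c \<in> carrier (?T B)"
    show "\<pi> i (sum_map M (single ?T B c)) = \<pi> i (single ?T B c (?I i))"
    proof (cases "B = ?I i")
      case True
      then show ?thesis using H(2)[OF c] by (simp add: single_def)
    next
      case False
      have "\<pi> i c = \<zero>\<^bsub>C i\<^esub>"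
      proof (cases "B \<in> ?\<B>")
        case True
        then obtain j where j: "B = ?I j" "?N j" by blast
        then have "c \<in> ?I j" using c T by simp
        then obtain c' where "c = \<iota> j c'" "c' \<in> carrier (C j)" by (rule imageE)
        then show ?thesis using proj_inj_neq[of i j c'] False j by auto
      next
        case False
        then have "c = \<zero>\<^bsub>M\<^esub>" using c T0 by blast
        then show ?thesis using pr0 by simp
      qed
      then show ?thesis using H(2)[OF c] False pr0 by (simp add: single_def)
    qed
  qed
  have "inj_on (sum_map M) (carrier ?E)"
  proof (rule inj_on_kernel[OF F.ext_sum_left_module total H(1)])
    fix e assume e: "e \<in> carrier ?E" and z: "sum_map M e = \<zero>\<^bsub>M\<^esub>"
    have "e B = \<zero>\<^bsub>M\<^esub>" for B
    proof (cases "B \<in> ?\<B>")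
      case True
      then obtain i where i: "B = ?I i" "?N i" by blast
      have "e B \<in> carrier (?T B)" using e by simp
      then have "e B \<in> ?I i" using T i by simp
      then obtain c where c: "e B = \<iota> i c" "c \<in> carrier (C i)" by (rule imageE)
      have "c = \<zero>\<^bsub>C i\<^esub>" using pi_sum[OF i(2) e] z pr0 c i(1) proj_inj by simp
      then show ?thesis using c inc0 by simp
    next
      case False
      have "e B \<in> carrier (?T B)" using e by simp
      then show ?thesis using T0[OF False] by blast
    qed
    then show "e = \<zero>\<^bsub>?E\<^esub>" by auto
  qed
  moreover have "sum_map M ` carrier ?E = carrier M"
  proof
    show "sum_map M ` carrier ?E \<subseteq> carrier M" using mod_homD(1)[OF H(1)] by blast
    show "carrier M \<subseteq> sum_map M ` carrier ?E"
    proof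
      fix x assume x: "x \<in> carrier M"
      have S: "submodule (sum_map M ` carrier ?E) R M"
        by (rule submodule_image[OF F.ext_sum_left_module total H(1) left_module.submodule_carrier[OF F.ext_sum_left_module]])
      show "x \<in> sum_map M ` carrier ?E"
      proof (rule gen[OF x S])
        fix i
        have p: "\<pi> i x \<in> carrier (C i)" by (rule mod_homD(1)[OF proj x])
        show "\<iota> i (\<pi> i x) \<in> sum_map M ` carrier ?E"
        proof (cases "?N i")
          case True
          have c: "\<iota> i (\<pi> i x) \<in> carrier (?T (?I i))" using T[OF True] p by simp
          show ?thesis
            by (rule image_eqI[OF _ mod_homD(1)[OF F.single_hom c]]) (simp only: H(2)[OF c])
        next
          case False
          then have "\<pi> i x = \<zero>\<^bsub>C i\<^esub>" using p by blast
          then show ?thesis using inc0 submoduleD(3)[OF S] by simp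
        qed
      qed
    qed
  qed
  ultimately show ?thesis unfolding direct_sum_iff_sum_map[OF total B] bij_betw_def by blast
qed

lemma biproduct_image_retract:
  assumes "biproduct R M C \<iota> \<pi>"
  shows "retract R (submod M (\<iota> i ` carrier (C i))) (C i)" "retract R (C i) (submod M (\<iota> i ` carrier (C i)))"
proof -
  interpret biproduct R M C \<iota> \<pi> by fact
  have "mod_iso R (C i) (submod M (\<iota> i ` carrier (C i)))"
    unfolding mod_iso_def
  proof (rule bexI)
    show "\<iota> i \<in> mod_hom R (C i) (submod M (\<iota> i ` carrier (C i)))" by (rule mod_hom_corestrict[OF inj]) blast
    have "inj_on (\<iota> i) (carrier (C i))" by (rule inj_on_inverseI[of _ "\<pi> i"]) (rule proj_inj)
    then show "bij_betw (\<iota> i) (carrier (C i)) (carrier (submod M (\<iota> i ` carrier (C i))))" by (simp add: bij_betw_def)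
  qed
  from mod_iso_retract[OF summand this]
  show "retract R (submod M (\<iota> i ` carrier (C i))) (C i)" "retract R (C i) (submod M (\<iota> i ` carrier (C i)))" by auto
qed

lemma direct_sum_self: "left_module R X \<Longrightarrow> direct_sum X R ({carrier X} - {{\<zero>\<^bsub>X\<^esub>}})"
proof -
  assume X: "left_module R X"
  have "biproduct R X (\<lambda>_ :: unit. X) (\<lambda>_ x. x) (\<lambda>_ x. x)"
    by (rule biproduct.intro) (simp_all add: X mod_hom_id)
  from biproduct_direct_sum[OF this]
  have "direct_sum X R {carrier X | i :: unit. carrier X \<noteq> {\<zero>\<^bsub>X\<^esub>}}" by simp
  moreover have "{carrier X | i :: unit. carrier X \<noteq> {\<zero>\<^bsub>X\<^esub>}} = {carrier X} - {{\<zero>\<^bsub>X\<^esub>}}" by auto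
  ultimately show ?thesis by (simp only:)
qed

lemma (in left_artinian) in_syzygy_categoryI:
  assumes T: "left_module R T" and X: "left_module R X" and ret: "retract R X (syzygy R T j)"
  shows "in_syzygy_category R T X"
  unfolding in_syzygy_category_def in_add_def
proof (intro conjI X exI)
  show "finite ({carrier X} - {{\<zero>\<^bsub>X\<^esub>}})" by simp
  show "direct_sum X R ({carrier X} - {{\<zero>\<^bsub>X\<^esub>}})" by (rule direct_sum_self[OF X])
  show "\<forall>B\<in>{carrier X} - {{\<zero>\<^bsub>X\<^esub>}}. \<exists>A\<in>range (syzygy R T). is_summand R (submod X B) A"
    using ret is_summand_retract[OF X syzygy_left_module[OF T, of j]] by auto
qed

section \<open>Minimal resolutions\<close>

lemma retract_zero:
  assumes A: "left_module R A" and X: "left_module R X" and ret: "retract R A X" and z: "carrier X = {\<zero>\<^bsub>X\<^esub>}"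
  shows "carrier A = {\<zero>\<^bsub>A\<^esub>}"
proof -
  obtain i p where i: "i \<in> mod_hom R A X" and p: "p \<in> mod_hom R X A" and pi: "\<And>x. x \<in> carrier A \<Longrightarrow> p (i x) = x"
    using ret unfolding retract_def by blast
  have "x = \<zero>\<^bsub>A\<^esub>" if x: "x \<in> carrier A" for x
    using mod_homD(1)[OF i x] z pi[OF x] mod_hom_zero[OF X A p] by simp
  then show ?thesis using left_module.submodule_carrier[OF A, THEN submoduleD(3)] by blast
qed

lemma superfluous_carrier:
  assumes P: "left_module R P" and sup: "superfluous R P (carrier P)"
  shows "carrier P = {\<zero>\<^bsub>P\<^esub>}"
proof -
  interpret P: left_module R P by fact
  have "{\<zero>\<^bsub>P\<^esub>} <+>\<^bsub>P\<^esub> carrier P = carrier P" by (auto simp: set_add_def')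
  then show ?thesis using sup P.submodule_zero unfolding superfluous_def by auto
qed

lemma projective_cover_zero:
  assumes cov: "projective_cover R P f X" and z: "carrier X = {\<zero>\<^bsub>X\<^esub>}"
  shows "carrier P = {\<zero>\<^bsub>P\<^esub>}"
proof -
  have f: "f \<in> mod_hom R P X" and P: "left_module R P" and sup: "superfluous R P (a_kernel P X f)"
    using cov by (auto simp: projective_cover_def projective_left_module)
  have "a_kernel P X f = carrier P" using mod_homD(1)[OF f] z by (auto simp: a_kernel_iff)
  then show ?thesis using superfluous_carrier[OF P] sup by simp
qed

context left_artinian
begin

lemma syz_zero: "left_module R X \<Longrightarrow> carrier X = {\<zero>\<^bsub>X\<^esub>} \<Longrightarrow> carrier (syz R X) = {\<zero>\<^bsub>syz R X\<^esub>}"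
proof -
  assume X: "left_module R X" "carrier X = {\<zero>\<^bsub>X\<^esub>}"
  obtain P f where cov: "projective_cover R P f X" and s: "syz R X = submod P (a_kernel P X f)"
    using cover_some[OF X(1)] by blast
  have f: "f \<in> mod_hom R P X" using cov by (simp add: projective_cover_def)
  have "a_kernel P X f = carrier P" using mod_homD(1)[OF f] X(2) by (auto simp: a_kernel_iff)
  then show ?thesis using projective_cover_zero[OF cov X(2)] s by simp
qed

lemma syzygy_zero_mono:
  assumes M: "left_module R M" and z: "carrier (syzygy R M n) = {\<zero>\<^bsub>syzygy R M n\<^esub>}" and "n \<le> m"
  shows "carrier (syzygy R M m) = {\<zero>\<^bsub>syzygy R M m\<^esub>}"
  using \<open>n \<le> m\<close>
proof (induction m rule: dec_induct)
  case base show ?case by (rule z)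
next
  case (step m)
  show ?case unfolding syzygy_Suc by (rule syz_zero[OF syzygy_left_module[OF M] step.IH])
qed

lemma syz_zero_projective:
  fixes X :: "('r, ('r, 'm) mod_univ) module"
  assumes X: "left_module R X" and z: "carrier (syz R X) = {\<zero>\<^bsub>syz R X\<^esub>}"
  shows "projective R X"
proof -
  obtain P f where cov: "projective_cover R P f X" and s: "syz R X = submod P (a_kernel P X f)"
    using cover_some[OF X] by blast
  have P: "projective R P" and f: "f \<in> mod_hom R P X" "f ` carrier P = carrier X"
    using cov by (auto simp: projective_cover_def)
  have ker: "a_kernel P X f = {\<zero>\<^bsub>P\<^esub>}" using z s by simp
  have "inj_on f (carrier P)"
    by (rule inj_on_kernel[OF projective_left_module[OF P] X f(1)]) (use ker in \<open>auto simp: a_kernel_iff set_eq_iff\<close>)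
  then show ?thesis using projective_iso[OF P X f(1)] f(2) by (simp add: bij_betw_def)
qed

text \<open>The projective covers of the syzygies, spliced together.\<close>

lemma minimal_resolution:
  fixes M :: "('r, 'm) module"
  assumes M: "left_module R M"
  shows "\<exists>(P :: nat \<Rightarrow> ('r, ('r, 'm) mod_univ) module) \<epsilon> d. proj_resolution R M P \<epsilon> d \<and>
    (\<forall>k. carrier (syzygy R M k) = {\<zero>\<^bsub>syzygy R M k\<^esub>} \<longrightarrow> carrier (P k) = {\<zero>\<^bsub>P k\<^esub>})"
proof -
  let ?S = "syzygy R M"
  have "\<exists>(P :: ('r, ('r, 'm) mod_univ) module) f. projective_cover R P f (?S n) \<and> ?S (Suc n) = submod P (a_kernel P (?S n) f)" for n
    unfolding syzygy_Suc using cover_some[OF syzygy_left_module[OF M, of n]] by blast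
  then obtain P :: "nat \<Rightarrow> ('r, ('r, 'm) mod_univ) module" and f where
    cov: "\<And>n. projective_cover R (P n) (f n) (?S n)" and S: "\<And>n. ?S (Suc n) = submod (P n) (a_kernel (P n) (?S n) (f n))"
    by metis
  have P: "projective R (P n)" and f: "f n \<in> mod_hom R (P n) (?S n)" "f n ` carrier (P n) = carrier (?S n)" for n
    using cov[of n] by (auto simp: projective_cover_def)
  note copy = univ_copy_iso[OF M]
  let ?dec = "inv_into (carrier M) Base :: ('r, 'm) mod_univ \<Rightarrow> 'm"
  have dec: "?dec \<in> mod_hom R (univ_copy M) M" by (rule mod_hom_inv_into[OF M copy(2,3)])
  have dec_bij: "bij_betw ?dec (carrier (univ_copy M)) (carrier M)" by (rule bij_betw_inv_into[OF copy(3)])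
  let ?\<epsilon> = "\<lambda>x. ?dec (f 0 x)" and ?d = "\<lambda>n. f (Suc n)"
  have f0: "f 0 \<in> mod_hom R (P 0) (univ_copy M)" "f 0 ` carrier (P 0) = carrier (univ_copy M)" using f[of 0] by simp_all
  have "proj_resolution R M P ?\<epsilon> ?d"
    unfolding proj_resolution_def
  proof (intro conjI allI)
    show "projective R (P n)" for n by (rule P)
    show "?\<epsilon> \<in> mod_hom R (P 0) M" by (rule mod_hom_comp[OF f0(1) dec])
    show "?d n \<in> mod_hom R (P (Suc n)) (P n)" for n
      by (rule mod_hom_expand[of _ _ _ _ "a_kernel (P n) (?S n) (f n)"]) (use f(1)[of "Suc n"] S in \<open>auto simp: a_kernel_iff\<close>)
    have "?\<epsilon> ` carrier (P 0) = ?dec ` carrier (univ_copy M)" using f0(2) by (simp flip: image_image)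
    then show "?\<epsilon> ` carrier (P 0) = carrier M" using dec_bij by (simp add: bij_betw_def)
    have "?dec y = \<zero>\<^bsub>M\<^esub> \<longleftrightarrow> y = \<zero>\<^bsub>univ_copy M\<^esub>" if "y \<in> carrier (univ_copy M)" for y
      using that dec_bij mod_hom_zero[OF copy(1) M dec] left_module.submodule_carrier[OF copy(1), THEN submoduleD(3)]
      by (metis bij_betw_def inj_onD)
    then have "a_kernel (P 0) (?S 0) (f 0) = a_kernel (P 0) M ?\<epsilon>"
      using mod_homD(1)[OF f0(1)] mod_hom_zero[OF copy(1) M dec] by (auto simp: a_kernel_iff)
    then show "?d 0 ` carrier (P 1) = a_kernel (P 0) M ?\<epsilon>" using f(2)[of 1] S[of 0] by simp
    fix n
    have "a_kernel (P (Suc n)) (?S (Suc n)) (f (Suc n)) = a_kernel (P (Suc n)) (P n) (?d n)"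
      using S[of n] by (auto simp: a_kernel_iff)
    then show "?d (Suc n) ` carrier (P (Suc (Suc n))) = a_kernel (P (Suc n)) (P n) (?d n)"
      using f(2)[of "Suc (Suc n)"] S[of "Suc n"] by simp
  qed
  moreover have "carrier (P k) = {\<zero>\<^bsub>P k\<^esub>}" if "carrier (?S k) = {\<zero>\<^bsub>?S k\<^esub>}" for k
    by (rule projective_cover_zero[OF cov that])
  ultimately show ?thesis by blast
qed

lemma syz_retract_kernel:
  assumes X: "left_module R X" and YQ: "left_module R Y" "projective R Q" "g \<in> mod_hom R Q Y"
    "g ` carrier Q = carrier Y" "retract R X Y"
  shows "retract R (syz R X) (submod Q (a_kernel Q Y g))"
proof -
  obtain P' f where cov: "projective_cover R P' f X" and s: "syz R X = submod P' (a_kernel P' X f)"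
    using cover_some[OF X] by blast
  show ?thesis unfolding s by (rule kernel_retract[OF cov X YQ])
qed

text \<open>The minimal syzygies are direct summands of the kernels of an arbitrary projective resolution, by induction
  along the two resolutions.\<close>

lemma minimal_syzygy_retract:
  assumes M: "left_module R M" and res: "proj_resolution R M P \<epsilon> d"
  shows "retract R (syzygy R M (Suc j)) (submod (P j) (d j ` carrier (P (Suc j))))"
proof -
  have P: "projective R (P n)" and e: "\<epsilon> \<in> mod_hom R (P 0) M" "\<epsilon> ` carrier (P 0) = carrier M"
    and d: "d n \<in> mod_hom R (P (Suc n)) (P n)" and ex0: "d 0 ` carrier (P 1) = a_kernel (P 0) M \<epsilon>"
    and ex1: "d (Suc n) ` carrier (P (Suc (Suc n))) = a_kernel (P (Suc n)) (P n) (d n)" for n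
    using res unfolding proj_resolution_def by simp_all
  note Pm = projective_left_module[OF P]
  show ?thesis
  proof (induction j)
    case 0
    note copy = univ_copy_iso[OF M]
    have "mod_iso R M (univ_copy M)" unfolding mod_iso_def using copy(2,3) by blast
    then have "retract R (univ_copy M) M" using mod_iso_retract[OF M] by blast
    then show ?case
      unfolding syzygy_Suc using syz_retract_kernel[OF copy(1) M P e] ex0 by simp
  next
    case (Suc j)
    let ?Y = "submod (P j) (d j ` carrier (P (Suc j)))"
    have sub: "submodule (d j ` carrier (P (Suc j))) R (P j)"
      by (rule submodule_image[OF Pm Pm d left_module.submodule_carrier[OF Pm]])
    have "retract R (syz R (syzygy R M (Suc j))) (submod (P (Suc j)) (a_kernel (P (Suc j)) ?Y (d j)))"
    proof (rule syz_retract_kernel[OF syzygy_left_module[OF M] _ P _ _ Suc.IH])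
      show "left_module R ?Y" by (rule left_module.left_module_submod[OF Pm sub])
      show "d j \<in> mod_hom R (P (Suc j)) ?Y" by (rule mod_hom_corestrict[OF d]) blast
    qed simp
    moreover have "a_kernel (P (Suc j)) ?Y (d j) = d (Suc j) ` carrier (P (Suc (Suc j)))"
      unfolding ex1 by (auto simp: a_kernel_iff)
    ultimately show ?case unfolding syzygy_Suc[of R M "Suc j"] by simp
  qed
qed

lemma Inf_enat_mem: "(D :: enat set) \<noteq> {} \<Longrightarrow> Inf D \<in> D"
  unfolding Inf_enat_def using LeastI[of "\<lambda>x. x \<in> D"] by auto

text \<open>A resolution that stops at \<open>n\<close> has kernel zero there, and the next minimal syzygy is a direct
  summand of it. Conversely the minimal resolution stops once a syzygy is zero.\<close>

lemma pdim_le_iff: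
  fixes M :: "('r, 'm) module"
  assumes M: "left_module R M"
  shows "pdim R M \<le> enat n \<longleftrightarrow> carrier (syzygy R M (Suc n)) = {\<zero>\<^bsub>syzygy R M (Suc n)\<^esub>}"
proof
  let ?L = "\<lambda>n. \<exists>(P :: nat \<Rightarrow> ('r, ('r, 'm) mod_univ) module) \<epsilon> d.
       proj_resolution R M P \<epsilon> d \<and> (\<forall>k>n. carrier (P k) = {\<zero>\<^bsub>P k\<^esub>})"
  have pd: "pdim R M = Inf {enat n | n. ?L n}" by (simp add: pdim_def)
  show "pdim R M \<le> enat n" if z: "carrier (syzygy R M (Suc n)) = {\<zero>\<^bsub>syzygy R M (Suc n)\<^esub>}"
  proof -
    obtain P :: "nat \<Rightarrow> ('r, ('r, 'm) mod_univ) module" and \<epsilon> d where res: "proj_resolution R M P \<epsilon> d"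
      and P: "\<And>k. carrier (syzygy R M k) = {\<zero>\<^bsub>syzygy R M k\<^esub>} \<Longrightarrow> carrier (P k) = {\<zero>\<^bsub>P k\<^esub>}"
      using minimal_resolution[OF M] by blast
    have "carrier (P k) = {\<zero>\<^bsub>P k\<^esub>}" if "k > n" for k
      by (rule P, rule syzygy_zero_mono[OF M z]) (use that in simp)
    then have "?L n" using res by blast
    then have "enat n \<in> {enat n | n. ?L n}" by blast
    then show ?thesis unfolding pd by (rule Inf_lower)
  qed
  assume le: "pdim R M \<le> enat n"
  have "{enat n | n. ?L n} \<noteq> {}"
  proof
    assume e: "{enat n | n. ?L n} = {}"
    have "pdim R M = \<infinity>" unfolding pd e by (simp add: Inf_enat_def)
    then show False using le by simp
  qed
  then have "Inf {enat n | n. ?L n} \<in> {enat n | n. ?L n}"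
    by (rule Inf_enat_mem)
  then obtain m where m: "pdim R M = enat m" "?L m" unfolding pd by blast
  obtain P :: "nat \<Rightarrow> ('r, ('r, 'm) mod_univ) module" and \<epsilon> d where res: "proj_resolution R M P \<epsilon> d"
    and P: "\<And>k. k > m \<Longrightarrow> carrier (P k) = {\<zero>\<^bsub>P k\<^esub>}" using m(2) by blast
  have Pm: "left_module R (P k)" and d: "d k \<in> mod_hom R (P (Suc k)) (P k)" for k
    using res by (auto simp: proj_resolution_def projective_left_module)
  let ?Y = "d m ` carrier (P (Suc m))"
  have Y: "?Y = {\<zero>\<^bsub>P m\<^esub>}" using P[of "Suc m"] mod_hom_zero[OF Pm Pm d, of m] by simp
  have sub: "submodule ?Y R (P m)"
    by (rule submodule_image[OF Pm Pm d left_module.submodule_carrier[OF Pm]])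
  have "carrier (syzygy R M (Suc m)) = {\<zero>\<^bsub>syzygy R M (Suc m)\<^esub>}"
    by (rule retract_zero[OF syzygy_left_module[OF M] left_module.left_module_submod[OF Pm sub] minimal_syzygy_retract[OF M res]])
       (simp add: Y)
  then show "carrier (syzygy R M (Suc n)) = {\<zero>\<^bsub>syzygy R M (Suc n)\<^esub>}"
    by (rule syzygy_zero_mono[OF M]) (use le m in simp)
qed

lemma syz_iter_retract:
  assumes X: "left_module R X" and Y: "left_module R Y" and ret: "retract R X Y"
  shows "retract R ((syz R ^^ n) X) ((syz R ^^ n) Y) \<and> left_module R ((syz R ^^ n) X) \<and> left_module R ((syz R ^^ n) Y)"
  by (induction n) (simp_all add: X Y ret retract_syz syz_left_module)

end

lemma left_artinianI: "artinian_ring R \<Longrightarrow> left_artinian R"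
  by (intro left_artinian.intro base_ring.intro left_artinian_axioms.intro) (auto simp: artinian_ring_def)

lemma left_artinian_oppI: "artinian_ring R \<Longrightarrow> left_artinian (opp_ring R)"
  by (intro left_artinian.intro base_ring.intro left_artinian_axioms.intro) (auto simp: artinian_ring_def ring_opp_ring)

text \<open>The image of the class of \<open>1\<close> under the embedding of \<open>R/J\<close>. The product of this class with \<open>r\<close> is the
  class of \<open>r\<close> because \<open>J\<close> is an ideal on both sides.\<close>

lemma (in left_artinian) embeds_annihilator:
  assumes T: "left_module (opp_ring R) T"
    and emb: "embeds (opp_ring R) (quot_module (regular_module (opp_ring R)) J) T"
  shows "\<exists>t\<in>carrier T. \<forall>r\<in>carrier R. r \<odot>\<^bsub>T\<^esub> t = \<zero>\<^bsub>T\<^esub> \<longleftrightarrow> r \<in> J"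
proof -
  interpret T: left_module "opp_ring R" T by fact
  let ?Q = "quot_module (regular_module (opp_ring R)) J"
  define cos where "cos r = J +>\<^bsub>regular_module (opp_ring R)\<^esub> r" for r
  have cos_iff: "x \<in> cos r \<longleftrightarrow> (\<exists>j\<in>J. x = j \<oplus>\<^bsub>R\<^esub> r)" for x r
    by (auto simp: cos_def a_r_coset_def')
  note Js = submoduleD[OF jacobson_submodule, simplified]
  have carr: "carrier ?Q = cos ` carrier R"
    by (auto simp: quot_module_def A_RCOSETS_def' cos_def)
  obtain f where f: "f \<in> mod_hom (opp_ring R) ?Q T" "inj_on f (carrier ?Q)" using emb by (auto simp: embeds_def)
  have one: "cos \<one>\<^bsub>R\<^esub> \<in> carrier ?Q" unfolding carr by simp
  have neg: "\<ominus>\<^bsub>R\<^esub> j \<in> J" if "j \<in> J" for j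
  proof -
    interpret reg: left_module R "regular_module R" by (rule regular_left_module[OF ring_axioms])
    have jc: "j \<in> carrier R" using Js(1)[OF that] .
    have "\<ominus>\<^bsub>R\<^esub> \<one>\<^bsub>R\<^esub> \<otimes>\<^bsub>R\<^esub> j \<in> J" by (rule jacobson_l_mult) (simp_all add: that)
    then show ?thesis using jc by (simp add: l_minus)
  qed
  have cos_add: "cos (j \<oplus>\<^bsub>R\<^esub> r) = cos r" if j: "j \<in> J" and r: "r \<in> carrier R" for j r
  proof -
    have jc: "j \<in> carrier R" using Js(1)[OF j] .
    have "x \<in> cos (j \<oplus>\<^bsub>R\<^esub> r) \<longleftrightarrow> x \<in> cos r" for x
    proof
      assume "x \<in> cos (j \<oplus>\<^bsub>R\<^esub> r)"
      then obtain k where k: "k \<in> J" "x = k \<oplus>\<^bsub>R\<^esub> (j \<oplus>\<^bsub>R\<^esub> r)" unfolding cos_iff by blast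
      then have "x = (k \<oplus>\<^bsub>R\<^esub> j) \<oplus>\<^bsub>R\<^esub> r" using Js(1) jc r by (simp add: a_assoc)
      then show "x \<in> cos r" unfolding cos_iff using Js(4)[OF k(1) j] by blast
    next
      assume "x \<in> cos r"
      then obtain k where k: "k \<in> J" "x = k \<oplus>\<^bsub>R\<^esub> r" unfolding cos_iff by blast
      then have "x = (k \<oplus>\<^bsub>R\<^esub> \<ominus>\<^bsub>R\<^esub> j) \<oplus>\<^bsub>R\<^esub> (j \<oplus>\<^bsub>R\<^esub> r)"
        using Js(1) jc r by (simp add: a_assoc r_neg1)
      then show "x \<in> cos (j \<oplus>\<^bsub>R\<^esub> r)" unfolding cos_iff using Js(4)[OF k(1) neg[OF j]] by blast
    qed
    then show ?thesis by blast
  qed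
  have smult: "r \<odot>\<^bsub>?Q\<^esub> cos \<one>\<^bsub>R\<^esub> = cos r" if r: "r \<in> carrier R" for r
  proof -
    have *: "cos (c \<otimes>\<^bsub>R\<^esub> r) = cos r" if "c \<in> cos \<one>\<^bsub>R\<^esub>" for c
    proof -
      obtain j where j: "j \<in> J" "c = j \<oplus>\<^bsub>R\<^esub> \<one>\<^bsub>R\<^esub>" using \<open>c \<in> cos \<one>\<^bsub>R\<^esub>\<close> unfolding cos_iff by blast
      then have "c \<otimes>\<^bsub>R\<^esub> r = j \<otimes>\<^bsub>R\<^esub> r \<oplus>\<^bsub>R\<^esub> r" using Js(1) r by (simp add: l_distr)
      then show ?thesis using cos_add[OF jacobson_r_mult[OF j(1) r] r] by simp
    qed
    have ne: "\<one>\<^bsub>R\<^esub> \<in> cos \<one>\<^bsub>R\<^esub>" unfolding cos_iff by (rule bexI[of _ "\<zero>\<^bsub>R\<^esub>"]) (simp_all add: Js(3))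
    have "r \<odot>\<^bsub>?Q\<^esub> cos \<one>\<^bsub>R\<^esub> = (\<Union>c\<in>cos \<one>\<^bsub>R\<^esub>. cos (c \<otimes>\<^bsub>R\<^esub> r))"
      by (simp add: quot_module_def cos_def)
    also have "\<dots> = (\<Union>c\<in>cos \<one>\<^bsub>R\<^esub>. cos r)" by (rule SUP_cong[OF refl *])
    also have "\<dots> = cos r" using ne by blast
    finally show ?thesis .
  qed
  have cos_zero: "cos \<zero>\<^bsub>R\<^esub> = J"
  proof -
    have "x \<in> cos \<zero>\<^bsub>R\<^esub> \<longleftrightarrow> x \<in> J" for x unfolding cos_iff using Js(1) by (metis r_zero)
    then show ?thesis by blast
  qed
  have cos_eq: "cos r = J \<longleftrightarrow> r \<in> J" if r: "r \<in> carrier R" for r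
  proof
    assume "cos r = J"
    moreover have "r \<in> cos r" unfolding cos_iff by (rule bexI[of _ "\<zero>\<^bsub>R\<^esub>"]) (simp_all add: Js(3) r)
    ultimately show "r \<in> J" by simp
  next
    assume "r \<in> J"
    then have "cos (r \<oplus>\<^bsub>R\<^esub> \<zero>\<^bsub>R\<^esub>) = cos \<zero>\<^bsub>R\<^esub>" by (rule cos_add) simp
    then show "cos r = J" using r cos_zero by simp
  qed
  have JQ: "J \<in> carrier ?Q" unfolding carr using imageI[OF zero_closed, of cos] cos_zero by simp
  have fJ: "f J = \<zero>\<^bsub>T\<^esub>"
  proof -
    have "\<zero>\<^bsub>R\<^esub> \<odot>\<^bsub>?Q\<^esub> cos \<one>\<^bsub>R\<^esub> = J" using smult[OF zero_closed] cos_zero by simp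
    then have "f J = \<zero>\<^bsub>R\<^esub> \<odot>\<^bsub>T\<^esub> f (cos \<one>\<^bsub>R\<^esub>)" using mod_homD(3)[OF f(1), of "\<zero>\<^bsub>R\<^esub>" "cos \<one>\<^bsub>R\<^esub>"] one by simp
    then show ?thesis using T.smult_l_zero[of "f (cos \<one>\<^bsub>R\<^esub>)"] mod_homD(1)[OF f(1) one] by simp
  qed
  show ?thesis
  proof (intro bexI ballI)
    show "f (cos \<one>\<^bsub>R\<^esub>) \<in> carrier T" by (rule mod_homD(1)[OF f(1) one])
    fix r assume r: "r \<in> carrier R"
    have "r \<odot>\<^bsub>T\<^esub> f (cos \<one>\<^bsub>R\<^esub>) = f (cos r)" using mod_homD(3)[OF f(1), of r "cos \<one>\<^bsub>R\<^esub>"] one r smult by simp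
    moreover have "f (cos r) = \<zero>\<^bsub>T\<^esub> \<longleftrightarrow> cos r = J"
    proof
      have "cos r \<in> carrier ?Q" unfolding carr using r by simp
      then show "f (cos r) = \<zero>\<^bsub>T\<^esub> \<Longrightarrow> cos r = J" using f(2) JQ fJ by (metis inj_onD)
    qed (use fJ in simp)
    ultimately show "r \<odot>\<^bsub>T\<^esub> f (cos \<one>\<^bsub>R\<^esub>) = \<zero>\<^bsub>T\<^esub> \<longleftrightarrow> r \<in> J" using cos_eq[OF r] by simp
  qed
qed


section \<open>Syzygies of a module of finite syzygy type\<close>

lemma tor_zero_retract_right:
  assumes A: "left_module (opp_ring R) A" and X: "left_module R X" and M: "left_module R M"
    and ret: "retract R M X" and tz: "tor_zero R A X"
  shows "tor_zero R A M"
proof -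
  note Ro = left_module.axioms(1)[OF A]
  note P = projective_free_mod[OF Ro] and F = free_left_module[OF Ro]
  show ?thesis
    using tz unfolding tor_zero_iff_left[OF P A canon_epi[OF A] X] tor_zero_iff_left[OF P A canon_epi[OF A] M]
    by (rule tens_inj_retract[OF F submodule_kernel[OF F A canon_epi(1)[OF A]] X M ret])
qed

lemma tor_zero_zero:
  assumes A: "left_module (opp_ring R) A" and z: "carrier A = {\<zero>\<^bsub>A\<^esub>}" and M: "left_module R M"
  shows "tor_zero R A M"
  by (rule tor_zero_projective_left[OF projective_zero[OF A z] M])

locale syzygy_setting =
  fixes R :: "'r ring" and T :: "('r, 't) module"
  assumes art: "artinian_ring R" and T: "left_module (opp_ring R) T"
begin

sublocale L: left_artinian R by (rule left_artinianI[OF art])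
sublocale O: left_artinian "opp_ring R" by (rule left_artinian_oppI[OF art])

abbreviation S where "S \<equiv> opp_ring R"
abbreviation \<Omega> where "\<Omega> \<equiv> syzygy (opp_ring R) T"

lemma syz_T: "left_module S (\<Omega> j)"
  by (rule O.syzygy_left_module[OF T])

lemma tor_zero_syz:
  assumes A: "left_module S A" and X: "left_module R X"
  shows "tor_zero R (syz S A) X \<longleftrightarrow> tor_zero R A (syz R X)"
proof -
  obtain P f where cP: "projective_cover S P f A" and sA: "syz S A = submod P (a_kernel P A f)"
    using O.cover_some[OF A] by blast
  obtain Q g where cQ: "projective_cover R Q g X" and sX: "syz R X = submod Q (a_kernel Q X g)"
    using L.cover_some[OF X] by blast
  have P: "projective S P" "f \<in> mod_hom S P A" "f ` carrier P = carrier A"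
    and Q: "projective R Q" "g \<in> mod_hom R Q X" "g ` carrier Q = carrier X"
    using cP cQ by (auto simp: projective_cover_def)
  show ?thesis unfolding sA sX by (rule tor_zero_shift[OF P(1) A P(2,3) Q(1) X Q(2,3)])
qed

lemma tor_zero_shift_syzygy:
  assumes M: "left_module R M"
  shows "tor_zero R (\<Omega> (j + k)) (syzygy R M i) \<longleftrightarrow> tor_zero R (\<Omega> j) (syzygy R M (i + k))"
proof (induction k arbitrary: i)
  case 0
  then show ?case by simp
next
  case (Suc k)
  have "tor_zero R (\<Omega> (j + Suc k)) (syzygy R M i) \<longleftrightarrow> tor_zero R (\<Omega> (j + k)) (syzygy R M (Suc i))"
    using tor_zero_syz[OF syz_T L.syzygy_left_module[OF M]] by (simp only: syzygy_Suc add_Suc_right)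
  then show ?case using Suc[of "Suc i"] by simp
qed

lemma tor_zero_beyond_pdim:
  assumes M: "left_module R M" and d: "pdim R M \<le> enat d" and le: "d \<le> i + j"
  shows "tor_zero R (\<Omega> j) (syzygy R M i)"
proof -
  have "carrier (syzygy R M (Suc d)) = {\<zero>\<^bsub>syzygy R M (Suc d)\<^esub>}" using L.pdim_le_iff[OF M] d by blast
  then have "carrier (syzygy R M (Suc (i + j))) = {\<zero>\<^bsub>syzygy R M (Suc (i + j))\<^esub>}"
    by (rule L.syzygy_zero_mono[OF M]) (use le in simp)
  then have "projective R (syzygy R M (i + j))"
    unfolding syzygy_Suc by (rule L.syz_zero_projective[OF L.syzygy_left_module[OF M]])
  then have "tor_zero R (\<Omega> 0) (syzygy R M (i + j))" by (rule tor_zero_projective_right[OF syz_T])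
  then show ?thesis using tor_zero_shift_syzygy[OF M, of 0 j i] by simp
qed

text \<open>Shifting reduces the claim to \<open>T\<close> itself and the last nonprojective syzygy of \<open>M\<close>.\<close>

lemma tor_nonzero_at_pdim:
  assumes emb: "embeds S (quot_module (regular_module S) (jacobson_radical R)) T"
    and M: "left_module R M" and d: "pdim R M = enat (Suc e)" and ij: "i + j = e"
  shows "\<not> tor_zero R (\<Omega> j) (syzygy R M i)"
proof -
  obtain t where t: "t \<in> carrier T" "\<And>r. r \<in> carrier R \<Longrightarrow> r \<odot>\<^bsub>T\<^esub> t = \<zero>\<^bsub>T\<^esub> \<longleftrightarrow> r \<in> jacobson_radical R"
    using L.embeds_annihilator[OF T emb] by blast
  note copy = univ_copy_iso[OF T]
  interpret T: left_module S T by (rule T)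
  have t': "Base t \<in> carrier (univ_copy T)" by (rule mod_homD(1)[OF copy(2) t(1)])
  have ann: "r \<odot>\<^bsub>univ_copy T\<^esub> Base t = \<zero>\<^bsub>univ_copy T\<^esub> \<longleftrightarrow> r \<in> jacobson_radical R" if r: "r \<in> carrier R" for r
  proof -
    have "r \<odot>\<^bsub>univ_copy T\<^esub> Base t = Base (r \<odot>\<^bsub>T\<^esub> t)" using mod_homD(3)[OF copy(2), of r t] r t(1) by simp
    moreover have "\<zero>\<^bsub>univ_copy T\<^esub> = Base \<zero>\<^bsub>T\<^esub>" using mod_hom_zero[OF T copy(1,2)] by simp
    ultimately show ?thesis using t(2)[OF r] by simp
  qed
  let ?N = "syzygy R M e"
  have Nm: "left_module R ?N" by (rule L.syzygy_left_module[OF M])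
  obtain Q g where cov: "projective_cover R Q g ?N" and s: "syz R ?N = submod Q (a_kernel Q ?N g)"
    using L.cover_some[OF Nm] by blast
  have "carrier (syzygy R M (Suc (Suc e))) = {\<zero>\<^bsub>syzygy R M (Suc (Suc e))\<^esub>}" using L.pdim_le_iff[OF M, of "Suc e"] d by simp
  then have proj: "projective R (submod Q (a_kernel Q ?N g))"
    using L.syz_zero_projective[OF L.syzygy_left_module[OF M, of "Suc e"]] s by (simp only: syzygy_Suc)
  have "carrier (syzygy R M (Suc e)) \<noteq> {\<zero>\<^bsub>syzygy R M (Suc e)\<^esub>}" using L.pdim_le_iff[OF M, of e] d by simp
  then have nz: "a_kernel Q ?N g \<noteq> {\<zero>\<^bsub>Q\<^esub>}" using s by (simp only: syzygy_Suc submod_simps simp_thms)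
  have "\<not> tor_zero R (univ_copy T) ?N"
    by (rule L.tor_nonzero[OF copy(1) t' ann Nm cov proj nz])
  then show ?thesis using tor_zero_shift_syzygy[OF M, of 0 j i] ij by simp
qed

lemma category_left_module: "in_syzygy_category S T X \<Longrightarrow> left_module S X"
  by (simp add: in_syzygy_category_def in_add_def)

lemma indecomposable_decomposition:
  fixes X :: "('r, ('r, 't) mod_univ) module"
  assumes "finite_syzygy_type S T" and X: "in_syzygy_category S T X"
  obtains \<B> where "direct_sum X S \<B>" "\<And>B. B \<in> \<B> \<Longrightarrow> indecomposable S (submod X B)"
  using assms unfolding finite_syzygy_type_def by blast

lemma direct_sum_term_retract:
  assumes X: "left_module S X" and ds: "direct_sum X S \<B>" and B: "B \<in> \<B>"
  shows "retract S (submod X B) X" "left_module S (submod X B)"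
proof -
  obtain \<iota> \<pi> where b: "biproduct S X (terms X \<B>) \<iota> \<pi>" using direct_sum_biproduct[OF X ds] by blast
  show "retract S (submod X B) X" "left_module S (submod X B)"
    using biproduct.retract_term[OF b, of B] biproduct.summand[OF b, of B] B by (simp_all add: terms_def)
qed

text \<open>The history of an indecomposable summand \<open>c n\<close> of \<open>\<Omega> n\<close>: each member arises from the syzygy of its
  predecessor.\<close>

definition syz_chain :: "nat \<Rightarrow> (nat \<Rightarrow> ('r, ('r, 't) mod_univ) module) \<Rightarrow> bool" where
  "syz_chain n c \<longleftrightarrow> (\<forall>k\<le>n. in_syzygy_category S T (c k) \<and> indecomposable S (c k) \<and> retract S (c k) (\<Omega> k)) \<and>
     (\<forall>k<n. retract S (c (Suc k)) (syz S (c k)))"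

text \<open>Given such a decomposition of \<open>\<Omega> n\<close>, the module \<open>\<Omega> (Suc n)\<close> is the direct sum of the syzygies of the terms. Each of these
  syzygies belongs to the syzygy category and is decomposed in turn, which extends the chains by one step. Building
  chains and decomposition together avoids the Krull-Schmidt theorem.\<close>

lemma syz_chain_decomposition:
  assumes fin: "finite_syzygy_type S T"
  shows "\<exists>\<B>. direct_sum (\<Omega> n) S \<B> \<and> (\<forall>B\<in>\<B>. \<exists>c. syz_chain n c \<and>
    retract S (submod (\<Omega> n) B) (c n) \<and> retract S (c n) (submod (\<Omega> n) B))"
proof (induction n)
  case 0
  have "in_syzygy_category S T (\<Omega> 0)" by (rule O.in_syzygy_categoryI[OF T syz_T retract_refl])
  then obtain \<B> where ds: "direct_sum (\<Omega> 0) S \<B>" and ind: "\<And>B. B \<in> \<B> \<Longrightarrow> indecomposable S (submod (\<Omega> 0) B)"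
    using indecomposable_decomposition[OF fin] by blast
  have "\<exists>c. syz_chain 0 c \<and> retract S (submod (\<Omega> 0) B) (c 0) \<and> retract S (c 0) (submod (\<Omega> 0) B)" if B: "B \<in> \<B>" for B
  proof -
    note r = direct_sum_term_retract[OF syz_T ds B]
    have "syz_chain 0 (\<lambda>_. submod (\<Omega> 0) B)"
      unfolding syz_chain_def using r ind[OF B] O.in_syzygy_categoryI[OF T r(2,1)] by simp
    then show ?thesis using retract_refl by (intro exI[of _ "\<lambda>_. submod (\<Omega> 0) B"]) simp
  qed
  then show ?case using ds by blast
next
  case (Suc n)
  then obtain \<B> where ds: "direct_sum (\<Omega> n) S \<B>" and ch: "\<And>B. B \<in> \<B> \<Longrightarrow> \<exists>c. syz_chain n c \<and>
    retract S (submod (\<Omega> n) B) (c n) \<and> retract S (c n) (submod (\<Omega> n) B)" by blast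
  let ?C = "terms (\<Omega> n) \<B>"
  obtain \<iota> \<pi> where "biproduct S (\<Omega> n) ?C \<iota> \<pi>" using direct_sum_biproduct[OF syz_T ds] by blast
  then obtain \<kappa> \<rho> where b: "biproduct S (\<Omega> (Suc n)) (\<lambda>B. syz S (?C B)) \<kappa> \<rho>"
    unfolding syzygy_Suc using O.biproduct_syz by blast
  interpret b: biproduct S "\<Omega> (Suc n)" "\<lambda>B. syz S (?C B)" \<kappa> \<rho> by (rule b)
  have cat: "in_syzygy_category S T (syz S (?C B))" for B
    by (rule O.in_syzygy_categoryI[OF T b.summand b.retract_term])
  have "\<exists>\<D>. direct_sum (syz S (?C B)) S \<D> \<and> (\<forall>D\<in>\<D>. indecomposable S (submod (syz S (?C B)) D))" for B
    by (rule indecomposable_decomposition[OF fin cat]) blast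
  then obtain \<D> where D: "\<And>B. direct_sum (syz S (?C B)) S (\<D> B)"
    "\<And>B D. D \<in> \<D> B \<Longrightarrow> indecomposable S (submod (syz S (?C B)) D)" by metis
  let ?E = "\<lambda>B. terms (syz S (?C B)) (\<D> B)"
  have "\<exists>\<eta> \<theta>. biproduct S (syz S (?C B)) (?E B) \<eta> \<theta>" for B
    by (rule direct_sum_biproduct[OF b.summand D(1)])
  then obtain \<eta> \<theta> where e: "\<And>B. biproduct S (syz S (?C B)) (?E B) (\<eta> B) (\<theta> B)" by metis
  let ?G = "\<lambda>(B, D). ?E B D" and ?inc = "\<lambda>(B, D) x. \<kappa> B (\<eta> B D x)"
  note bt = biproduct_trans[OF b e]
  let ?\<B>' = "{?inc p ` carrier (?G p) | p. carrier (?G p) \<noteq> {\<zero>\<^bsub>?G p\<^esub>}}"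
  have ds': "direct_sum (\<Omega> (Suc n)) S ?\<B>'" by (rule biproduct_direct_sum[OF bt])
  have "\<exists>c. syz_chain (Suc n) c \<and> retract S (submod (\<Omega> (Suc n)) B') (c (Suc n)) \<and>
      retract S (c (Suc n)) (submod (\<Omega> (Suc n)) B')" if B': "B' \<in> ?\<B>'" for B'
  proof -
    from B' obtain p where p: "B' = ?inc p ` carrier (?G p)" "carrier (?G p) \<noteq> {\<zero>\<^bsub>?G p\<^esub>}" by blast
    obtain B D where BD: "p = (B, D)" by (cases p)
    let ?X = "syz S (?C B)" and ?Y = "submod (syz S (?C B)) D"
    have DD: "D \<in> \<D> B"
    proof (rule ccontr)
      assume "D \<notin> \<D> B"
      then have "carrier (?G p) = {\<zero>\<^bsub>?G p\<^esub>}" by (simp add: BD terms_def)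
      then show False using p(2) by simp
    qed
    have G: "?G p = ?Y" using DD by (simp add: BD terms_def)
    \<comment> \<open>The terms at other indices are zero modules, whose syzygies are zero.\<close>
    have BB: "B \<in> \<B>"
    proof (rule ccontr)
      assume "B \<notin> \<B>"
      then have "carrier (?C B) = {\<zero>\<^bsub>?C B\<^esub>}" by (simp add: terms_def)
      moreover have "left_module S (?C B)"
        by (rule module_family.family[OF terms_family[OF syz_T]]) (use ds in \<open>simp add: direct_sum_def\<close>)
      ultimately have z: "carrier ?X = {\<zero>\<^bsub>?X\<^esub>}" by (intro O.syz_zero)
      have "carrier ?Y = {\<zero>\<^bsub>?Y\<^esub>}"
        using direct_sum_term_retract[OF b.summand D(1) DD] by (intro retract_zero[OF _ b.summand _ z])
      then show False using p(2) G by simp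
    qed
    have C: "?C B = submod (\<Omega> n) B" using BB by (simp add: terms_def)
    obtain c where c: "syz_chain n c" "retract S (submod (\<Omega> n) B) (c n)" using ch[OF BB] by blast
    have Ym: "left_module S ?Y" and YX: "retract S ?Y ?X"
      using direct_sum_term_retract[OF b.summand D(1) DD] by blast+
    have YO: "retract S ?Y (\<Omega> (Suc n))" by (rule retract_trans[OF YX b.retract_term])
    have cn: "left_module S (c n)" using c(1) category_left_module unfolding syz_chain_def by blast
    have "retract S ?X (syz S (c n))"
      unfolding C by (rule O.retract_syz[OF _ cn c(2)]) (rule direct_sum_term_retract(2)[OF syz_T ds BB])
    then have Yc: "retract S ?Y (syz S (c n))" by (rule retract_trans[OF YX])
    let ?c = "c(Suc n := ?Y)"
    have "syz_chain (Suc n) ?c"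
      unfolding syz_chain_def
    proof (intro conjI allI impI)
      fix k
      show "k \<le> Suc n \<Longrightarrow> in_syzygy_category S T (?c k)" "k \<le> Suc n \<Longrightarrow> indecomposable S (?c k)"
        "k \<le> Suc n \<Longrightarrow> retract S (?c k) (\<Omega> k)"
        using c(1) O.in_syzygy_categoryI[OF T Ym YO] D(2)[OF DD] YO unfolding syz_chain_def
        by (cases "k = Suc n"; simp)+
      show "k < Suc n \<Longrightarrow> retract S (?c (Suc k)) (syz S (?c k))"
        using c(1) Yc unfolding syz_chain_def by (cases "k = n"; simp)
    qed
    moreover have "retract S (submod (\<Omega> (Suc n)) B') ?Y" "retract S ?Y (submod (\<Omega> (Suc n)) B')"
      using biproduct_image_retract[OF bt, of p] unfolding p(1) G by blast+
    ultimately show ?thesis by (intro exI[of _ ?c]) simp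
  qed
  then show ?case using ds' by blast
qed

lemma syz_chain_iter:
  assumes c: "syz_chain n c" and "a \<le> b" "b \<le> n"
  shows "retract S (c b) ((syz S ^^ (b - a)) (c a))"
  using assms(2,3)
proof (induction b rule: dec_induct)
  case base
  then show ?case by (simp add: retract_refl)
next
  case (step b)
  have m: "left_module S (c k)" if "k \<le> n" for k using c category_left_module that unfolding syz_chain_def by blast
  have IH: "retract S (c b) ((syz S ^^ (b - a)) (c a))" using step by simp
  have ca: "left_module S ((syz S ^^ (b - a)) (c a))"
    using O.syz_iter_retract[OF m m retract_refl, of a "b - a"] step by simp
  have "retract S (c (Suc b)) (syz S (c b))" using c step unfolding syz_chain_def by simp
  also have "retract S (syz S (c b)) (syz S ((syz S ^^ (b - a)) (c a)))"
    by (rule O.retract_syz[OF m ca IH]) (use step in simp)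
  finally (retract_trans) show ?case using step by (simp add: Suc_diff_le)
qed

lemma syz_iter_syzygy: "(syz S ^^ m) (\<Omega> a) = \<Omega> (a + m)"
  by (induction m) (simp_all only: funpow.simps id_apply comp_apply syzygy_Suc add_Suc_right add_0_right)

text \<open>The loop from \<open>c a\<close> to \<open>c b\<close> makes \<open>c a\<close> a direct summand of its own syzygies of all degrees
  \<open>m (b - a)\<close>; continuing along the chain to \<open>c n\<close> preserves this.\<close>

lemma syz_chain_recurrent:
  assumes c: "syz_chain n c" and ab: "a < b" "b \<le> n" and ret: "retract S (c a) (c b)"
  shows "retract S (c n) (\<Omega> (n + m * (b - a)))"
proof -
  have mod: "left_module S (c k)" if "k \<le> n" for k using c category_left_module that unfolding syz_chain_def by blast
  have an: "a \<le> n" using ab by simp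
  let ?p = "b - a"
  have sm: "left_module S ((syz S ^^ k) (c a))" for k using O.syz_iter_retract[OF mod[OF an] mod[OF an] retract_refl] by blast
  have one: "retract S (c a) ((syz S ^^ ?p) (c a))"
    by (rule retract_trans[OF ret syz_chain_iter[OF c]]) (use ab in auto)
  have loop: "retract S (c a) ((syz S ^^ (m * ?p)) (c a))" for m
  proof (induction m)
    case 0
    then show ?case by (simp add: retract_refl)
  next
    case (Suc m)
    have "retract S ((syz S ^^ ?p) (c a)) ((syz S ^^ ?p) ((syz S ^^ (m * ?p)) (c a)))"
      using O.syz_iter_retract[OF mod[OF an] sm Suc.IH] by blast
    from retract_trans[OF one this] show ?case by (simp add: funpow_add)
  qed
  have 1: "retract S (c n) ((syz S ^^ (n - a)) (c a))" by (rule syz_chain_iter[OF c an order_refl])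
  have 2: "retract S ((syz S ^^ (n - a)) (c a)) ((syz S ^^ (n - a)) ((syz S ^^ (m * ?p)) (c a)))"
    using O.syz_iter_retract[OF mod[OF an] sm loop] by blast
  have "retract S (c a) (\<Omega> a)" using c an unfolding syz_chain_def by blast
  then have 3: "retract S ((syz S ^^ (n - a + m * ?p)) (c a)) (\<Omega> (a + (n - a + m * ?p)))"
    using O.syz_iter_retract[OF mod[OF an] syz_T] syz_iter_syzygy by metis
  have "retract S (c n) ((syz S ^^ (n - a + m * ?p)) (c a))"
    using retract_trans[OF 1 2] by (simp add: funpow_add)
  from retract_trans[OF this 3] show ?thesis using an by simp
qed

section \<open>Repetition, contingency and projective dimension\<close>

text \<open>A chain of length \<open>s\<close> has \<open>s + 1\<close> members of at most \<open>s\<close> isomorphism types, so it contains a loop. The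
  projective part of the decomposition can be taken to be zero.\<close>

lemma repetitive_at_bound:
  assumes fin: "finite_syzygy_type S T"
    and A: "\<And>X :: ('r, ('r, 't) mod_univ) module. in_syzygy_category S T X \<Longrightarrow> indecomposable S X \<Longrightarrow>
      \<exists>i\<in>{1..s}. mod_iso S X (A i)"
  shows "repetitive_at S T s"
proof -
  interpret Om: left_module S "\<Omega> s" by (rule syz_T)
  obtain \<B> where ds: "direct_sum (\<Omega> s) S \<B>" and ch: "\<And>B. B \<in> \<B> \<Longrightarrow> \<exists>c. syz_chain s c \<and>
    retract S (submod (\<Omega> s) B) (c s) \<and> retract S (c s) (submod (\<Omega> s) B)"
    using syz_chain_decomposition[OF fin] by blast
  have inf: "infinite {j. is_summand S (submod (\<Omega> s) B) (\<Omega> j)}" if B: "B \<in> \<B>" for B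
  proof -
    obtain c where c: "syz_chain s c" and ret: "retract S (submod (\<Omega> s) B) (c s)" using ch[OF B] by blast
    have ck: "in_syzygy_category S T (c k)" "indecomposable S (c k)" if "k \<le> s" for k
      using c that unfolding syz_chain_def by blast+
    have "\<forall>k\<in>{0..s}. \<exists>i\<in>{1..s}. mod_iso S (c k) (A i)" using A ck by simp
    then obtain ix where ix: "\<And>k. k \<le> s \<Longrightarrow> ix k \<in> {1..s}" "\<And>k. k \<le> s \<Longrightarrow> mod_iso S (c k) (A (ix k))"
      by (metis atLeastAtMost_iff le0)
    have "\<not> inj_on ix {0..s}"
    proof
      assume "inj_on ix {0..s}"
      moreover have "ix ` {0..s} \<subseteq> {1..s}"
      proof (rule image_subsetI)
        fix k assume "k \<in> {0..s}"
        then show "ix k \<in> {1..s}" using ix(1)[of k] by (simp only: atLeastAtMost_iff)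
      qed
      ultimately have "card {0..s} \<le> card {1..s}" by (rule card_inj_on_le) (rule finite_atLeastAtMost)
      then show False by simp
    qed
    then obtain x y where xy: "x \<le> s" "y \<le> s" "ix x = ix y" "x \<noteq> y" by (auto simp: inj_on_def)
    define a b where "a = min x y" and "b = max x y"
    have ab: "a < b" "b \<le> s" "ix a = ix b" using xy by (auto simp: a_def b_def min_def max_def)
    have iso: "retract S (c k) (A (ix k)) \<and> retract S (A (ix k)) (c k)" if "k \<le> s" for k
      by (rule mod_iso_retract[OF category_left_module[OF ck(1)] ix(2)]) (rule that)+
    have "a \<le> s" using ab by simp
    then have "retract S (c a) (A (ix b))" using iso[of a] ab(3) by simp
    then have "retract S (c a) (c b)" using iso[OF ab(2)] retract_trans by blast
    from syz_chain_recurrent[OF c ab(1,2) this]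
    have "retract S (submod (\<Omega> s) B) (\<Omega> (s + m * (b - a)))" for m using retract_trans[OF ret] by blast
    then have "is_summand S (submod (\<Omega> s) B) (\<Omega> (s + m * (b - a)))" for m
      using is_summand_retract[OF direct_sum_term_retract(2)[OF syz_T ds B] syz_T] by blast
    then have "range (\<lambda>m. s + m * (b - a)) \<subseteq> {j. is_summand S (submod (\<Omega> s) B) (\<Omega> j)}" by blast
    moreover have "inj (\<lambda>m. s + m * (b - a))" using ab(1) by (auto intro: injI)
    ultimately show ?thesis using range_inj_infinite infinite_super by blast
  qed
  have "direct_sum2 (\<Omega> s) S {\<zero>\<^bsub>\<Omega> s\<^esub>} (carrier (\<Omega> s))"
    unfolding direct_sum2_def
  proof (intro conjI Om.submodule_zero Om.submodule_carrier)
    show "{\<zero>\<^bsub>\<Omega> s\<^esub>} \<inter> carrier (\<Omega> s) = {\<zero>\<^bsub>\<Omega> s\<^esub>}" by auto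
    show "{\<zero>\<^bsub>\<Omega> s\<^esub>} <+>\<^bsub>\<Omega> s\<^esub> carrier (\<Omega> s) = carrier (\<Omega> s)" by (auto simp: set_add_def')
  qed
  moreover have "projective S (submod (\<Omega> s) {\<zero>\<^bsub>\<Omega> s\<^esub>})"
    by (rule projective_zero[OF Om.left_module_submod[OF Om.submodule_zero]]) simp
  moreover have "direct_sum (submod (\<Omega> s) (carrier (\<Omega> s))) S \<B>" using ds by simp
  ultimately show ?thesis unfolding repetitive_at_def Let_def using inf by blast
qed

text \<open>If the projective dimension were \<open>Suc e\<close> with \<open>e \<ge> k\<close>, then \<open>Tor\<^sub>1(\<Omega>\<^sup>kT, \<Omega>\<^sup>e\<^sup>-\<^sup>kM)\<close> would be nonzero. But a
  recurring summand of \<open>\<Omega>\<^sup>kT\<close> is a summand of some \<open>\<Omega>\<^sup>jT\<close> with \<open>j > k\<close>, where \<open>Tor\<^sub>1\<close> against this syzygy of \<open>M\<close>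
  vanishes.\<close>

lemma pdim_le_repetitive:
  assumes emb: "embeds S (quot_module (regular_module S) (jacobson_radical R)) T"
    and rep: "repetitive_at S T k" and M: "left_module R M" and fin: "pdim R M \<noteq> \<infinity>"
  shows "pdim R M \<le> enat k"
proof (rule ccontr)
  assume "\<not> pdim R M \<le> enat k"
  moreover obtain d where "pdim R M = enat d" using fin by (cases "pdim R M") auto
  moreover define e where "e = d - 1"
  ultimately have e: "pdim R M = enat (Suc e)" "k \<le> e" by simp_all
  let ?N = "syzygy R M (e - k)"
  have Nm: "left_module R ?N" by (rule L.syzygy_left_module[OF M])
  have nz: "\<not> tor_zero R (\<Omega> k) ?N" by (rule tor_nonzero_at_pdim[OF emb M e(1)]) (use e(2) in simp)
  obtain P Q \<B> where ds2: "direct_sum2 (\<Omega> k) S P Q" and P: "projective S (submod (\<Omega> k) P)"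
    and ds: "direct_sum (submod (\<Omega> k) Q) S \<B>"
    and inf: "\<And>B. B \<in> \<B> \<Longrightarrow> infinite {j. is_summand S (submod (\<Omega> k) B) (\<Omega> j)}"
    using rep unfolding repetitive_at_def Let_def by blast
  have Q: "submodule Q S (\<Omega> k)" using ds2 by (simp add: direct_sum2_def)
  have Qm: "left_module S (submod (\<Omega> k) Q)" by (rule left_module.left_module_submod[OF syz_T Q])
  obtain \<iota> \<pi> where b: "biproduct S (submod (\<Omega> k) Q) (terms (submod (\<Omega> k) Q) \<B>) \<iota> \<pi>"
    using direct_sum_biproduct[OF Qm ds] by blast
  have "tor_zero R (terms (submod (\<Omega> k) Q) \<B> B) ?N" for B
  proof (cases "B \<in> \<B>")
    case True
    have Bm: "left_module S (submod (\<Omega> k) B)" using direct_sum_term_retract(2)[OF Qm ds True] by simp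
    obtain j where j: "k < j" "is_summand S (submod (\<Omega> k) B) (\<Omega> j)"
      using inf[OF True] unfolding infinite_nat_iff_unbounded by blast
    have "tor_zero R (\<Omega> j) ?N" by (rule tor_zero_beyond_pdim[OF M, of "Suc e"]) (use e j in auto)
    then have "tor_zero R (submod (\<Omega> k) B) ?N"
      using tor_zero_retract[OF syz_T Bm Nm] j(2) is_summand_retract[OF Bm syz_T] by blast
    then show ?thesis using True by (simp add: terms_def)
  next
    case False
    then show ?thesis by (intro tor_zero_zero[OF biproduct.summand[OF b] _ Nm]) (simp add: terms_def)
  qed
  then have tQ: "tor_zero R (submod (\<Omega> k) Q) ?N" by (rule tor_zero_biproduct[OF b Nm])
  have tP: "tor_zero R (submod (\<Omega> k) P) ?N" by (rule tor_zero_projective_left[OF P Nm])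
  obtain \<rho> where b2: "biproduct S (\<Omega> k) (\<lambda>b. submod (\<Omega> k) (if b then P else Q)) (\<lambda>b x. x) \<rho>"
    using direct_sum2_biproduct[OF syz_T ds2] by blast
  have "tor_zero R (\<Omega> k) ?N" by (rule tor_zero_biproduct[OF b2 Nm]) (simp add: tP tQ)
  with nz show False by simp
qed

lemma tor_zero_univ_copy:
  assumes A: "left_module S A" and M: "left_module R M"
  shows "tor_zero R A (univ_copy M) \<longleftrightarrow> tor_zero R A M"
proof -
  note copy = univ_copy_iso[OF M]
  have "mod_iso R M (univ_copy M)" unfolding mod_iso_def using copy(2,3) by blast
  from mod_iso_retract[OF M this] show ?thesis
    using tor_zero_retract_right[OF A copy(1) M] tor_zero_retract_right[OF A M copy(1)] by blast
qed

lemma Tor_nontrivial_iff: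
  assumes A: "left_module S A" and M: "left_module R M"
  shows "carrier (Tor R 1 A M) \<noteq> {\<one>\<^bsub>Tor R 1 A M\<^esub>} \<longleftrightarrow> \<not> tor_zero R A M"
  using Tor_1_trivial_iff[OF A M] O.minimal_resolution[OF A] by blast

text \<open>A module with nonzero \<open>Tor\<^sub>1\<close> against \<open>M\<close> is not a summand of \<open>\<Omega>\<^sup>jT\<close> for \<open>j \<ge> d\<close>.\<close>

lemma contingency_le:
  assumes A: "left_module S A" and M: "left_module R M" and d: "pdim R M = enat d" and nz: "\<not> tor_zero R A M"
  shows "contingency S T A \<le> ereal (real d) - 1"
proof -
  have lt: "j < d" if "is_summand S A (\<Omega> j)" for j
  proof (rule ccontr)
    assume "\<not> j < d"
    then have "tor_zero R (\<Omega> j) (syzygy R M 0)" by (intro tor_zero_beyond_pdim[OF M, of d]) (simp_all add: d)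
    then have "tor_zero R A (univ_copy M)"
      using tor_zero_retract[OF syz_T A univ_copy_iso(1)[OF M]] that is_summand_retract[OF A syz_T] by simp
    then show False using nz tor_zero_univ_copy[OF A M] by blast
  qed
  show ?thesis
  proof (cases "\<forall>j. \<not> is_summand S A (\<Omega> j)")
    case True
    have "(- 1 :: ereal) \<le> ereal (real d) - 1"
      by (simp add: one_ereal_def)
    then show ?thesis using True by (simp add: contingency_def)
  next
    case False
    have "Sup {ereal (real j) | j. is_summand S A (\<Omega> j)} \<le> ereal (real d) - 1"
    proof (rule Sup_least)
      fix x assume "x \<in> {ereal (real j) | j. is_summand S A (\<Omega> j)}"
      then obtain j where j: "x = ereal (real j)" "j < d" using lt by blast
      then have "real j \<le> real d - 1" by linarith
      then show "x \<le> ereal (real d) - 1" using j by (simp add: one_ereal_def)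
    qed
    then show ?thesis unfolding contingency_def by (simp only: False if_False)
  qed
qed

lemma contingency_ge:
  assumes "is_summand S A (\<Omega> j)"
  shows "ereal (real j) \<le> contingency S T A"
proof -
  have "ereal (real j) \<le> Sup {ereal (real j) | j. is_summand S A (\<Omega> j)}" by (rule Sup_upper) (use assms in blast)
  then show ?thesis using assms by (auto simp: contingency_def)
qed

text \<open>For \<open>d = 0\<close> all the torsion vanishes and \<open>C\<close> is empty. For \<open>d = Suc e\<close> an indecomposable summand of
  \<open>\<Omega>\<^sup>eT\<close> with nonzero torsion attains the upper bound \<open>e\<close>.\<close>

lemma pdim_contingency:
  fixes A :: "nat \<Rightarrow> ('r, 'a) module"
  assumes fin: "finite_syzygy_type S T"
    and emb: "embeds S (quot_module (regular_module S) (jacobson_radical R)) T"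
    and Am: "\<And>i. i \<in> {1..s} \<Longrightarrow> left_module S (A i)"
    and A: "\<And>X :: ('r, ('r, 't) mod_univ) module. in_syzygy_category S T X \<Longrightarrow> indecomposable S X \<Longrightarrow>
      \<exists>i\<in>{1..s}. mod_iso S X (A i)"
    and M: "left_module R M" and d: "pdim R M = enat d"
  defines "C \<equiv> {contingency S T (A i) | i. i \<in> {1..s} \<and> carrier (Tor R 1 (A i) M) \<noteq> {\<one>\<^bsub>Tor R 1 (A i) M\<^esub>}}"
  shows "ereal_of_enat (pdim R M) = (if C = {} then -1 else Max C) + 1"
proof -
  have C: "C = contingency S T ` A ` {i \<in> {1..s}. \<not> tor_zero R (A i) M}"
    unfolding C_def using Tor_nontrivial_iff[OF Am M] by blast
  have fC: "finite C" unfolding C by simp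
  have le: "x \<le> ereal (real d) - 1" if "x \<in> C" for x
    using that unfolding C by (auto intro!: contingency_le[OF Am M d])
  show ?thesis
  proof (cases d)
    case 0
    have "tor_zero R (A i) M" if i: "i \<in> {1..s}" for i
    proof -
      have "carrier (syzygy R M (Suc 0)) = {\<zero>\<^bsub>syzygy R M (Suc 0)\<^esub>}" using L.pdim_le_iff[OF M, of 0] d 0 by simp
      then have "projective R (univ_copy M)"
        using L.syz_zero_projective[OF L.syzygy_left_module[OF M, of 0]] by (simp only: syzygy_Suc syzygy.simps(1))
      then show ?thesis using tor_zero_projective_right[OF Am[OF i]] tor_zero_univ_copy[OF Am[OF i] M] by blast
    qed
    then have "C = {}" unfolding C by blast
    then show ?thesis using d 0 by (simp add: zero_enat_def[symmetric] one_ereal_def)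
  next
    case (Suc e)
    have nz: "\<not> tor_zero R (\<Omega> e) (univ_copy M)"
      using tor_nonzero_at_pdim[OF emb M, of e 0 e] d Suc by simp
    have "in_syzygy_category S T (\<Omega> e)" by (rule O.in_syzygy_categoryI[OF T syz_T retract_refl])
    then obtain \<B> where ds: "direct_sum (\<Omega> e) S \<B>" and ind: "\<And>B. B \<in> \<B> \<Longrightarrow> indecomposable S (submod (\<Omega> e) B)"
      using indecomposable_decomposition[OF fin] by blast
    obtain \<iota> \<pi> where b: "biproduct S (\<Omega> e) (terms (\<Omega> e) \<B>) \<iota> \<pi>" using direct_sum_biproduct[OF syz_T ds] by blast
    have "\<exists>B. \<not> tor_zero R (terms (\<Omega> e) \<B> B) (univ_copy M)"
      using tor_zero_biproduct[OF b univ_copy_iso(1)[OF M]] nz by blast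
    then obtain B where nzB: "\<not> tor_zero R (terms (\<Omega> e) \<B> B) (univ_copy M)" by blast
    have B: "B \<in> \<B>"
    proof (rule ccontr)
      assume "B \<notin> \<B>"
      then have "tor_zero R (terms (\<Omega> e) \<B> B) (univ_copy M)"
        by (intro tor_zero_zero[OF biproduct.summand[OF b] _ univ_copy_iso(1)[OF M]]) (simp add: terms_def)
      with nzB show False by simp
    qed
    let ?B = "submod (\<Omega> e) B"
    have nzB': "\<not> tor_zero R ?B (univ_copy M)" using nzB B by (simp add: terms_def)
    note r = direct_sum_term_retract[OF syz_T ds B]
    obtain i where i: "i \<in> {1..s}" "mod_iso S ?B (A i)"
      using A[OF O.in_syzygy_categoryI[OF T r(2,1)] ind[OF B]] by blast
    have ri: "retract S ?B (A i)" "retract S (A i) ?B" using mod_iso_retract[OF r(2) i(2)] by auto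
    have "\<not> tor_zero R (A i) M"
      using tor_zero_retract[OF Am[OF i(1)] r(2) univ_copy_iso(1)[OF M] ri(1)] nzB' tor_zero_univ_copy[OF Am[OF i(1)] M] by blast
    then have iC: "contingency S T (A i) \<in> C" unfolding C using i(1) by blast
    have "is_summand S (A i) (\<Omega> e)"
      using is_summand_retract[OF Am[OF i(1)] syz_T] retract_trans[OF ri(2) r(1)] by blast
    then have ge: "ereal (real e) \<le> contingency S T (A i)" by (rule contingency_ge)
    have "ereal (real d) - 1 = ereal (real e)" using Suc by (simp add: one_ereal_def)
    then have ci: "contingency S T (A i) = ereal (real e)" using ge le[OF iC] by simp
    have "Max C = ereal (real e)"
      by (rule Max_eqI[OF fC]) (use le \<open>ereal (real d) - 1 = ereal (real e)\<close> iC ci in auto)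
    then show ?thesis using iC d Suc by (auto simp: one_ereal_def)
  qed
qed

end

theorem theorem2p6:
  fixes R :: "'r ring"
    and T :: "('r, 't) module"
    and A :: "nat \<Rightarrow> ('r, 'a) module"
    and s :: nat
  assumes "artinian_ring R"
    and "right_module R T"
    and "finite_syzygy_type (opp_ring R) T"
    and "syzygy_type (opp_ring R) T = s"
    and "embeds (opp_ring R) (quot_module (regular_module (opp_ring R)) (jacobson_radical R)) T"
    and "\<And>i. i \<in> {1..s} \<Longrightarrow>
           in_syzygy_category (opp_ring R) T (A i) \<and> indecomposable (opp_ring R) (A i)"
    and "\<And>i j. \<lbrakk>i \<in> {1..s}; j \<in> {1..s}; mod_iso (opp_ring R) (A i) (A j)\<rbrakk> \<Longrightarrow> i = j"
    and "\<And>X :: ('r, ('r, 't) mod_univ) module.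
           \<lbrakk>in_syzygy_category (opp_ring R) T X; indecomposable (opp_ring R) X\<rbrakk> \<Longrightarrow>
           \<exists>i\<in>{1..s}. mod_iso (opp_ring R) X (A i)"
  shows "left_Fin_dim TYPE('m) R \<le> rep_index (opp_ring R) T \<and> rep_index (opp_ring R) T \<le> enat s \<and>
    (\<forall>M :: ('r, 'm) module. left_module R M \<and> pdim R M \<noteq> \<infinity> \<longrightarrow>
      (let S = {contingency (opp_ring R) T (A i) | i.
                  i \<in> {1..s} \<and> carrier (Tor R 1 (A i) M) \<noteq> {\<one>\<^bsub>Tor R 1 (A i) M\<^esub>}};
           \<mu> = (if S = {} then -1 else Max S)
       in ereal_of_enat (pdim R M) = \<mu> + 1))"
proof (intro conjI allI impI)
  interpret syzygy_setting R T by (rule syzygy_setting.intro[OF assms(1,2)])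
  show "left_Fin_dim TYPE('m) R \<le> rep_index S T"
    unfolding left_Fin_dim_def
  proof (rule Sup_least)
    fix x assume "x \<in> {pdim R M | M :: ('r, 'm) module. left_module R M \<and> pdim R M \<noteq> \<infinity>}"
    then obtain M :: "('r, 'm) module" where M: "x = pdim R M" "left_module R M" "pdim R M \<noteq> \<infinity>" by blast
    show "x \<le> rep_index S T"
      unfolding rep_index_def
    proof (rule Inf_greatest)
      fix y assume "y \<in> {enat k | k. repetitive_at S T k}"
      then obtain k where k: "y = enat k" "repetitive_at S T k" by blast
      show "x \<le> y" unfolding M(1) k(1) by (rule pdim_le_repetitive[OF assms(5) k(2) M(2,3)])
    qed
  qed
  have "repetitive_at S T s" by (rule repetitive_at_bound[OF assms(3,8)])
  then show "rep_index S T \<le> enat s" unfolding rep_index_def by (intro Inf_lower) blast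
  fix M :: "('r, 'm) module"
  assume M: "left_module R M \<and> pdim R M \<noteq> \<infinity>"
  then obtain d where d: "pdim R M = enat d" by (cases "pdim R M") auto
  have Am: "left_module S (A i)" if "i \<in> {1..s}" for i using assms(6)[OF that] category_left_module by blast
  show "let S = {contingency (opp_ring R) T (A i) | i.
                  i \<in> {1..s} \<and> carrier (Tor R 1 (A i) M) \<noteq> {\<one>\<^bsub>Tor R 1 (A i) M\<^esub>}};
           \<mu> = (if S = {} then -1 else Max S)
       in ereal_of_enat (pdim R M) = \<mu> + 1"
    unfolding Let_def by (rule pdim_contingency[OF assms(3,5) Am assms(8) conjunct1[OF M] d])
qed

end
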